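(* Let $(R,\mathfrak m,k)$ be a Cohen–Macaulay local ring with canonical module $\omega_R$, and assume that $R$ is not Gorenstein. Let $n\ge 1$ be an integer. If $n$ is odd, then $$\beta_n(\omega_R)\ \geq\ \sum_{i=0}^{n-1}(-1)^{n-i+1}\beta_i(\omega_R).$$ If $n$ is even, then $$\beta_n(\omega_R)\ \geq\ \sum_{i=0}^{n-1}(-1)^{n-i+1}\beta_i(\omega_R)+2.$$ In particular, if $R$ is of type $2$, then $\beta_2(\omega_R)\geq \beta_1(\omega_R)$.
   Context: Rings are commutative and noetherian. For a finitely generated module $M$ over the local ring $(R,\mathfrak m,k)$, $\beta_i(M)=\dim_k\operatorname{Tor}^R_i(k,M)$ is the $i$-th Betti number of $M$ over $R$. The type of $M$ is $\dim_k\operatorname{Ext}^{t}_R(k,M)$ with $t=\operatorname{depth} M$; the type of $R$ is the type of $R$ as a module over itself. *)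

theory Defs
  imports
    "HOL-Algebra.Ring_Divisibility"
    "HOL-Library.Extended_Nat"
    "Jordan_Normal_Form.Missing_VectorSpace"
begin

section \<open>Local rings and modules\<close>

locale noetherian_local_ring = cring R + noetherian_ring R + maximalideal \<mm> R
  for R (structure) and \<mm> +
  assumes unique_maximal: "maximalideal I R \<Longrightarrow> I = \<mm>"

text \<open>The \<open>mult\<close> and \<open>one\<close> fields of a module record have no meaning; they are filled arbitrarily
  below.\<close>

definition ring_module :: "('r, 'c) ring_scheme \<Rightarrow> ('r, 'r) module" where
  "ring_module R =
    \<lparr>carrier = carrier R, mult = mult R, one = one R, zero = zero R, add = add R,
     smult = mult R\<rparr>"

definition quot_module :: "('r, 'm) module \<Rightarrow> 'm set \<Rightarrow> ('r, 'm set) module" where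
  "quot_module M N =
    \<lparr>carrier = a_rcosets\<^bsub>M\<^esub> N, mult = (\<lambda>X Y. N), one = N, zero = N, add = set_add M,
     smult = (\<lambda>r X. \<Union>x\<in>X. N +>\<^bsub>M\<^esub> (r \<odot>\<^bsub>M\<^esub> x))\<rparr>"

text \<open>The residue field \<open>k = R/\<mm>\<close> as an \<open>R\<close>-module; as a field it is \<open>R Quot \<mm>\<close>, with the same
  carrier.\<close>

definition residue_module :: "('r, 'c) ring_scheme \<Rightarrow> 'r set \<Rightarrow> ('r, 'r set) module" where
  "residue_module R \<mm> = quot_module (ring_module R) \<mm>"

definition fin_gen :: "('r, 'c) ring_scheme \<Rightarrow> ('r, 'm) module \<Rightarrow> bool" where
  "fin_gen R M \<longleftrightarrow> module R M \<and>
    (\<exists>S. finite S \<and> S \<subseteq> carrier M \<and> module.span R M S = carrier M)"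

text \<open>A module \<open>V\<close> with \<open>\<mm>V = 0\<close> is a vector space over \<open>R Quot \<mm>\<close>: a residue class acts through
  any of its representatives.\<close>

definition residue_space :: "('r, 'm) module \<Rightarrow> ('r set, 'm) module" where
  "residue_space V =
    \<lparr>carrier = carrier V, mult = mult V, one = one V, zero = zero V, add = add V,
     smult = (\<lambda>X v. (SOME r. r \<in> X) \<odot>\<^bsub>V\<^esub> v)\<rparr>"

definition residue_dim :: "('r, 'c) ring_scheme \<Rightarrow> 'r set \<Rightarrow> ('r, 'm) module \<Rightarrow> nat" where
  "residue_dim R \<mm> V = vectorspace.dim (R Quot \<mm>) (residue_space V)"


section \<open>Tensor products and modules of homomorphisms\<close>

text \<open>The free module on a set \<open>X\<close> consists of the finitely supported functions on \<open>X\<close>.\<close>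

definition free_module :: "('r, 'c) ring_scheme \<Rightarrow> 'x set \<Rightarrow> ('r, 'x \<Rightarrow> 'r) module" where
  "free_module R X =
    (ring.func_space R X)\<lparr>carrier := {f \<in> X \<rightarrow>\<^sub>E carrier R. finite {x \<in> X. f x \<noteq> \<zero>\<^bsub>R\<^esub>}}\<rparr>"

definition free_gen :: "('r, 'c) ring_scheme \<Rightarrow> 'x set \<Rightarrow> 'x \<Rightarrow> 'x \<Rightarrow> 'r" where
  "free_gen R X p = (\<lambda>q\<in>X. if q = p then \<one>\<^bsub>R\<^esub> else \<zero>\<^bsub>R\<^esub>)"

definition tensor_rels ::
    "('r, 'c) ring_scheme \<Rightarrow> ('r, 'm) module \<Rightarrow> ('r, 'n) module \<Rightarrow> ('m \<times> 'n \<Rightarrow> 'r) set" where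
  "tensor_rels R M N =
    (let F = free_module R (carrier M \<times> carrier N);
         \<delta> = free_gen R (carrier M \<times> carrier N)
     in {\<delta> (x \<oplus>\<^bsub>M\<^esub> x', y) \<ominus>\<^bsub>F\<^esub> (\<delta> (x, y) \<oplus>\<^bsub>F\<^esub> \<delta> (x', y)) | x x' y.
           x \<in> carrier M \<and> x' \<in> carrier M \<and> y \<in> carrier N}
      \<union> {\<delta> (x, y \<oplus>\<^bsub>N\<^esub> y') \<ominus>\<^bsub>F\<^esub> (\<delta> (x, y) \<oplus>\<^bsub>F\<^esub> \<delta> (x, y')) | x y y'.
           x \<in> carrier M \<and> y \<in> carrier N \<and> y' \<in> carrier N}
      \<union> {\<delta> (r \<odot>\<^bsub>M\<^esub> x, y) \<ominus>\<^bsub>F\<^esub> (r \<odot>\<^bsub>F\<^esub> \<delta> (x, y)) | r x y.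
           r \<in> carrier R \<and> x \<in> carrier M \<and> y \<in> carrier N}
      \<union> {\<delta> (x, r \<odot>\<^bsub>N\<^esub> y) \<ominus>\<^bsub>F\<^esub> (r \<odot>\<^bsub>F\<^esub> \<delta> (x, y)) | r x y.
           r \<in> carrier R \<and> x \<in> carrier M \<and> y \<in> carrier N})"

definition tensor ::
    "('r, 'c) ring_scheme \<Rightarrow> ('r, 'm) module \<Rightarrow> ('r, 'n) module
      \<Rightarrow> ('r, ('m \<times> 'n \<Rightarrow> 'r) set) module" where
  "tensor R M N =
    (let F = free_module R (carrier M \<times> carrier N)
     in quot_module F (module.span R F (tensor_rels R M N)))"

definition pure_tensor ::
    "('r, 'c) ring_scheme \<Rightarrow> ('r, 'm) module \<Rightarrow> ('r, 'n) module
      \<Rightarrow> 'm \<Rightarrow> 'n \<Rightarrow> ('m \<times> 'n \<Rightarrow> 'r) set" where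
  "pure_tensor R M N x y =
    (let F = free_module R (carrier M \<times> carrier N)
     in module.span R F (tensor_rels R M N) +>\<^bsub>F\<^esub> free_gen R (carrier M \<times> carrier N) (x, y))"

text \<open>The homomorphism \<open>id \<otimes> f : M \<otimes> N \<rightarrow> M \<otimes> N'\<close> induced by \<open>f : N \<rightarrow> N'\<close>; by the universal
  property it exists and is unique on the carrier of \<open>M \<otimes> N\<close>.\<close>

definition tensor_map ::
    "('r, 'c) ring_scheme \<Rightarrow> ('r, 'm) module \<Rightarrow> ('r, 'n) module \<Rightarrow> ('r, 'p) module
      \<Rightarrow> ('n \<Rightarrow> 'p) \<Rightarrow> ('m \<times> 'n \<Rightarrow> 'r) set \<Rightarrow> ('m \<times> 'p \<Rightarrow> 'r) set" where
  "tensor_map R M N N' f =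
    (SOME g. g \<in> module_hom R (tensor R M N) (tensor R M N') \<and>
       (\<forall>x\<in>carrier M. \<forall>y\<in>carrier N. g (pure_tensor R M N x y) = pure_tensor R M N' x (f y)))"

definition hom_module ::
    "('r, 'c) ring_scheme \<Rightarrow> ('r, 'm) module \<Rightarrow> ('r, 'n) module \<Rightarrow> ('r, 'm \<Rightarrow> 'n) module" where
  "hom_module R M N =
    \<lparr>carrier = module_hom R M N \<inter> extensional (carrier M),
     mult = (\<lambda>f g. \<lambda>x\<in>carrier M. \<zero>\<^bsub>N\<^esub>),
     one = (\<lambda>x\<in>carrier M. \<zero>\<^bsub>N\<^esub>),
     zero = (\<lambda>x\<in>carrier M. \<zero>\<^bsub>N\<^esub>),
     add = (\<lambda>f g. \<lambda>x\<in>carrier M. f x \<oplus>\<^bsub>N\<^esub> g x),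
     smult = (\<lambda>r f. \<lambda>x\<in>carrier M. r \<odot>\<^bsub>N\<^esub> f x)\<rparr>"


section \<open>Free resolutions, Tor and Ext\<close>

abbreviation free_pow :: "('r, 'c) ring_scheme \<Rightarrow> nat \<Rightarrow> ('r, nat \<Rightarrow> 'r) module" where
  "free_pow R n \<equiv> ring.func_space R {..<n}"

definition ker_on :: "('m \<Rightarrow> 'n) \<Rightarrow> ('r, 'm) module \<Rightarrow> ('r, 'n) module \<Rightarrow> 'm set" where
  "ker_on f M N = {x \<in> carrier M. f x = \<zero>\<^bsub>N\<^esub>}"

text \<open>A resolution \<open>\<dots> \<rightarrow> R\<^bsup>b 1\<^esup> \<rightarrow> R\<^bsup>b 0\<^esup> \<rightarrow> M \<rightarrow> 0\<close> by finitely generated free modules, with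
  differentials \<open>d i : R\<^bsup>b (i + 1)\<^esup> \<rightarrow> R\<^bsup>b i\<^esup>\<close> and augmentation \<open>e\<close>. Over a noetherian ring every
  finitely generated module has one.\<close>

definition free_resolution ::
    "('r, 'c) ring_scheme \<Rightarrow> ('r, 'm) module \<Rightarrow> (nat \<Rightarrow> nat)
      \<Rightarrow> (nat \<Rightarrow> (nat \<Rightarrow> 'r) \<Rightarrow> (nat \<Rightarrow> 'r)) \<Rightarrow> ((nat \<Rightarrow> 'r) \<Rightarrow> 'm) \<Rightarrow> bool" where
  "free_resolution R M b d e \<longleftrightarrow>
     e \<in> module_hom R (free_pow R (b 0)) M \<and>
     e ` carrier (free_pow R (b 0)) = carrier M \<and>
     (\<forall>i. d i \<in> module_hom R (free_pow R (b (Suc i))) (free_pow R (b i))) \<and>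
     d 0 ` carrier (free_pow R (b (Suc 0))) = ker_on e (free_pow R (b 0)) M \<and>
     (\<forall>i. d (Suc i) ` carrier (free_pow R (b (Suc (Suc i)))) =
            ker_on (d i) (free_pow R (b (Suc i))) (free_pow R (b i)))"

text \<open>Tor and Ext of finitely generated modules over a noetherian ring do not depend on the
  resolution, up to isomorphism, so they are computed from an arbitrarily chosen one.\<close>

definition some_resolution ::
    "('r, 'c) ring_scheme \<Rightarrow> ('r, 'm) module
      \<Rightarrow> (nat \<Rightarrow> nat) \<times> (nat \<Rightarrow> (nat \<Rightarrow> 'r) \<Rightarrow> (nat \<Rightarrow> 'r))" where
  "some_resolution R M = (SOME (b, d). \<exists>e. free_resolution R M b d e)"

text \<open>\<open>Z/B\<close> for submodules \<open>B \<subseteq> Z\<close> of \<open>M\<close>.\<close>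

definition subquot :: "('r, 'm) module \<Rightarrow> 'm set \<Rightarrow> 'm set \<Rightarrow> ('r, 'm set) module" where
  "subquot M Z B = quot_module (M\<lparr>carrier := Z\<rparr>) B"

text \<open>\<open>Tor\<^sub>i(N, M)\<close> is the \<open>i\<close>-th homology of \<open>N \<otimes> F\<close>, where \<open>F\<close> is a free resolution of \<open>M\<close>.\<close>

definition Tor ::
    "('r, 'c) ring_scheme \<Rightarrow> nat \<Rightarrow> ('r, 'n) module \<Rightarrow> ('r, 'm) module
      \<Rightarrow> ('r, ('n \<times> (nat \<Rightarrow> 'r) \<Rightarrow> 'r) set set) module" where
  "Tor R i N M =
    (let (b, d) = some_resolution R M;
         F = (\<lambda>j. free_pow R (b j));
         C = (\<lambda>j. tensor R N (F j));
         \<Delta> = (\<lambda>j. tensor_map R N (F (Suc j)) (F j) (d j))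
     in subquot (C i)
          (case i of 0 \<Rightarrow> carrier (C 0) | Suc j \<Rightarrow> ker_on (\<Delta> j) (C (Suc j)) (C j))
          (\<Delta> i ` carrier (C (Suc i))))"

text \<open>\<open>Ext\<^sup>i(N, M)\<close> is the \<open>i\<close>-th cohomology of \<open>Hom(F, M)\<close>, where \<open>F\<close> is a free resolution
  of \<open>N\<close>.\<close>

definition Ext ::
    "('r, 'c) ring_scheme \<Rightarrow> nat \<Rightarrow> ('r, 'n) module \<Rightarrow> ('r, 'm) module
      \<Rightarrow> ('r, ((nat \<Rightarrow> 'r) \<Rightarrow> 'm) set) module" where
  "Ext R i N M =
    (let (b, d) = some_resolution R N;
         F = (\<lambda>j. free_pow R (b j));
         C = (\<lambda>j. hom_module R (F j) M);
         \<Delta> = (\<lambda>j f. compose (carrier (F (Suc j))) f (d j))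
     in subquot (C i)
          (ker_on (\<Delta> i) (C i) (C (Suc i)))
          (case i of 0 \<Rightarrow> {\<zero>\<^bsub>C 0\<^esub>} | Suc j \<Rightarrow> \<Delta> j ` carrier (C j)))"

definition betti :: "('r, 'c) ring_scheme \<Rightarrow> 'r set \<Rightarrow> nat \<Rightarrow> ('r, 'm) module \<Rightarrow> nat" where
  "betti R \<mm> i M = residue_dim R \<mm> (Tor R i (residue_module R \<mm>) M)"


section \<open>Depth, dimension and type\<close>

text \<open>The submodule \<open>(xs)M\<close>.\<close>

definition list_smult :: "('r, 'c) ring_scheme \<Rightarrow> 'r list \<Rightarrow> ('r, 'm) module \<Rightarrow> 'm set" where
  "list_smult R xs M = module.span R M {r \<odot>\<^bsub>M\<^esub> y | r y. r \<in> set xs \<and> y \<in> carrier M}"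

text \<open>Each \<open>xs ! i\<close> is a nonzerodivisor on \<open>M/(xs ! 0, \<dots>, xs ! (i - 1))M\<close>, and \<open>M \<noteq> (xs)M\<close>.\<close>

definition regular_sequence ::
    "('r, 'c) ring_scheme \<Rightarrow> ('r, 'm) module \<Rightarrow> 'r list \<Rightarrow> bool" where
  "regular_sequence R M xs \<longleftrightarrow>
     set xs \<subseteq> carrier R \<and>
     (\<forall>i<length xs. \<forall>y\<in>carrier M.
        xs ! i \<odot>\<^bsub>M\<^esub> y \<in> list_smult R (take i xs) M \<longrightarrow> y \<in> list_smult R (take i xs) M) \<and>
     list_smult R xs M \<noteq> carrier M"

definition depth :: "('r, 'c) ring_scheme \<Rightarrow> 'r set \<Rightarrow> ('r, 'm) module \<Rightarrow> enat" where
  "depth R \<mm> M = (SUP xs\<in>{xs. regular_sequence R M xs \<and> set xs \<subseteq> \<mm>}. enat (length xs))"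

definition krull_dim :: "('r, 'c) ring_scheme \<Rightarrow> enat" where
  "krull_dim R =
    (SUP n\<in>{n. \<exists>P :: nat \<Rightarrow> 'r set.
       (\<forall>i\<le>n. primeideal (P i) R) \<and> (\<forall>i<n. P i \<subset> P (Suc i))}. enat n)"

definition module_type :: "('r, 'c) ring_scheme \<Rightarrow> 'r set \<Rightarrow> ('r, 'm) module \<Rightarrow> nat" where
  "module_type R \<mm> M =
    residue_dim R \<mm> (Ext R (the_enat (depth R \<mm> M)) (residue_module R \<mm>) M)"

definition ring_type :: "('r, 'c) ring_scheme \<Rightarrow> 'r set \<Rightarrow> nat" where
  "ring_type R \<mm> = module_type R \<mm> (ring_module R)"

locale cohen_macaulay_local_ring = noetherian_local_ring +
  assumes depth_eq_dim: "depth R \<mm> (ring_module R) = krull_dim R"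

definition maximal_cohen_macaulay ::
    "('r, 'c) ring_scheme \<Rightarrow> 'r set \<Rightarrow> ('r, 'm) module \<Rightarrow> bool" where
  "maximal_cohen_macaulay R \<mm> M \<longleftrightarrow>
     fin_gen R M \<and> carrier M \<noteq> {\<zero>\<^bsub>M\<^esub>} \<and> depth R \<mm> M = krull_dim R"


section \<open>Injective dimension\<close>

text \<open>HOL cannot quantify over types inside a formula, so the modules \<open>B\<close> against which injectivity
  is tested, and the terms of injective resolutions below, live on the type \<open>nat \<Rightarrow> 'r\<close>. Nothing
  is lost: for injectivity, this type carries a copy of \<open>R\<close>, and by Baer's criterion it suffices to
  test on the ideals of \<open>R\<close>. For resolutions, every module \<open>M\<close> over a noetherian ring \<open>R\<close> embeds
  into an injective module of cardinality at most \<open>max(|M|, |R|, |nat|)\<close>; if \<open>M\<close> is finitely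
  generated and \<open>R \<noteq> 0\<close>, the terms of a resolution, including the last cosyzygy, therefore fit
  into \<open>nat \<Rightarrow> 'r\<close>.\<close>

definition injective_module :: "('r, 'c) ring_scheme \<Rightarrow> ('r, 'm) module \<Rightarrow> bool" where
  "injective_module R E \<longleftrightarrow> module R E \<and>
     (\<forall>(B :: ('r, nat \<Rightarrow> 'r) module) A f.
        module R B \<and> LinearCombinations.submodule R A B \<and>
        f \<in> module_hom R (B\<lparr>carrier := A\<rparr>) E \<longrightarrow>
        (\<exists>g\<in>module_hom R B E. \<forall>x\<in>A. g x = f x))"

text \<open>There is an exact sequence \<open>0 \<rightarrow> M \<rightarrow> I\<^sup>0 \<rightarrow> I\<^sup>1 \<rightarrow> \<dots>\<close> of injective modules \<open>I\<^sup>i\<close> that are zero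
  for large \<open>i\<close>.\<close>

definition finite_inj_dim :: "('r, 'c) ring_scheme \<Rightarrow> ('r, 'm) module \<Rightarrow> bool" where
  "finite_inj_dim R M \<longleftrightarrow>
     (\<exists>(I :: nat \<Rightarrow> ('r, nat \<Rightarrow> 'r) module) d e n.
        (\<forall>i. injective_module R (I i)) \<and>
        e \<in> module_hom R M (I 0) \<and> inj_on e (carrier M) \<and>
        (\<forall>i. d i \<in> module_hom R (I i) (I (Suc i))) \<and>
        e ` carrier M = ker_on (d 0) (I 0) (I (Suc 0)) \<and>
        (\<forall>i. d i ` carrier (I i) = ker_on (d (Suc i)) (I (Suc i)) (I (Suc (Suc i)))) \<and>
        (\<forall>i>n. carrier (I i) = {\<zero>\<^bsub>I i\<^esub>}))"

definition gorenstein :: "('r, 'c) ring_scheme \<Rightarrow> bool" where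
  "gorenstein R \<longleftrightarrow> finite_inj_dim R (ring_module R)"

text \<open>Only meant for a Cohen--Macaulay local ring \<open>(R, \<mm>)\<close>.\<close>

definition canonical_module ::
    "('r, 'c) ring_scheme \<Rightarrow> 'r set \<Rightarrow> ('r, 'm) module \<Rightarrow> bool" where
  "canonical_module R \<mm> W \<longleftrightarrow>
     maximal_cohen_macaulay R \<mm> W \<and> module_type R \<mm> W = 1 \<and> finite_inj_dim R W"

end

theory Submission
  imports Defs
begin

text \<open>
  Choose an \<open>R\<close>-regular sequence \<open>y\<close> of length \<open>dim R\<close>, let \<open>A = R/(y)\<close>, which has finite length \<open>p\<close>, and
  let \<open>K\<^sub>0 = \<omega>\<close> and \<open>K\<^sub>1, K\<^sub>2, \<dots>\<close> be the syzygies in a free resolution \<open>F\<close> of \<open>\<omega>\<close>. Everything is a count of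
  lengths. Since \<open>y\<close> is also \<open>\<omega>\<close>-regular, \<open>0 \<rightarrow> K\<^bsub>i+1\<^esub> \<rightarrow> F\<^sub>i \<rightarrow> K\<^sub>i \<rightarrow> 0\<close> stays exact modulo \<open>y\<close>, so the
  lengths of \<open>K\<^sub>i/yK\<^sub>i\<close> are alternating sums of the ranks of \<open>F\<close>, starting from \<open>length (\<omega>/y\<omega>) = p\<close>. Always
  \<open>length (K\<^sub>i/yK\<^sub>i) \<le> \<mu>(K\<^sub>i) p\<close>. If this is strict for \<open>i\<close>, then \<open>K\<^bsub>i+1\<^esub>/yK\<^bsub>i+1\<^esub>\<close> is longer than the
  contribution of its image in \<open>F\<^sub>i/\<mm>F\<^sub>i\<close>, so some minimal generator of \<open>K\<^bsub>i+1\<^esub>\<close> lies in \<open>\<mm>F\<^sub>i\<close> and is killed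
  modulo \<open>y\<close> by the socle of \<open>A\<close>; hence it is strict for \<open>i + 1\<close>. Equality for \<open>i = 0\<close> would mean that \<open>\<omega>\<close> is
  cyclic, hence free, and \<open>R\<close> Gorenstein. The strict inequality for all \<open>i\<close> is the claim about Betti numbers.

  That \<open>y\<close> is \<open>\<omega>\<close>-regular with \<open>length (\<omega>/y\<omega>) \<ge> p\<close> is extracted from a finite injective resolution
  \<open>I\<close> of \<open>\<omega>\<close>: the cohomology of \<open>0 :\<^sub>I J\<close> plays the role of \<open>Ext(R/J, \<omega>)\<close>, and adding one generator to \<open>J\<close>
  gives long exact sequences. The socle of \<open>\<omega>/y\<omega>\<close> is \<open>Ext\<^sup>d(k, \<omega>)\<close>, hence has length one; this bounds
  \<open>length (\<omega>/y\<omega>)\<close> by \<open>p\<close> and \<open>\<mu>(\<omega>)\<close> by the type of \<open>R\<close>.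
\<close>


section \<open>Heights of families of sets\<close>

text \<open>Submodule lattices replace quotients because every quotient lives on a new type while
  the inductions pass through arbitrarily many of them; length, Ext and regularity are therefore
  attributes of pairs \<open>B \<subseteq> Z\<close>. The resolution is an arbitrary one, not a
  minimal one: \<open>b (Suc i) = r (Suc i) + \<beta> (Suc i) + r i\<close>, with \<open>r i\<close>
  the rank of the differential modulo \<open>\<mm>\<close>, and the \<open>r i\<close> cancel in the
  count. The obstacle with \<omega> is that its depth only provides some \<omega>-regular sequence,
  perhaps not \<open>y\<close>. That sequence shows Ext^i(k, \<omega>) = 0 for i < d when Ext is
  computed from a free resolution of k; balancing carries this over to the injective resolution of
  \<omega>, where Ext^i(R/J, \<omega>) with varying J is accessible, and there it forces
  \<open>y\<close> to be regular. Dividing the strict length inequality by \<open>p\<close> leaves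
  \<beta>_n minus its alternating sum > (-1)^n; integrality turns this into >= 0 for odd n and >= 2
  for even n. In type 2 this 2 absorbs \<beta>_0, which is at most the type.\<close>

primrec chain_to :: "'a set set \<Rightarrow> nat \<Rightarrow> 'a set \<Rightarrow> bool" where
  "chain_to L 0 X \<longleftrightarrow> X \<in> L"
| "chain_to L (Suc n) X \<longleftrightarrow> X \<in> L \<and> (\<exists>Y. chain_to L n Y \<and> Y \<subset> X)"

text \<open>Counted by strict inclusions, not by members, so that on the submodules between
  \<open>B\<close> and \<open>Z\<close> it is the length of \<open>Z/B\<close>. The empty family
  also gets height 0.\<close>

definition height :: "'a set set \<Rightarrow> enat" where
  "height L = (SUP n\<in>{n. \<exists>X. chain_to L n X}. enat n)"

text \<open>The ascending chain condition as well-foundedness of reverse inclusion: maximal members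
  then come from minimal elements, and extensions from lexicographic products.\<close>

definition noetherian_family :: "'a set set \<Rightarrow> bool" where
  "noetherian_family L \<longleftrightarrow> wf {(T, S). S \<in> L \<and> T \<in> L \<and> S \<subset> T}"

lemma chain_to_in: "chain_to L n X \<Longrightarrow> X \<in> L"
  by (cases n) auto

lemma chain_to_le: "chain_to L n X \<Longrightarrow> m \<le> n \<Longrightarrow> \<exists>Y. chain_to L m Y"
proof (induction n arbitrary: X)
  case (Suc n)
  then show ?case by (metis chain_to.simps(2) le_SucE)
qed auto

lemma enat_le_height: "enat n \<le> height L \<longleftrightarrow> (\<exists>X. chain_to L n X)" if "L \<noteq> {}"
proof
  assume le: "enat n \<le> height L"
  show "\<exists>X. chain_to L n X"
  proof (rule ccontr)
    assume no: "\<not> ?thesis"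
    then have n: "n \<noteq> 0" using that by (cases n) auto
    have "height L \<le> enat (n - 1)"
      unfolding height_def
    proof (rule SUP_least)
      fix m assume "m \<in> {n. \<exists>X. chain_to L n X}"
      then obtain X where "chain_to L m X" by blast
      then have "\<not> n \<le> m" using no chain_to_le by blast
      then have "m < n" by simp
      then have "m \<le> n - 1" by linarith
      then show "enat m \<le> enat (n - 1)" by simp
    qed
    with le have "enat n \<le> enat (n - 1)" by (rule order_trans)
    with n show False by simp
  qed
next
  assume "\<exists>X. chain_to L n X"
  then show "enat n \<le> height L" unfolding height_def by (auto intro: SUP_upper)
qed

lemma enat_le_by_nats: "(\<And>n. enat n \<le> a \<Longrightarrow> enat n \<le> b) \<Longrightarrow> a \<le> b"
  by (cases a; cases b) (auto, meson le_cases not_less_eq_eq)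

lemma enat_add_le_by_nats:
  assumes "\<And>n m. enat n \<le> a \<Longrightarrow> enat m \<le> b \<Longrightarrow> enat (n + m) \<le> c"
  shows "a + b \<le> c"
proof (rule enat_le_by_nats)
  fix k assume k: "enat k \<le> a + b"
  show "enat k \<le> c"
  proof (cases a)
    case (enat p)
    show ?thesis
    proof (cases b)
      fix q assume "b = enat q"
      then have "enat (p + q) \<le> c" "enat k \<le> enat (p + q)" using assms[of p q] k enat by simp_all
      then show ?thesis by (rule order_trans[rotated])
    next
      assume "b = \<infinity>"
      then have "enat (p + k) \<le> c" using assms[of p k] enat by simp
      then show ?thesis by (meson enat_ord_simps(1) le_add2 order_trans)
    qed
  next
    case infinity
    have "enat 0 \<le> b" by (simp add: zero_enat_def[symmetric])
    then show ?thesis using assms[of k 0] infinity by simp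
  qed
qed

lemma chain_to_map:
  assumes "\<And>S. S \<in> L \<Longrightarrow> \<phi> S \<in> L'" "\<And>S T. S \<in> L \<Longrightarrow> T \<in> L \<Longrightarrow> S \<subset> T \<Longrightarrow> \<phi> S \<subset> \<phi> T"
  shows "chain_to L n X \<Longrightarrow> chain_to L' n (\<phi> X)"
proof (induction n arbitrary: X)
  case (Suc n)
  then obtain Y where Y: "chain_to L n Y" "Y \<subset> X" and "X \<in> L" by auto
  then have "\<phi> Y \<subset> \<phi> X" "\<phi> X \<in> L'" using assms chain_to_in by blast+
  then show ?case using Suc.IH[OF Y(1)] by auto
qed (auto simp: assms)

lemma height_le_map:
  assumes ne: "L \<noteq> {}" and in_L': "\<And>S. S \<in> L \<Longrightarrow> \<phi> S \<in> L'"
    and mono: "\<And>S T. S \<in> L \<Longrightarrow> T \<in> L \<Longrightarrow> S \<subset> T \<Longrightarrow> \<phi> S \<subset> \<phi> T"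
  shows "height L \<le> height L'"
proof (rule enat_le_by_nats)
  fix n assume "enat n \<le> height L"
  then obtain X where "chain_to L n X" unfolding enat_le_height[OF ne] ..
  with in_L' mono have "chain_to L' n (\<phi> X)" by (rule chain_to_map)
  moreover from this have "L' \<noteq> {}" using chain_to_in by force
  ultimately show "enat n \<le> height L'" using enat_le_height by blast
qed

text \<open>Every strict step of a chain in \<open>L\<close> is strict under \<phi> or under \<psi>,
  so the steps distribute over a chain in \<open>L1\<close> and one in \<open>L2\<close>. The
  intended images of a submodule \<open>S\<close> are \<open>S \<inter> Y\<close> and
  \<open>S + Y\<close>.\<close>

lemma height_le_two_maps:
  assumes "L \<noteq> {}" "\<And>S. S \<in> L \<Longrightarrow> \<phi> S \<in> L1" "\<And>S. S \<in> L \<Longrightarrow> \<psi> S \<in> L2"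
    "\<And>S T. S \<in> L \<Longrightarrow> T \<in> L \<Longrightarrow> S \<subset> T \<Longrightarrow>
      \<phi> S \<subseteq> \<phi> T \<and> \<psi> S \<subseteq> \<psi> T \<and> (\<phi> S \<noteq> \<phi> T \<or> \<psi> S \<noteq> \<psi> T)"
  shows "height L \<le> height L1 + height L2"
proof (rule enat_le_by_nats)
  have *: "chain_to L n X \<Longrightarrow> \<exists>p q. n \<le> p + q \<and> chain_to L1 p (\<phi> X) \<and> chain_to L2 q (\<psi> X)" for n X
  proof (induction n arbitrary: X)
    case 0
    then show ?case using assms(2,3) by (auto intro!: exI[of _ 0])
  next
    case (Suc n)
    then obtain Y where Y: "chain_to L n Y" "Y \<subset> X" and X: "X \<in> L" by auto
    from Suc.IH[OF Y(1)] obtain p q where pq: "n \<le> p + q" "chain_to L1 p (\<phi> Y)" "chain_to L2 q (\<psi> Y)"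
      by blast
    have YL: "Y \<in> L" using Y chain_to_in by blast
    have m: "\<phi> Y \<subseteq> \<phi> X" "\<psi> Y \<subseteq> \<psi> X" "\<phi> Y \<noteq> \<phi> X \<or> \<psi> Y \<noteq> \<psi> X" using assms(4)[OF YL X Y(2)] by auto
    have up: "chain_to K r Z' \<Longrightarrow> Z' \<subseteq> Z \<Longrightarrow> Z \<in> K \<Longrightarrow>
        chain_to K (if Z' = Z then r else Suc r) Z" for K r and Z Z' :: "'z set" by auto
    have 1: "chain_to L1 (if \<phi> Y = \<phi> X then p else Suc p) (\<phi> X)"
      using up[OF pq(2) m(1)] assms(2) X by blast
    have 2: "chain_to L2 (if \<psi> Y = \<psi> X then q else Suc q) (\<psi> X)"
      using up[OF pq(3) m(2)] assms(3) X by blast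
    show ?case using 1 2 m(3) pq(1)
      by (intro exI[of _ "if \<phi> Y = \<phi> X then p else Suc p"] exI[of _ "if \<psi> Y = \<psi> X then q else Suc q"]) auto
  qed
  fix n assume "enat n \<le> height L"
  then obtain X where "chain_to L n X" using enat_le_height[OF assms(1)] by blast
  from *[OF this] obtain p q where pq: "n \<le> p + q" "chain_to L1 p (\<phi> X)" "chain_to L2 q (\<psi> X)" by blast
  have "L1 \<noteq> {}" "L2 \<noteq> {}" using pq chain_to_in by blast+
  then have "enat p \<le> height L1" "enat q \<le> height L2" using pq enat_le_height by blast+
  then have "enat p + enat q \<le> height L1 + height L2" by (rule add_mono)
  moreover have "enat n \<le> enat p + enat q" using pq(1) by simp
  ultimately show "enat n \<le> height L1 + height L2" by (rule order_trans[rotated])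
qed

lemma chain_to_append:
  assumes "chain_to L1 p X" "L1 \<subseteq> L" "L2 \<subseteq> L" "\<And>S T. S \<in> L1 \<Longrightarrow> T \<in> L2 \<Longrightarrow> S \<subseteq> T"
  shows "chain_to L2 q Y \<Longrightarrow> \<exists>n\<ge>p + q. chain_to L n Y"
proof (induction q arbitrary: Y)
  case 0
  have c: "chain_to L p X"
    using chain_to_map[of L1 "\<lambda>x. x" L p X] assms(1,2) by blast
  have "X \<subseteq> Y" using assms(4) chain_to_in[OF assms(1)] 0 by simp
  \<comment> \<open>If both chains meet in one set, the lengths just add; otherwise the passage from
    \<open>X\<close> to \<open>Y\<close> is one more inclusion.\<close>
  show ?case
  proof (cases "X = Y")
    case True then show ?thesis using c by (intro exI[of _ p]) simp
  next
    case False
    then have "chain_to L (Suc p) Y" using c \<open>X \<subseteq> Y\<close> 0 assms(3) by auto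
    then show ?thesis by (intro exI[of _ "Suc p"]) (simp del: chain_to.simps)
  qed
next
  case (Suc q)
  then obtain Z where Z: "chain_to L2 q Z" "Z \<subset> Y" and "Y \<in> L2" by auto
  from Suc.IH[OF Z(1)] obtain n where "n \<ge> p + q" "chain_to L n Z" by blast
  then have "chain_to L (Suc n) Y" using Z \<open>Y \<in> L2\<close> assms(3) by auto
  then show ?case using \<open>n \<ge> p + q\<close> by (intro exI[of _ "Suc n"]) auto
qed

lemma height_append:
  assumes "L1 \<noteq> {}" "L2 \<noteq> {}" "L1 \<subseteq> L" "L2 \<subseteq> L" "\<And>S T. S \<in> L1 \<Longrightarrow> T \<in> L2 \<Longrightarrow> S \<subseteq> T"
  shows "height L1 + height L2 \<le> height L"
proof (rule enat_add_le_by_nats)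
  fix n m assume "enat n \<le> height L1" "enat m \<le> height L2"
  then obtain X Y where "chain_to L1 n X" "chain_to L2 m Y"
    using enat_le_height[OF assms(1)] enat_le_height[OF assms(2)] by blast
  from chain_to_append[OF this(1) assms(3,4,5) this(2)] obtain k where
    "k \<ge> n + m" "chain_to L k Y" by blast
  then show "enat (n + m) \<le> height L"
    using enat_le_height[of L] chain_to_le[of L k Y "n + m"] assms(1,3) by blast
qed

text \<open>A strict inclusion in \<open>L\<close> is strict in at least one of the two monotone
  images, so it descends in the lexicographic product of the two reversed inclusions.\<close>

lemma noetherian_two_maps:
  assumes "noetherian_family L1" "noetherian_family L2"
    "\<And>S. S \<in> L \<Longrightarrow> \<phi> S \<in> L1" "\<And>S. S \<in> L \<Longrightarrow> \<psi> S \<in> L2"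
    "\<And>S T. S \<in> L \<Longrightarrow> T \<in> L \<Longrightarrow> S \<subset> T \<Longrightarrow>
      \<phi> S \<subseteq> \<phi> T \<and> \<psi> S \<subseteq> \<psi> T \<and> (\<phi> S \<noteq> \<phi> T \<or> \<psi> S \<noteq> \<psi> T)"
  shows "noetherian_family L"
proof -
  let ?r = "\<lambda>L. {(T, S). S \<in> L \<and> T \<in> L \<and> S \<subset> T}"
  have "wf (inv_image (?r L1 <*lex*> ?r L2) (\<lambda>S. (\<phi> S, \<psi> S)))"
    using assms(1,2) unfolding noetherian_family_def by (intro wf_inv_image wf_lex_prod)
  moreover have "?r L \<subseteq> inv_image (?r L1 <*lex*> ?r L2) (\<lambda>S. (\<phi> S, \<psi> S))"
  proof
    fix p assume "p \<in> ?r L"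
    then obtain T S where p: "p = (T, S)" and "S \<in> L" "T \<in> L" "S \<subset> T" by blast
    then have "\<phi> S \<in> L1" "\<phi> T \<in> L1" "\<psi> S \<in> L2" "\<psi> T \<in> L2" "\<phi> S \<subseteq> \<phi> T" "\<psi> S \<subseteq> \<psi> T"
      "\<phi> S \<noteq> \<phi> T \<or> \<psi> S \<noteq> \<psi> T"
      using assms(3-5) by blast+
    then show "p \<in> inv_image (?r L1 <*lex*> ?r L2) (\<lambda>S. (\<phi> S, \<psi> S))"
      unfolding p in_inv_image in_lex_prod psubset_eq mem_Collect_eq case_prod_conv by metis
  qed
  ultimately show ?thesis unfolding noetherian_family_def by (rule wf_subset)
qed

lemma noetherian_map:
  assumes "noetherian_family L'" "\<And>S. S \<in> L \<Longrightarrow> \<phi> S \<in> L'"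
    "\<And>S T. S \<in> L \<Longrightarrow> T \<in> L \<Longrightarrow> S \<subset> T \<Longrightarrow> \<phi> S \<subset> \<phi> T"
  shows "noetherian_family L"
proof (rule noetherian_two_maps[where \<phi> = \<phi> and \<psi> = \<phi>, OF assms(1,1)])
  fix S T assume "S \<in> L" "T \<in> L" "S \<subset> T"
  then have "\<phi> S \<subset> \<phi> T" by (rule assms(3))
  then show "\<phi> S \<subseteq> \<phi> T \<and> \<phi> S \<subseteq> \<phi> T \<and> (\<phi> S \<noteq> \<phi> T \<or> \<phi> S \<noteq> \<phi> T)" by (simp add: psubset_eq)
qed (fact assms(2))+

lemma noetherian_maximal:
  assumes "noetherian_family L" "A \<subseteq> L" "S \<in> A"
  shows "\<exists>T\<in>A. S \<subseteq> T \<and> (\<forall>U\<in>A. T \<subseteq> U \<longrightarrow> U = T)"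
proof -
  have "S \<in> {U \<in> A. S \<subseteq> U}" using assms(3) by simp
  from wfE_min[OF assms(1)[unfolded noetherian_family_def] this]
  obtain T where T: "T \<in> A" "S \<subseteq> T" and
    max: "\<And>U. (U, T) \<in> {(T, S). S \<in> L \<and> T \<in> L \<and> S \<subset> T} \<Longrightarrow> U \<notin> {U \<in> A. S \<subseteq> U}"
    by blast
  have "U = T" if U: "U \<in> A" "T \<subseteq> U" for U
    using max[of U] T assms(2) U by blast
  then show ?thesis using T by blast
qed

section \<open>Submodules and subquotients\<close>

abbreviation submod :: "('r, 'c) ring_scheme \<Rightarrow> ('r, 'm, 'd) module_scheme \<Rightarrow> 'm set \<Rightarrow> bool" where
  "submod R M N \<equiv> LinearCombinations.submodule R N M"

lemma submodI:
  assumes "module R M" "N \<subseteq> carrier M" "\<zero>\<^bsub>M\<^esub> \<in> N"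
    "\<And>x y. x \<in> N \<Longrightarrow> y \<in> N \<Longrightarrow> x \<oplus>\<^bsub>M\<^esub> y \<in> N"
    "\<And>r x. r \<in> carrier R \<Longrightarrow> x \<in> N \<Longrightarrow> r \<odot>\<^bsub>M\<^esub> x \<in> N"
  shows "submod R M N"
  using assms by (simp add: LinearCombinations.submodule_def)

lemma submodD:
  assumes "submod R M N"
  shows "module R M" "N \<subseteq> carrier M" "\<zero>\<^bsub>M\<^esub> \<in> N"
    "\<And>x y. x \<in> N \<Longrightarrow> y \<in> N \<Longrightarrow> x \<oplus>\<^bsub>M\<^esub> y \<in> N"
    "\<And>r x. r \<in> carrier R \<Longrightarrow> x \<in> N \<Longrightarrow> r \<odot>\<^bsub>M\<^esub> x \<in> N"
  using assms by (auto simp: LinearCombinations.submodule_def)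

lemma submod_in_carrier: "submod R M N \<Longrightarrow> x \<in> N \<Longrightarrow> x \<in> carrier M"
  using submodD(2) by blast

context module
begin

lemma submod_uminus: "submod R M N \<Longrightarrow> x \<in> N \<Longrightarrow> \<ominus>\<^bsub>M\<^esub> x \<in> N"
  using submodD(5)[of R N M "\<ominus> \<one>" x] submodD(2)[of R N M] smult_l_minus[of \<one> x] by auto

lemma submod_minus: "submod R M N \<Longrightarrow> x \<in> N \<Longrightarrow> y \<in> N \<Longrightarrow> x \<ominus>\<^bsub>M\<^esub> y \<in> N"
  unfolding a_minus_def by (rule submodD(4)[OF _ _ submod_uminus])

lemma minus_add_cancel [simp]:
  "x \<in> carrier M \<Longrightarrow> y \<in> carrier M \<Longrightarrow> (x \<ominus>\<^bsub>M\<^esub> y) \<oplus>\<^bsub>M\<^esub> y = x"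
  by (simp add: a_minus_def M.a_assoc M.l_neg)

lemma add_minus_cancel [simp]:
  "x \<in> carrier M \<Longrightarrow> y \<in> carrier M \<Longrightarrow> (x \<oplus>\<^bsub>M\<^esub> y) \<ominus>\<^bsub>M\<^esub> y = x"
  by (simp add: a_minus_def M.a_assoc M.r_neg)

lemma add_minus_cancel_left [simp]:
  "x \<in> carrier M \<Longrightarrow> y \<in> carrier M \<Longrightarrow> (y \<oplus>\<^bsub>M\<^esub> x) \<ominus>\<^bsub>M\<^esub> y = x"
  using add_minus_cancel[of x y] by (simp add: M.a_comm)

lemma minus_self [simp]: "x \<in> carrier M \<Longrightarrow> x \<ominus>\<^bsub>M\<^esub> x = \<zero>\<^bsub>M\<^esub>"
  by (simp add: a_minus_def M.r_neg)

lemma minus_zero [simp]: "x \<in> carrier M \<Longrightarrow> x \<ominus>\<^bsub>M\<^esub> \<zero>\<^bsub>M\<^esub> = x"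
  by (simp add: a_minus_def)

lemma minus_eq_zero_iff [simp]:
  "x \<in> carrier M \<Longrightarrow> y \<in> carrier M \<Longrightarrow> x \<ominus>\<^bsub>M\<^esub> y = \<zero>\<^bsub>M\<^esub> \<longleftrightarrow> x = y"
  using minus_add_cancel[of x y] by auto

lemma smult_minus: "r \<in> carrier R \<Longrightarrow> x \<in> carrier M \<Longrightarrow> y \<in> carrier M \<Longrightarrow>
    r \<odot>\<^bsub>M\<^esub> (x \<ominus>\<^bsub>M\<^esub> y) = r \<odot>\<^bsub>M\<^esub> x \<ominus>\<^bsub>M\<^esub> r \<odot>\<^bsub>M\<^esub> y"
  by (simp add: a_minus_def smult_r_distr smult_r_minus)

lemma smult_minus_left: "r \<in> carrier R \<Longrightarrow> s \<in> carrier R \<Longrightarrow> x \<in> carrier M \<Longrightarrow>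
    (r \<ominus> s) \<odot>\<^bsub>M\<^esub> x = r \<odot>\<^bsub>M\<^esub> x \<ominus>\<^bsub>M\<^esub> s \<odot>\<^bsub>M\<^esub> x"
  by (simp add: a_minus_def smult_l_distr smult_l_minus)

lemma smult_commute: "r \<in> carrier R \<Longrightarrow> s \<in> carrier R \<Longrightarrow> x \<in> carrier M \<Longrightarrow>
    r \<odot>\<^bsub>M\<^esub> (s \<odot>\<^bsub>M\<^esub> x) = s \<odot>\<^bsub>M\<^esub> (r \<odot>\<^bsub>M\<^esub> x)"
  by (metis R.m_comm smult_assoc1)

lemma minus_add_minus: "x \<in> carrier M \<Longrightarrow> y \<in> carrier M \<Longrightarrow> x' \<in> carrier M \<Longrightarrow> y' \<in> carrier M \<Longrightarrow>
    (x \<oplus>\<^bsub>M\<^esub> x') \<ominus>\<^bsub>M\<^esub> (y \<oplus>\<^bsub>M\<^esub> y') = (x \<ominus>\<^bsub>M\<^esub> y) \<oplus>\<^bsub>M\<^esub> (x' \<ominus>\<^bsub>M\<^esub> y')"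
  by (simp add: a_minus_def M.minus_add M.a_ac)

lemma add_in_submod_iff:
  "submod R M N \<Longrightarrow> x \<in> N \<Longrightarrow> y \<in> carrier M \<Longrightarrow> x \<oplus>\<^bsub>M\<^esub> y \<in> N \<longleftrightarrow> y \<in> N"
  using submodD(4)[of R N M x y] submod_minus[of N "x \<oplus>\<^bsub>M\<^esub> y" x] submod_in_carrier[of R N M x]
    add_minus_cancel_left[of y x] by auto

lemma minus_in_submod_iff:
  "submod R M N \<Longrightarrow> x \<in> N \<Longrightarrow> y \<in> carrier M \<Longrightarrow> y \<ominus>\<^bsub>M\<^esub> x \<in> N \<longleftrightarrow> y \<in> N"
  using submodD(4)[of R N M "y \<ominus>\<^bsub>M\<^esub> x" x] submod_minus[of N y x] submod_in_carrier[of R N M x]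
    minus_add_cancel[of y x] by auto

lemma in_set_add: "z \<in> A <+>\<^bsub>M\<^esub> B \<longleftrightarrow> (\<exists>a\<in>A. \<exists>b\<in>B. z = a \<oplus>\<^bsub>M\<^esub> b)"
  by (auto simp: set_add_def set_mult_def)

lemma submod_carrier: "submod R M (carrier M)"
  by (rule submodI) (auto simp: module_axioms)

lemma submod_zero: "submod R M {\<zero>\<^bsub>M\<^esub>}"
  by (rule submodI) (auto simp: module_axioms)

lemma submod_Int: "submod R M A \<Longrightarrow> submod R M B \<Longrightarrow> submod R M (A \<inter> B)"
  by (auto simp: LinearCombinations.submodule_def)

lemma submod_set_add:
  assumes A: "submod R M A" and B: "submod R M B"
  shows "submod R M (A <+>\<^bsub>M\<^esub> B)"
proof (rule submodI[OF module_axioms])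
  note [simp] = submod_in_carrier[OF A] submod_in_carrier[OF B]
  show "A <+>\<^bsub>M\<^esub> B \<subseteq> carrier M" by (auto simp: in_set_add)
  show "\<zero>\<^bsub>M\<^esub> \<in> A <+>\<^bsub>M\<^esub> B"
    unfolding in_set_add using submodD(3)[OF A] submodD(3)[OF B] by force
  fix x y assume "x \<in> A <+>\<^bsub>M\<^esub> B" "y \<in> A <+>\<^bsub>M\<^esub> B"
  then obtain a b a' b' where *: "a \<in> A" "b \<in> B" "x = a \<oplus>\<^bsub>M\<^esub> b" "a' \<in> A" "b' \<in> B" "y = a' \<oplus>\<^bsub>M\<^esub> b'"
    unfolding in_set_add by blast
  then have "x \<oplus>\<^bsub>M\<^esub> y = (a \<oplus>\<^bsub>M\<^esub> a') \<oplus>\<^bsub>M\<^esub> (b \<oplus>\<^bsub>M\<^esub> b')" by (simp add: M.a_ac)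
  then show "x \<oplus>\<^bsub>M\<^esub> y \<in> A <+>\<^bsub>M\<^esub> B"
    unfolding in_set_add using * submodD(4)[OF A] submodD(4)[OF B] by blast
next
  note [simp] = submod_in_carrier[OF A] submod_in_carrier[OF B]
  fix r x assume r: "r \<in> carrier R" and "x \<in> A <+>\<^bsub>M\<^esub> B"
  then obtain a b where *: "a \<in> A" "b \<in> B" "x = a \<oplus>\<^bsub>M\<^esub> b" unfolding in_set_add by blast
  then have "r \<odot>\<^bsub>M\<^esub> x = r \<odot>\<^bsub>M\<^esub> a \<oplus>\<^bsub>M\<^esub> r \<odot>\<^bsub>M\<^esub> b" using r by (simp add: smult_r_distr)
  then show "r \<odot>\<^bsub>M\<^esub> x \<in> A <+>\<^bsub>M\<^esub> B"
    unfolding in_set_add using * submodD(5)[OF A r] submodD(5)[OF B r] by blast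
qed

lemma set_add_upper1:
  assumes A: "submod R M A" and B: "submod R M B"
  shows "A \<subseteq> A <+>\<^bsub>M\<^esub> B"
proof
  fix x assume "x \<in> A"
  then show "x \<in> A <+>\<^bsub>M\<^esub> B"
    unfolding in_set_add using submod_in_carrier[OF A] submodD(3)[OF B]
    by (intro bexI[of _ x] bexI[of _ "\<zero>\<^bsub>M\<^esub>"]) auto
qed

lemma set_add_upper2:
  assumes A: "submod R M A" and B: "submod R M B"
  shows "B \<subseteq> A <+>\<^bsub>M\<^esub> B"
proof
  fix x assume "x \<in> B"
  then show "x \<in> A <+>\<^bsub>M\<^esub> B"
    unfolding in_set_add using submod_in_carrier[OF B] submodD(3)[OF A]
    by (intro bexI[of _ x] bexI[of _ "\<zero>\<^bsub>M\<^esub>"]) auto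
qed

lemma set_add_least:
  assumes C: "submod R M C" and "A \<subseteq> C" "B \<subseteq> C"
  shows "A <+>\<^bsub>M\<^esub> B \<subseteq> C"
  unfolding subset_iff in_set_add using assms(2,3) submodD(4)[OF C] by blast

lemma set_add_mono: "A \<subseteq> A' \<Longrightarrow> B \<subseteq> B' \<Longrightarrow> A <+>\<^bsub>M\<^esub> B \<subseteq> A' <+>\<^bsub>M\<^esub> B'"
  unfolding subset_iff in_set_add by blast

lemma set_add_commute: "submod R M A \<Longrightarrow> submod R M B \<Longrightarrow> A <+>\<^bsub>M\<^esub> B = B <+>\<^bsub>M\<^esub> A"
  using submod_in_carrier M.a_comm unfolding set_eq_iff in_set_add by metis

lemma submod_smult_image:
  assumes "submod R M Z" "r \<in> carrier R"
  shows "submod R M ((\<lambda>z. r \<odot>\<^bsub>M\<^esub> z) ` Z)"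
proof (rule submodI[OF module_axioms])
  note Z = submodD[OF assms(1)] submod_in_carrier[OF assms(1)]
  show "(\<lambda>z. r \<odot>\<^bsub>M\<^esub> z) ` Z \<subseteq> carrier M" using Z assms(2) by auto
  show "\<zero>\<^bsub>M\<^esub> \<in> (\<lambda>z. r \<odot>\<^bsub>M\<^esub> z) ` Z"
    using Z(3) assms(2) by (intro image_eqI[of _ _ "\<zero>\<^bsub>M\<^esub>"]) auto
  fix x y assume "x \<in> (\<lambda>z. r \<odot>\<^bsub>M\<^esub> z) ` Z" "y \<in> (\<lambda>z. r \<odot>\<^bsub>M\<^esub> z) ` Z"
  then obtain a b where "a \<in> Z" "b \<in> Z" "x = r \<odot>\<^bsub>M\<^esub> a" "y = r \<odot>\<^bsub>M\<^esub> b" by blast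
  then have "a \<oplus>\<^bsub>M\<^esub> b \<in> Z" "x \<oplus>\<^bsub>M\<^esub> y = r \<odot>\<^bsub>M\<^esub> (a \<oplus>\<^bsub>M\<^esub> b)"
    using Z(4,6) assms(2) by (auto simp: smult_r_distr)
  then show "x \<oplus>\<^bsub>M\<^esub> y \<in> (\<lambda>z. r \<odot>\<^bsub>M\<^esub> z) ` Z" by blast
next
  note Z = submodD[OF assms(1)] submod_in_carrier[OF assms(1)]
  fix s x assume "s \<in> carrier R" "x \<in> (\<lambda>z. r \<odot>\<^bsub>M\<^esub> z) ` Z"
  then obtain z where "z \<in> Z" "x = r \<odot>\<^bsub>M\<^esub> z" by blast
  then show "s \<odot>\<^bsub>M\<^esub> x \<in> (\<lambda>z. r \<odot>\<^bsub>M\<^esub> z) ` Z"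
    using Z(5)[OF \<open>s \<in> carrier R\<close>, of z] Z(6)[of z] smult_commute[OF \<open>s \<in> carrier R\<close> assms(2), of z] by auto
qed

lemma submod_cyclic:
  assumes "v \<in> carrier M"
  shows "submod R M ((\<lambda>r. r \<odot>\<^bsub>M\<^esub> v) ` carrier R)"
proof (rule submodI[OF module_axioms])
  show "\<zero>\<^bsub>M\<^esub> \<in> (\<lambda>r. r \<odot>\<^bsub>M\<^esub> v) ` carrier R"
    using assms by (intro image_eqI[of _ _ "\<zero>"]) auto
next
  fix x y assume "x \<in> (\<lambda>r. r \<odot>\<^bsub>M\<^esub> v) ` carrier R" "y \<in> (\<lambda>r. r \<odot>\<^bsub>M\<^esub> v) ` carrier R"
  then show "x \<oplus>\<^bsub>M\<^esub> y \<in> (\<lambda>r. r \<odot>\<^bsub>M\<^esub> v) ` carrier R"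
    using assms by (auto simp: smult_l_distr[symmetric])
next
  fix s x assume "s \<in> carrier R" "x \<in> (\<lambda>r. r \<odot>\<^bsub>M\<^esub> v) ` carrier R"
  then show "s \<odot>\<^bsub>M\<^esub> x \<in> (\<lambda>r. r \<odot>\<^bsub>M\<^esub> v) ` carrier R"
    using assms by (auto simp: smult_assoc1[symmetric])
qed (use assms in auto)

lemma span_in_submod: "submod R M N \<Longrightarrow> S \<subseteq> N \<Longrightarrow> span S \<subseteq> N"
  by (rule span_is_subset)

end

section \<open>Length and chain condition of a subquotient \<open>Z/B\<close>\<close>

definition submod_interval ::
    "('r, 'c) ring_scheme \<Rightarrow> ('r, 'm, 'd) module_scheme \<Rightarrow> 'm set \<Rightarrow> 'm set \<Rightarrow> 'm set set" where
  "submod_interval R M B Z = {N. submod R M N \<and> B \<subseteq> N \<and> N \<subseteq> Z}"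

text \<open>The length of \<open>Z/B\<close>, read off the lattice of intermediate submodules and
  allowed to be infinite.\<close>

definition mlength ::
    "('r, 'c) ring_scheme \<Rightarrow> ('r, 'm, 'd) module_scheme \<Rightarrow> 'm set \<Rightarrow> 'm set \<Rightarrow> enat" where
  "mlength R M B Z = height (submod_interval R M B Z)"

definition noetherian_subquot ::
    "('r, 'c) ring_scheme \<Rightarrow> ('r, 'm, 'd) module_scheme \<Rightarrow> 'm set \<Rightarrow> 'm set \<Rightarrow> bool" where
  "noetherian_subquot R M B Z \<longleftrightarrow> noetherian_family (submod_interval R M B Z)"

context module
begin

text \<open>The modular law. If both traces agreed, a \<open>t\<close> in \<open>T\<close> would be
  \<open>s + y\<close> with \<open>s\<close> in \<open>S\<close> and \<open>y\<close> in
  \<open>Y\<close>; then \<open>y = t - s\<close> lies in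
  \<open>T \<inter> Y = S \<inter> Y\<close>, and \<open>t\<close> is in \<open>S\<close>.\<close>

lemma modular_strict:
  assumes "submod R M Y" "submod R M S" "submod R M T" "S \<subset> T"
  shows "S \<inter> Y \<noteq> T \<inter> Y \<or> S <+>\<^bsub>M\<^esub> Y \<noteq> T <+>\<^bsub>M\<^esub> Y"
proof (rule ccontr)
  assume "\<not> ?thesis"
  then have 1: "S \<inter> Y = T \<inter> Y" and 2: "S <+>\<^bsub>M\<^esub> Y = T <+>\<^bsub>M\<^esub> Y" by auto
  obtain t where t: "t \<in> T" "t \<notin> S" using assms(4) by blast
  have "t \<in> S <+>\<^bsub>M\<^esub> Y" using 2 set_add_upper1[OF assms(3,1)] t by blast
  then obtain s y where sy: "s \<in> S" "y \<in> Y" "t = s \<oplus>\<^bsub>M\<^esub> y" unfolding in_set_add by blast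
  have "s \<in> T" using sy assms(4) by blast
  then have "y \<in> T" using add_in_submod_iff[OF assms(3) \<open>s \<in> T\<close>, of y] sy t submod_in_carrier[OF assms(1)] by blast
  then have "y \<in> S" using 1 sy by blast
  then show False using sy t submodD(4)[OF assms(2)] by blast
qed

lemma submod_interval_split:
  assumes "submod R M Y" "B \<subseteq> Y" "Y \<subseteq> Z" "submod R M Z"
  shows "S \<in> submod_interval R M B Z \<Longrightarrow> S \<inter> Y \<in> submod_interval R M B Y"
    "S \<in> submod_interval R M B Z \<Longrightarrow> S <+>\<^bsub>M\<^esub> Y \<in> submod_interval R M Y Z"
    "S \<in> submod_interval R M B Z \<Longrightarrow> T \<in> submod_interval R M B Z \<Longrightarrow> S \<subset> T \<Longrightarrow>
      S \<inter> Y \<subseteq> T \<inter> Y \<and> S <+>\<^bsub>M\<^esub> Y \<subseteq> T <+>\<^bsub>M\<^esub> Y \<and> (S \<inter> Y \<noteq> T \<inter> Y \<or> S <+>\<^bsub>M\<^esub> Y \<noteq> T <+>\<^bsub>M\<^esub> Y)"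
proof -
  assume S: "S \<in> submod_interval R M B Z"
  then show "S \<inter> Y \<in> submod_interval R M B Y"
    using assms by (auto simp: submod_interval_def intro: submod_Int)
  show "S <+>\<^bsub>M\<^esub> Y \<in> submod_interval R M Y Z"
    using S assms submod_set_add[of S Y] set_add_upper2[of S Y] set_add_least[of Z S Y]
    by (auto simp: submod_interval_def)
next
  assume S: "S \<in> submod_interval R M B Z" "T \<in> submod_interval R M B Z" "S \<subset> T"
  then show "S \<inter> Y \<subseteq> T \<inter> Y \<and> S <+>\<^bsub>M\<^esub> Y \<subseteq> T <+>\<^bsub>M\<^esub> Y \<and> (S \<inter> Y \<noteq> T \<inter> Y \<or> S <+>\<^bsub>M\<^esub> Y \<noteq> T <+>\<^bsub>M\<^esub> Y)"
    using modular_strict[OF assms(1)] set_add_mono[of S T Y Y] by (auto simp: submod_interval_def)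
qed

text \<open>Chains below and above \<open>Y\<close> can be glued, which gives one inequality; by the
  modular law a chain from \<open>B\<close> to \<open>Z\<close> splits into its traces on both sides
  of \<open>Y\<close>, which gives the other.\<close>

lemma mlength_add:
  assumes "submod R M B" "submod R M Y" "submod R M Z" "B \<subseteq> Y" "Y \<subseteq> Z"
  shows "mlength R M B Z = mlength R M B Y + mlength R M Y Z"
proof (rule antisym)
  have ne: "B \<in> submod_interval R M B Z" "B \<in> submod_interval R M B Y" "Y \<in> submod_interval R M Y Z"
    using assms by (auto simp: submod_interval_def)
  show "mlength R M B Z \<le> mlength R M B Y + mlength R M Y Z"
    unfolding mlength_def
    using ne submod_interval_split[OF assms(2,4,5,3)]
    by (intro height_le_two_maps[where \<phi> = "\<lambda>S. S \<inter> Y" and \<psi> = "\<lambda>S. S <+>\<^bsub>M\<^esub> Y"]) blast+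
  show "mlength R M B Y + mlength R M Y Z \<le> mlength R M B Z"
    unfolding mlength_def
    by (rule height_append) (use ne assms in \<open>auto simp: submod_interval_def\<close>)
qed

lemma noetherian_subquot_add:
  assumes "submod R M Y" "submod R M Z" "B \<subseteq> Y" "Y \<subseteq> Z"
    "noetherian_subquot R M B Y" "noetherian_subquot R M Y Z"
  shows "noetherian_subquot R M B Z"
  unfolding noetherian_subquot_def
  by (rule noetherian_two_maps[OF assms(5,6)[unfolded noetherian_subquot_def],
        where \<phi> = "\<lambda>S. S \<inter> Y" and \<psi> = "\<lambda>S. S <+>\<^bsub>M\<^esub> Y"])
    (use submod_interval_split[OF assms(1,3,4,2)] in blast)+

end

lemma noetherian_subquot_mono:
  "noetherian_subquot R M B Z \<Longrightarrow> B \<subseteq> B' \<Longrightarrow> Z' \<subseteq> Z \<Longrightarrow> noetherian_subquot R M B' Z'"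
  unfolding noetherian_subquot_def
  by (rule noetherian_map[where \<phi> = "\<lambda>x. x" and L' = "submod_interval R M B Z"])
    (auto simp: submod_interval_def)

lemma mlength_self [simp]: "mlength R M B B = 0"
proof -
  have "chain_to (submod_interval R M B B) n X \<Longrightarrow> n = 0" for n X
    by (cases n) (auto simp: submod_interval_def dest!: chain_to_in)
  then have "height (submod_interval R M B B) \<le> 0"
    unfolding height_def by (intro SUP_least) (auto simp: zero_enat_def)
  then show ?thesis by (simp add: mlength_def)
qed

lemma mlength_pos:
  assumes "submod R M B" "submod R M Z" "B \<subset> Z"
  shows "1 \<le> mlength R M B Z"
proof -
  have c: "chain_to (submod_interval R M B Z) 1 Z"
    using assms by (auto simp: submod_interval_def)
  then have "submod_interval R M B Z \<noteq> {}" using chain_to_in[OF c] by blast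
  from enat_le_height[OF this] c have "enat 1 \<le> mlength R M B Z"
    unfolding mlength_def by blast
  then show ?thesis by (simp add: one_enat_def)
qed

lemma mlength_le_1:
  assumes "submod R M B" "submod R M Z" "B \<subseteq> Z"
    "\<And>N. submod R M N \<Longrightarrow> B \<subset> N \<Longrightarrow> N \<subseteq> Z \<Longrightarrow> N = Z"
  shows "mlength R M B Z \<le> 1"
proof -
  have "n \<le> 1" if c: "chain_to (submod_interval R M B Z) n X" for n X
  proof (rule ccontr)
    assume "\<not> n \<le> 1"
    then obtain Y where "chain_to (submod_interval R M B Z) 2 Y"
      using chain_to_le[OF c, of 2] by auto
    then obtain X1 X2 where "X1 \<subset> X2" "X2 \<subset> Y" "X1 \<in> submod_interval R M B Z"
       "X2 \<in> submod_interval R M B Z" "Y \<in> submod_interval R M B Z"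
      by (auto simp: numeral_2_eq_2)
    then show False using assms(4)[of X2] unfolding submod_interval_def by blast
  qed
  then have "height (submod_interval R M B Z) \<le> enat 1"
    unfolding height_def by (intro SUP_least) auto
  then show ?thesis by (simp add: mlength_def one_enat_def)
qed

lemma mlength_mono:
  assumes "B \<subseteq> B'" "Z' \<subseteq> Z" "submod R M B'" "B' \<subseteq> Z'"
  shows "mlength R M B' Z' \<le> mlength R M B Z"
  unfolding mlength_def
  by (rule height_le_map[where \<phi> = "\<lambda>x. x"]) (use assms in \<open>auto simp: submod_interval_def\<close>)

subsection \<open>Isomorphisms of subquotients\<close>

text \<open>A submodule of \<open>M \<times> N\<close>. Such relations are closed under converse,
  composition and restriction, so maps defined only up to a choice, connecting homomorphisms in
  particular, are linear by construction.\<close>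

definition linear_rel :: "('r, 'c) ring_scheme \<Rightarrow> ('r, 'm, 'd) module_scheme \<Rightarrow> ('r, 'n, 'e) module_scheme
    \<Rightarrow> ('m \<times> 'n) set \<Rightarrow> bool" where
  "linear_rel R M N \<rho> \<longleftrightarrow> module R M \<and> module R N \<and> \<rho> \<subseteq> carrier M \<times> carrier N \<and>
     (\<zero>\<^bsub>M\<^esub>, \<zero>\<^bsub>N\<^esub>) \<in> \<rho> \<and>
     (\<forall>x y x' y'. (x, y) \<in> \<rho> \<longrightarrow> (x', y') \<in> \<rho> \<longrightarrow> (x \<oplus>\<^bsub>M\<^esub> x', y \<oplus>\<^bsub>N\<^esub> y') \<in> \<rho>) \<and>
     (\<forall>r x y. r \<in> carrier R \<longrightarrow> (x, y) \<in> \<rho> \<longrightarrow> (r \<odot>\<^bsub>M\<^esub> x, r \<odot>\<^bsub>N\<^esub> y) \<in> \<rho>)"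

text \<open>\<open>Z/B \<cong> Z'/B'\<close>, witnessed by a linear relation, so that no quotient is ever formed.\<close>

definition subquot_iso :: "('r, 'c) ring_scheme \<Rightarrow> ('r, 'm, 'd) module_scheme \<Rightarrow> 'm set \<Rightarrow> 'm set
    \<Rightarrow> ('r, 'n, 'e) module_scheme \<Rightarrow> 'n set \<Rightarrow> 'n set \<Rightarrow> bool" where
  "subquot_iso R M B Z N B' Z' \<longleftrightarrow> (\<exists>\<rho>. linear_rel R M N \<rho> \<and> Domain \<rho> = Z \<and> Range \<rho> = Z' \<and>
     (\<forall>(x, y)\<in>\<rho>. x \<in> B \<longleftrightarrow> y \<in> B') \<and> B \<subseteq> Z \<and> B' \<subseteq> Z' \<and> submod R M B \<and> submod R N B')"

lemma linear_relI:
  assumes "module R M" "module R N" "\<And>x y. (x, y) \<in> \<rho> \<Longrightarrow> x \<in> carrier M \<and> y \<in> carrier N"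
    "(\<zero>\<^bsub>M\<^esub>, \<zero>\<^bsub>N\<^esub>) \<in> \<rho>"
    "\<And>x y x' y'. (x, y) \<in> \<rho> \<Longrightarrow> (x', y') \<in> \<rho> \<Longrightarrow> (x \<oplus>\<^bsub>M\<^esub> x', y \<oplus>\<^bsub>N\<^esub> y') \<in> \<rho>"
    "\<And>r x y. r \<in> carrier R \<Longrightarrow> (x, y) \<in> \<rho> \<Longrightarrow> (r \<odot>\<^bsub>M\<^esub> x, r \<odot>\<^bsub>N\<^esub> y) \<in> \<rho>"
  shows "linear_rel R M N \<rho>"
  unfolding linear_rel_def using assms by auto

lemma linear_relD:
  assumes "linear_rel R M N \<rho>"
  shows "module R M" "module R N"
  using assms by (auto simp: linear_rel_def)

lemma linear_rel_add: "linear_rel R M N \<rho> \<Longrightarrow> (x, y) \<in> \<rho> \<Longrightarrow> (x', y') \<in> \<rho> \<Longrightarrow> (x \<oplus>\<^bsub>M\<^esub> x', y \<oplus>\<^bsub>N\<^esub> y') \<in> \<rho>"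
  by (auto simp: linear_rel_def)

lemma linear_rel_smult: "linear_rel R M N \<rho> \<Longrightarrow> r \<in> carrier R \<Longrightarrow> (x, y) \<in> \<rho> \<Longrightarrow> (r \<odot>\<^bsub>M\<^esub> x, r \<odot>\<^bsub>N\<^esub> y) \<in> \<rho>"
  by (auto simp: linear_rel_def)

lemma linear_rel_carrier: "linear_rel R M N \<rho> \<Longrightarrow> (x, y) \<in> \<rho> \<Longrightarrow> x \<in> carrier M \<and> y \<in> carrier N"
  by (auto simp: linear_rel_def)

lemma linear_rel_zero: "linear_rel R M N \<rho> \<Longrightarrow> (\<zero>\<^bsub>M\<^esub>, \<zero>\<^bsub>N\<^esub>) \<in> \<rho>"
  by (auto simp: linear_rel_def)

lemma linear_rel_minus:
  assumes "linear_rel R M N \<rho>" "(x, y) \<in> \<rho>" "(x', y') \<in> \<rho>"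
  shows "(x \<ominus>\<^bsub>M\<^esub> x', y \<ominus>\<^bsub>N\<^esub> y') \<in> \<rho>"
proof -
  interpret M: module R M using assms(1) by (simp add: linear_rel_def)
  interpret N: module R N using assms(1) by (simp add: linear_rel_def)
  have "(\<ominus>\<^bsub>R\<^esub> \<one>\<^bsub>R\<^esub> \<odot>\<^bsub>M\<^esub> x', \<ominus>\<^bsub>R\<^esub> \<one>\<^bsub>R\<^esub> \<odot>\<^bsub>N\<^esub> y') \<in> \<rho>" using linear_rel_smult[OF assms(1) _ assms(3)] by simp
  then have "(\<ominus>\<^bsub>M\<^esub> x', \<ominus>\<^bsub>N\<^esub> y') \<in> \<rho>"
    using linear_rel_carrier[OF assms(1,3)] by (simp add: M.smult_l_minus N.smult_l_minus)
  then show ?thesis using linear_rel_add[OF assms(1,2)] by (simp add: a_minus_def)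
qed

lemma linear_rel_converse: "linear_rel R M N \<rho> \<Longrightarrow> linear_rel R N M (\<rho>\<inverse>)"
  by (auto simp: linear_rel_def)

lemma linear_rel_comp:
  assumes r: "linear_rel R M N \<rho>" and s: "linear_rel R N P \<sigma>"
  shows "linear_rel R M P (\<rho> O \<sigma>)"
proof (rule linear_relI[OF linear_relD(1)[OF r] linear_relD(2)[OF s]])
  show "(\<zero>\<^bsub>M\<^esub>, \<zero>\<^bsub>P\<^esub>) \<in> \<rho> O \<sigma>" using linear_rel_zero[OF r] linear_rel_zero[OF s] by blast
  fix x y assume "(x, y) \<in> \<rho> O \<sigma>"
  then obtain z where z: "(x, z) \<in> \<rho>" "(z, y) \<in> \<sigma>" by blast
  show "x \<in> carrier M \<and> y \<in> carrier P" using linear_rel_carrier[OF r z(1)] linear_rel_carrier[OF s z(2)] by blast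
  fix q assume "q \<in> carrier R"
  then show "(q \<odot>\<^bsub>M\<^esub> x, q \<odot>\<^bsub>P\<^esub> y) \<in> \<rho> O \<sigma>"
    using linear_rel_smult[OF r _ z(1)] linear_rel_smult[OF s _ z(2)] by blast
next
  fix x y x' y' assume "(x, y) \<in> \<rho> O \<sigma>" "(x', y') \<in> \<rho> O \<sigma>"
  then obtain z z' where z: "(x, z) \<in> \<rho>" "(z, y) \<in> \<sigma>" "(x', z') \<in> \<rho>" "(z', y') \<in> \<sigma>" by blast
  then show "(x \<oplus>\<^bsub>M\<^esub> x', y \<oplus>\<^bsub>P\<^esub> y') \<in> \<rho> O \<sigma>"
    using linear_rel_add[OF r z(1,3)] linear_rel_add[OF s z(2,4)] by blast
qed

lemma linear_rel_restrict:
  assumes "linear_rel R M N \<rho>" "submod R M S"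
  shows "linear_rel R M N {(x, y). (x, y) \<in> \<rho> \<and> x \<in> S}"
  using assms(1) submodD(3-5)[OF assms(2)] by (auto simp: linear_rel_def)

lemma linear_rel_congruent:
  assumes "submod R N B"
  shows "linear_rel R N N {(x, y). x \<in> carrier N \<and> y \<in> carrier N \<and> x \<ominus>\<^bsub>N\<^esub> y \<in> B}"
proof -
  interpret N: module R N by (rule submodD(1)[OF assms])
  show ?thesis
    by (rule linear_relI)
      (use submodD(3-5)[OF assms] N.module_axioms in \<open>auto simp: N.minus_add_minus N.smult_minus[symmetric]\<close>)
qed

lemma linear_rel_Image:
  assumes "linear_rel R M N \<rho>" "submod R M S"
  shows "submod R N (\<rho> `` S)"
proof (rule submodI[OF linear_relD(2)[OF assms(1)]])
  show "\<rho> `` S \<subseteq> carrier N" using linear_rel_carrier[OF assms(1)] by blast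
  show "\<zero>\<^bsub>N\<^esub> \<in> \<rho> `` S" using linear_rel_zero[OF assms(1)] submodD(3)[OF assms(2)] by blast
  fix y assume "y \<in> \<rho> `` S"
  then obtain x where x: "x \<in> S" "(x, y) \<in> \<rho>" by blast
  {
    fix q assume "q \<in> carrier R"
    then show "q \<odot>\<^bsub>N\<^esub> y \<in> \<rho> `` S"
      using linear_rel_smult[OF assms(1) _ x(2)] submodD(5)[OF assms(2) _ x(1)] by blast
  next
    fix y' assume "y' \<in> \<rho> `` S"
    then obtain x' where x': "x' \<in> S" "(x', y') \<in> \<rho>" by blast
    then show "y \<oplus>\<^bsub>N\<^esub> y' \<in> \<rho> `` S"
      using linear_rel_add[OF assms(1) x(2) x'(2)] submodD(4)[OF assms(2) x(1) x'(1)] by blast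
  }
qed

lemma linear_rel_Domain: "linear_rel R M N \<rho> \<Longrightarrow> submod R M (Domain \<rho>)"
proof -
  assume r: "linear_rel R M N \<rho>"
  then have "module R N" by (simp add: linear_rel_def)
  have "\<rho>\<inverse> `` carrier N = Domain \<rho>" using linear_rel_carrier[OF r] by blast
  then show ?thesis
    using linear_rel_Image[OF linear_rel_converse[OF r] module.submod_carrier[OF \<open>module R N\<close>]] by simp
qed

lemma linear_rel_Range: "linear_rel R M N \<rho> \<Longrightarrow> submod R N (Range \<rho>)"
  using linear_rel_Domain[OF linear_rel_converse] by (metis Domain_converse)

lemma subquot_iso_sym: "subquot_iso R M B Z N B' Z' \<Longrightarrow> subquot_iso R N B' Z' M B Z"
proof -
  assume "subquot_iso R M B Z N B' Z'"
  then obtain \<rho> where r: "linear_rel R M N \<rho>" "Domain \<rho> = Z" "Range \<rho> = Z'"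
      "\<forall>(x, y)\<in>\<rho>. x \<in> B \<longleftrightarrow> y \<in> B'" "B \<subseteq> Z" "B' \<subseteq> Z'" "submod R M B" "submod R N B'"
    unfolding subquot_iso_def by blast
  moreover have "Domain (\<rho>\<inverse>) = Z'" "Range (\<rho>\<inverse>) = Z" "\<forall>(x, y)\<in>\<rho>\<inverse>. x \<in> B' \<longleftrightarrow> y \<in> B"
    using r by auto
  ultimately show ?thesis unfolding subquot_iso_def using linear_rel_converse[OF r(1)] by blast
qed

lemma subquot_iso_trans:
  assumes "subquot_iso R M B Z N B' Z'" "subquot_iso R N B' Z' P B'' Z''"
  shows "subquot_iso R M B Z P B'' Z''"
proof -
  obtain \<rho> where r: "linear_rel R M N \<rho>" "Domain \<rho> = Z" "Range \<rho> = Z'"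
      "\<forall>(x, y)\<in>\<rho>. x \<in> B \<longleftrightarrow> y \<in> B'" "B \<subseteq> Z" "submod R M B"
    using assms(1) unfolding subquot_iso_def by blast
  obtain \<sigma> where s: "linear_rel R N P \<sigma>" "Domain \<sigma> = Z'" "Range \<sigma> = Z''"
      "\<forall>(x, y)\<in>\<sigma>. x \<in> B' \<longleftrightarrow> y \<in> B''" "B'' \<subseteq> Z''" "submod R P B''"
    using assms(2) unfolding subquot_iso_def by blast
  have "Domain (\<rho> O \<sigma>) = Z" "Range (\<rho> O \<sigma>) = Z''" using r(2,3) s(2,3) by blast+
  moreover have "\<forall>(x, y)\<in>\<rho> O \<sigma>. x \<in> B \<longleftrightarrow> y \<in> B''" using r(4) s(4) by blast
  ultimately show ?thesis
    unfolding subquot_iso_def using linear_rel_comp[OF r(1) s(1)] r(5,6) s(5,6) by blast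
qed

lemma subquot_iso_interval_map:
  assumes "subquot_iso R M B Z N B' Z'"
  obtains \<phi> where "\<And>S. S \<in> submod_interval R M B Z \<Longrightarrow> \<phi> S \<in> submod_interval R N B' Z'"
    "\<And>S T. S \<in> submod_interval R M B Z \<Longrightarrow> T \<in> submod_interval R M B Z \<Longrightarrow> S \<subset> T \<Longrightarrow> \<phi> S \<subset> \<phi> T"
proof -
  obtain \<rho> where r: "linear_rel R M N \<rho>" "Domain \<rho> = Z" "Range \<rho> = Z'"
      "\<And>x y. (x, y)\<in>\<rho> \<Longrightarrow> x \<in> B \<longleftrightarrow> y \<in> B'" "B \<subseteq> Z" "B' \<subseteq> Z'"
      and B': "submod R N B'"
    using assms unfolding subquot_iso_def by blast
  interpret M: module R M using r(1) by (simp add: linear_rel_def)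
  interpret N: module R N using r(1) by (simp add: linear_rel_def)
  show thesis
  proof
    fix S assume S: "S \<in> submod_interval R M B Z"
    have "B' \<subseteq> \<rho> `` S"
    proof
      fix z assume "z \<in> B'"
      then obtain w where "(w, z) \<in> \<rho>" "w \<in> B" using r(3,4,6) by blast
      then show "z \<in> \<rho> `` S" using S by (auto simp: submod_interval_def)
    qed
    then show "\<rho> `` S \<in> submod_interval R N B' Z'"
      using S linear_rel_Image[OF r(1)] r(3) by (auto simp: submod_interval_def)
  next
    fix S T assume S: "S \<in> submod_interval R M B Z" and T: "T \<in> submod_interval R M B Z" and "S \<subset> T"
    then obtain t where t: "t \<in> T" "t \<notin> S" by blast
    have sS: "submod R M S" using S by (simp add: submod_interval_def)
    obtain z where z: "(t, z) \<in> \<rho>" using t T r(2) by (auto simp: submod_interval_def)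
    have "z \<notin> \<rho> `` S"
    proof
      assume "z \<in> \<rho> `` S"
      then obtain s where s: "s \<in> S" "(s, z) \<in> \<rho>" by blast
      then have "(t \<ominus>\<^bsub>M\<^esub> s, \<zero>\<^bsub>N\<^esub>) \<in> \<rho>"
        using linear_rel_minus[OF r(1) z s(2)] linear_rel_carrier[OF r(1) z] by simp
      then have "t \<ominus>\<^bsub>M\<^esub> s \<in> B"
        using r(4) submodD(3)[OF B'] by blast
      then have "t \<ominus>\<^bsub>M\<^esub> s \<in> S" using S by (auto simp: submod_interval_def)
      then show False
        using M.minus_in_submod_iff[OF sS s(1)] linear_rel_carrier[OF r(1) z] t by blast
    qed
    moreover have "\<rho> `` S \<subseteq> \<rho> `` T" using \<open>S \<subset> T\<close> by blast
    ultimately show "\<rho> `` S \<subset> \<rho> `` T" using z t(1) by blast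
  qed
qed

lemma subquot_iso_mlength:
  assumes "subquot_iso R M B Z N B' Z'"
  shows "mlength R M B Z = mlength R N B' Z'"
proof -
  have le: "mlength R M B Z \<le> mlength R N B' Z'" if iso: "subquot_iso R M B Z N B' Z'"
    for M :: "('a, 'x, 'y) module_scheme" and N :: "('a, 'z, 'w) module_scheme" and B Z B' Z'
  proof -
    have "B \<in> submod_interval R M B Z" using iso by (auto simp: subquot_iso_def submod_interval_def)
    then show ?thesis
      unfolding mlength_def
    proof -
      assume ne: "B \<in> submod_interval R M B Z"
      obtain \<phi> where \<phi>: "\<And>S. S \<in> submod_interval R M B Z \<Longrightarrow> \<phi> S \<in> submod_interval R N B' Z'"
        "\<And>S T. S \<in> submod_interval R M B Z \<Longrightarrow> T \<in> submod_interval R M B Z \<Longrightarrow> S \<subset> T \<Longrightarrow> \<phi> S \<subset> \<phi> T"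
        using subquot_iso_interval_map[OF iso] by blast
      show "height (submod_interval R M B Z) \<le> height (submod_interval R N B' Z')"
        by (rule height_le_map[of _ \<phi>]) (use ne in blast, fact \<phi>(1), fact \<phi>(2))
    qed
  qed
  show ?thesis using le[OF assms] le[OF subquot_iso_sym[OF assms]] by (rule antisym)
qed

lemma subquot_iso_noetherian:
  assumes "subquot_iso R M B Z N B' Z'" "noetherian_subquot R N B' Z'"
  shows "noetherian_subquot R M B Z"
proof -
  obtain \<phi> where \<phi>: "\<And>S. S \<in> submod_interval R M B Z \<Longrightarrow> \<phi> S \<in> submod_interval R N B' Z'"
    "\<And>S T. S \<in> submod_interval R M B Z \<Longrightarrow> T \<in> submod_interval R M B Z \<Longrightarrow> S \<subset> T \<Longrightarrow> \<phi> S \<subset> \<phi> T"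
    using subquot_iso_interval_map[OF assms(1)] by blast
  show ?thesis
    unfolding noetherian_subquot_def
    by (rule noetherian_map[OF assms(2)[unfolded noetherian_subquot_def], of _ \<phi>]) (fact \<phi>(1), fact \<phi>(2))
qed

text \<open>The relation has to reach \<open>Z'\<close> only modulo \<open>B'\<close>; composing it
  with congruence modulo \<open>B'\<close> makes its range all of \<open>Z'\<close>.\<close>

lemma subquot_isoI:
  assumes "linear_rel R M N \<rho>" "\<And>x. x \<in> Z \<Longrightarrow> \<exists>y. (x, y) \<in> \<rho>"
    "\<And>x y. (x, y) \<in> \<rho> \<Longrightarrow> x \<in> Z \<and> y \<in> Z'"
    "\<And>z. z \<in> Z' \<Longrightarrow> \<exists>x y. (x, y) \<in> \<rho> \<and> z \<ominus>\<^bsub>N\<^esub> y \<in> B'"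
    "\<And>x y. (x, y) \<in> \<rho> \<Longrightarrow> x \<in> B \<longleftrightarrow> y \<in> B'"
    "B \<subseteq> Z" "B' \<subseteq> Z'" "submod R M B" "submod R N B'" "submod R N Z'"
  shows "subquot_iso R M B Z N B' Z'"
proof -
  interpret M: module R M using assms(1) by (simp add: linear_rel_def)
  interpret N: module R N using assms(1) by (simp add: linear_rel_def)
  define \<sigma> where "\<sigma> = \<rho> O {(z, y). z \<in> carrier N \<and> y \<in> carrier N \<and> z \<ominus>\<^bsub>N\<^esub> y \<in> B'}\<inverse>"
  note B' = submodD[OF assms(9)] and Z' = submod_in_carrier[OF assms(10)]
  note c = linear_rel_carrier[OF assms(1)]
  have \<sigma>: "(x, z) \<in> \<sigma> \<longleftrightarrow> (\<exists>y. (x, y) \<in> \<rho> \<and> z \<in> carrier N \<and> z \<ominus>\<^bsub>N\<^esub> y \<in> B')" for x z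
    using c by (auto simp: \<sigma>_def)
  have lin: "linear_rel R M N \<sigma>"
    unfolding \<sigma>_def by (rule linear_rel_comp[OF assms(1) linear_rel_converse[OF linear_rel_congruent[OF assms(9)]]])
  have iff: "z \<in> T \<longleftrightarrow> y \<in> T" if "z \<ominus>\<^bsub>N\<^esub> y \<in> B'" "z \<in> carrier N" "y \<in> carrier N" "submod R N T" "B' \<subseteq> T" for y z T
    using N.add_in_submod_iff[OF that(4), of "z \<ominus>\<^bsub>N\<^esub> y" y] that by auto
  have dom: "Domain \<sigma> = Z"
  proof
    show "Domain \<sigma> \<subseteq> Z" using assms(3) by (auto simp: \<sigma>)
    show "Z \<subseteq> Domain \<sigma>"
    proof
      fix x assume "x \<in> Z"
      then obtain y where "(x, y) \<in> \<rho>" using assms(2) by blast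
      then have "(x, y) \<in> \<sigma>" unfolding \<sigma> using c B'(3) by (intro exI[of _ y]) simp
      then show "x \<in> Domain \<sigma>" by blast
    qed
  qed
  have ran: "Range \<sigma> = Z'"
  proof
    show "Range \<sigma> \<subseteq> Z'"
    proof
      fix z assume "z \<in> Range \<sigma>"
      then obtain x y where y: "(x, y) \<in> \<rho>" "z \<in> carrier N" "z \<ominus>\<^bsub>N\<^esub> y \<in> B'" by (auto simp: \<sigma>)
      then show "z \<in> Z'" using iff[OF y(3,2) _ assms(10,7)] c assms(3) by blast
    qed
    show "Z' \<subseteq> Range \<sigma>" using assms(4) Z' by (fastforce simp: \<sigma>)
  qed
  have "x \<in> B \<longleftrightarrow> z \<in> B'" if xz: "(x, z) \<in> \<sigma>" for x z
  proof -
    obtain y where y: "(x, y) \<in> \<rho>" "z \<in> carrier N" "z \<ominus>\<^bsub>N\<^esub> y \<in> B'" using xz by (auto simp: \<sigma>)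
    show ?thesis using iff[OF y(3,2) _ assms(9)] c[OF y(1)] assms(5)[OF y(1)] by blast
  qed
  then show ?thesis
    unfolding subquot_iso_def using lin dom ran assms(6-9) by blast
qed

abbreviation "plus_mult M B x Z \<equiv> B <+>\<^bsub>M\<^esub> (\<lambda>z. x \<odot>\<^bsub>M\<^esub> z) ` Z"

context module
begin

lemma second_iso:
  assumes X: "submod R M X" and Y: "submod R M Y"
  shows "subquot_iso R M (Y \<inter> X) Y M X (Y <+>\<^bsub>M\<^esub> X)"
proof (rule subquot_isoI[where \<rho> = "{(y, z). y = z \<and> y \<in> Y}"])
  note c = submod_in_carrier[OF Y] submod_in_carrier[OF X]
  show "linear_rel R M M {(y, z). y = z \<and> y \<in> Y}"
    by (rule linear_relI) (use submodD[OF Y] submod_in_carrier[OF Y] in auto)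
  show "submod R M (Y \<inter> X)" by (rule submod_Int[OF Y X])
  show "submod R M (Y <+>\<^bsub>M\<^esub> X)" by (rule submod_set_add[OF Y X])
  show "X \<subseteq> Y <+>\<^bsub>M\<^esub> X" by (rule set_add_upper2[OF Y X])
  fix z assume "z \<in> Y <+>\<^bsub>M\<^esub> X"
  then obtain y x where "y \<in> Y" "x \<in> X" "z = y \<oplus>\<^bsub>M\<^esub> x" unfolding in_set_add by blast
  then show "\<exists>x y. (x, y) \<in> {(y, z). y = z \<and> y \<in> Y} \<and> z \<ominus>\<^bsub>M\<^esub> y \<in> X"
    using c by auto
qed (use X set_add_upper1[OF Y X] in auto)

lemma mlength_second_iso:
  "submod R M X \<Longrightarrow> submod R M Y \<Longrightarrow> mlength R M (Y \<inter> X) Y = mlength R M X (Y <+>\<^bsub>M\<^esub> X)"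
  by (rule subquot_iso_mlength[OF second_iso])

end

subsection \<open>Homomorphisms\<close>

lemma hom_graph_linear:
  assumes "module R M" "module R N" "f \<in> module_hom R M N"
  shows "linear_rel R M N {(x, y). x \<in> carrier M \<and> y = f x}"
proof -
  interpret f: mod_hom R M N f using assms by (simp add: mod_hom_def mod_hom_axioms_def)
  show ?thesis
    by (rule linear_relI) (use assms f.f0_is_0 in auto)
qed

lemma hom_graph_Image:
  assumes "S \<subseteq> carrier M"
  shows "{(x, y). x \<in> carrier M \<and> y = f x} `` S = f ` S"
  using assms by auto

lemma hom_in_carrier: "f \<in> module_hom R M N \<Longrightarrow> x \<in> carrier M \<Longrightarrow> f x \<in> carrier N"
  by (auto simp: module_hom_def)

lemma hom_zero:
  assumes "module R M" "module R N" "f \<in> module_hom R M N"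
  shows "f \<zero>\<^bsub>M\<^esub> = \<zero>\<^bsub>N\<^esub>"
  using linear_rel_zero[OF hom_graph_linear[OF assms]] by simp

lemma hom_minus:
  assumes "module R M" "module R N" "f \<in> module_hom R M N" "x \<in> carrier M" "y \<in> carrier M"
  shows "f (x \<ominus>\<^bsub>M\<^esub> y) = f x \<ominus>\<^bsub>N\<^esub> f y"
  using linear_rel_minus[OF hom_graph_linear[OF assms(1-3)], of x "f x" y "f y"] assms(4,5) by simp

lemma hom_image_submod:
  assumes "module R M" "module R N" "f \<in> module_hom R M N" "submod R M S"
  shows "submod R N (f ` S)"
  using linear_rel_Image[OF hom_graph_linear[OF assms(1-3)] assms(4)]
    hom_graph_Image[OF submodD(2)[OF assms(4)], of f] by simp

lemma hom_preimage_submod: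
  assumes "module R M" "module R N" "f \<in> module_hom R M N" "submod R N S"
  shows "submod R M {x \<in> carrier M. f x \<in> S}"
proof -
  have "{(x, y). x \<in> carrier M \<and> y = f x}\<inverse> `` S = {x \<in> carrier M. f x \<in> S}" by auto
  then show ?thesis
    using linear_rel_Image[OF linear_rel_converse[OF hom_graph_linear[OF assms(1-3)]] assms(4)] by simp
qed

lemma hom_ker_submod:
  assumes "module R M" "module R N" "f \<in> module_hom R M N"
  shows "submod R M (ker_on f M N)"
  using hom_preimage_submod[OF assms module.submod_zero[OF assms(2)]] by (simp add: ker_on_def)

lemma smult_hom: "module R M \<Longrightarrow> r \<in> carrier R \<Longrightarrow> (\<lambda>z. r \<odot>\<^bsub>M\<^esub> z) \<in> module_hom R M M"
  by (auto simp: module_hom_def module.smult_closed module.smult_r_distr module.smult_commute)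

lemma hom_kernel_submod:
  assumes "module R M" "module R N" "f \<in> module_hom R M N" "submod R M Z"
  shows "submod R M {x \<in> Z. f x = \<zero>\<^bsub>N\<^esub>}"
proof -
  have "{x \<in> Z. f x = \<zero>\<^bsub>N\<^esub>} = Z \<inter> {x \<in> carrier M. f x \<in> {\<zero>\<^bsub>N\<^esub>}}" using submodD(2)[OF assms(4)] by blast
  then show ?thesis
    using module.submod_Int[OF assms(1,4) hom_preimage_submod[OF assms(1-3) module.submod_zero[OF assms(2)]]] by simp
qed

lemma hom_vimage_image:
  assumes M: "module R M" and N: "module R N" and f: "f \<in> module_hom R M N" and Z: "submod R M Z"
    and B: "submod R M B" "B \<subseteq> Z"
  shows "{x \<in> Z. f x \<in> f ` B} = {x \<in> Z. f x = \<zero>\<^bsub>N\<^esub>} <+>\<^bsub>M\<^esub> B"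
proof -
  interpret M: module R M by fact
  interpret N: module R N by fact
  let ?K = "{x \<in> Z. f x = \<zero>\<^bsub>N\<^esub>}"
  show ?thesis
  proof
    show "{x \<in> Z. f x \<in> f ` B} \<subseteq> ?K <+>\<^bsub>M\<^esub> B"
    proof
      fix x assume "x \<in> {x \<in> Z. f x \<in> f ` B}"
      then obtain u where x: "x \<in> Z" and u: "u \<in> B" "f x = f u" by blast
      have uc: "u \<in> carrier M" and xc: "x \<in> carrier M" using submod_in_carrier[OF B(1) u(1)] submod_in_carrier[OF Z x] by auto
      have "x \<ominus>\<^bsub>M\<^esub> u \<in> ?K"
        using M.submod_minus[OF Z x, of u] B(2) u hom_minus[OF M N f xc uc] hom_in_carrier[OF f uc] by auto
      moreover have "x = (x \<ominus>\<^bsub>M\<^esub> u) \<oplus>\<^bsub>M\<^esub> u" using uc xc by simp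
      ultimately show "x \<in> ?K <+>\<^bsub>M\<^esub> B" unfolding M.in_set_add using u(1) by blast
    qed
    show "?K <+>\<^bsub>M\<^esub> B \<subseteq> {x \<in> Z. f x \<in> f ` B}"
    proof
      fix x assume "x \<in> ?K <+>\<^bsub>M\<^esub> B"
      then obtain k u where x: "k \<in> ?K" "u \<in> B" "x = k \<oplus>\<^bsub>M\<^esub> u" unfolding M.in_set_add by blast
      have uc: "u \<in> carrier M" and kc: "k \<in> carrier M" using submod_in_carrier[OF B(1) x(2)] submod_in_carrier[OF Z] x(1) by auto
      have "f x = f u" using x(1,3) module_hom_add[OF f kc uc] hom_in_carrier[OF f uc] by simp
      moreover have "x \<in> Z" using submodD(4)[OF Z, of k u] x B(2) by blast
      ultimately show "x \<in> {x \<in> Z. f x \<in> f ` B}" using x(2) by blast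
    qed
  qed
qed

lemma hom_subquot_iso:
  assumes "module R M" "module R N" "f \<in> module_hom R M N" "submod R M Z" "submod R N B'" "B' \<subseteq> f ` Z"
  shows "subquot_iso R M {x \<in> Z. f x \<in> B'} Z N B' (f ` Z)"
proof (rule subquot_isoI[where \<rho> = "{(x, y). x \<in> Z \<and> y = f x}"])
  note c = submodD(2)[OF assms(4)]
  have Z: "x \<in> Z \<Longrightarrow> x \<in> carrier M" for x using c by blast
  interpret f: mod_hom R M N f using assms by (simp add: mod_hom_def mod_hom_axioms_def)
  show "linear_rel R M N {(x, y). x \<in> Z \<and> y = f x}"
    by (rule linear_relI) (use assms(1,2) submodD(3-5)[OF assms(4)] Z f.f0_is_0 in auto)
  have "{x \<in> Z. f x \<in> B'} = {x \<in> carrier M. f x \<in> B'} \<inter> Z" using c by blast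
  then show "submod R M {x \<in> Z. f x \<in> B'}"
    using module.submod_Int[OF assms(1) hom_preimage_submod[OF assms(1-3,5)] assms(4)] by simp
  show "submod R N (f ` Z)" by (rule hom_image_submod[OF assms(1-4)])
  fix z assume "z \<in> f ` Z"
  then obtain x where "x \<in> Z" "z = f x" by blast
  then show "\<exists>x y. (x, y) \<in> {(x, y). x \<in> Z \<and> y = f x} \<and> z \<ominus>\<^bsub>N\<^esub> y \<in> B'"
    using f.f_im[OF Z] f.N.minus_self submodD(3)[OF assms(5)] by (intro exI[of _ x] exI[of _ "f x"]) auto
qed (use assms(5,6) in auto)

lemma hom_mlength:
  assumes "module R M" "module R N" "f \<in> module_hom R M N" "submod R M Z" "submod R N B'" "B' \<subseteq> f ` Z"
  shows "mlength R M {x \<in> Z. f x \<in> B'} Z = mlength R N B' (f ` Z)"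
  by (rule subquot_iso_mlength[OF hom_subquot_iso[OF assms]])

subsection \<open>Regular sequences on subquotients\<close>

text \<open>\<open>B + (xs)Z\<close>; the multiples are added one element of \<open>xs\<close> at a time.\<close>

primrec seq_ext :: "('r, 'm, 'd) module_scheme \<Rightarrow> 'm set \<Rightarrow> 'm set \<Rightarrow> 'r list \<Rightarrow> 'm set" where
  "seq_ext M Z B [] = B"
| "seq_ext M Z B (x # xs) = seq_ext M Z (plus_mult M B x Z) xs"

primrec seq_regular :: "('r, 'm, 'd) module_scheme \<Rightarrow> 'm set \<Rightarrow> 'm set \<Rightarrow> 'r list \<Rightarrow> bool" where
  "seq_regular M Z B [] \<longleftrightarrow> True"
| "seq_regular M Z B (x # xs) \<longleftrightarrow> (\<forall>z\<in>Z. x \<odot>\<^bsub>M\<^esub> z \<in> B \<longrightarrow> z \<in> B) \<and>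
     seq_regular M Z (plus_mult M B x Z) xs"

lemma seq_ext_snoc: "seq_ext M Z B (xs @ [x]) = plus_mult M (seq_ext M Z B xs) x Z"
  by (induction xs arbitrary: B) auto

lemma seq_regular_snoc: "seq_regular M Z B (xs @ [x]) \<longleftrightarrow>
    seq_regular M Z B xs \<and> (\<forall>z\<in>Z. x \<odot>\<^bsub>M\<^esub> z \<in> seq_ext M Z B xs \<longrightarrow> z \<in> seq_ext M Z B xs)"
  by (induction xs arbitrary: B) auto

abbreviation "seq_mult M Z \<equiv> seq_ext M Z {\<zero>\<^bsub>M\<^esub>}"

abbreviation "seq_reg M Z \<equiv> seq_regular M Z {\<zero>\<^bsub>M\<^esub>}"

context module
begin

lemma seq_step:
  assumes "submod R M B" "submod R M Z" "B \<subseteq> Z" "x \<in> carrier R"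
  shows "submod R M (plus_mult M B x Z)" "plus_mult M B x Z \<subseteq> Z"
    "B \<subseteq> plus_mult M B x Z" "(\<lambda>z. x \<odot>\<^bsub>M\<^esub> z) ` Z \<subseteq> plus_mult M B x Z"
proof -
  note xZ = submod_smult_image[OF assms(2,4)]
  show "submod R M (plus_mult M B x Z)" by (rule submod_set_add[OF assms(1) xZ])
  show "plus_mult M B x Z \<subseteq> Z"
    using submodD(5)[OF assms(2,4)] by (intro set_add_least[OF assms(2,3)]) auto
  show "B \<subseteq> plus_mult M B x Z" by (rule set_add_upper1[OF assms(1) xZ])
  show "(\<lambda>z. x \<odot>\<^bsub>M\<^esub> z) ` Z \<subseteq> plus_mult M B x Z" by (rule set_add_upper2[OF assms(1) xZ])
qed

lemma seq_ext_props:
  assumes "submod R M Z"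
  shows "submod R M B \<Longrightarrow> B \<subseteq> Z \<Longrightarrow> set xs \<subseteq> carrier R \<Longrightarrow>
    submod R M (seq_ext M Z B xs) \<and> B \<subseteq> seq_ext M Z B xs \<and> seq_ext M Z B xs \<subseteq> Z \<and>
    (\<forall>x\<in>set xs. \<forall>z\<in>Z. x \<odot>\<^bsub>M\<^esub> z \<in> seq_ext M Z B xs)"
proof (induction xs arbitrary: B)
  case (Cons x xs)
  then have x: "x \<in> carrier R" by simp
  note st = seq_step[OF Cons.prems(1) assms Cons.prems(2) x]
  note IH = Cons.IH[OF st(1,2)]
  show ?case using IH Cons.prems(3) st(3,4) by auto
qed auto

text \<open>Together with \<open>seq_ext_props\<close> this characterises \<open>B + (xs)Z\<close>
  as a smallest submodule, so the recursive description agrees with the span used in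
  \<open>list_smult\<close> and the order of \<open>xs\<close> is immaterial.\<close>

lemma seq_ext_least:
  assumes "submod R M C" "B \<subseteq> C" "\<And>x z. x \<in> set xs \<Longrightarrow> z \<in> Z \<Longrightarrow> x \<odot>\<^bsub>M\<^esub> z \<in> C"
  shows "seq_ext M Z B xs \<subseteq> C"
  using assms(2,3)
proof (induction xs arbitrary: B)
  case (Cons x xs)
  have "plus_mult M B x Z \<subseteq> C"
    by (rule set_add_least[OF assms(1)]) (use Cons.prems in auto)
  then show ?case using Cons.IH Cons.prems(2) by simp
qed auto

subsection \<open>The submodule \<open>IZ\<close>\<close>

definition ideal_smult :: "'a set \<Rightarrow> 'c set \<Rightarrow> 'c set" where
  "ideal_smult I Z = span {r \<odot>\<^bsub>M\<^esub> z | r z. r \<in> I \<and> z \<in> Z}"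

lemma ideal_smult_submod:
  assumes "I \<subseteq> carrier R" "Z \<subseteq> carrier M"
  shows "submod R M (ideal_smult I Z)"
  unfolding ideal_smult_def by (rule span_is_submodule) (use assms in auto)

lemma ideal_smult_mem:
  assumes "I \<subseteq> carrier R" "Z \<subseteq> carrier M" "r \<in> I" "z \<in> Z"
  shows "r \<odot>\<^bsub>M\<^esub> z \<in> ideal_smult I Z"
proof -
  have "{r \<odot>\<^bsub>M\<^esub> z | r z. r \<in> I \<and> z \<in> Z} \<subseteq> carrier M" using assms by auto
  from in_own_span[OF this] show ?thesis unfolding ideal_smult_def using assms by blast
qed

lemma ideal_smult_least:
  assumes "submod R M C" "\<And>r z. r \<in> I \<Longrightarrow> z \<in> Z \<Longrightarrow> r \<odot>\<^bsub>M\<^esub> z \<in> C"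
  shows "ideal_smult I Z \<subseteq> C"
  unfolding ideal_smult_def by (rule span_in_submod[OF assms(1)]) (use assms(2) in auto)

lemma ideal_smult_subset:
  assumes "submod R M Z" "I \<subseteq> carrier R"
  shows "ideal_smult I Z \<subseteq> Z"
  by (rule ideal_smult_least[OF assms(1)]) (use submodD(5)[OF assms(1)] assms(2) in auto)

lemma ideal_smult_mono:
  assumes "I \<subseteq> carrier R" "Z' \<subseteq> carrier M" "Z \<subseteq> Z'"
  shows "ideal_smult I Z \<subseteq> ideal_smult I Z'"
  by (rule ideal_smult_least[OF ideal_smult_submod]) (use assms ideal_smult_mem in auto)

abbreviation adjoin :: "'c set \<Rightarrow> 'c \<Rightarrow> 'c set" where
  "adjoin B v \<equiv> B <+>\<^bsub>M\<^esub> (\<lambda>r. r \<odot>\<^bsub>M\<^esub> v) ` carrier R"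

lemma adjoin_props:
  assumes "submod R M B" "v \<in> carrier M"
  shows "submod R M (adjoin B v)" "B \<subseteq> adjoin B v" "v \<in> adjoin B v"
proof -
  note c = submod_cyclic[OF assms(2)]
  show "submod R M (adjoin B v)" by (rule submod_set_add[OF assms(1) c])
  show "B \<subseteq> adjoin B v" by (rule set_add_upper1[OF assms(1) c])
  have "v \<in> (\<lambda>r. r \<odot>\<^bsub>M\<^esub> v) ` carrier R" using assms by (intro image_eqI[of _ _ \<one>]) auto
  then show "v \<in> adjoin B v" using set_add_upper2[OF assms(1) c] by blast
qed

lemma in_adjoin: "w \<in> adjoin B v \<longleftrightarrow> (\<exists>b\<in>B. \<exists>r\<in>carrier R. w = b \<oplus>\<^bsub>M\<^esub> r \<odot>\<^bsub>M\<^esub> v)"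
  unfolding in_set_add by blast

lemma adjoin_least:
  assumes "submod R M C" "B \<subseteq> C" "v \<in> C"
  shows "adjoin B v \<subseteq> C"
  by (rule set_add_least[OF assms(1,2)]) (use submodD(5)[OF assms(1)] assms(3) in auto)

end

subsection \<open>Depth\<close>

lemma hom_ideal_smult_image:
  assumes M: "module R M" and N: "module R N" and f: "f \<in> module_hom R M N" and Z: "submod R M Z" and I: "I \<subseteq> carrier R"
  shows "f ` module.ideal_smult R M I Z = module.ideal_smult R N I (f ` Z)"
proof -
  interpret M: module R M by fact
  interpret N: module R N by fact
  have fZ: "f ` Z \<subseteq> carrier N" by (rule submodD(2)[OF hom_image_submod[OF M N f Z]])
  note s1 = M.ideal_smult_submod[OF I submodD(2)[OF Z]] and s2 = N.ideal_smult_submod[OF I fZ]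
  have sm: "f (r \<odot>\<^bsub>M\<^esub> z) = r \<odot>\<^bsub>N\<^esub> f z" if "r \<in> I" "z \<in> Z" for r z
    using module_hom_smult[OF f, of r z] that I submodD(2)[OF Z] by blast
  show ?thesis
  proof
    have "M.ideal_smult I Z \<subseteq> {x \<in> carrier M. f x \<in> N.ideal_smult I (f ` Z)}"
      by (rule M.ideal_smult_least[OF hom_preimage_submod[OF M N f s2]])
        (use I submodD(2)[OF Z] sm N.ideal_smult_mem[OF I fZ] in auto)
    then show "f ` M.ideal_smult I Z \<subseteq> N.ideal_smult I (f ` Z)" by blast
    show "N.ideal_smult I (f ` Z) \<subseteq> f ` M.ideal_smult I Z"
      by (rule N.ideal_smult_least[OF hom_image_submod[OF M N f s1]])
        (use sm M.ideal_smult_mem[OF I submodD(2)[OF Z]] in \<open>auto simp flip: sm\<close>)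
  qed
qed

lemma list_smult_eq_seq_ext:
  fixes R :: "('r, 'c) ring_scheme" and M :: "('r, 'm) module"
  assumes M: "module R M" and xs: "set xs \<subseteq> carrier R"
  shows "list_smult R xs M = seq_mult M (carrier M) xs"
proof
  interpret M: module R M by fact
  let ?G = "{r \<odot>\<^bsub>M\<^esub> y | r y. r \<in> set xs \<and> y \<in> carrier M}"
  have G: "?G \<subseteq> carrier M" using xs by auto
  note p = M.seq_ext_props[OF M.submod_carrier M.submod_zero _ xs]
  show "list_smult R xs M \<subseteq> seq_mult M (carrier M) xs"
    unfolding list_smult_def by (rule M.span_in_submod) (use p in auto)
  have s: "submod R M (M.span ?G)" by (rule M.span_is_submodule[OF G])
  show "seq_mult M (carrier M) xs \<subseteq> list_smult R xs M"
    unfolding list_smult_def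
    by (rule M.seq_ext_least[OF s]) (use submodD(3)[OF s] M.in_own_span[OF G] in auto)
qed

lemma regular_sequence_imp_seq_regular:
  fixes R :: "('r, 'c) ring_scheme" and M :: "('r, 'm) module"
  assumes M: "module R M" and reg: "regular_sequence R M xs"
  shows "seq_reg M (carrier M) xs"
proof -
  have xs: "set xs \<subseteq> carrier R" using reg by (simp add: regular_sequence_def)
  have "seq_reg M (carrier M) (take i xs)" if "i \<le> length xs" for i
    using that
  proof (induction i)
    case (Suc i)
    have "set (take i xs) \<subseteq> carrier R" using xs set_take_subset by fastforce
    note e = list_smult_eq_seq_ext[OF M this]
    have "\<forall>z\<in>carrier M. xs ! i \<odot>\<^bsub>M\<^esub> z \<in> seq_mult M (carrier M) (take i xs) \<longrightarrow>
       z \<in> seq_mult M (carrier M) (take i xs)"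
      using reg Suc.prems unfolding regular_sequence_def e[symmetric] by simp
    then show ?case using Suc by (simp add: take_Suc_conv_app_nth seq_regular_snoc)
  qed simp
  from this[of "length xs"] show ?thesis by simp
qed

text \<open>A supremum of naturals that reaches a finite positive \<open>n\<close> is reached by a
  member. For \<open>n = 0\<close> this could fail, because the supremum over no sequence at all is
  also 0.\<close>

lemma depth_ge_regular:
  fixes M :: "('r, 'm) module"
  assumes "enat n \<le> depth R \<mm> M" "n \<noteq> 0"
  obtains xs where "regular_sequence R M xs" "set xs \<subseteq> \<mm>" "n \<le> length xs"
proof -
  let ?A = "{xs. regular_sequence R M xs \<and> set xs \<subseteq> \<mm>}"
  have "\<exists>xs\<in>?A. n \<le> length xs"
  proof (rule ccontr)
    assume no: "\<not> ?thesis"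
    have "depth R \<mm> M \<le> enat (n - 1)"
      unfolding depth_def
    proof (rule SUP_least)
      fix xs assume "xs \<in> ?A"
      then have "length xs \<le> n - 1" using no by force
      then show "enat (length xs) \<le> enat (n - 1)" by simp
    qed
    with assms(1) have "enat n \<le> enat (n - 1)" by (rule order_trans)
    then show False using assms(2) by simp
  qed
  then show thesis using that by blast
qed

lemma length_regular_le_depth:
  "regular_sequence R M xs \<Longrightarrow> set xs \<subseteq> \<mm> \<Longrightarrow> enat (length xs) \<le> depth R \<mm> M"
  unfolding depth_def by (rule SUP_upper) simp

text \<open>For \<open>d = 0\<close> the sequence is empty, even when \<open>M = 0\<close>.\<close>

lemma depth_eq_regular:
  fixes R :: "('r, 'c) ring_scheme" and M :: "('r, 'm) module"
  assumes M: "module R M" and d: "depth R \<mm> M = enat d"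
  obtains xs where "seq_reg M (carrier M) xs" "set xs \<subseteq> \<mm>" "length xs = d"
proof (cases "d = 0")
  case True then show thesis using that[of "[]"] by simp
next
  case False
  obtain xs where xs: "regular_sequence R M xs" "set xs \<subseteq> \<mm>" "d \<le> length xs"
    using depth_ge_regular[of d R \<mm> M] False d by auto
  moreover have "length xs \<le> d" using length_regular_le_depth[OF xs(1,2)] d by simp
  ultimately show thesis using that[of xs] regular_sequence_imp_seq_regular[OF M xs(1)] xs(2) by simp
qed

subsection \<open>The ring as a module over itself\<close>

lemma ring_module_simps [simp]:
  "carrier (ring_module R) = carrier R" "zero (ring_module R) = zero R" "add (ring_module R) = add R"
  "smult (ring_module R) = mult R"
  by (auto simp: ring_module_def)

abbreviation "colength R J \<equiv> mlength R (ring_module R) J (carrier R)"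

lemma ring_module_minus [simp]: "a_minus (ring_module R) = a_minus R" "a_inv (ring_module R) = a_inv R"
  "set_add (ring_module R) = set_add R"
proof -
  show i: "a_inv (ring_module R) = a_inv R" by (simp add: a_inv_def m_inv_def fun_eq_iff)
  show "a_minus (ring_module R) = a_minus R" by (simp add: a_minus_def i fun_eq_iff)
  show "set_add (ring_module R) = set_add R" by (simp add: set_add_def set_mult_def fun_eq_iff)
qed

context cring
begin

lemma module_ring_module: "module R (ring_module R)"
proof (rule module_criteria[OF is_cring])
  show "\<forall>v\<in>carrier (ring_module R). \<exists>w\<in>carrier (ring_module R). v \<oplus>\<^bsub>ring_module R\<^esub> w = \<zero>\<^bsub>ring_module R\<^esub>"
    using r_neg by (auto intro!: bexI[of _ "\<ominus> _"])
qed (auto simp: a_ac m_assoc l_distr r_distr)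

lemma submod_iff_ideal: "submod R (ring_module R) I \<longleftrightarrow> ideal I R"
proof
  assume I: "submod R (ring_module R) I"
  note d = submodD[OF I, simplified]
  show "ideal I R"
  proof (rule idealI[OF ring_axioms])
    show "subgroup I (add_monoid R)"
    proof
      fix x assume x: "x \<in> I"
      have "(\<ominus> \<one>) \<otimes> x \<in> I" using d(5) x by simp
      then show "inv\<^bsub>add_monoid R\<^esub> x \<in> I" using d(2) x by (auto simp: l_minus a_inv_def[symmetric])
    qed (use d in auto)
    fix a x assume "a \<in> I" "x \<in> carrier R"
    then show "x \<otimes> a \<in> I" "a \<otimes> x \<in> I" using d(5)[of x a] m_comm[of a x] d(2) by auto
  qed
next
  assume "ideal I R"
  then interpret I: ideal I R .
  show "submod R (ring_module R) I"
    by (rule submodI[OF module_ring_module]) (use I.a_subset I.I_l_closed I.zero_closed in auto)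
qed

lemma ideal_submod: "ideal I R \<Longrightarrow> submod R (ring_module R) I"
  by (simp add: submod_iff_ideal)

end

lemma (in module) annihilator_ideal:
  assumes "submod R M B" "v \<in> carrier M"
  shows "ideal {r \<in> carrier R. r \<odot>\<^bsub>M\<^esub> v \<in> B} R"
  unfolding R.submod_iff_ideal[symmetric]
  by (rule submodI[OF R.module_ring_module])
    (use submodD(3-5)[OF assms(1)] assms(2) in \<open>auto simp: smult_l_distr smult_assoc1\<close>)

lemma (in module) cyclic_iso:
  assumes B: "submod R M B" and v: "v \<in> carrier M"
  shows "subquot_iso R (ring_module R) {r \<in> carrier R. r \<odot>\<^bsub>M\<^esub> v \<in> B} (carrier R) M B (adjoin B v)"
proof (rule subquot_isoI[where \<rho> = "{(r, w). r \<in> carrier R \<and> w = r \<odot>\<^bsub>M\<^esub> v}"])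
  show "linear_rel R (ring_module R) M {(r, w). r \<in> carrier R \<and> w = r \<odot>\<^bsub>M\<^esub> v}"
    by (rule linear_relI[OF R.module_ring_module module_axioms])
      (use v in \<open>auto simp: smult_l_distr smult_assoc1\<close>)
  show "submod R (ring_module R) {r \<in> carrier R. r \<odot>\<^bsub>M\<^esub> v \<in> B}"
    unfolding R.submod_iff_ideal by (rule annihilator_ideal[OF assms])
  show "submod R M (adjoin B v)" "B \<subseteq> adjoin B v" using adjoin_props[OF assms] by auto
  fix z assume "z \<in> adjoin B v"
  then obtain b r where "b \<in> B" "r \<in> carrier R" "z = b \<oplus>\<^bsub>M\<^esub> r \<odot>\<^bsub>M\<^esub> v" unfolding in_adjoin by blast
  then show "\<exists>x y. (x, y) \<in> {(r, w). r \<in> carrier R \<and> w = r \<odot>\<^bsub>M\<^esub> v} \<and> z \<ominus>\<^bsub>M\<^esub> y \<in> B"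
    using v submod_in_carrier[OF B] by (intro exI[of _ r] exI[of _ "r \<odot>\<^bsub>M\<^esub> v"]) auto
next
  fix x y assume "(x, y) \<in> {(r, w). r \<in> carrier R \<and> w = r \<odot>\<^bsub>M\<^esub> v}"
  then have xy: "x \<in> carrier R" "y = x \<odot>\<^bsub>M\<^esub> v" by auto
  show "x \<in> carrier R \<and> y \<in> adjoin B v"
    using xy submodD(5)[OF adjoin_props(1)[OF assms] _ adjoin_props(3)[OF assms]] by simp
qed (use B in auto)

lemma (in module) mlength_adjoin:
  "submod R M B \<Longrightarrow> v \<in> carrier M \<Longrightarrow>
    mlength R M B (adjoin B v) = colength R {r \<in> carrier R. r \<odot>\<^bsub>M\<^esub> v \<in> B}"
  by (rule subquot_iso_mlength[OF cyclic_iso, symmetric])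

subsection \<open>Noetherian modules\<close>

context noetherian_ring
begin

lemma noetherian_family_ideals: "noetherian_family {I. ideal I R}"
  unfolding noetherian_family_def wf_iff_no_infinite_down_chain
proof (rule notI, elim exE)
  fix f assume f: "\<forall>i. (f (Suc i), f i) \<in> {(T, S). S \<in> {I. ideal I R} \<and> T \<in> {I. ideal I R} \<and> S \<subset> T}"
  have step: "f i \<subset> f (Suc i)" "ideal (f i) R" for i using f[THEN spec[of _ i]] by simp_all
  have mono: "i \<le> j \<Longrightarrow> f i \<subseteq> f j" for i j
    by (rule lift_Suc_mono_le[of f]) (use step in auto)
  have "subset.chain {I. ideal I R} (range f)"
    unfolding subset_chain_def
  proof (intro conjI ballI)
    fix x y assume "x \<in> range f" "y \<in> range f"
    then obtain i j where "x = f i" "y = f j" by blast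
    then show "x \<subseteq> y \<or> y \<subseteq> x" using mono[of i j] mono[of j i] by (cases "i \<le> j") auto
  qed (use step in auto)
  \<comment> \<open>In a noetherian ring the union of a chain of ideals belongs to the chain, which
    a strictly increasing sequence contradicts.\<close>
  then have "\<Union>(range f) \<in> range f" by (intro ideal_chain_is_trivial) auto
  then obtain n where "\<Union>(range f) = f n" by blast
  then show False using step(1)[of n] by blast
qed

end

lemma noetherian_ring_module:
  assumes "cring R" "noetherian_ring R"
  shows "noetherian_subquot R (ring_module R) B Z"
proof -
  interpret cring R by fact
  show ?thesis
    unfolding noetherian_subquot_def
    by (rule noetherian_map[OF noetherian_ring.noetherian_family_ideals[OF assms(2)], of _ "\<lambda>x. x"])
      (auto simp: submod_interval_def submod_iff_ideal)
qed

lemma noetherian_subquot_self: "noetherian_subquot R M B B"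
proof -
  have e: "{(T, S). S \<in> submod_interval R M B B \<and> T \<in> submod_interval R M B B \<and> S \<subset> T} = {}"
    by (auto simp: submod_interval_def)
  show ?thesis unfolding noetherian_subquot_def noetherian_family_def e by simp
qed

context module
begin

lemma noetherian_adjoin:
  assumes "noetherian_ring R" "submod R M B" "v \<in> carrier M"
  shows "noetherian_subquot R M B (adjoin B v)"
  by (rule subquot_iso_noetherian[OF subquot_iso_sym[OF cyclic_iso[OF assms(2,3)]]])
    (rule noetherian_ring_module[OF R.is_cring assms(1)])

text \<open>Each further generator \<open>v\<close> adds the layer \<open>(B + Rv)/B\<close>, a
  quotient of \<open>R\<close>.\<close>

lemma noetherian_span:
  assumes "noetherian_ring R" "finite S" "S \<subseteq> carrier M"
  shows "noetherian_subquot R M {\<zero>\<^bsub>M\<^esub>} (span S)"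
  using assms(2,3)
proof (induction S)
  case empty
  have "span {} \<subseteq> {\<zero>\<^bsub>M\<^esub>}" by (rule span_in_submod[OF submod_zero]) simp
  then show ?case using noetherian_subquot_mono[OF noetherian_subquot_self, of "{\<zero>\<^bsub>M\<^esub>}" "{\<zero>\<^bsub>M\<^esub>}"] by blast
next
  case (insert v S)
  then have S: "S \<subseteq> carrier M" "v \<in> carrier M" by auto
  have sp: "submod R M (span S)" by (rule span_is_submodule[OF S(1)])
  note ad = adjoin_props[OF sp S(2)]
  have "span (insert v S) \<subseteq> adjoin (span S) v"
    by (rule span_in_submod[OF ad(1)]) (use ad(2,3) in_own_span[OF S(1)] in auto)
  moreover have "noetherian_subquot R M {\<zero>\<^bsub>M\<^esub>} (adjoin (span S) v)"
    by (rule noetherian_subquot_add[OF sp ad(1) _ ad(2) insert.IH[OF S(1)] noetherian_adjoin[OF assms(1) sp S(2)]])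
      (use submodD(3)[OF sp] in auto)
  ultimately show ?case using noetherian_subquot_mono by blast
qed

text \<open>Among the spans of finite subsets of \<open>N\<close> there is a maximal one; adjoining
  any further element of \<open>N\<close> cannot enlarge it.\<close>

lemma noetherian_fin_gen:
  assumes "noetherian_subquot R M {\<zero>\<^bsub>M\<^esub>} (carrier M)" "submod R M N"
  obtains S where "finite S" "S \<subseteq> N" "span S = N"
proof -
  let ?A = "{span S | S. finite S \<and> S \<subseteq> N}"
  have N: "N \<subseteq> carrier M" by (rule submodD(2)[OF assms(2)])
  have sub: "submod R M (span S)" "S \<subseteq> span S" "span S \<subseteq> N" if S: "S \<subseteq> N" for S
    using span_is_submodule[of S] in_own_span[of S] S N span_in_submod[OF assms(2) S] by auto
  have "?A \<subseteq> submod_interval R M {\<zero>\<^bsub>M\<^esub>} (carrier M)"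
    using sub(1,3) N submodD(3)[OF sub(1)] unfolding submod_interval_def by blast
  moreover have "span {} \<in> ?A" by blast
  ultimately have "\<exists>T\<in>?A. span {} \<subseteq> T \<and> (\<forall>U\<in>?A. T \<subseteq> U \<longrightarrow> U = T)"
    by (rule noetherian_maximal[OF assms(1)[unfolded noetherian_subquot_def]])
  then obtain T where T: "T \<in> ?A" "\<And>U. U \<in> ?A \<Longrightarrow> T \<subseteq> U \<Longrightarrow> U = T" by (elim bexE conjE) simp
  then obtain S where S: "finite S" "S \<subseteq> N" "T = span S" by blast
  have "N \<subseteq> span S"
  proof
    fix x assume x: "x \<in> N"
    have xS: "insert x S \<subseteq> N" using x S by simp
    have "T \<subseteq> span (insert x S)"
      unfolding S(3) by (rule span_in_submod[OF sub(1)[OF xS]]) (use sub(2)[OF xS] in auto)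
    moreover have "span (insert x S) \<in> ?A" using xS S(1) by blast
    ultimately have "span (insert x S) = T" by (rule T(2)[rotated])
    then show "x \<in> span S" using sub(2)[OF xS] S(3) by blast
  qed
  then show thesis using that[OF S(1,2)] sub(3)[OF S(2)] by blast
qed

end

lemma fin_gen_noetherian:
  assumes "noetherian_ring R" "fin_gen R M"
  shows "noetherian_subquot R M {\<zero>\<^bsub>M\<^esub>} (carrier M)"
proof -
  interpret module R M using assms(2) by (simp add: fin_gen_def)
  show ?thesis using noetherian_span[OF assms(1)] assms(2) unfolding fin_gen_def by metis
qed

subsection \<open>Local rings\<close>

context noetherian_local_ring
begin

lemma is_noetherian: "noetherian_ring R"
  by (rule noetherian_ring_axioms)

lemma \<mm>_sub [simp]: "x \<in> \<mm> \<Longrightarrow> x \<in> carrier R"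
  using a_subset by blast

lemma \<mm>_subset: "\<mm> \<subseteq> carrier R"
  using a_subset .

lemma one_not_in_\<mm>: "\<one> \<notin> \<mm>"
  using I_notcarr one_imp_carrier by blast

lemma proper_ideal_subset_\<mm>:
  assumes "ideal I R" "I \<noteq> carrier R"
  shows "I \<subseteq> \<mm>"
proof -
  let ?A = "{J. ideal J R \<and> J \<noteq> carrier R}"
  have "\<exists>T\<in>?A. I \<subseteq> T \<and> (\<forall>U\<in>?A. T \<subseteq> U \<longrightarrow> U = T)"
    by (rule noetherian_maximal[OF noetherian_family_ideals]) (use assms in auto)
  then obtain J where "J \<in> ?A" "I \<subseteq> J" and max': "\<forall>U\<in>?A. J \<subseteq> U \<longrightarrow> U = J" by (elim bexE conjE)
  then have J: "ideal J R" "J \<noteq> carrier R" "I \<subseteq> J" by auto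
  have max: "U = J" if U: "ideal U R" "U \<noteq> carrier R" "J \<subseteq> U" for U using max' U by blast
  have "maximalideal J R"
    by (rule maximalidealI[OF J(1)]) (use J(2) max in auto)
  then show ?thesis using unique_maximal J(3) by blast
qed

lemma unit_of_not_in_\<mm>:
  assumes "x \<in> carrier R" "x \<notin> \<mm>"
  obtains y where "y \<in> carrier R" "y \<otimes> x = \<one>"
proof -
  have "ideal (PIdl x) R" by (rule cgenideal_ideal[OF assms(1)])
  moreover have "x \<in> PIdl x" by (rule cgenideal_self[OF assms(1)])
  ultimately have "PIdl x = carrier R" using proper_ideal_subset_\<mm> assms(2) by blast
  then have "\<one> \<in> PIdl x" by simp
  then obtain y where "y \<in> carrier R" "\<one> = y \<otimes> x" unfolding cgenideal_def by blast
  then show thesis using that by simp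
qed

lemma one_minus_unit:
  assumes "x \<in> \<mm>"
  obtains y where "y \<in> carrier R" "y \<otimes> (\<one> \<ominus> x) = \<one>"
proof (rule unit_of_not_in_\<mm>[of "\<one> \<ominus> x"])
  show "\<one> \<ominus> x \<notin> \<mm>"
  proof
    assume "\<one> \<ominus> x \<in> \<mm>"
    then have "(\<one> \<ominus> x) \<oplus> x \<in> \<mm>" using assms by (rule a_closed)
    moreover have "(\<one> \<ominus> x) \<oplus> x = \<one>" using assms by (simp add: a_minus_def a_assoc l_neg)
    ultimately show False using one_not_in_\<mm> by simp
  qed
qed (use assms that in auto)

text \<open>The one-generator case of Nakayama's lemma: \<open>\<one> \<ominus> x\<close> is a
  unit.\<close>

lemma not_in_of_one_minus:
  assumes "submod R M B" "v \<in> carrier M" "x \<in> \<mm>" "v \<ominus>\<^bsub>M\<^esub> x \<odot>\<^bsub>M\<^esub> v \<in> B"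
  shows "v \<in> B"
proof -
  interpret M: module R M by (rule submodD(1)[OF assms(1)])
  obtain y where y: "y \<in> carrier R" "y \<otimes> (\<one> \<ominus> x) = \<one>" using one_minus_unit[OF assms(3)] by blast
  have "(\<one> \<ominus> x) \<odot>\<^bsub>M\<^esub> v \<in> B" using assms by (simp add: M.smult_minus_left)
  then have "y \<odot>\<^bsub>M\<^esub> ((\<one> \<ominus> x) \<odot>\<^bsub>M\<^esub> v) \<in> B" using submodD(5)[OF assms(1)] y(1) by blast
  moreover have "y \<odot>\<^bsub>M\<^esub> ((\<one> \<ominus> x) \<odot>\<^bsub>M\<^esub> v) = v"
    using y assms(2,3) by (simp add: M.smult_assoc1[symmetric])
  ultimately show ?thesis by simp
qed

text \<open>The hypothesis \<open>sub\<close> expresses \<open>B + \<mm>Z = Z\<close> without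
  forming \<open>\<mm>Z\<close>. If \<open>B \<noteq> Z\<close>, a maximal proper submodule
  \<open>S\<close> of \<open>Z\<close> above \<open>B\<close> exists; \<open>Z/S\<close> is simple,
  hence killed by \<open>\<mm>\<close>, so \<open>sub\<close> applies to \<open>S\<close> and gives
  \<open>S = Z\<close>.\<close>

lemma nakayama:
  assumes B: "submod R M B" and Z: "submod R M Z" and "B \<subseteq> Z" and noeth: "noetherian_subquot R M B Z"
    and sub: "\<And>S. submod R M S \<Longrightarrow> B \<subseteq> S \<Longrightarrow> S \<subseteq> Z \<Longrightarrow> (\<And>r z. r \<in> \<mm> \<Longrightarrow> z \<in> Z \<Longrightarrow> r \<odot>\<^bsub>M\<^esub> z \<in> S) \<Longrightarrow> S = Z"
  shows "B = Z"
proof (rule ccontr)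
  assume ne: "B \<noteq> Z"
  interpret M: module R M by (rule submodD(1)[OF B])
  let ?A = "{S \<in> submod_interval R M B Z. S \<noteq> Z}"
  have "B \<in> ?A" using B ne \<open>B \<subseteq> Z\<close> by (simp add: submod_interval_def)
  then have "\<exists>S\<in>?A. B \<subseteq> S \<and> (\<forall>U\<in>?A. S \<subseteq> U \<longrightarrow> U = S)"
    by (rule noetherian_maximal[OF noeth[unfolded noetherian_subquot_def], rotated]) auto
  then obtain S where S: "S \<in> ?A" and max: "\<And>U. U \<in> ?A \<Longrightarrow> S \<subseteq> U \<Longrightarrow> U = S"
    by (elim bexE conjE) simp
  have S': "submod R M S" "B \<subseteq> S" "S \<subseteq> Z" "S \<noteq> Z" using S by (auto simp: submod_interval_def)
  have full: "M.adjoin S w = Z" if w: "w \<in> Z" "w \<notin> S" for w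
  proof -
    have wc: "w \<in> carrier M" using submod_in_carrier[OF Z w(1)] .
    note ad = M.adjoin_props[OF S'(1) wc]
    have "M.adjoin S w \<subseteq> Z" by (rule M.adjoin_least[OF Z S'(3) w(1)])
    then have "M.adjoin S w \<noteq> Z \<Longrightarrow> M.adjoin S w \<in> ?A" using ad S'(2) by (auto simp: submod_interval_def)
    then show ?thesis using max[of "M.adjoin S w"] ad w by blast
  qed
  obtain v where v: "v \<in> Z" "v \<notin> S" using S'(3,4) by blast
  have vc: "v \<in> carrier M" using submod_in_carrier[OF Z v(1)] .
  \<comment> \<open>Otherwise \<open>r v\<close> would generate \<open>Z\<close> over
    \<open>S\<close>, so \<open>v = s + t r v\<close>; as \<open>1 - t r\<close> is a unit,
    \<open>v\<close> would lie in \<open>S\<close>.\<close>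
  have mv: "r \<odot>\<^bsub>M\<^esub> v \<in> S" if r: "r \<in> \<mm>" for r
  proof (rule ccontr)
    assume n: "r \<odot>\<^bsub>M\<^esub> v \<notin> S"
    have "r \<odot>\<^bsub>M\<^esub> v \<in> Z" using submodD(5)[OF Z] r v by simp
    from full[OF this n] v(1) obtain s t where st: "s \<in> S" "t \<in> carrier R" "v = s \<oplus>\<^bsub>M\<^esub> t \<odot>\<^bsub>M\<^esub> (r \<odot>\<^bsub>M\<^esub> v)"
      unfolding M.in_adjoin[symmetric] M.in_adjoin by (metis M.in_adjoin)
    have tr: "t \<otimes> r \<in> \<mm>" using r st(2) I_l_closed by blast
    have e: "t \<odot>\<^bsub>M\<^esub> (r \<odot>\<^bsub>M\<^esub> v) = (t \<otimes> r) \<odot>\<^bsub>M\<^esub> v" using M.smult_assoc1[of t r v] r st(2) vc by simp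
    have "v \<ominus>\<^bsub>M\<^esub> (t \<otimes> r) \<odot>\<^bsub>M\<^esub> v = s"
      using st(3) M.add_minus_cancel[of s "(t \<otimes> r) \<odot>\<^bsub>M\<^esub> v"] submod_in_carrier[OF S'(1) st(1)] tr vc
      unfolding e by simp
    then show False using not_in_of_one_minus[OF S'(1) vc tr] st(1) v(2) by simp
  qed
  have "S = Z"
  proof (rule sub[OF S'(1-3)])
    fix r z assume r: "r \<in> \<mm>" and "z \<in> Z"
    then have "z \<in> M.adjoin S v" using full[OF v] by simp
    then obtain s t where st: "s \<in> S" "t \<in> carrier R" "z = s \<oplus>\<^bsub>M\<^esub> t \<odot>\<^bsub>M\<^esub> v" unfolding M.in_adjoin by blast
    have "r \<odot>\<^bsub>M\<^esub> z = r \<odot>\<^bsub>M\<^esub> s \<oplus>\<^bsub>M\<^esub> t \<odot>\<^bsub>M\<^esub> (r \<odot>\<^bsub>M\<^esub> v)"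
      using st r vc submod_in_carrier[OF S'(1) st(1)] M.smult_commute[of t r v] by (simp add: M.smult_r_distr)
    then show "r \<odot>\<^bsub>M\<^esub> z \<in> S"
      using submodD(4)[OF S'(1)] submodD(5)[OF S'(1)] st r mv[OF r] \<mm>_sub by simp
  qed
  then show False using S'(4) by simp
qed

text \<open>The layer is cyclic and killed by \<open>\<mm>\<close>, so it is a copy of
  \<open>k\<close>: an element outside \<open>B\<close> has a unit as its coefficient at
  \<open>v\<close>.\<close>

lemma mlength_adjoin_simple:
  assumes "submod R M B" "v \<in> carrier M" "v \<notin> B" "\<And>r. r \<in> \<mm> \<Longrightarrow> r \<odot>\<^bsub>M\<^esub> v \<in> B"
  shows "mlength R M B (B <+>\<^bsub>M\<^esub> (\<lambda>r. r \<odot>\<^bsub>M\<^esub> v) ` carrier R) = 1"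
proof -
  interpret M: module R M by (rule submodD(1)[OF assms(1)])
  note ad = M.adjoin_props[OF assms(1,2)]
  have "mlength R M B (M.adjoin B v) \<le> 1"
  proof (rule mlength_le_1[OF assms(1) ad(1,2)])
    fix N assume N: "submod R M N" "B \<subset> N" "N \<subseteq> M.adjoin B v"
    then obtain w where w: "w \<in> N" "w \<notin> B" by blast
    then obtain b r where br: "b \<in> B" "r \<in> carrier R" "w = b \<oplus>\<^bsub>M\<^esub> r \<odot>\<^bsub>M\<^esub> v"
      using N(3) unfolding subset_iff M.in_adjoin by blast
    have "r \<notin> \<mm>" using assms(4)[of r] br w(2) submodD(4)[OF assms(1)] by auto
    then obtain y where y: "y \<in> carrier R" "y \<otimes> r = \<one>" using unit_of_not_in_\<mm> br(2) by blast
    have "b \<in> N" using br N(2) by blast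
    then have "r \<odot>\<^bsub>M\<^esub> v \<in> N" using M.add_in_submod_iff[OF N(1), of b "r \<odot>\<^bsub>M\<^esub> v"] br w assms(2) by simp
    then have "y \<odot>\<^bsub>M\<^esub> (r \<odot>\<^bsub>M\<^esub> v) \<in> N" using submodD(5)[OF N(1)] y(1) by blast
    then have "v \<in> N" using y br(2) assms(2) by (simp add: M.smult_assoc1[symmetric])
    then have "M.adjoin B v \<subseteq> N" using M.adjoin_least[OF N(1)] N(2) by blast
    then show "N = M.adjoin B v" using N(3) by blast
  qed
  moreover have "1 \<le> mlength R M B (M.adjoin B v)"
    by (rule mlength_pos[OF assms(1) ad(1)]) (use ad(2,3) assms(3) in blast)
  ultimately show ?thesis by (rule antisym)
qed

end

subsection \<open>Free modules of finite rank\<close>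

context cring
begin

lemma free_pow_module: "module R (free_pow R n)"
  by (rule func_space_is_module)

lemma free_pow_simps:
  "carrier (free_pow R n) = {..<n} \<rightarrow>\<^sub>E carrier R"
  "f \<oplus>\<^bsub>free_pow R n\<^esub> g = (\<lambda>i\<in>{..<n}. f i \<oplus> g i)"
  "\<zero>\<^bsub>free_pow R n\<^esub> = (\<lambda>i\<in>{..<n}. \<zero>)"
  "r \<odot>\<^bsub>free_pow R n\<^esub> f = (\<lambda>i\<in>{..<n}. r \<otimes> f i)"
  by (simp_all add: func_space_def)

lemma free_pow_coord: "w \<in> carrier (free_pow R n) \<Longrightarrow> i < n \<Longrightarrow> w i \<in> carrier R"
  by (auto simp: free_pow_simps PiE_iff)

lemma free_gen_carrier: "i < n \<Longrightarrow> free_gen R {..<n} i \<in> carrier (free_pow R n)"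
  by (auto simp: free_pow_simps free_gen_def)

lemma coord_hom: "i < n \<Longrightarrow> (\<lambda>w. w i) \<in> module_hom R (free_pow R n) (ring_module R)"
  by (auto simp: module_hom_def free_pow_simps)

text \<open>The vector is built up by truncation: raising the cut-off by one adds a single multiple
  of a basis vector.\<close>

lemma free_pow_induct:
  assumes C: "submod R (free_pow R n) C" and w: "w \<in> carrier (free_pow R n)"
    and basis: "\<And>i. i < n \<Longrightarrow> w i \<odot>\<^bsub>free_pow R n\<^esub> free_gen R {..<n} i \<in> C"
  shows "w \<in> C"
proof -
  interpret F: module R "free_pow R n" by (rule free_pow_module)
  have wc: "\<And>i. i < n \<Longrightarrow> w i \<in> carrier R" using free_pow_coord[OF w] .
  have "(\<lambda>j\<in>{..<n}. if j < k then w j else \<zero>) \<in> C" if "k \<le> n" for k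
    using that
  proof (induction k)
    case 0
    have eq: "(\<lambda>j\<in>{..<n}. if j < 0 then w j else \<zero>) = \<zero>\<^bsub>free_pow R n\<^esub>"
      by (simp add: free_pow_simps restrict_def fun_eq_iff)
    show ?case unfolding eq by (rule submodD(3)[OF C])
  next
    case (Suc k)
    have eq: "(\<lambda>j\<in>{..<n}. if j < Suc k then w j else \<zero>) =
      (\<lambda>j\<in>{..<n}. if j < k then w j else \<zero>) \<oplus>\<^bsub>free_pow R n\<^esub> (w k \<odot>\<^bsub>free_pow R n\<^esub> free_gen R {..<n} k)"
      using Suc.prems wc by (auto simp: free_pow_simps free_gen_def fun_eq_iff restrict_def less_Suc_eq)
    have IH: "(\<lambda>j\<in>{..<n}. if j < k then w j else \<zero>) \<in> C" by (rule Suc.IH) (use Suc.prems in simp)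
    have k: "k < n" using Suc.prems by simp
    show ?case unfolding eq by (rule submodD(4)[OF C IH basis[OF k]])
  qed
  from this[of n] have "(\<lambda>j\<in>{..<n}. if j < n then w j else \<zero>) \<in> C" by simp
  moreover have "(\<lambda>j\<in>{..<n}. if j < n then w j else \<zero>) = w"
    using w by (auto simp: free_pow_simps PiE_def extensional_def fun_eq_iff)
  ultimately show ?thesis by simp
qed

lemma free_pow_eq_of_basis:
  assumes "submod R (free_pow R n) C" "\<And>i. i < n \<Longrightarrow> free_gen R {..<n} i \<in> C"
  shows "C = carrier (free_pow R n)"
proof
  show "C \<subseteq> carrier (free_pow R n)" by (rule submodD(2)[OF assms(1)])
  show "carrier (free_pow R n) \<subseteq> C"
  proof
    fix w assume w: "w \<in> carrier (free_pow R n)"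
    show "w \<in> C"
      by (rule free_pow_induct[OF assms(1) w])
        (use submodD(5)[OF assms(1)] assms(2) free_pow_coord[OF w] in auto)
  qed
qed

lemma free_hom_exists:
  assumes "module R M" "\<And>i. i < n \<Longrightarrow> v i \<in> carrier M"
  shows "\<exists>f\<in>module_hom R (free_pow R n) M. \<forall>i<n. f (free_gen R {..<n} i) = v i"
proof -
  interpret M: module R M by fact
  define f where "f w = (\<Oplus>\<^bsub>M\<^esub>i\<in>{..<n}. w i \<odot>\<^bsub>M\<^esub> v i)" for w
  have f: "f \<in> module_hom R (free_pow R n) M"
    unfolding module_hom_def
  proof (intro CollectI conjI allI impI)
    show "f \<in> carrier (free_pow R n) \<rightarrow> carrier M"
      unfolding f_def using assms(2) free_pow_coord by (auto intro!: M.M.finsum_closed)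
  next
    fix w w' assume w: "w \<in> carrier (free_pow R n) \<and> w' \<in> carrier (free_pow R n)"
    then have c: "\<And>i. i < n \<Longrightarrow> w i \<in> carrier R \<and> w' i \<in> carrier R" using free_pow_coord by blast
    have "f (w \<oplus>\<^bsub>free_pow R n\<^esub> w') = (\<Oplus>\<^bsub>M\<^esub>i\<in>{..<n}. w i \<odot>\<^bsub>M\<^esub> v i \<oplus>\<^bsub>M\<^esub> w' i \<odot>\<^bsub>M\<^esub> v i)"
      unfolding f_def using c assms(2) by (intro M.M.finsum_cong') (auto simp: free_pow_simps M.smult_l_distr)
    also have "\<dots> = f w \<oplus>\<^bsub>M\<^esub> f w'"
      unfolding f_def using c assms(2) by (intro M.M.finsum_addf) auto
    finally show "f (w \<oplus>\<^bsub>free_pow R n\<^esub> w') = f w \<oplus>\<^bsub>M\<^esub> f w'" .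
  next
    fix r w assume w: "r \<in> carrier R \<and> w \<in> carrier (free_pow R n)"
    then have c: "\<And>i. i < n \<Longrightarrow> w i \<in> carrier R" using free_pow_coord by blast
    have "f (r \<odot>\<^bsub>free_pow R n\<^esub> w) = (\<Oplus>\<^bsub>M\<^esub>i\<in>{..<n}. r \<odot>\<^bsub>M\<^esub> (w i \<odot>\<^bsub>M\<^esub> v i))"
      unfolding f_def using w c assms(2) by (intro M.M.finsum_cong') (auto simp: free_pow_simps M.smult_assoc1)
    also have "\<dots> = r \<odot>\<^bsub>M\<^esub> f w"
      unfolding f_def using w c assms(2) by (intro M.finsum_smult_ldistr[symmetric]) auto
    finally show "f (r \<odot>\<^bsub>free_pow R n\<^esub> w) = r \<odot>\<^bsub>M\<^esub> f w" .
  qed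
  moreover have "f (free_gen R {..<n} i) = v i" if i: "i < n" for i
  proof -
    have "f (free_gen R {..<n} i) = (\<Oplus>\<^bsub>M\<^esub>j\<in>{..<n}. if i = j then v j else \<zero>\<^bsub>M\<^esub>)"
      unfolding f_def using assms(2) i by (intro M.M.finsum_cong') (auto simp: free_gen_def)
    also have "\<dots> = v i" using i assms(2) by (intro M.M.finsum_singleton) auto
    finally show ?thesis .
  qed
  ultimately show ?thesis by blast
qed

text \<open>Projectivity of \<open>R\<^sup>n\<close>: every total linear relation out of it contains a homomorphism.\<close>

lemma free_lift:
  assumes \<rho>: "linear_rel R (free_pow R n) M \<rho>" and total: "\<And>i. i < n \<Longrightarrow> \<exists>m. (free_gen R {..<n} i, m) \<in> \<rho>"
  shows "\<exists>f\<in>module_hom R (free_pow R n) M. \<forall>w\<in>carrier (free_pow R n). (w, f w) \<in> \<rho>"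
proof -
  interpret M: module R M by (rule linear_relD(2)[OF \<rho>])
  interpret F: module R "free_pow R n" by (rule free_pow_module)
  obtain v where v: "\<And>i. i < n \<Longrightarrow> (free_gen R {..<n} i, v i) \<in> \<rho>" using total by metis
  then have "\<And>i. i < n \<Longrightarrow> v i \<in> carrier M" using linear_rel_carrier[OF \<rho>] by blast
  then obtain f where f: "f \<in> module_hom R (free_pow R n) M" "\<And>i. i < n \<Longrightarrow> f (free_gen R {..<n} i) = v i"
    using free_hom_exists[OF M.module_axioms, of n v] by auto
  let ?C = "{w \<in> carrier (free_pow R n). (w, f w) \<in> \<rho>}"
  have C: "submod R (free_pow R n) ?C"
  proof (rule submodI[OF F.module_axioms])
    show "\<zero>\<^bsub>free_pow R n\<^esub> \<in> ?C"
      using linear_rel_zero[OF \<rho>] hom_zero[OF F.module_axioms M.module_axioms f(1)] by simp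
    fix x y assume "x \<in> ?C" "y \<in> ?C"
    then show "x \<oplus>\<^bsub>free_pow R n\<^esub> y \<in> ?C"
      using linear_rel_add[OF \<rho>, of x "f x" y "f y"] module_hom_add[OF f(1)] by auto
  next
    fix r x assume "r \<in> carrier R" "x \<in> ?C"
    then show "r \<odot>\<^bsub>free_pow R n\<^esub> x \<in> ?C"
      using linear_rel_smult[OF \<rho>, of r x "f x"] module_hom_smult[OF f(1)] by auto
  qed auto
  have "?C = carrier (free_pow R n)"
    by (rule free_pow_eq_of_basis[OF C]) (use f(2) v free_gen_carrier in auto)
  then show ?thesis using f(1) by blast
qed

lemma free_lift':
  assumes "linear_rel R (free_pow R n) M \<rho>" "\<And>w. w \<in> carrier (free_pow R n) \<Longrightarrow> \<exists>m. (w, m) \<in> \<rho>"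
  obtains f where "f \<in> module_hom R (free_pow R n) M" "\<And>w. w \<in> carrier (free_pow R n) \<Longrightarrow> (w, f w) \<in> \<rho>"
  using free_lift[OF assms(1)] assms(2) free_gen_carrier by blast

text \<open>The lifting form of projectivity: the graph of \<open>f\<close> followed by the converse
  graph of \<open>g\<close> is a linear relation, total by \<open>im\<close>, and
  \<open>free_lift'\<close> selects a homomorphism inside it.\<close>

lemma free_lift_along:
  assumes N: "module R N" and L: "module R L" and f: "f \<in> module_hom R (free_pow R n) N"
    and g: "g \<in> module_hom R L N" and im: "\<And>w. w \<in> carrier (free_pow R n) \<Longrightarrow> f w \<in> g ` carrier L"
  shows "\<exists>h\<in>module_hom R (free_pow R n) L. \<forall>w\<in>carrier (free_pow R n). g (h w) = f w"
proof -
  note \<rho> = linear_rel_comp[OF hom_graph_linear[OF free_pow_module N f] linear_rel_converse[OF hom_graph_linear[OF L N g]]]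
  obtain h where h: "h \<in> module_hom R (free_pow R n) L"
      "\<And>w. w \<in> carrier (free_pow R n) \<Longrightarrow>
        (w, h w) \<in> {(x, y). x \<in> carrier (free_pow R n) \<and> y = f x} O {(x, y). x \<in> carrier L \<and> y = g x}\<inverse>"
    by (rule free_lift'[OF \<rho>]) (use im in blast)+
  have "g (h w) = f w" if w: "w \<in> carrier (free_pow R n)" for w using h(2)[OF w] by auto
  then show ?thesis using h(1) by blast
qed

text \<open>A filtration from \<open>I R^n\<close> at \<open>k = 0\<close> to \<open>R^n\<close> at
  \<open>k = n\<close>: only the coordinates from \<open>k\<close> on are confined to
  \<open>I\<close>. Consecutive layers are copies of \<open>R/I\<close>.\<close>

definition coord_sub :: "nat \<Rightarrow> 'a set \<Rightarrow> nat \<Rightarrow> (nat \<Rightarrow> 'a) set" where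
  "coord_sub n I k = {w \<in> carrier (free_pow R n). \<forall>i<n. k \<le> i \<longrightarrow> w i \<in> I}"

lemma coord_sub_submod:
  assumes "ideal I R"
  shows "submod R (free_pow R n) (coord_sub n I k)"
proof -
  interpret F: module R "free_pow R n" by (rule free_pow_module)
  note I = submodD[OF ideal_submod[OF assms], simplified]
  show ?thesis
  proof (rule submodI[OF F.module_axioms])
    show "\<zero>\<^bsub>free_pow R n\<^esub> \<in> coord_sub n I k" using I(3) by (auto simp: coord_sub_def free_pow_simps)
    fix x y assume "x \<in> coord_sub n I k" "y \<in> coord_sub n I k"
    then show "x \<oplus>\<^bsub>free_pow R n\<^esub> y \<in> coord_sub n I k"
      using F.M.add.m_closed[of x y] I(4) by (auto simp: coord_sub_def free_pow_simps(2))
  next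
    fix r x assume "r \<in> carrier R" "x \<in> coord_sub n I k"
    then show "r \<odot>\<^bsub>free_pow R n\<^esub> x \<in> coord_sub n I k"
      using F.smult_closed[of r x] I(5) by (auto simp: coord_sub_def free_pow_simps(4))
  qed (auto simp: coord_sub_def)
qed

lemma coord_sub_top: "coord_sub n I n = carrier (free_pow R n)"
  by (auto simp: coord_sub_def)

lemma coord_sub_step_iso:
  assumes I: "ideal I R" and k: "k < n"
  shows "subquot_iso R (free_pow R n) (coord_sub n I k) (coord_sub n I (Suc k)) (ring_module R) I (carrier R)"
proof -
  note F = free_pow_module[of n]
  note S = coord_sub_submod[OF I, of n "Suc k"]
  have img: "(\<lambda>w. w k) ` coord_sub n I (Suc k) = carrier R"
  proof
    show "(\<lambda>w. w k) ` coord_sub n I (Suc k) \<subseteq> carrier R" using k free_pow_coord by (auto simp: coord_sub_def)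
    show "carrier R \<subseteq> (\<lambda>w. w k) ` coord_sub n I (Suc k)"
    proof
      fix r assume r: "r \<in> carrier R"
      have "(\<lambda>j\<in>{..<n}. if j = k then r else \<zero>) \<in> coord_sub n I (Suc k)"
        using r submodD(3)[OF ideal_submod[OF I]] by (auto simp: coord_sub_def free_pow_simps)
      then show "r \<in> (\<lambda>w. w k) ` coord_sub n I (Suc k)"
        using k by (intro image_eqI[of _ _ "\<lambda>j\<in>{..<n}. if j = k then r else \<zero>"]) auto
    qed
  qed
  have pre: "{x \<in> coord_sub n I (Suc k). x k \<in> I} = coord_sub n I k"
    using k by (auto simp: coord_sub_def le_less Suc_le_eq)
  have "I \<subseteq> carrier R" using submodD(2)[OF ideal_submod[OF I]] by simp
  then show ?thesis
    using hom_subquot_iso[OF F module_ring_module coord_hom[OF k] S ideal_submod[OF I]]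
    unfolding img pre by simp
qed

lemma coord_sub_mono: "k \<le> l \<Longrightarrow> coord_sub n I k \<subseteq> coord_sub n I l"
  by (auto simp: coord_sub_def)

lemma mlength_free_pow:
  assumes I: "ideal I R"
  shows "mlength R (free_pow R n) (coord_sub n I 0) (carrier (free_pow R n)) =
    of_nat n * colength R I"
proof -
  interpret F: module R "free_pow R n" by (rule free_pow_module)
  have "mlength R (free_pow R n) (coord_sub n I 0) (coord_sub n I k) =
    of_nat k * colength R I" if "k \<le> n" for k
    using that
  proof (induction k)
    case (Suc k)
    have "mlength R (free_pow R n) (coord_sub n I 0) (coord_sub n I (Suc k)) =
      mlength R (free_pow R n) (coord_sub n I 0) (coord_sub n I k) +
      mlength R (free_pow R n) (coord_sub n I k) (coord_sub n I (Suc k))"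
      by (rule F.mlength_add) (simp_all add: coord_sub_submod I coord_sub_mono)
    then show ?case
      using Suc subquot_iso_mlength[OF coord_sub_step_iso[OF I, of k n]] by (simp add: distrib_right add.commute)
  qed simp
  from this[of n] show ?thesis by (simp add: coord_sub_top)
qed

text \<open>With the zero ideal the filtration \<open>coord_sub\<close> has layers isomorphic to
  \<open>R\<close>.\<close>

lemma noetherian_free_pow:
  assumes "noetherian_ring R"
  shows "noetherian_subquot R (free_pow R n) B Z"
proof -
  interpret F: module R "free_pow R n" by (rule free_pow_module)
  have I: "ideal {\<zero>} R" by (rule zeroideal)
  have "noetherian_subquot R (free_pow R n) (coord_sub n {\<zero>} 0) (coord_sub n {\<zero>} k)" if "k \<le> n" for k
    using that
  proof (induction k)
    case 0
    show ?case by (rule noetherian_subquot_self)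
  next
    case (Suc k)
    have "noetherian_subquot R (free_pow R n) (coord_sub n {\<zero>} k) (coord_sub n {\<zero>} (Suc k))"
      using subquot_iso_noetherian[OF coord_sub_step_iso[OF I] noetherian_ring_module[OF is_cring assms]] Suc.prems by simp
    then show ?case
      by (rule F.noetherian_subquot_add[OF coord_sub_submod[OF I, of n k] coord_sub_submod[OF I], rotated 3])
        (use Suc in \<open>simp_all add: coord_sub_mono\<close>)
  qed
  from this[of n] have "noetherian_subquot R (free_pow R n) (coord_sub n {\<zero>} 0) (carrier (free_pow R n))"
    by (simp add: coord_sub_top)
  moreover have "coord_sub n {\<zero>} 0 = {\<zero>\<^bsub>free_pow R n\<^esub>}"
    by (auto simp: coord_sub_def free_pow_simps PiE_iff extensional_def fun_eq_iff)
  ultimately have N: "noetherian_subquot R (free_pow R n) {\<zero>\<^bsub>free_pow R n\<^esub>} (carrier (free_pow R n))" by simp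
  show ?thesis
    unfolding noetherian_subquot_def
    by (rule noetherian_map[OF N[unfolded noetherian_subquot_def], of _ "\<lambda>x. x"])
      (auto simp: submod_interval_def submodD(3) submodD(2)[THEN subsetD])
qed

lemma coord_sub_least:
  assumes C: "submod R (free_pow R n) C"
    and "\<And>i r. i < n \<Longrightarrow> r \<in> I \<Longrightarrow> r \<odot>\<^bsub>free_pow R n\<^esub> free_gen R {..<n} i \<in> C"
  shows "coord_sub n I 0 \<subseteq> C"
proof
  fix w assume "w \<in> coord_sub n I 0"
  then have w: "w \<in> carrier (free_pow R n)" "\<And>i. i < n \<Longrightarrow> w i \<in> I" by (auto simp: coord_sub_def)
  show "w \<in> C" by (rule free_pow_induct[OF C w(1)]) (use w(2) assms(2) in blast)
qed

lemma coord_mult_ideal: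
  assumes "submod R (free_pow R n) C" "i < n"
  shows "ideal {r \<in> carrier R. r \<odot>\<^bsub>free_pow R n\<^esub> free_gen R {..<n} i \<in> C} R"
  by (rule module.annihilator_ideal[OF free_pow_module assms(1) free_gen_carrier[OF assms(2)]])

lemma ideal_smult_free_pow:
  assumes I: "ideal I R"
  shows "module.ideal_smult R (free_pow R n) I (carrier (free_pow R n)) = coord_sub n I 0"
proof
  interpret F: module R "free_pow R n" by (rule free_pow_module)
  note d = submodD[OF ideal_submod[OF I], simplified]
  show "F.ideal_smult I (carrier (free_pow R n)) \<subseteq> coord_sub n I 0"
  proof (rule F.ideal_smult_least[OF coord_sub_submod[OF I]])
    fix r z assume "r \<in> I" and z: "z \<in> carrier (free_pow R n)"
    moreover from this have "r \<in> carrier R" using d(2) by blast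
    ultimately show "r \<odot>\<^bsub>free_pow R n\<^esub> z \<in> coord_sub n I 0"
      using d(5) free_pow_coord[OF z] F.smult_closed[OF _ z, of r]
      by (auto simp: coord_sub_def free_pow_simps(4)) (metis m_comm)
  qed
  show "coord_sub n I 0 \<subseteq> F.ideal_smult I (carrier (free_pow R n))"
    by (rule coord_sub_least[OF F.ideal_smult_submod])
      (use d(2) F.ideal_smult_mem[OF d(2) subset_refl] free_gen_carrier in auto)
qed

lemma seq_ext_free_pow:
  assumes ys: "set ys \<subseteq> carrier R"
  shows "seq_mult (free_pow R n) (carrier (free_pow R n)) ys =
    coord_sub n (seq_ext (ring_module R) (carrier R) {\<zero>} ys) 0"
proof
  interpret F: module R "free_pow R n" by (rule free_pow_module)
  interpret A: module R "ring_module R" by (rule module_ring_module)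
  let ?J = "seq_ext (ring_module R) (carrier R) {\<zero>} ys"
  let ?C = "seq_mult (free_pow R n) (carrier (free_pow R n)) ys"
  note J = A.seq_ext_props[OF A.submod_carrier A.submod_zero _ ys, simplified]
  note Cp = F.seq_ext_props[OF F.submod_carrier F.submod_zero _ ys, simplified]
  have Ji: "ideal ?J R" using J submod_iff_ideal by blast
  have C: "submod R (free_pow R n) ?C" using Cp by blast
  note d = submodD[OF ideal_submod[OF Ji], simplified]
  show "?C \<subseteq> coord_sub n ?J 0"
  proof (rule F.seq_ext_least[OF coord_sub_submod[OF Ji]])
    show "{\<zero>\<^bsub>free_pow R n\<^esub>} \<subseteq> coord_sub n ?J 0"
      using submodD(3)[OF coord_sub_submod[OF Ji]] by simp
    fix x z assume x: "x \<in> set ys" and z: "z \<in> carrier (free_pow R n)"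
    then show "x \<odot>\<^bsub>free_pow R n\<^esub> z \<in> coord_sub n ?J 0"
      using J ys free_pow_coord[OF z] F.smult_closed[OF _ z, of x] by (auto simp: coord_sub_def free_pow_simps(4))
  qed
  show "coord_sub n ?J 0 \<subseteq> ?C"
  proof (rule coord_sub_least[OF C])
    fix i r assume i: "i < n" and r: "r \<in> ?J"
    \<comment> \<open>The coefficients that carry a basis vector into \<open>(ys)R^n\<close> form an
      ideal containing all multiples of \<open>ys\<close>, hence all of \<open>?J\<close>.\<close>
    let ?K = "{r \<in> carrier R. r \<odot>\<^bsub>free_pow R n\<^esub> free_gen R {..<n} i \<in> ?C}"
    note K = ideal_submod[OF coord_mult_ideal[OF C i]]
    have "?J \<subseteq> ?K"
    proof (rule A.seq_ext_least[OF K])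
      show "{\<zero>} \<subseteq> ?K" using submodD(3)[OF K] by simp
      fix x z assume x: "x \<in> set ys" and z: "z \<in> carrier R"
      have "x \<odot>\<^bsub>free_pow R n\<^esub> (z \<odot>\<^bsub>free_pow R n\<^esub> free_gen R {..<n} i) \<in> ?C"
        using Cp x F.smult_closed[OF z free_gen_carrier[OF i]] by blast
      then show "x \<odot>\<^bsub>ring_module R\<^esub> z \<in> ?K"
        using x z ys F.smult_assoc1[of x z "free_gen R {..<n} i"] free_gen_carrier[OF i] by auto
    qed
    then show "r \<odot>\<^bsub>free_pow R n\<^esub> free_gen R {..<n} i \<in> ?C" using r by blast
  qed
qed

lemma seq_regular_free_pow:
  "set ys \<subseteq> carrier R \<Longrightarrow> seq_regular (ring_module R) (carrier R) {\<zero>} ys \<Longrightarrow>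
    seq_reg (free_pow R n) (carrier (free_pow R n)) ys"
proof (induction ys rule: rev_induct)
  case (snoc y ys)
  let ?J = "seq_ext (ring_module R) (carrier R) {\<zero>} ys"
  have ys: "set ys \<subseteq> carrier R" "y \<in> carrier R" using snoc.prems(1) by auto
  have reg: "seq_regular (ring_module R) (carrier R) {\<zero>} ys"
    and y: "\<And>z. z \<in> carrier R \<Longrightarrow> y \<otimes> z \<in> ?J \<Longrightarrow> z \<in> ?J"
    using snoc.prems(2) unfolding seq_regular_snoc ring_module_simps by blast+
  have "z \<in> coord_sub n ?J 0"
    if z: "z \<in> carrier (free_pow R n)" and yz: "y \<odot>\<^bsub>free_pow R n\<^esub> z \<in> coord_sub n ?J 0" for z
    unfolding coord_sub_def
  proof (intro CollectI conjI z allI impI)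
    fix i assume i: "i < n"
    have "(y \<odot>\<^bsub>free_pow R n\<^esub> z) i \<in> ?J" using yz i by (simp add: coord_sub_def)
    moreover have "(y \<odot>\<^bsub>free_pow R n\<^esub> z) i = y \<otimes> z i" using i by (simp add: free_pow_simps(4))
    ultimately show "z i \<in> ?J" using y[OF free_pow_coord[OF z i]] by simp
  qed
  then show ?case
    unfolding seq_regular_snoc seq_ext_free_pow[OF ys(1)] using snoc.IH[OF ys(1) reg] by blast
qed simp

end

lemma (in module) finite_family_hom:
  assumes "finite S" "S \<subseteq> carrier M"
  obtains n f where "f \<in> module_hom R (free_pow R n) M" "f ` carrier (free_pow R n) = span S"
proof -
  obtain n and v :: "nat \<Rightarrow> 'c" where v: "S = v ` {i. i < n}"
    using assms(1) finite_imp_nat_seg_image_inj_on by metis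
  then have vc: "\<And>i. i < n \<Longrightarrow> v i \<in> carrier M" using assms(2) by blast
  obtain f where f: "f \<in> module_hom R (free_pow R n) M" "\<And>i. i < n \<Longrightarrow> f (free_gen R {..<n} i) = v i"
    using R.free_hom_exists[OF module_axioms, of n v] vc by auto
  note F = R.free_pow_module[of n]
  interpret F: module R "free_pow R n" by (rule F)
  have im: "submod R M (f ` carrier (free_pow R n))"
    by (rule hom_image_submod[OF F module_axioms f(1) F.submod_carrier])
  have sp: "submod R M (span S)" by (rule span_is_submodule[OF assms(2)])
  have "{x \<in> carrier (free_pow R n). f x \<in> span S} = carrier (free_pow R n)"
  proof (rule R.free_pow_eq_of_basis[OF hom_preimage_submod[OF F module_axioms f(1) sp]])
    fix i assume i: "i < n"
    then have "v i \<in> span S" using in_own_span[OF assms(2)] v by blast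
    then show "free_gen R {..<n} i \<in> {x \<in> carrier (free_pow R n). f x \<in> span S}"
      using f(2)[OF i] R.free_gen_carrier[OF i] by simp
  qed
  moreover have "span S \<subseteq> f ` carrier (free_pow R n)"
  proof (rule span_in_submod[OF im])
    show "S \<subseteq> f ` carrier (free_pow R n)"
    proof
      fix s assume "s \<in> S"
      then obtain i where i: "i < n" "s = v i" using v by auto
      then have "s = f (free_gen R {..<n} i)" using f(2) by simp
      then show "s \<in> f ` carrier (free_pow R n)" using R.free_gen_carrier[OF i(1)] by blast
    qed
  qed
  ultimately show thesis using that[OF f(1)] by blast
qed

subsection \<open>Existence of free resolutions\<close>

lemma free_cover_exists:
  assumes "noetherian_ring R" "noetherian_subquot R M {\<zero>\<^bsub>M\<^esub>} (carrier M)" "submod R M N"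
  obtains n f where "f \<in> module_hom R (free_pow R n) M" "f ` carrier (free_pow R n) = N"
proof -
  interpret module R M by (rule submodD(1)[OF assms(3)])
  obtain S where S: "finite S" "S \<subseteq> N" "span S = N" using noetherian_fin_gen[OF assms(2,3)] .
  have "S \<subseteq> carrier M" using S(2) submodD(2)[OF assms(3)] by blast
  then show thesis using finite_family_hom[OF S(1)] S(3) that by metis
qed

lemma free_resolution_exists:
  assumes R: "noetherian_ring R" and M: "fin_gen R M"
  shows "\<exists>b d e. free_resolution R M b d e"
proof -
  interpret module R M using M by (simp add: fin_gen_def)
  obtain n0 e where e: "e \<in> module_hom R (free_pow R n0) M" "e ` carrier (free_pow R n0) = carrier M"
    using free_cover_exists[OF R fin_gen_noetherian[OF R M] submod_carrier] .
  \<comment> \<open>A state is a differential together with its two ranks. \<open>P\<close> anchors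
    the first one on the kernel of the augmentation, \<open>Q\<close> makes consecutive ones
    composable and exact.\<close>
  define P where "P i s \<longleftrightarrow> (case s of (p, q, f) \<Rightarrow> f \<in> module_hom R (free_pow R q) (free_pow R p) \<and>
      (i = 0 \<longrightarrow> p = n0 \<and> f ` carrier (free_pow R q) = ker_on e (free_pow R n0) M))"
    for i :: nat and s :: "nat \<times> nat \<times> ((nat \<Rightarrow> 'a) \<Rightarrow> nat \<Rightarrow> 'a)"
  define Q where "Q i s t \<longleftrightarrow> (case s of (p, q, f) \<Rightarrow> case t of (p', q', f') \<Rightarrow> p' = q \<and>
      f' ` carrier (free_pow R q') = ker_on f (free_pow R q) (free_pow R p))"
    for i :: nat and s t :: "nat \<times> nat \<times> ((nat \<Rightarrow> 'a) \<Rightarrow> nat \<Rightarrow> 'a)"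
  have "\<exists>s. \<forall>i. P i (s i) \<and> Q i (s i) (s (Suc i))"
  proof (rule dependent_nat_choice)
    obtain q f where "f \<in> module_hom R (free_pow R q) (free_pow R n0)"
      "f ` carrier (free_pow R q) = ker_on e (free_pow R n0) M"
      using free_cover_exists[OF R R.noetherian_free_pow[OF R]
          hom_ker_submod[OF R.free_pow_module module_axioms e(1)]] .
    then show "\<exists>s. P 0 s" by (intro exI[of _ "(n0, q, f)"]) (simp add: P_def)
  next
    fix s i assume s: "P i s"
    obtain p q f where sf: "s = (p, q, f)" by (cases s)
    then have f: "f \<in> module_hom R (free_pow R q) (free_pow R p)" using s by (simp add: P_def)
    obtain q' f' where "f' \<in> module_hom R (free_pow R q') (free_pow R q)"
      "f' ` carrier (free_pow R q') = ker_on f (free_pow R q) (free_pow R p)"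
      using free_cover_exists[OF R R.noetherian_free_pow[OF R]
          hom_ker_submod[OF R.free_pow_module R.free_pow_module f]] .
    then show "\<exists>t. P (Suc i) t \<and> Q i s t" by (intro exI[of _ "(q, q', f')"]) (simp add: P_def Q_def sf)
  qed
  then obtain s where s: "\<And>i. P i (s i)" "\<And>i. Q i (s i) (s (Suc i))" by blast
  define b where "b i = fst (s i)" for i
  define d where "d i = snd (snd (s i))" for i
  have b: "fst (snd (s i)) = b (Suc i)" for i using s(2)[of i] by (auto simp: Q_def b_def split: prod.splits)
  have seq: "s i = (b i, b (Suc i), d i)" for i using b[of i] by (simp add: b_def d_def prod_eq_iff)
  have P: "d i \<in> module_hom R (free_pow R (b (Suc i))) (free_pow R (b i))" for i
    using s(1)[of i] unfolding seq P_def by simp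
  have P0: "b 0 = n0" "d 0 ` carrier (free_pow R (b (Suc 0))) = ker_on e (free_pow R n0) M"
    using s(1)[of 0] unfolding seq P_def by simp_all
  have Q: "d (Suc i) ` carrier (free_pow R (b (Suc (Suc i)))) = ker_on (d i) (free_pow R (b (Suc i))) (free_pow R (b i))" for i
    using s(2)[of i] unfolding seq[of i] seq[of "Suc i"] Q_def by simp
  have "free_resolution R M b d e"
    unfolding free_resolution_def using e P P0 Q by simp
  then show ?thesis by blast
qed

lemma some_resolution_is_resolution:
  assumes "noetherian_ring R" "fin_gen R M"
  obtains b d e where "some_resolution R M = (b, d)" "free_resolution R M b d e"
proof -
  from free_resolution_exists[OF assms] obtain b d e where res: "free_resolution R M b d e"
    by (elim exE)
  have "case (b, d) of (b, d) \<Rightarrow> \<exists>e. free_resolution R M b d e"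
    unfolding case_prod_conv by (rule exI) (rule res)
  then have ex: "\<exists>p. case p of (b, d) \<Rightarrow> \<exists>e. free_resolution R M b d e"
    by (rule exI)
  have some: "case some_resolution R M of (b, d) \<Rightarrow> \<exists>e. free_resolution R M b d e"
    unfolding some_resolution_def by (rule someI_ex) (rule ex)
  obtain b' d' where bd: "some_resolution R M = (b', d')" by (cases "some_resolution R M")
  have "\<exists>e. free_resolution R M b' d' e" using some unfolding bd case_prod_conv .
  then obtain e' where e': "free_resolution R M b' d' e'" by (elim exE)
  show thesis by (rule that) (rule bd, rule e')
qed

section \<open>Betti numbers as ranks\<close>

subsection \<open>Quotient modules\<close>

context module
begin

lemma submod_abelian_subgroup:
  assumes B: "submod R M B"
  shows "abelian_subgroup B M"
proof (rule abelian_subgroupI3[OF additive_subgroupI M.abelian_group_axioms])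
  show "subgroup B (add_monoid M)"
  proof (rule M.add.subgroupI)
    show "B \<subseteq> carrier M" by (rule submodD(2)[OF B])
    show "B \<noteq> {}" using submodD(3)[OF B] by blast
    fix x assume "x \<in> B"
    then show "\<ominus>\<^bsub>M\<^esub> x \<in> B" by (rule submod_uminus[OF B])
    fix y assume "y \<in> B"
    then show "x \<oplus>\<^bsub>M\<^esub> y \<in> B" by (rule submodD(4)[OF B \<open>x \<in> B\<close>])
  qed
qed

lemma coset_eq_iff:
  assumes B: "submod R M B" and "x \<in> carrier M" "y \<in> carrier M"
  shows "B +>\<^bsub>M\<^esub> x = B +>\<^bsub>M\<^esub> y \<longleftrightarrow> x \<ominus>\<^bsub>M\<^esub> y \<in> B"
proof -
  interpret B: abelian_subgroup B M by (rule submod_abelian_subgroup[OF B])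
  have "B +>\<^bsub>M\<^esub> x = B +>\<^bsub>M\<^esub> y \<longleftrightarrow> x \<in> B +>\<^bsub>M\<^esub> y"
    using B.a_repr_independence'[of x y] B.a_repr_independenceD[of x y] assms(2,3) by metis
  then show ?thesis using B.a_rcos_module[OF assms(3,2)] by (simp add: a_minus_def)
qed

lemma coset_add:
  assumes B: "submod R M B" and "x \<in> carrier M" "y \<in> carrier M"
  shows "(B +>\<^bsub>M\<^esub> x) <+>\<^bsub>M\<^esub> (B +>\<^bsub>M\<^esub> y) = B +>\<^bsub>M\<^esub> (x \<oplus>\<^bsub>M\<^esub> y)"
  by (rule abelian_subgroup.a_rcos_sum[OF submod_abelian_subgroup[OF B] assms(2,3)])

lemma coset_zero: "submod R M B \<Longrightarrow> B +>\<^bsub>M\<^esub> \<zero>\<^bsub>M\<^esub> = B"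
  by (rule abelian_subgroup.a_rcos_const[OF submod_abelian_subgroup submodD(3)])

lemma coset_smult:
  assumes B: "submod R M B" and "x \<in> carrier M" "r \<in> carrier R"
  shows "(\<Union>y\<in>B +>\<^bsub>M\<^esub> x. B +>\<^bsub>M\<^esub> (r \<odot>\<^bsub>M\<^esub> y)) = B +>\<^bsub>M\<^esub> (r \<odot>\<^bsub>M\<^esub> x)"
proof -
  interpret B: abelian_subgroup B M by (rule submod_abelian_subgroup[OF B])
  have "B +>\<^bsub>M\<^esub> (r \<odot>\<^bsub>M\<^esub> y) = B +>\<^bsub>M\<^esub> (r \<odot>\<^bsub>M\<^esub> x)" if y: "y \<in> B +>\<^bsub>M\<^esub> x" for y
  proof -
    have yc: "y \<in> carrier M" using B.a_elemrcos_carrier[OF assms(2) y] .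
    have "y \<ominus>\<^bsub>M\<^esub> x \<in> B" using B.a_rcos_module[OF assms(2) yc] y by (simp add: a_minus_def)
    then have "r \<odot>\<^bsub>M\<^esub> (y \<ominus>\<^bsub>M\<^esub> x) \<in> B" by (rule submodD(5)[OF B assms(3)])
    then show ?thesis
      using coset_eq_iff[OF B, of "r \<odot>\<^bsub>M\<^esub> y" "r \<odot>\<^bsub>M\<^esub> x"] assms yc by (simp add: smult_minus)
  qed
  moreover have "x \<in> B +>\<^bsub>M\<^esub> x" by (rule B.a_rcos_self[OF assms(2)])
  ultimately show ?thesis by blast
qed

end

lemma quot_module_simps:
  "carrier (quot_module M B) = a_rcosets\<^bsub>M\<^esub> B" "\<zero>\<^bsub>quot_module M B\<^esub> = B"
  "X \<oplus>\<^bsub>quot_module M B\<^esub> Y = X <+>\<^bsub>M\<^esub> Y"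
  "r \<odot>\<^bsub>quot_module M B\<^esub> X = (\<Union>x\<in>X. B +>\<^bsub>M\<^esub> (r \<odot>\<^bsub>M\<^esub> x))"
  by (simp_all add: quot_module_def)

lemma quot_module_carrier: "carrier (quot_module M B) = {B +>\<^bsub>M\<^esub> x | x. x \<in> carrier M}"
  by (auto simp: quot_module_simps A_RCOSETS_def RCOSETS_def a_r_coset_def)

lemma quot_module_coset:
  assumes "module R M" "submod R M B"
  shows "x \<in> carrier M \<Longrightarrow> B +>\<^bsub>M\<^esub> x \<in> carrier (quot_module M B)"
    "x \<in> carrier M \<Longrightarrow> y \<in> carrier M \<Longrightarrow>
      (B +>\<^bsub>M\<^esub> x) \<oplus>\<^bsub>quot_module M B\<^esub> (B +>\<^bsub>M\<^esub> y) = B +>\<^bsub>M\<^esub> (x \<oplus>\<^bsub>M\<^esub> y)"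
    "x \<in> carrier M \<Longrightarrow> r \<in> carrier R \<Longrightarrow>
      r \<odot>\<^bsub>quot_module M B\<^esub> (B +>\<^bsub>M\<^esub> x) = B +>\<^bsub>M\<^esub> (r \<odot>\<^bsub>M\<^esub> x)"
  using assms module.coset_add[OF assms] module.coset_smult[OF assms]
  by (auto simp: quot_module_carrier quot_module_simps(3,4))

lemma quot_module_module:
  assumes M: "module R M" and B: "submod R M B"
  shows "module R (quot_module M B)"
proof -
  interpret M: module R M by fact
  let ?Q = "quot_module M B"
  note c = quot_module_coset[OF M B]
  have ex: "\<exists>x\<in>carrier M. X = B +>\<^bsub>M\<^esub> x" if X: "X \<in> carrier ?Q" for X
    using X by (auto simp: quot_module_carrier)
  have z: "\<zero>\<^bsub>?Q\<^esub> = B +>\<^bsub>M\<^esub> \<zero>\<^bsub>M\<^esub>" using M.coset_zero[OF B] by (simp add: quot_module_simps)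
  show ?thesis
  proof (rule module_criteria[OF M.R.is_cring], goal_cases)
    case 1 then show ?case using c(1) z by simp
  next
    case 2 show ?case by (auto dest!: ex simp: c)
  next
    case 3
    show ?case
    proof
      fix v assume "v \<in> carrier ?Q"
      then obtain x where x: "x \<in> carrier M" "v = B +>\<^bsub>M\<^esub> x" using ex by blast
      then show "\<exists>w\<in>carrier ?Q. v \<oplus>\<^bsub>?Q\<^esub> w = \<zero>\<^bsub>?Q\<^esub>"
        by (intro bexI[of _ "B +>\<^bsub>M\<^esub> (\<ominus>\<^bsub>M\<^esub> x)"]) (simp_all add: c z M.M.r_neg)
    qed
  next
    case 4 show ?case by (auto dest!: ex simp: c)
  next
    case 5 show ?case by (auto dest!: ex simp: c M.M.a_comm)
  next
    case 6 show ?case by (auto dest!: ex simp: c M.M.a_assoc)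
  next
    case 7 show ?case unfolding z by (auto dest!: ex simp: c)
  next
    case 8 show ?case by (auto dest!: ex simp: c M.smult_assoc1)
  next
    case 9 show ?case by (auto dest!: ex simp: c)
  next
    case 10 show ?case by (auto dest!: ex simp: c M.smult_l_distr)
  next
    case 11 show ?case by (auto dest!: ex simp: c M.smult_r_distr)
  qed
qed

lemma quot_map_hom:
  assumes M: "module R M" and B: "submod R M B"
  shows "(\<lambda>x. B +>\<^bsub>M\<^esub> x) \<in> module_hom R M (quot_module M B)"
  using quot_module_coset[OF assms] by (auto simp: module_hom_def)

lemma quot_module_mlength:
  assumes M: "module R M" and B: "submod R M B"
  shows "mlength R (quot_module M B) {\<zero>\<^bsub>quot_module M B\<^esub>} (carrier (quot_module M B)) = mlength R M B (carrier M)"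
proof -
  interpret M: module R M by fact
  interpret Q: module R "quot_module M B" by (rule quot_module_module[OF assms])
  let ?\<pi> = "\<lambda>x. B +>\<^bsub>M\<^esub> x"
  have im: "?\<pi> ` carrier M = carrier (quot_module M B)" by (auto simp: quot_module_carrier)
  have "x \<in> carrier M \<Longrightarrow> B +>\<^bsub>M\<^esub> x = B \<longleftrightarrow> x \<in> B" for x
    using M.coset_eq_iff[OF B, of x "\<zero>\<^bsub>M\<^esub>"] M.coset_zero[OF B] by simp
  then have pre: "{x \<in> carrier M. ?\<pi> x \<in> {\<zero>\<^bsub>quot_module M B\<^esub>}} = B"
    using submodD(2)[OF B] by (auto simp: quot_module_simps(2))
  have "{\<zero>\<^bsub>quot_module M B\<^esub>} \<subseteq> ?\<pi> ` carrier M" unfolding im using Q.M.zero_closed by simp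
  from hom_mlength[OF M Q.module_axioms quot_map_hom[OF assms] M.submod_carrier Q.submod_zero this]
  show ?thesis unfolding pre im by simp
qed

lemma submod_restrict_module: "submod R M Z \<Longrightarrow> module R (M\<lparr>carrier := Z\<rparr>)"
  using module.submodule_is_module[OF submodD(1)] by blast

lemma submod_restrict_iff:
  assumes "submod R M Z"
  shows "submod R (M\<lparr>carrier := Z\<rparr>) N \<longleftrightarrow> submod R M N \<and> N \<subseteq> Z"
  using submod_restrict_module[OF assms] submodD(1,2)[OF assms]
  unfolding LinearCombinations.submodule_def by auto

lemma restrict_mlength:
  assumes "submod R M Z"
  shows "mlength R (M\<lparr>carrier := Z\<rparr>) B Z = mlength R M B Z"
  unfolding mlength_def submod_interval_def submod_restrict_iff[OF assms]
  by (rule arg_cong[where f = height]) auto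

subsection \<open>Dimension over the residue field\<close>

context noetherian_local_ring
begin

lemma residue_smult:
  assumes V: "module R V" and ann: "\<And>r v. r \<in> \<mm> \<Longrightarrow> v \<in> carrier V \<Longrightarrow> r \<odot>\<^bsub>V\<^esub> v = \<zero>\<^bsub>V\<^esub>"
    and r: "r \<in> carrier R" and v: "v \<in> carrier V"
  shows "(\<mm> +> r) \<odot>\<^bsub>residue_space V\<^esub> v = r \<odot>\<^bsub>V\<^esub> v"
proof -
  interpret V: module R V by fact
  define s where "s = (SOME s. s \<in> \<mm> +> r)"
  have "r \<in> \<mm> +> r" by (rule a_rcos_self[OF r])
  then have s: "s \<in> \<mm> +> r" unfolding s_def by (rule someI)
  then have sc: "s \<in> carrier R" using a_elemrcos_carrier r by blast
  have "s \<oplus> \<ominus> r \<in> \<mm>" using a_rcos_module[OF r sc] s by simp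
  then have "(s \<oplus> \<ominus> r) \<odot>\<^bsub>V\<^esub> v = \<zero>\<^bsub>V\<^esub>" using ann v by blast
  then have "s \<odot>\<^bsub>V\<^esub> v \<ominus>\<^bsub>V\<^esub> r \<odot>\<^bsub>V\<^esub> v = \<zero>\<^bsub>V\<^esub>"
    using V.smult_minus_left[OF sc r v] by (simp add: a_minus_def)
  then show ?thesis using sc r v by (simp add: residue_space_def s_def)
qed

lemma residue_vectorspace:
  assumes V: "module R V" and ann: "\<And>r v. r \<in> \<mm> \<Longrightarrow> v \<in> carrier V \<Longrightarrow> r \<odot>\<^bsub>V\<^esub> v = \<zero>\<^bsub>V\<^esub>"
  shows "vectorspace (R Quot \<mm>) (residue_space V)"
proof -
  interpret V: module R V by fact
  have fld: "field (R Quot \<mm>)" by (rule quotient_is_field[OF is_cring])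
  have sm: "\<And>r v. r \<in> carrier R \<Longrightarrow> v \<in> carrier V \<Longrightarrow> (\<mm> +> r) \<odot>\<^bsub>residue_space V\<^esub> v = r \<odot>\<^bsub>V\<^esub> v"
    by (rule residue_smult[OF V ann])
  have simps: "carrier (residue_space V) = carrier V" "add (residue_space V) = add V"
    "zero (residue_space V) = zero V" by (simp_all add: residue_space_def)
  have ex: "\<exists>r\<in>carrier R. X = \<mm> +> r" if X: "X \<in> carrier (R Quot \<mm>)" for X
    using X by (auto simp: FactRing_def A_RCOSETS_def RCOSETS_def a_r_coset_def)
  have q: "\<one>\<^bsub>R Quot \<mm>\<^esub> = \<mm> +> \<one>"
    "\<And>r s. r \<in> carrier R \<Longrightarrow> s \<in> carrier R \<Longrightarrow> (\<mm> +> r) \<otimes>\<^bsub>R Quot \<mm>\<^esub> (\<mm> +> s) = \<mm> +> (r \<otimes> s)"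
    "\<And>r s. r \<in> carrier R \<Longrightarrow> s \<in> carrier R \<Longrightarrow> (\<mm> +> r) \<oplus>\<^bsub>R Quot \<mm>\<^esub> (\<mm> +> s) = \<mm> +> (r \<oplus> s)"
    using rcoset_mult_add a_rcos_sum by (auto simp: FactRing_def)
  have "module (R Quot \<mm>) (residue_space V)"
  proof (rule module_criteria[OF quotient_is_cring[OF is_cring]], goal_cases)
    case 3 show ?case unfolding simps using V.M.r_neg by (auto intro!: bexI[of _ "\<ominus>\<^bsub>V\<^esub> _"])
  next
    case 4 show ?case by (auto dest!: ex simp: simps sm)
  next
    case 8 show ?case by (auto dest!: ex simp: simps sm q V.smult_assoc1)
  next
    case 9 show ?case by (auto simp: simps sm q)
  next
    case 10 show ?case by (auto dest!: ex simp: simps sm q V.smult_l_distr)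
  next
    case 11 show ?case by (auto dest!: ex simp: simps sm q V.smult_r_distr)
  qed (auto simp: simps V.M.a_ac)
  then show ?thesis by (simp add: vectorspace_def fld)
qed

lemma residue_submod_iff:
  assumes V: "module R V" and ann: "\<And>r v. r \<in> \<mm> \<Longrightarrow> v \<in> carrier V \<Longrightarrow> r \<odot>\<^bsub>V\<^esub> v = \<zero>\<^bsub>V\<^esub>"
  shows "submod (R Quot \<mm>) (residue_space V) N \<longleftrightarrow> submod R V N"
proof -
  interpret V: module R V by fact
  have K: "module (R Quot \<mm>) (residue_space V)"
    using residue_vectorspace[OF assms] by (simp add: vectorspace_def)
  have ex: "\<exists>r\<in>carrier R. X = \<mm> +> r" if X: "X \<in> carrier (R Quot \<mm>)" for X
    using X by (auto simp: FactRing_def A_RCOSETS_def RCOSETS_def a_r_coset_def)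
  have cos: "r \<in> carrier R \<Longrightarrow> \<mm> +> r \<in> carrier (R Quot \<mm>)" for r
    by (auto simp: FactRing_def A_RCOSETS_def RCOSETS_def a_r_coset_def)
  have sm: "\<And>r v. r \<in> carrier R \<Longrightarrow> v \<in> carrier V \<Longrightarrow> (\<mm> +> r) \<odot>\<^bsub>residue_space V\<^esub> v = r \<odot>\<^bsub>V\<^esub> v"
    by (rule residue_smult[OF V ann])
  have simps: "carrier (residue_space V) = carrier V" "add (residue_space V) = add V"
    "zero (residue_space V) = zero V" by (simp_all add: residue_space_def)
  show ?thesis
  proof
    assume N: "submod (R Quot \<mm>) (residue_space V) N"
    note d = submodD[OF N, unfolded simps]
    show "submod R V N"
    proof (rule submodI[OF V d(2,3)])
      fix r x assume r: "r \<in> carrier R" and x: "x \<in> N"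
      then show "r \<odot>\<^bsub>V\<^esub> x \<in> N" using d(5)[OF cos[OF r] x] sm[OF r, of x] d(2) by auto
    qed (use d(4) in auto)
  next
    assume N: "submod R V N"
    note d = submodD[OF N]
    show "submod (R Quot \<mm>) (residue_space V) N"
    proof (rule submodI[OF K])
      fix X x assume "X \<in> carrier (R Quot \<mm>)" and x: "x \<in> N"
      then obtain r where r: "r \<in> carrier R" "X = \<mm> +> r" using ex by blast
      then show "X \<odot>\<^bsub>residue_space V\<^esub> x \<in> N" using d(5)[OF r(1) x] sm[OF r(1), of x] d(2) x by auto
    qed (use d in \<open>auto simp: simps\<close>)
  qed
qed

lemma mlength_span_le_card:
  assumes V: "module R V" and ann: "\<And>r v. r \<in> \<mm> \<Longrightarrow> v \<in> carrier V \<Longrightarrow> r \<odot>\<^bsub>V\<^esub> v = \<zero>\<^bsub>V\<^esub>"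
  shows "finite A \<Longrightarrow> A \<subseteq> carrier V \<Longrightarrow>
    \<exists>N. submod R V N \<and> A \<subseteq> N \<and> mlength R V {\<zero>\<^bsub>V\<^esub>} N \<le> enat (card A)"
proof (induction A rule: finite_induct)
  case empty
  show ?case using module.submod_zero[OF V] by (intro exI[of _ "{\<zero>\<^bsub>V\<^esub>}"]) simp
next
  case (insert a A)
  interpret V: module R V by fact
  obtain N where N: "submod R V N" "A \<subseteq> N" "mlength R V {\<zero>\<^bsub>V\<^esub>} N \<le> enat (card A)"
    using insert by auto
  have a: "a \<in> carrier V" using insert.prems by simp
  note ad = V.adjoin_props[OF N(1) a]
  have "mlength R V N (V.adjoin N a) \<le> 1"
  proof (cases "a \<in> N")
    case True
    then have "V.adjoin N a = N" using V.adjoin_least[OF N(1) subset_refl] ad(2) by blast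
    then show ?thesis by simp
  next
    case False
    have "mlength R V N (V.adjoin N a) = 1"
      by (rule mlength_adjoin_simple[OF N(1) a False]) (use ann a submodD(3)[OF N(1)] in auto)
    then show ?thesis by simp
  qed
  moreover have "mlength R V {\<zero>\<^bsub>V\<^esub>} (V.adjoin N a) =
      mlength R V {\<zero>\<^bsub>V\<^esub>} N + mlength R V N (V.adjoin N a)"
    by (rule V.mlength_add[OF V.submod_zero N(1) ad(1)]) (use submodD(3)[OF N(1)] ad(2) in auto)
  ultimately have "mlength R V {\<zero>\<^bsub>V\<^esub>} (V.adjoin N a) \<le> enat (card A) + 1"
    using N(3) by (simp add: add_mono)
  then have "mlength R V {\<zero>\<^bsub>V\<^esub>} (V.adjoin N a) \<le> enat (card (insert a A))"
    using insert.hyps by (simp add: one_enat_def)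
  then show ?case using ad N(2) by (intro exI[of _ "V.adjoin N a"]) auto
qed

lemma generators_of_mlength:
  assumes V: "module R V" and ann: "\<And>r v. r \<in> \<mm> \<Longrightarrow> v \<in> carrier V \<Longrightarrow> r \<odot>\<^bsub>V\<^esub> v = \<zero>\<^bsub>V\<^esub>"
  shows "submod R V S \<Longrightarrow> mlength R V S (carrier V) = enat k \<Longrightarrow>
    \<exists>A. finite A \<and> card A \<le> k \<and> A \<subseteq> carrier V \<and> (\<forall>N. submod R V N \<and> S \<union> A \<subseteq> N \<longrightarrow> N = carrier V)"
proof (induction k arbitrary: S)
  case 0
  interpret V: module R V by fact
  have "S = carrier V"
  proof (rule ccontr)
    assume "S \<noteq> carrier V"
    then have "1 \<le> mlength R V S (carrier V)"
      using mlength_pos[OF 0(1) V.submod_carrier] submodD(2)[OF 0(1)] by blast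
    then show False using 0(2) by (simp add: one_enat_def)
  qed
  then show ?case using submodD(2) by (intro exI[of _ "{}"]) auto
next
  case (Suc k)
  interpret V: module R V by fact
  have "S \<noteq> carrier V" using Suc.prems(2) by (auto simp: zero_enat_def)
  then obtain v where v: "v \<in> carrier V" "v \<notin> S" using submodD(2)[OF Suc.prems(1)] by blast
  note ad = V.adjoin_props[OF Suc.prems(1) v(1)]
  have "mlength R V S (V.adjoin S v) = 1"
    by (rule mlength_adjoin_simple[OF Suc.prems(1) v]) (use ann v submodD(3)[OF Suc.prems(1)] in auto)
  moreover have "mlength R V S (carrier V) = mlength R V S (V.adjoin S v) + mlength R V (V.adjoin S v) (carrier V)"
    by (rule V.mlength_add[OF Suc.prems(1) ad(1) V.submod_carrier ad(2) submodD(2)[OF ad(1)]])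
  ultimately have "mlength R V (V.adjoin S v) (carrier V) = enat k"
    using Suc.prems(2) by (cases "mlength R V (V.adjoin S v) (carrier V)") (auto simp: one_enat_def)
  from Suc.IH[OF ad(1) this] obtain A where A: "finite A" "card A \<le> k" "A \<subseteq> carrier V"
    "\<And>N. submod R V N \<Longrightarrow> V.adjoin S v \<union> A \<subseteq> N \<Longrightarrow> N = carrier V" by auto
  have "N = carrier V" if N: "submod R V N" "S \<union> insert v A \<subseteq> N" for N
    by (rule A(4)[OF N(1)]) (use N V.adjoin_least[OF N(1), of S v] in auto)
  moreover have "card (insert v A) \<le> Suc k" using A(1,2) by (simp add: card_insert_if)
  ultimately show ?case using A(1,3) v(1) by (intro exI[of _ "insert v A"]) auto
qed

text \<open>The dimension is the least size of a generating set. A generator raises the length by at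
  most one, which bounds it from below; a vector outside a subspace raises the length by exactly
  one, so \<open>d\<close> well-chosen vectors suffice.\<close>

lemma residue_dim_eq_mlength:
  assumes V: "module R V" and ann: "\<And>r v. r \<in> \<mm> \<Longrightarrow> v \<in> carrier V \<Longrightarrow> r \<odot>\<^bsub>V\<^esub> v = \<zero>\<^bsub>V\<^esub>"
    and len: "mlength R V {\<zero>\<^bsub>V\<^esub>} (carrier V) = enat d"
  shows "residue_dim R \<mm> V = d"
proof -
  interpret V: module R V by fact
  let ?K = "R Quot \<mm>" and ?W = "residue_space V"
  interpret W: vectorspace ?K ?W by (rule residue_vectorspace[OF V ann])
  have cW: "carrier ?W = carrier V" by (simp add: residue_space_def)
  note sub = residue_submod_iff[OF V ann]
  have lower: "d \<le> card A" if A: "finite A" "A \<subseteq> carrier ?W" "W.span A = carrier ?W" for A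
  proof -
    obtain N where N: "submod R V N" "A \<subseteq> N" "mlength R V {\<zero>\<^bsub>V\<^esub>} N \<le> enat (card A)"
      using mlength_span_le_card[OF V ann A(1)] A(2) unfolding cW by auto
    have "W.span A \<subseteq> N" by (rule W.span_in_submod[OF _ N(2)]) (use sub N(1) in blast)
    then have "N = carrier V" using A(3) submodD(2)[OF N(1)] unfolding cW by blast
    then show ?thesis using N(3) len by simp
  qed
  obtain A where A: "finite A" "card A \<le> d" "A \<subseteq> carrier V"
    "\<And>N. submod R V N \<Longrightarrow> {\<zero>\<^bsub>V\<^esub>} \<union> A \<subseteq> N \<Longrightarrow> N = carrier V"
    using generators_of_mlength[OF V ann V.submod_zero len] by auto
  have spA: "submod ?K ?W (W.span A)" by (rule W.span_is_submodule) (use A(3) cW in auto)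
  then have "submod R V (W.span A)" using sub by blast
  moreover have "A \<subseteq> W.span A" by (rule W.in_own_span) (use A(3) cW in auto)
  ultimately have gen: "W.span A = carrier ?W"
    using A(4)[of "W.span A"] submodD(3)[of R "W.span A" V] unfolding cW by blast
  then have cA: "card A = d" using lower[of A] A(1-3) unfolding cW by simp
  have "W.dim = d"
    unfolding W.dim_def
  proof (rule Least_equality)
    show "\<exists>B. finite B \<and> card B = d \<and> B \<subseteq> carrier ?W \<and> W.gen_set B"
      using A(1,3) cA gen unfolding cW by blast
    fix y assume "\<exists>B. finite B \<and> card B = y \<and> B \<subseteq> carrier ?W \<and> W.gen_set B"
    then show "d \<le> y" using lower by blast
  qed
  then show ?thesis by (simp add: residue_dim_def)
qed

text \<open>The bridge to the definitions: Tor and Ext are literal quotient modules, and their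
  dimension over \<open>k\<close> is replaced here by a length of submodules of the original
  module.\<close>

lemma residue_dim_subquot:
  fixes M :: "('a, 'm) module"
  assumes B: "submod R M B" and Z: "submod R M Z" and "B \<subseteq> Z"
    and ann: "\<And>r z. r \<in> \<mm> \<Longrightarrow> z \<in> Z \<Longrightarrow> r \<odot>\<^bsub>M\<^esub> z \<in> B" and len: "mlength R M B Z = enat d"
  shows "residue_dim R \<mm> (subquot M Z B) = d"
proof -
  let ?N = "M\<lparr>carrier := Z\<rparr>"
  have N: "module R ?N" by (rule submod_restrict_module[OF Z])
  interpret N: module R ?N by (rule N)
  have BN: "submod R ?N B" using submod_restrict_iff[OF Z] B \<open>B \<subseteq> Z\<close> by blast
  have l: "mlength R (quot_module ?N B) {\<zero>\<^bsub>quot_module ?N B\<^esub>} (carrier (quot_module ?N B)) = enat d"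
    using quot_module_mlength[OF N BN] restrict_mlength[OF Z] len by simp
  have "r \<odot>\<^bsub>quot_module ?N B\<^esub> v = \<zero>\<^bsub>quot_module ?N B\<^esub>" if r: "r \<in> \<mm>" and v: "v \<in> carrier (quot_module ?N B)" for r v
  proof -
    obtain x where x: "x \<in> Z" "v = B +>\<^bsub>?N\<^esub> x" using v by (auto simp: quot_module_carrier)
    have "r \<odot>\<^bsub>quot_module ?N B\<^esub> v = B +>\<^bsub>?N\<^esub> (r \<odot>\<^bsub>M\<^esub> x)"
      using quot_module_coset(3)[OF N BN, of x r] x r by simp
    also have "\<dots> = B"
      by (rule abelian_subgroup.a_rcos_const[OF N.submod_abelian_subgroup[OF BN] ann[OF r x(1)]])
    finally show ?thesis by (simp add: quot_module_simps)
  qed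
  from residue_dim_eq_mlength[OF quot_module_module[OF N BN] this l]
  show ?thesis by (simp add: subquot_def)
qed

end

subsection \<open>The free module on a set\<close>

context cring
begin

lemma free_module_simps:
  "carrier (free_module R X) = {f \<in> X \<rightarrow>\<^sub>E carrier R. finite {x \<in> X. f x \<noteq> \<zero>}}"
  "f \<oplus>\<^bsub>free_module R X\<^esub> g = (\<lambda>x\<in>X. f x \<oplus> g x)"
  "\<zero>\<^bsub>free_module R X\<^esub> = (\<lambda>x\<in>X. \<zero>)"
  "r \<odot>\<^bsub>free_module R X\<^esub> f = (\<lambda>x\<in>X. r \<otimes> f x)"
  by (simp_all add: free_module_def func_space_def)

lemma free_module_submod: "submod R (func_space X) (carrier (free_module R X))"
proof (rule submodI[OF func_space_is_module])
  fix f g assume f: "f \<in> carrier (free_module R X)" and g: "g \<in> carrier (free_module R X)"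
  then have "finite ({x \<in> X. f x \<noteq> \<zero>} \<union> {x \<in> X. g x \<noteq> \<zero>})" by (simp add: free_module_simps)
  then have "finite {x \<in> X. f x \<oplus> g x \<noteq> \<zero>}" by (rule rev_finite_subset) auto
  then show "f \<oplus>\<^bsub>func_space X\<^esub> g \<in> carrier (free_module R X)"
    using f g by (auto simp: free_module_simps func_space_def cong: conj_cong)
next
  fix r f assume r: "r \<in> carrier R" and f: "f \<in> carrier (free_module R X)"
  then have "finite {x \<in> X. f x \<noteq> \<zero>}" by (simp add: free_module_simps)
  then have "finite {x \<in> X. r \<otimes> f x \<noteq> \<zero>}" by (rule rev_finite_subset) (use r in auto)
  then show "r \<odot>\<^bsub>func_space X\<^esub> f \<in> carrier (free_module R X)"
    using f r by (auto simp: free_module_simps func_space_def cong: conj_cong)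
qed (auto simp: free_module_simps func_space_def)

lemma free_module_module: "module R (free_module R X)"
proof -
  have "free_module R X = (func_space X)\<lparr>carrier := carrier (free_module R X)\<rparr>"
    by (simp add: free_module_def)
  then show ?thesis using submod_restrict_module[OF free_module_submod] by metis
qed

lemma free_gen_in_free_module: "p \<in> X \<Longrightarrow> free_gen R X p \<in> carrier (free_module R X)"
  by (auto simp: free_module_simps free_gen_def)

lemma free_module_induct:
  assumes C: "submod R (free_module R X) C" and basis: "\<And>p. p \<in> X \<Longrightarrow> free_gen R X p \<in> C"
  shows "C = carrier (free_module R X)"
proof
  show "C \<subseteq> carrier (free_module R X)" by (rule submodD(2)[OF C])
  interpret F: module R "free_module R X" by (rule free_module_module)
  have "\<forall>f\<in>carrier (free_module R X). {x \<in> X. f x \<noteq> \<zero>} \<subseteq> S \<longrightarrow> f \<in> C" if S: "finite S" for S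
    using S
  proof (induction S rule: finite_induct)
    case empty
    show ?case
    proof (intro ballI impI)
      fix f assume "f \<in> carrier (free_module R X)" "{x \<in> X. f x \<noteq> \<zero>} \<subseteq> {}"
      then have "f = \<zero>\<^bsub>free_module R X\<^esub>"
        by (auto simp: free_module_simps PiE_iff extensional_def fun_eq_iff)
      then show "f \<in> C" using submodD(3)[OF C] by simp
    qed
  next
    case (insert p S)
    show ?case
    proof (intro ballI impI)
      fix f assume f: "f \<in> carrier (free_module R X)" and supp: "{x \<in> X. f x \<noteq> \<zero>} \<subseteq> insert p S"
      show "f \<in> C"
      proof (cases "p \<in> X")
        case False
        then have "{x \<in> X. f x \<noteq> \<zero>} \<subseteq> S" using supp by blast
        then show ?thesis using insert.IH f by blast
      next
        case True
        let ?g = "\<lambda>x\<in>X. if x = p then \<zero> else f x"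
        have fc: "\<And>x. x \<in> X \<Longrightarrow> f x \<in> carrier R" using f by (auto simp: free_module_simps)
        have "{x \<in> X. ?g x \<noteq> \<zero>} \<subseteq> {x \<in> X. f x \<noteq> \<zero>}" by auto
        then have "finite {x \<in> X. ?g x \<noteq> \<zero>}"
          by (rule finite_subset) (use f in \<open>simp add: free_module_simps(1)\<close>)
        then have "?g \<in> carrier (free_module R X)" using fc by (auto simp: free_module_simps)
        moreover have "{x \<in> X. ?g x \<noteq> \<zero>} \<subseteq> S" using supp by auto
        ultimately have g: "?g \<in> C" using insert.IH by blast
        have eq: "f = ?g \<oplus>\<^bsub>free_module R X\<^esub> (f p \<odot>\<^bsub>free_module R X\<^esub> free_gen R X p)"
          using f fc True by (auto simp: free_module_simps free_gen_def fun_eq_iff PiE_iff extensional_def)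
        have "f p \<odot>\<^bsub>free_module R X\<^esub> free_gen R X p \<in> C"
          by (rule submodD(5)[OF C fc[OF True] basis[OF True]])
        then show ?thesis by (subst eq) (rule submodD(4)[OF C g])
      qed
    qed
  qed
  then show "carrier (free_module R X) \<subseteq> C" by (auto simp: free_module_simps(1))
qed

lemma free_module_hom:
  assumes P: "module R P" and u: "\<And>p. p \<in> X \<Longrightarrow> u p \<in> carrier P"
  obtains h where "h \<in> module_hom R (free_module R X) P" "\<And>p. p \<in> X \<Longrightarrow> h (free_gen R X p) = u p"
proof -
  interpret P: module R P by fact
  define h where "h f = (\<Oplus>\<^bsub>P\<^esub>p\<in>{x \<in> X. f x \<noteq> \<zero>}. f p \<odot>\<^bsub>P\<^esub> u p)" for f
  \<comment> \<open>The sum over the support may run over any larger finite set; additivity of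
    \<open>h\<close> compares two functions on the union of their supports.\<close>
  have sum: "h f = (\<Oplus>\<^bsub>P\<^esub>p\<in>S. f p \<odot>\<^bsub>P\<^esub> u p)"
    if f: "\<And>x. x \<in> X \<Longrightarrow> f x \<in> carrier R" and S: "finite S" "S \<subseteq> X" "{x \<in> X. f x \<noteq> \<zero>} \<subseteq> S" for f S
    unfolding h_def
  proof (rule P.M.add.finprod_mono_neutral_cong_left[OF S(1,3)])
    show "i \<in> S - {x \<in> X. f x \<noteq> \<zero>} \<Longrightarrow> f i \<odot>\<^bsub>P\<^esub> u i = \<zero>\<^bsub>P\<^esub>" for i
      using S(2) u[of i] by auto
    show "(\<lambda>p. f p \<odot>\<^bsub>P\<^esub> u p) \<in> S \<rightarrow> carrier P" using S(2) f u by blast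
  qed simp
  have c: "x \<in> X \<Longrightarrow> f x \<in> carrier R" "finite {x \<in> X. f x \<noteq> \<zero>}" if "f \<in> carrier (free_module R X)" for f x
    using that by (auto simp: free_module_simps)
  have hom: "h \<in> module_hom R (free_module R X) P"
    unfolding module_hom_def
  proof (intro CollectI conjI allI impI)
    show "h \<in> carrier (free_module R X) \<rightarrow> carrier P"
      unfolding h_def using u c(1) by (auto intro!: P.M.finsum_closed)
  next
    fix f g assume fg: "f \<in> carrier (free_module R X) \<and> g \<in> carrier (free_module R X)"
    let ?S = "{x \<in> X. f x \<noteq> \<zero>} \<union> {x \<in> X. g x \<noteq> \<zero>}"
    have S: "finite ?S" "?S \<subseteq> X" using fg c(2) by auto
    have fc: "\<And>x. x \<in> X \<Longrightarrow> f x \<in> carrier R" "\<And>x. x \<in> X \<Longrightarrow> g x \<in> carrier R" using fg c(1) by blast+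
    have "h (f \<oplus>\<^bsub>free_module R X\<^esub> g) = (\<Oplus>\<^bsub>P\<^esub>p\<in>?S. (f \<oplus>\<^bsub>free_module R X\<^esub> g) p \<odot>\<^bsub>P\<^esub> u p)"
      by (rule sum[OF _ S]) (use fc in \<open>auto simp: free_module_simps\<close>)
    also have "\<dots> = (\<Oplus>\<^bsub>P\<^esub>p\<in>?S. f p \<odot>\<^bsub>P\<^esub> u p \<oplus>\<^bsub>P\<^esub> g p \<odot>\<^bsub>P\<^esub> u p)"
      using fc u by (intro P.M.finsum_cong') (auto simp: free_module_simps P.smult_l_distr)
    also have "\<dots> = (\<Oplus>\<^bsub>P\<^esub>p\<in>?S. f p \<odot>\<^bsub>P\<^esub> u p) \<oplus>\<^bsub>P\<^esub> (\<Oplus>\<^bsub>P\<^esub>p\<in>?S. g p \<odot>\<^bsub>P\<^esub> u p)"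
      using fc u by (intro P.M.finsum_addf) auto
    also have "\<dots> = h f \<oplus>\<^bsub>P\<^esub> h g"
      using sum[OF fc(1) S] sum[OF fc(2) S] by auto
    finally show "h (f \<oplus>\<^bsub>free_module R X\<^esub> g) = h f \<oplus>\<^bsub>P\<^esub> h g" .
  next
    fix r f assume rf: "r \<in> carrier R \<and> f \<in> carrier (free_module R X)"
    let ?S = "{x \<in> X. f x \<noteq> \<zero>}"
    have S: "finite ?S" "?S \<subseteq> X" using rf c(2) by auto
    have fc: "\<And>x. x \<in> X \<Longrightarrow> f x \<in> carrier R" using rf c(1) by blast
    have "h (r \<odot>\<^bsub>free_module R X\<^esub> f) = (\<Oplus>\<^bsub>P\<^esub>p\<in>?S. (r \<odot>\<^bsub>free_module R X\<^esub> f) p \<odot>\<^bsub>P\<^esub> u p)"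
      by (rule sum[OF _ S]) (use rf fc in \<open>auto simp: free_module_simps\<close>)
    also have "\<dots> = (\<Oplus>\<^bsub>P\<^esub>p\<in>?S. r \<odot>\<^bsub>P\<^esub> (f p \<odot>\<^bsub>P\<^esub> u p))"
      using rf fc u by (intro P.M.finsum_cong') (auto simp: free_module_simps P.smult_assoc1)
    also have "\<dots> = r \<odot>\<^bsub>P\<^esub> h f"
      unfolding h_def using rf fc u S by (intro P.finsum_smult_ldistr[symmetric]) auto
    finally show "h (r \<odot>\<^bsub>free_module R X\<^esub> f) = r \<odot>\<^bsub>P\<^esub> h f" .
  qed
  have "h (free_gen R X p) = u p" if p: "p \<in> X" for p
  proof -
    have "h (free_gen R X p) = (\<Oplus>\<^bsub>P\<^esub>q\<in>{p}. free_gen R X p q \<odot>\<^bsub>P\<^esub> u q)"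
      by (rule sum) (use p in \<open>auto simp: free_gen_def\<close>)
    also have "\<dots> = u p" using p u[OF p] by (simp add: free_gen_def)
    finally show ?thesis .
  qed
  with hom show thesis by (rule that)
qed

end

subsection \<open>Tensor products with the residue field\<close>

lemma (in cring) tensor_structure:
  assumes N: "module R N" and P: "module R P"
  defines "X \<equiv> carrier N \<times> carrier P"
  shows "submod R (free_module R X) (module.span R (free_module R X) (tensor_rels R N P))"
    "tensor_rels R N P \<subseteq> module.span R (free_module R X) (tensor_rels R N P)"
    "tensor_rels R N P \<subseteq> carrier (free_module R X)"
proof -
  interpret N: module R N by fact
  interpret P: module R P by fact
  interpret F: module R "free_module R X" by (rule free_module_module)
  have d: "\<And>a b. a \<in> carrier N \<Longrightarrow> b \<in> carrier P \<Longrightarrow> free_gen R X (a, b) \<in> carrier (free_module R X)"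
    by (rule free_gen_in_free_module) (simp add: X_def)
  show r: "tensor_rels R N P \<subseteq> carrier (free_module R X)"
    unfolding tensor_rels_def Let_def X_def[symmetric] by (auto simp: d)
  show "submod R (free_module R X) (F.span (tensor_rels R N P))" by (rule F.span_is_submodule[OF r])
  show "tensor_rels R N P \<subseteq> F.span (tensor_rels R N P)" by (rule F.in_own_span[OF r])
qed

lemma (in cring) tensor_module:
  assumes "module R N" "module R P"
  shows "module R (tensor R N P)"
  unfolding tensor_def Let_def by (rule quot_module_module[OF free_module_module tensor_structure(1)[OF assms]])

lemma (in cring) pure_tensor_carrier:
  assumes N: "module R N" and P: "module R P" and "x \<in> carrier N" "y \<in> carrier P"
  shows "pure_tensor R N P x y \<in> carrier (tensor R N P)"
  unfolding tensor_def pure_tensor_def Let_def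
  by (rule quot_module_coset(1)[OF free_module_module tensor_structure(1)[OF N P]])
    (use assms in \<open>auto intro: free_gen_in_free_module\<close>)

lemma (in cring) pure_tensor_eqI:
  assumes N: "module R N" and P: "module R P" and "p \<in> carrier (free_module R (carrier N \<times> carrier P))"
    "q \<in> carrier (free_module R (carrier N \<times> carrier P))"
    "p \<ominus>\<^bsub>free_module R (carrier N \<times> carrier P)\<^esub> q \<in> tensor_rels R N P"
  defines "F \<equiv> free_module R (carrier N \<times> carrier P)"
  shows "module.span R F (tensor_rels R N P) +>\<^bsub>F\<^esub> p = module.span R F (tensor_rels R N P) +>\<^bsub>F\<^esub> q"
  using module.coset_eq_iff[OF free_module_module tensor_structure(1)[OF N P] assms(3,4)]
    tensor_structure(2)[OF N P] assms(5) unfolding F_def by blast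

lemma (in cring) pure_tensor_linear:
  assumes N: "module R N" and P: "module R P" and x: "x \<in> carrier N" and y: "y \<in> carrier P"
  shows "y' \<in> carrier P \<Longrightarrow> pure_tensor R N P x (y \<oplus>\<^bsub>P\<^esub> y') =
      pure_tensor R N P x y \<oplus>\<^bsub>tensor R N P\<^esub> pure_tensor R N P x y'"
    "r \<in> carrier R \<Longrightarrow> pure_tensor R N P x (r \<odot>\<^bsub>P\<^esub> y) = r \<odot>\<^bsub>tensor R N P\<^esub> pure_tensor R N P x y"
    "r \<in> carrier R \<Longrightarrow> pure_tensor R N P (r \<odot>\<^bsub>N\<^esub> x) y = r \<odot>\<^bsub>tensor R N P\<^esub> pure_tensor R N P x y"
proof -
  interpret N: module R N by fact
  interpret P: module R P by fact
  let ?X = "carrier N \<times> carrier P"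
  let ?F = "free_module R ?X"
  interpret F: module R ?F by (rule free_module_module)
  let ?d = "free_gen R ?X"
  have d: "\<And>a b. a \<in> carrier N \<Longrightarrow> b \<in> carrier P \<Longrightarrow> ?d (a, b) \<in> carrier ?F"
    by (rule free_gen_in_free_module) simp
  note q = quot_module_coset[OF free_module_module tensor_structure(1)[OF N P]]
  {
    assume y': "y' \<in> carrier P"
    have "?d (x, y \<oplus>\<^bsub>P\<^esub> y') \<ominus>\<^bsub>?F\<^esub> (?d (x, y) \<oplus>\<^bsub>?F\<^esub> ?d (x, y')) \<in> tensor_rels R N P"
      unfolding tensor_rels_def Let_def using x y y' by blast
    from pure_tensor_eqI[OF N P _ _ this]
    show "pure_tensor R N P x (y \<oplus>\<^bsub>P\<^esub> y') =
      pure_tensor R N P x y \<oplus>\<^bsub>tensor R N P\<^esub> pure_tensor R N P x y'"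
      unfolding tensor_def pure_tensor_def Let_def using d x y y' q(2)[of "?d (x, y)" "?d (x, y')"] by simp
  next
    assume r: "r \<in> carrier R"
    have "?d (x, r \<odot>\<^bsub>P\<^esub> y) \<ominus>\<^bsub>?F\<^esub> (r \<odot>\<^bsub>?F\<^esub> ?d (x, y)) \<in> tensor_rels R N P"
      unfolding tensor_rels_def Let_def using x y r by blast
    from pure_tensor_eqI[OF N P _ _ this]
    show "pure_tensor R N P x (r \<odot>\<^bsub>P\<^esub> y) = r \<odot>\<^bsub>tensor R N P\<^esub> pure_tensor R N P x y"
      unfolding tensor_def pure_tensor_def Let_def using d x y r q(3)[of "?d (x, y)" r] by simp
    have "?d (r \<odot>\<^bsub>N\<^esub> x, y) \<ominus>\<^bsub>?F\<^esub> (r \<odot>\<^bsub>?F\<^esub> ?d (x, y)) \<in> tensor_rels R N P"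
      unfolding tensor_rels_def Let_def using x y r by blast
    from pure_tensor_eqI[OF N P _ _ this]
    show "pure_tensor R N P (r \<odot>\<^bsub>N\<^esub> x) y = r \<odot>\<^bsub>tensor R N P\<^esub> pure_tensor R N P x y"
      unfolding tensor_def pure_tensor_def Let_def using d x y r q(3)[of "?d (x, y)" r] by simp
  }
qed

lemma (in cring) tensor_induct:
  assumes N: "module R N" and P: "module R P" and C: "submod R (tensor R N P) C"
    and pure: "\<And>x y. x \<in> carrier N \<Longrightarrow> y \<in> carrier P \<Longrightarrow> pure_tensor R N P x y \<in> C"
  shows "C = carrier (tensor R N P)"
proof
  show "C \<subseteq> carrier (tensor R N P)" by (rule submodD(2)[OF C])
  let ?X = "carrier N \<times> carrier P"
  let ?F = "free_module R ?X"
  let ?S = "module.span R ?F (tensor_rels R N P)"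
  have t: "tensor R N P = quot_module ?F ?S" by (simp add: tensor_def Let_def)
  let ?\<pi> = "\<lambda>z. ?S +>\<^bsub>?F\<^esub> z"
  have \<pi>: "?\<pi> \<in> module_hom R ?F (tensor R N P)"
    unfolding t by (rule quot_map_hom[OF free_module_module tensor_structure(1)[OF N P]])
  have "{z \<in> carrier ?F. ?\<pi> z \<in> C} = carrier ?F"
  proof (rule free_module_induct[OF hom_preimage_submod[OF free_module_module tensor_module[OF N P] \<pi> C]])
    fix p assume "p \<in> ?X"
    then show "free_gen R ?X p \<in> {z \<in> carrier ?F. ?\<pi> z \<in> C}"
      using pure[of "fst p" "snd p"] free_gen_in_free_module[of p ?X]
      by (auto simp: pure_tensor_def Let_def)
  qed
  then show "carrier (tensor R N P) \<subseteq> C" unfolding t quot_module_carrier by blast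
qed

context noetherian_local_ring
begin

lemma \<mm>_ideal: "ideal \<mm> R"
  by (rule is_ideal)

lemma \<mm>_submod: "submod R (ring_module R) \<mm>"
  by (rule ideal_submod[OF \<mm>_ideal])

lemma residue_module_module: "module R (residue_module R \<mm>)"
  unfolding residue_module_def by (rule quot_module_module[OF module_ring_module \<mm>_submod])

definition residue_class :: "'a \<Rightarrow> 'a set" where
  "residue_class r = \<mm> +>\<^bsub>ring_module R\<^esub> r"

lemma residue_class_facts:
  "residue_class \<in> module_hom R (ring_module R) (residue_module R \<mm>)"
  "carrier (residue_module R \<mm>) = residue_class ` carrier R"
  "r \<in> carrier R \<Longrightarrow> residue_class r = \<zero>\<^bsub>residue_module R \<mm>\<^esub> \<longleftrightarrow> r \<in> \<mm>"
  "r \<in> carrier R \<Longrightarrow> r \<odot>\<^bsub>residue_module R \<mm>\<^esub> residue_class \<one> = residue_class r"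
proof -
  show h: "residue_class \<in> module_hom R (ring_module R) (residue_module R \<mm>)"
    unfolding residue_module_def residue_class_def by (rule quot_map_hom[OF module_ring_module \<mm>_submod])
  show "carrier (residue_module R \<mm>) = residue_class ` carrier R"
    by (auto simp: residue_module_def residue_class_def quot_module_carrier)
  assume r: "r \<in> carrier R"
  have "residue_class r = residue_class \<zero> \<longleftrightarrow> r \<in> \<mm>"
    unfolding residue_class_def
    using module.coset_eq_iff[OF module_ring_module \<mm>_submod, of r \<zero>] r by (simp add: a_minus_def)
  then show "residue_class r = \<zero>\<^bsub>residue_module R \<mm>\<^esub> \<longleftrightarrow> r \<in> \<mm>"
    using hom_zero[OF module_ring_module residue_module_module h] by simp
  show "r \<odot>\<^bsub>residue_module R \<mm>\<^esub> residue_class \<one> = residue_class r"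
    using module_hom_smult[OF h, of r \<one>] r by simp
qed

text \<open>\<open>f \<mapsto> 1 \<otimes> f\<close> identifies \<open>k \<otimes> P\<close> with \<open>P/\<mm>P\<close>.\<close>

definition tensor_one :: "('a, 'p) module \<Rightarrow> 'p \<Rightarrow> ('a set \<times> 'p \<Rightarrow> 'a) set" where
  "tensor_one P f = pure_tensor R (residue_module R \<mm>) P (residue_class \<one>) f"

lemma tensor_one_hom:
  assumes P: "module R P"
  shows "tensor_one P \<in> module_hom R P (tensor R (residue_module R \<mm>) P)"
proof -
  have c: "residue_class \<one> \<in> carrier (residue_module R \<mm>)" using residue_class_facts(2) by simp
  show ?thesis
    unfolding tensor_one_def module_hom_def
    using pure_tensor_carrier[OF residue_module_module P c] pure_tensor_linear(1,2)[OF residue_module_module P c]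
    by auto
qed

lemma pure_tensor_residue:
  assumes P: "module R P" and "r \<in> carrier R" "y \<in> carrier P"
  shows "pure_tensor R (residue_module R \<mm>) P (residue_class r) y = tensor_one P (r \<odot>\<^bsub>P\<^esub> y)"
proof -
  have c: "residue_class \<one> \<in> carrier (residue_module R \<mm>)" using residue_class_facts(2) by simp
  show ?thesis
    using pure_tensor_linear(2,3)[OF residue_module_module P c assms(3,2)] residue_class_facts(4)[OF assms(2)]
    by (simp add: tensor_one_def)
qed

lemma tensor_one_surj:
  assumes P: "module R P"
  shows "tensor_one P ` carrier P = carrier (tensor R (residue_module R \<mm>) P)"
proof (rule tensor_induct[OF residue_module_module P])
  interpret P: module R P by fact
  show "submod R (tensor R (residue_module R \<mm>) P) (tensor_one P ` carrier P)"
    by (rule hom_image_submod[OF P tensor_module[OF residue_module_module P] tensor_one_hom[OF P] P.submod_carrier])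
  fix x y assume "x \<in> carrier (residue_module R \<mm>)" and y: "y \<in> carrier P"
  then obtain r where r: "r \<in> carrier R" "x = residue_class r" using residue_class_facts(2) by blast
  show "pure_tensor R (residue_module R \<mm>) P x y \<in> tensor_one P ` carrier P"
    unfolding r(2) pure_tensor_residue[OF P r(1) y] using P.smult_closed[OF r(1) y] by blast
qed

text \<open>That \<open>\<mm>P\<close> dies follows from
  \<open>1 \<otimes> rz = r1 \<otimes> z\<close>. Conversely, the free module on pairs is mapped to
  \<open>P\<close> by \<open>(x, y) \<mapsto> \<sigma> x \<odot> y\<close> with representatives
  \<sigma> of residue classes; every tensor relation lands in \<open>\<mm>P\<close>, so a vanishing
  tensor forces its value into \<open>\<mm>P\<close>.\<close>

lemma tensor_one_kernel:
  assumes P: "module R P" and f: "f \<in> carrier P"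
  shows "tensor_one P f = \<zero>\<^bsub>tensor R (residue_module R \<mm>) P\<^esub> \<longleftrightarrow> f \<in> module.ideal_smult R P \<mm> (carrier P)"
proof
  interpret P: module R P by fact
  let ?k = "residue_module R \<mm>"
  let ?T = "tensor R ?k P"
  interpret T: module R ?T by (rule tensor_module[OF residue_module_module P])
  interpret k: module R ?k by (rule residue_module_module)
  note hom = tensor_one_hom[OF P]
  let ?mP = "P.ideal_smult \<mm> (carrier P)"
  have mP: "submod R P ?mP" by (rule P.ideal_smult_submod[OF \<mm>_subset]) simp
  {
    assume fm: "f \<in> ?mP"
    have "?mP \<subseteq> ker_on (tensor_one P) P ?T"
    proof (rule P.ideal_smult_least[OF hom_ker_submod[OF P T.module_axioms hom]])
      fix r z assume r: "r \<in> \<mm>" and z: "z \<in> carrier P"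
      have k0: "residue_class r = \<zero> \<odot>\<^bsub>?k\<^esub> residue_class \<one>"
        using residue_class_facts(2) residue_class_facts(3)[of r] r k.smult_l_null by auto
      have c: "residue_class \<one> \<in> carrier ?k" using residue_class_facts(2) by simp
      have "tensor_one P (r \<odot>\<^bsub>P\<^esub> z) = pure_tensor R ?k P (residue_class r) z"
        using pure_tensor_residue[OF P _ z] r by simp
      also have "\<dots> = \<zero> \<odot>\<^bsub>?T\<^esub> pure_tensor R ?k P (residue_class \<one>) z"
        unfolding k0 by (rule pure_tensor_linear(3)[OF residue_module_module P c z]) simp
      also have "\<dots> = \<zero>\<^bsub>?T\<^esub>" by (rule T.smult_l_null[OF pure_tensor_carrier[OF residue_module_module P c z]])
      finally show "r \<odot>\<^bsub>P\<^esub> z \<in> ker_on (tensor_one P) P ?T" using r z by (simp add: ker_on_def)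
    qed
    then show "tensor_one P f = \<zero>\<^bsub>?T\<^esub>" using fm by (auto simp: ker_on_def)
  }
  assume f0: "tensor_one P f = \<zero>\<^bsub>?T\<^esub>"
  let ?X = "carrier ?k \<times> carrier P"
  let ?F = "free_module R ?X"
  interpret F: module R ?F by (rule free_module_module)
  let ?S = "F.span (tensor_rels R ?k P)"
  have rep_ex: "\<exists>r. r \<in> carrier R \<and> residue_class r = x" if x: "x \<in> carrier ?k" for x
    using x residue_class_facts(2) by auto
  \<comment> \<open>This section is a mere choice of representatives, not additive; its defects lie
    in \<open>\<mm>\<close> and disappear modulo \<open>\<mm>P\<close>.\<close>
  define \<sigma> where "\<sigma> x = (SOME r. r \<in> carrier R \<and> residue_class r = x)" for x
  have \<sigma>: "\<sigma> x \<in> carrier R" "residue_class (\<sigma> x) = x" if x: "x \<in> carrier ?k" for x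
    using someI_ex[OF rep_ex[OF x]] by (auto simp: \<sigma>_def)
  have class_eq: "r \<ominus> s \<in> \<mm>" if "r \<in> carrier R" "s \<in> carrier R" "residue_class r = residue_class s" for r s
    using that module.coset_eq_iff[OF module_ring_module \<mm>_submod, of r s] by (simp add: residue_class_def)
  have "\<And>p. p \<in> ?X \<Longrightarrow> \<sigma> (fst p) \<odot>\<^bsub>P\<^esub> snd p \<in> carrier P" using \<sigma>(1) by auto
  then obtain h where h: "h \<in> module_hom R ?F P"
    and hg: "\<And>p. p \<in> ?X \<Longrightarrow> h (free_gen R ?X p) = \<sigma> (fst p) \<odot>\<^bsub>P\<^esub> snd p"
    using free_module_hom[OF P, of ?X "\<lambda>p. \<sigma> (fst p) \<odot>\<^bsub>P\<^esub> snd p"] by blast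
  have hg': "h (free_gen R ?X (x, y)) = \<sigma> x \<odot>\<^bsub>P\<^esub> y" if "x \<in> carrier ?k" "y \<in> carrier P" for x y
    using hg[of "(x, y)"] that by simp
  have gc: "free_gen R ?X (x, y) \<in> carrier ?F" if "x \<in> carrier ?k" "y \<in> carrier P" for x y
    by (rule free_gen_in_free_module) (use that in simp)
  have mem: "(r \<ominus> s) \<odot>\<^bsub>P\<^esub> y \<in> ?mP" if "r \<in> carrier R" "s \<in> carrier R" "residue_class r = residue_class s" "y \<in> carrier P" for r s y
    by (rule P.ideal_smult_mem[OF \<mm>_subset subset_refl class_eq[OF that(1-3)] that(4)])
  let ?C = "{z \<in> carrier ?F. h z \<in> ?mP}"
  have C: "submod R ?F ?C" by (rule hom_preimage_submod[OF free_module_module P h mP])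
  note hm = hom_minus[OF free_module_module P h]
  note ha = module_hom_add[OF h]
  note hs = module_hom_smult[OF h]
  have rc: "residue_class \<in> module_hom R (ring_module R) ?k" by (rule residue_class_facts(1))
  have rels: "tensor_rels R ?k P \<subseteq> ?C"
  proof
    fix z assume z: "z \<in> tensor_rels R ?k P"
    then have zc: "z \<in> carrier ?F" using tensor_structure(3)[OF residue_module_module P] by blast
    have "h z \<in> ?mP"
      using z unfolding tensor_rels_def Let_def
    proof (elim UnE CollectE exE conjE)
      fix x x' y assume a: "z = free_gen R ?X (x \<oplus>\<^bsub>?k\<^esub> x', y) \<ominus>\<^bsub>?F\<^esub>
          (free_gen R ?X (x, y) \<oplus>\<^bsub>?F\<^esub> free_gen R ?X (x', y))" "x \<in> carrier ?k" "x' \<in> carrier ?k" "y \<in> carrier P"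
      have "h z = \<sigma> (x \<oplus>\<^bsub>?k\<^esub> x') \<odot>\<^bsub>P\<^esub> y \<ominus>\<^bsub>P\<^esub> (\<sigma> x \<odot>\<^bsub>P\<^esub> y \<oplus>\<^bsub>P\<^esub> \<sigma> x' \<odot>\<^bsub>P\<^esub> y)"
        unfolding a(1) using a(2-4) by (simp add: hm ha hg' gc)
      also have "\<dots> = (\<sigma> (x \<oplus>\<^bsub>?k\<^esub> x') \<ominus> (\<sigma> x \<oplus> \<sigma> x')) \<odot>\<^bsub>P\<^esub> y"
        using a(2-4) \<sigma>(1) by (simp add: P.smult_minus_left P.smult_l_distr)
      also have "\<dots> \<in> ?mP"
      proof (rule mem)
        show "residue_class (\<sigma> (x \<oplus>\<^bsub>?k\<^esub> x')) = residue_class (\<sigma> x \<oplus> \<sigma> x')"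
          using module_hom_add[OF rc, of "\<sigma> x" "\<sigma> x'"] a(2,3) \<sigma> by simp
      qed (use a \<sigma>(1) in auto)
      finally show ?thesis .
    next
      fix x y y' assume a: "z = free_gen R ?X (x, y \<oplus>\<^bsub>P\<^esub> y') \<ominus>\<^bsub>?F\<^esub>
          (free_gen R ?X (x, y) \<oplus>\<^bsub>?F\<^esub> free_gen R ?X (x, y'))" "x \<in> carrier ?k" "y \<in> carrier P" "y' \<in> carrier P"
      have "h z = \<sigma> x \<odot>\<^bsub>P\<^esub> (y \<oplus>\<^bsub>P\<^esub> y') \<ominus>\<^bsub>P\<^esub> (\<sigma> x \<odot>\<^bsub>P\<^esub> y \<oplus>\<^bsub>P\<^esub> \<sigma> x \<odot>\<^bsub>P\<^esub> y')"
        unfolding a(1) using a(2-4) by (simp add: hm ha hg' gc)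
      also have "\<dots> = \<zero>\<^bsub>P\<^esub>" using a(2-4) \<sigma>(1) by (simp add: P.smult_r_distr)
      finally show ?thesis using submodD(3)[OF mP] by simp
    next
      fix r x y assume a: "z = free_gen R ?X (r \<odot>\<^bsub>?k\<^esub> x, y) \<ominus>\<^bsub>?F\<^esub> r \<odot>\<^bsub>?F\<^esub> free_gen R ?X (x, y)"
        "r \<in> carrier R" "x \<in> carrier ?k" "y \<in> carrier P"
      have "h z = \<sigma> (r \<odot>\<^bsub>?k\<^esub> x) \<odot>\<^bsub>P\<^esub> y \<ominus>\<^bsub>P\<^esub> r \<odot>\<^bsub>P\<^esub> (\<sigma> x \<odot>\<^bsub>P\<^esub> y)"
        unfolding a(1) using a(2-4) by (simp add: hm hs hg' gc)
      also have "\<dots> = (\<sigma> (r \<odot>\<^bsub>?k\<^esub> x) \<ominus> (r \<otimes> \<sigma> x)) \<odot>\<^bsub>P\<^esub> y"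
        using a(2-4) \<sigma>(1) by (simp add: P.smult_minus_left P.smult_assoc1)
      also have "\<dots> \<in> ?mP"
      proof (rule mem)
        show "residue_class (\<sigma> (r \<odot>\<^bsub>?k\<^esub> x)) = residue_class (r \<otimes> \<sigma> x)"
          using module_hom_smult[OF rc, of r "\<sigma> x"] a(2,3) \<sigma> by simp
      qed (use a \<sigma>(1) in auto)
      finally show ?thesis .
    next
      fix r x y assume a: "z = free_gen R ?X (x, r \<odot>\<^bsub>P\<^esub> y) \<ominus>\<^bsub>?F\<^esub> r \<odot>\<^bsub>?F\<^esub> free_gen R ?X (x, y)"
        "r \<in> carrier R" "x \<in> carrier ?k" "y \<in> carrier P"
      have "h z = \<sigma> x \<odot>\<^bsub>P\<^esub> (r \<odot>\<^bsub>P\<^esub> y) \<ominus>\<^bsub>P\<^esub> r \<odot>\<^bsub>P\<^esub> (\<sigma> x \<odot>\<^bsub>P\<^esub> y)"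
        unfolding a(1) using a(2-4) by (simp add: hm hs hg' gc)
      also have "\<dots> = \<zero>\<^bsub>P\<^esub>" using a(2-4) \<sigma>(1) P.smult_commute[of "\<sigma> x" r y] by simp
      finally show ?thesis using submodD(3)[OF mP] by simp
    qed
    then show "z \<in> ?C" using zc by simp
  qed
  have SC: "?S \<subseteq> ?C" by (rule F.span_in_submod[OF C rels])
  have c: "residue_class \<one> \<in> carrier ?k" using residue_class_facts(2) by simp
  note S = tensor_structure(1)[OF residue_module_module P]
  have "?S +>\<^bsub>?F\<^esub> free_gen R ?X (residue_class \<one>, f) = ?S"
    using f0 by (simp add: tensor_one_def pure_tensor_def tensor_def Let_def quot_module_simps)
  then have "free_gen R ?X (residue_class \<one>, f) \<in> ?S"
    using F.coset_eq_iff[OF S gc[OF c f] F.M.zero_closed] F.coset_zero[OF S] gc[OF c f] by simp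
  then have hf: "\<sigma> (residue_class \<one>) \<odot>\<^bsub>P\<^esub> f \<in> ?mP" using SC hg'[OF c f] by auto
  \<comment> \<open>The chosen representative of the class of 1 need not be 1, only congruent to it
    modulo \<open>\<mm>\<close>.\<close>
  have "(\<one> \<ominus> \<sigma> (residue_class \<one>)) \<odot>\<^bsub>P\<^esub> f \<in> ?mP" by (rule mem) (use \<sigma>[OF c] f in auto)
  then have "(\<one> \<ominus> \<sigma> (residue_class \<one>)) \<odot>\<^bsub>P\<^esub> f \<oplus>\<^bsub>P\<^esub> \<sigma> (residue_class \<one>) \<odot>\<^bsub>P\<^esub> f \<in> ?mP"
    using submodD(4)[OF mP] hf by blast
  moreover have "(\<one> \<ominus> \<sigma> (residue_class \<one>)) \<odot>\<^bsub>P\<^esub> f \<oplus>\<^bsub>P\<^esub> \<sigma> (residue_class \<one>) \<odot>\<^bsub>P\<^esub> f = f"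
    using \<sigma>(1)[OF c] f by (simp add: P.smult_minus_left)
  ultimately show "f \<in> ?mP" by simp
qed

text \<open>\<open>tensor_map\<close> is a choice among homomorphisms with the right values on pure
  tensors, so one such homomorphism must be produced. It sends \<open>1 \<otimes> u\<close> to
  \<open>1 \<otimes> f u\<close>, which is well defined because \<open>f\<close> maps
  \<open>\<mm>P\<close> into \<open>\<mm>Q\<close>.\<close>

lemma tensor_map_residue:
  assumes P: "module R P" and Q: "module R Q" and f: "f \<in> module_hom R P Q"
  defines "\<Delta> \<equiv> tensor_map R (residue_module R \<mm>) P Q f"
  shows "\<Delta> \<in> module_hom R (tensor R (residue_module R \<mm>) P) (tensor R (residue_module R \<mm>) Q)"
    "u \<in> carrier P \<Longrightarrow> \<Delta> (tensor_one P u) = tensor_one Q (f u)"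
proof -
  let ?k = "residue_module R \<mm>"
  interpret P: module R P by fact
  interpret Q: module R Q by fact
  interpret TP: module R "tensor R ?k P" by (rule tensor_module[OF residue_module_module P])
  interpret TQ: module R "tensor R ?k Q" by (rule tensor_module[OF residue_module_module Q])
  note hP = tensor_one_hom[OF P] and hQ = tensor_one_hom[OF Q]
  have fc: "f u \<in> carrier Q" if "u \<in> carrier P" for u using hom_in_carrier[OF f that] .
  have ker: "tensor_one Q (f u) = tensor_one Q (f v)"
    if uv: "u \<in> carrier P" "v \<in> carrier P" "tensor_one P u = tensor_one P v" for u v
  proof -
    have "tensor_one P (u \<ominus>\<^bsub>P\<^esub> v) = \<zero>\<^bsub>tensor R ?k P\<^esub>"
      using hom_minus[OF P TP.module_axioms hP uv(1,2)] uv hom_in_carrier[OF hP] by simp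
    then have 1: "u \<ominus>\<^bsub>P\<^esub> v \<in> P.ideal_smult \<mm> (carrier P)"
      using tensor_one_kernel[OF P, of "u \<ominus>\<^bsub>P\<^esub> v"] uv by simp
    have mQ: "submod R Q (Q.ideal_smult \<mm> (carrier Q))" by (rule Q.ideal_smult_submod[OF \<mm>_subset]) simp
    have "P.ideal_smult \<mm> (carrier P) \<subseteq> {x \<in> carrier P. f x \<in> Q.ideal_smult \<mm> (carrier Q)}"
    proof (rule P.ideal_smult_least[OF hom_preimage_submod[OF P Q f mQ]])
      fix r z assume rz: "r \<in> \<mm>" "z \<in> carrier P"
      then have "f (r \<odot>\<^bsub>P\<^esub> z) = r \<odot>\<^bsub>Q\<^esub> f z" using module_hom_smult[OF f] by simp
      then show "r \<odot>\<^bsub>P\<^esub> z \<in> {x \<in> carrier P. f x \<in> Q.ideal_smult \<mm> (carrier Q)}"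
        using Q.ideal_smult_mem[OF \<mm>_subset subset_refl rz(1) fc[OF rz(2)]] rz by simp
    qed
    then have "f (u \<ominus>\<^bsub>P\<^esub> v) \<in> Q.ideal_smult \<mm> (carrier Q)" using 1 by blast
    then have "tensor_one Q (f (u \<ominus>\<^bsub>P\<^esub> v)) = \<zero>\<^bsub>tensor R ?k Q\<^esub>"
      using tensor_one_kernel[OF Q, of "f (u \<ominus>\<^bsub>P\<^esub> v)"] fc[of "u \<ominus>\<^bsub>P\<^esub> v"] uv by simp
    then have "tensor_one Q (f u) \<ominus>\<^bsub>tensor R ?k Q\<^esub> tensor_one Q (f v) = \<zero>\<^bsub>tensor R ?k Q\<^esub>"
      using hom_minus[OF P Q f uv(1,2)] hom_minus[OF Q TQ.module_axioms hQ fc[OF uv(1)] fc[OF uv(2)]] by simp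
    then show ?thesis using hom_in_carrier[OF hQ fc[OF uv(1)]] hom_in_carrier[OF hQ fc[OF uv(2)]] by simp
  qed
  define g where "g t = tensor_one Q (f (SOME u. u \<in> carrier P \<and> tensor_one P u = t))" for t
  have g: "g (tensor_one P u) = tensor_one Q (f u)" if u: "u \<in> carrier P" for u
  proof -
    let ?v = "SOME v. v \<in> carrier P \<and> tensor_one P v = tensor_one P u"
    have "?v \<in> carrier P \<and> tensor_one P ?v = tensor_one P u"
      by (rule someI[of "\<lambda>v. v \<in> carrier P \<and> tensor_one P v = tensor_one P u" u]) (simp add: u)
    then show ?thesis unfolding g_def using ker[of ?v u] u by blast
  qed
  have ex: "\<exists>u\<in>carrier P. t = tensor_one P u" if t: "t \<in> carrier (tensor R ?k P)" for t
    using t tensor_one_surj[OF P] by blast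
  have gh: "g \<in> module_hom R (tensor R ?k P) (tensor R ?k Q)"
    unfolding module_hom_def
  proof (intro CollectI conjI allI impI)
    show "g \<in> carrier (tensor R ?k P) \<rightarrow> carrier (tensor R ?k Q)"
      using ex g fc hom_in_carrier[OF hQ] by fastforce
  next
    fix s t assume "s \<in> carrier (tensor R ?k P) \<and> t \<in> carrier (tensor R ?k P)"
    then obtain u v where u: "u \<in> carrier P" "s = tensor_one P u" and v: "v \<in> carrier P" "t = tensor_one P v"
      using ex by blast
    show "g (s \<oplus>\<^bsub>tensor R ?k P\<^esub> t) = g s \<oplus>\<^bsub>tensor R ?k Q\<^esub> g t"
      unfolding u(2) v(2) using g[of "u \<oplus>\<^bsub>P\<^esub> v"] g[OF u(1)] g[OF v(1)] u v
        module_hom_add[OF hP u(1) v(1)] module_hom_add[OF f u(1) v(1)] module_hom_add[OF hQ fc[OF u(1)] fc[OF v(1)]] by simp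
  next
    fix r t assume rt: "r \<in> carrier R \<and> t \<in> carrier (tensor R ?k P)"
    then obtain u where u: "u \<in> carrier P" "t = tensor_one P u" using ex by blast
    show "g (r \<odot>\<^bsub>tensor R ?k P\<^esub> t) = r \<odot>\<^bsub>tensor R ?k Q\<^esub> g t"
      unfolding u(2) using g[of "r \<odot>\<^bsub>P\<^esub> u"] g[OF u(1)] u rt
        module_hom_smult[OF hP _ u(1), of r] module_hom_smult[OF f _ u(1), of r] module_hom_smult[OF hQ _ fc[OF u(1)], of r] by simp
  qed
  have gp: "\<forall>x\<in>carrier ?k. \<forall>y\<in>carrier P. g (pure_tensor R ?k P x y) = pure_tensor R ?k Q x (f y)"
  proof (intro ballI)
    fix x y assume "x \<in> carrier ?k" and y: "y \<in> carrier P"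
    then obtain r where r: "r \<in> carrier R" "x = residue_class r" using residue_class_facts(2) by blast
    show "g (pure_tensor R ?k P x y) = pure_tensor R ?k Q x (f y)"
      unfolding r(2) pure_tensor_residue[OF P r(1) y] pure_tensor_residue[OF Q r(1) fc[OF y]]
      using g[of "r \<odot>\<^bsub>P\<^esub> y"] r(1) y module_hom_smult[OF f r(1) y] by simp
  qed
  have "\<Delta> \<in> module_hom R (tensor R ?k P) (tensor R ?k Q) \<and>
      (\<forall>x\<in>carrier ?k. \<forall>y\<in>carrier P. \<Delta> (pure_tensor R ?k P x y) = pure_tensor R ?k Q x (f y))"
    unfolding \<Delta>_def tensor_map_def by (rule someI[of _ g]) (use gh gp in blast)
  moreover have "residue_class \<one> \<in> carrier ?k" using residue_class_facts(2) by simp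
  ultimately show "\<Delta> \<in> module_hom R (tensor R ?k P) (tensor R ?k Q)"
    "u \<in> carrier P \<Longrightarrow> \<Delta> (tensor_one P u) = tensor_one Q (f u)" by (auto simp: tensor_one_def)
qed

section \<open>Betti numbers and the ranks of the differentials modulo the maximal ideal\<close>

lemma mlength_\<mm>: "colength R \<mm> = 1"
proof (rule antisym)
  show "colength R \<mm> \<le> 1"
  proof (rule mlength_le_1[OF \<mm>_submod])
    show "submod R (ring_module R) (carrier R)" using module.submod_carrier[OF module_ring_module] by simp
    fix N assume N: "submod R (ring_module R) N" "\<mm> \<subset> N" "N \<subseteq> carrier R"
    then have "ideal N R" by (simp add: submod_iff_ideal)
    then show "N = carrier R" using proper_ideal_subset_\<mm> N(2) by blast
  qed (rule \<mm>_subset)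
  show "1 \<le> colength R \<mm>"
    by (rule mlength_pos[OF \<mm>_submod])
      (use module.submod_carrier[OF module_ring_module] \<mm>_subset one_not_in_\<mm> in auto)
qed

lemma mlength_free_pow_\<mm>:
  "mlength R (free_pow R n) (coord_sub n \<mm> 0) (carrier (free_pow R n)) = enat n"
  using mlength_free_pow[OF \<mm>_ideal, of n] by (simp add: mlength_\<mm> of_nat_eq_enat)

lemma resolution_facts:
  assumes res: "free_resolution R M b d e"
  defines "K \<equiv> \<lambda>i. d i ` carrier (free_pow R (b (Suc i)))"
  shows "d i \<in> module_hom R (free_pow R (b (Suc i))) (free_pow R (b i))"
    "submod R (free_pow R (b i)) (K i)"
    "K (Suc i) = {u \<in> carrier (free_pow R (b (Suc i))). d i u = \<zero>\<^bsub>free_pow R (b i)\<^esub>}"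
proof -
  show h: "d i \<in> module_hom R (free_pow R (b (Suc i))) (free_pow R (b i))" for i
    using res by (simp add: free_resolution_def)
  show "submod R (free_pow R (b i)) (K i)"
    unfolding K_def
    by (rule hom_image_submod[OF free_pow_module free_pow_module h module.submod_carrier[OF free_pow_module]])
  show "K (Suc i) = {u \<in> carrier (free_pow R (b (Suc i))). d i u = \<zero>\<^bsub>free_pow R (b i)\<^esub>}"
    using res by (simp add: free_resolution_def K_def ker_on_def)
qed

text \<open>Rank and nullity for the complex \<open>k \<otimes> F\<close>: \<open>r i\<close> is the
  rank of the \<open>i\<close>-th differential modulo \<open>\<mm>\<close>, zero throughout exactly
  for a minimal resolution. Cycles and boundaries are pulled back to \<open>F\<close>, where they
  contain \<open>\<mm>F\<close> and lengths can be taken.\<close>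

theorem betti_ranks:
  fixes M :: "('a, 'm) module"
  assumes some: "some_resolution R M = (b, d)" and res: "free_resolution R M b d e"
  defines "K \<equiv> \<lambda>i. d i ` carrier (free_pow R (b (Suc i)))"
  obtains r where
    "\<And>i. mlength R (free_pow R (b i)) (coord_sub (b i) \<mm> 0) (K i <+>\<^bsub>free_pow R (b i)\<^esub> coord_sub (b i) \<mm> 0) = enat (r i)"
    "b 0 = r 0 + betti R \<mm> 0 M" "\<And>i. b (Suc i) = r (Suc i) + betti R \<mm> (Suc i) M + r i"
proof -
  let ?F = "\<lambda>i. free_pow R (b i)"
  let ?k = "residue_module R \<mm>"
  let ?T = "\<lambda>i. tensor R ?k (?F i)"
  let ?m = "\<lambda>i. coord_sub (b i) \<mm> 0"
  define \<Delta> where "\<Delta> i = tensor_map R ?k (?F (Suc i)) (?F i) (d i)" for i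
  define \<phi> where "\<phi> i = tensor_one (?F i)" for i
  have F: "module R (?F i)" for i by (rule free_pow_module)
  have T: "module R (?T i)" for i by (rule tensor_module[OF residue_module_module F])
  note dh = resolution_facts(1)[OF res]
  have K: "submod R (?F i) (K i)" "K (Suc i) = {u \<in> carrier (?F (Suc i)). d i u = \<zero>\<^bsub>?F i\<^esub>}" for i
    unfolding K_def by (rule resolution_facts(2)[OF res], rule resolution_facts(3)[OF res])
  have mF: "submod R (?F i) (?m i)" for i by (rule coord_sub_submod[OF \<mm>_ideal])
  have \<phi>: "\<phi> i \<in> module_hom R (?F i) (?T i)" for i unfolding \<phi>_def by (rule tensor_one_hom[OF F])
  have \<phi>0: "\<phi> i u = \<zero>\<^bsub>?T i\<^esub> \<longleftrightarrow> u \<in> ?m i" if u: "u \<in> carrier (?F i)" for i u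
    unfolding \<phi>_def using tensor_one_kernel[OF F u] ideal_smult_free_pow[OF \<mm>_ideal] by simp
  have \<phi>s: "\<phi> i ` carrier (?F i) = carrier (?T i)" for i unfolding \<phi>_def by (rule tensor_one_surj[OF F])
  have \<Delta>: "\<Delta> i \<in> module_hom R (?T (Suc i)) (?T i)" for i
    unfolding \<Delta>_def by (rule tensor_map_residue(1)[OF F F dh])
  have \<Delta>\<phi>: "\<Delta> i (\<phi> (Suc i) u) = \<phi> i (d i u)" if u: "u \<in> carrier (?F (Suc i))" for i u
    unfolding \<Delta>_def \<phi>_def by (rule tensor_map_residue(2)[OF F F dh u])
  define B where "B i = \<Delta> i ` carrier (?T (Suc i))" for i
  define Z where "Z i = (case i of 0 \<Rightarrow> carrier (?T 0) | Suc j \<Rightarrow> ker_on (\<Delta> j) (?T (Suc j)) (?T j))" for i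
  have dc: "d i u \<in> carrier (?F i)" if u: "u \<in> carrier (?F (Suc i))" for i u by (rule hom_in_carrier[OF dh u])
  have Bs: "submod R (?T i) (B i)" for i
    unfolding B_def by (rule hom_image_submod[OF T T \<Delta> module.submod_carrier[OF T]])
  have Zs: "submod R (?T i) (Z i)" for i
    unfolding Z_def by (cases i) (simp_all add: module.submod_carrier[OF T] hom_ker_submod[OF T T \<Delta>])
  \<comment> \<open>Boundaries of \<open>k \<otimes> F\<close> come from the image
    \<open>K i\<close> of the differential, up to the kernel \<open>\<mm>F\<close> of
    \<open>F \<rightarrow> k \<otimes> F\<close>.\<close>
  have preB: "{u \<in> carrier (?F i). \<phi> i u \<in> B i} = K i <+>\<^bsub>?F i\<^esub> ?m i" for i
  proof -
    have "B i = \<phi> i ` K i"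
      unfolding B_def K_def \<phi>s[symmetric] image_image by (rule image_cong[OF refl \<Delta>\<phi>])
    moreover have "{u \<in> carrier (?F i). \<phi> i u = \<zero>\<^bsub>?T i\<^esub>} = ?m i"
      using \<phi>0 submodD(2)[OF mF] by blast
    ultimately show ?thesis
      using hom_vimage_image[OF F T \<phi> module.submod_carrier[OF F] K(1) submodD(2)[OF K(1)]]
        module.set_add_commute[OF F mF K(1)] by simp
  qed
  have preZ: "{u \<in> carrier (?F (Suc j)). \<phi> (Suc j) u \<in> Z (Suc j)} =
      {u \<in> carrier (?F (Suc j)). d j u \<in> ?m j}" for j
    using \<phi>0[OF dc, of _ j] \<Delta>\<phi>[of _ j] hom_in_carrier[OF \<phi>, of _ "Suc j"]
    unfolding Z_def ker_on_def nat.case by (intro Collect_cong) auto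
  have BZ: "B i \<subseteq> Z i" for i
  proof (cases i)
    case 0 then show ?thesis using submodD(2)[OF Bs] by (simp add: Z_def)
  next
    case (Suc j)
    show ?thesis
    proof
      fix s assume s: "s \<in> B i"
      then obtain t where t: "t \<in> carrier (?T (Suc i))" "s = \<Delta> i t" unfolding B_def by blast
      obtain v where v: "v \<in> carrier (?F (Suc i))" "t = \<phi> (Suc i) v" using t(1) \<phi>s[of "Suc i"] by blast
      have "d (Suc j) v \<in> K (Suc j)" unfolding K_def using v(1) Suc by blast
      then have "d j (d (Suc j) v) = \<zero>\<^bsub>?F j\<^esub>" using K(2)[of j] by simp
      then have "\<Delta> j s = \<phi> j (\<zero>\<^bsub>?F j\<^esub>)"
        using t(2) v \<Delta>\<phi>[OF v(1)] \<Delta>\<phi>[of "d i v" j] dc[OF v(1)] Suc by simp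
      then have "\<Delta> j s = \<zero>\<^bsub>?T j\<^esub>" using hom_zero[OF F T \<phi>] by simp
      then show "s \<in> Z i" using submod_in_carrier[OF Bs s] Suc by (simp add: Z_def ker_on_def)
    qed
  qed
  have mZB: "q \<odot>\<^bsub>?T i\<^esub> z \<in> B i" if q: "q \<in> \<mm>" and z: "z \<in> Z i" for q z i
  proof -
    have "z \<in> carrier (?T i)" by (rule submod_in_carrier[OF Zs z])
    then obtain u where u: "u \<in> carrier (?F i)" "z = \<phi> i u" using \<phi>s[of i] by blast
    have "q \<odot>\<^bsub>?F i\<^esub> u \<in> ?m i"
      using module.ideal_smult_mem[OF F \<mm>_subset subset_refl q u(1)] ideal_smult_free_pow[OF \<mm>_ideal] by simp
    then have "\<phi> i (q \<odot>\<^bsub>?F i\<^esub> u) = \<zero>\<^bsub>?T i\<^esub>"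
      using \<phi>0[of "q \<odot>\<^bsub>?F i\<^esub> u" i] submod_in_carrier[OF mF] by blast
    then show ?thesis using module_hom_smult[OF \<phi> _ u(1), of q] q u(2) submodD(3)[OF Bs, of i] by simp
  qed
  have len: "mlength R (?T i) (B i) (Z i) =
      mlength R (?F i) (K i <+>\<^bsub>?F i\<^esub> ?m i) {u \<in> carrier (?F i). \<phi> i u \<in> Z i}" for i
  proof -
    let ?P = "{u \<in> carrier (?F i). \<phi> i u \<in> Z i}"
    have im: "\<phi> i ` ?P = Z i"
    proof
      show "Z i \<subseteq> \<phi> i ` ?P"
      proof
        fix z assume z: "z \<in> Z i"
        then have "z \<in> \<phi> i ` carrier (?F i)" using \<phi>s[of i] submod_in_carrier[OF Zs z] by simp
        then show "z \<in> \<phi> i ` ?P" using z by blast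
      qed
    qed blast
    have pre: "{x \<in> ?P. \<phi> i x \<in> B i} = K i <+>\<^bsub>?F i\<^esub> ?m i" unfolding preB[symmetric] using BZ[of i] by blast
    have "B i \<subseteq> \<phi> i ` ?P" unfolding im by (rule BZ)
    from hom_mlength[OF F T \<phi> hom_preimage_submod[OF F T \<phi> Zs] Bs this] show ?thesis
      unfolding im pre by simp
  qed
  have Ks: "submod R (?F i) (K i <+>\<^bsub>?F i\<^esub> ?m i)" "?m i \<subseteq> K i <+>\<^bsub>?F i\<^esub> ?m i" "K i \<subseteq> K i <+>\<^bsub>?F i\<^esub> ?m i" for i
    using module.submod_set_add[OF F K(1) mF] module.set_add_upper2[OF F K(1) mF] module.set_add_upper1[OF F K(1) mF] by auto
  have split: "enat (b i) = mlength R (?F i) (?m i) (K i <+>\<^bsub>?F i\<^esub> ?m i) +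
      mlength R (?F i) (K i <+>\<^bsub>?F i\<^esub> ?m i) (carrier (?F i))" for i
    using module.mlength_add[OF F mF Ks(1) module.submod_carrier[OF F] Ks(2) submodD(2)[OF Ks(1)], of i]
    by (simp add: mlength_free_pow_\<mm>)
  define r where "r i = the_enat (mlength R (?F i) (?m i) (K i <+>\<^bsub>?F i\<^esub> ?m i))" for i
  have fin: "mlength R (?F i) (?m i) (K i <+>\<^bsub>?F i\<^esub> ?m i) = enat (r i)" for i
    using split[of i] unfolding r_def by (cases "mlength R (?F i) (?m i) (K i <+>\<^bsub>?F i\<^esub> ?m i)") auto
  have betti: "betti R \<mm> i M = residue_dim R \<mm> (subquot (?T i) (Z i) (B i))" for i
    unfolding betti_def Tor_def some Let_def case_prod_conv B_def Z_def \<Delta>_def ..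
  have bd: "betti R \<mm> i M = n" if "mlength R (?T i) (B i) (Z i) = enat n" for i n
    unfolding betti by (rule residue_dim_subquot[OF Bs Zs BZ mZB that])
  show thesis
  proof (rule that[of r, OF fin])
    have Z0: "{u \<in> carrier (?F 0). \<phi> 0 u \<in> Z 0} = carrier (?F 0)"
      using hom_in_carrier[OF \<phi>] by (auto simp: Z_def)
    obtain n where n: "mlength R (?F 0) (K 0 <+>\<^bsub>?F 0\<^esub> ?m 0) (carrier (?F 0)) = enat n"
      using split[of 0] by (cases "mlength R (?F 0) (K 0 <+>\<^bsub>?F 0\<^esub> ?m 0) (carrier (?F 0))") auto
    have "betti R \<mm> 0 M = n" by (rule bd) (simp only: len Z0 n)
    then show "b 0 = r 0 + betti R \<mm> 0 M" using split[of 0] fin[of 0] n by simp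
  next
    fix j
    let ?P = "{u \<in> carrier (?F (Suc j)). d j u \<in> ?m j}"
    let ?KS = "K (Suc j) <+>\<^bsub>?F (Suc j)\<^esub> ?m (Suc j)"
    have P: "submod R (?F (Suc j)) ?P" by (rule hom_preimage_submod[OF F F dh mF])
    have KP: "?KS \<subseteq> ?P"
      unfolding preB[symmetric] preZ[symmetric] using BZ[of "Suc j"] by blast
    \<comment> \<open>The differential identifies \<open>F/?P\<close> with
      \<open>K j/(K j \<inter> \<mm>F)\<close>, and the second isomorphism theorem turns this into
      \<open>(K j + \<mm>F)/\<mm>F\<close>, of length \<open>r j\<close>.\<close>
    have "mlength R (?F (Suc j)) ?P (carrier (?F (Suc j))) = mlength R (?F j) (K j \<inter> ?m j) (K j)"
    proof -
      have pre: "{u \<in> carrier (?F (Suc j)). d j u \<in> K j \<inter> ?m j} = ?P" by (auto simp: K_def)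
      have "K j \<inter> ?m j \<subseteq> d j ` carrier (?F (Suc j))" by (auto simp: K_def)
      from hom_mlength[OF F F dh module.submod_carrier[OF F] module.submod_Int[OF F K(1) mF] this]
      show ?thesis unfolding pre by (simp add: K_def)
    qed
    also have "\<dots> = enat (r j)"
      using module.mlength_second_iso[OF F mF K(1), of j] fin[of j] by simp
    finally have PF: "mlength R (?F (Suc j)) ?P (carrier (?F (Suc j))) = enat (r j)" .
    have "mlength R (?F (Suc j)) ?KS (carrier (?F (Suc j))) = mlength R (?F (Suc j)) ?KS ?P + enat (r j)"
      using module.mlength_add[OF F Ks(1) P module.submod_carrier[OF F] KP submodD(2)[OF P]] PF by simp
    then have tot: "enat (b (Suc j)) = enat (r (Suc j)) + (mlength R (?F (Suc j)) ?KS ?P + enat (r j))"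
      using split[of "Suc j"] fin[of "Suc j"] by simp
    then obtain n where n: "mlength R (?F (Suc j)) ?KS ?P = enat n"
      by (cases "mlength R (?F (Suc j)) ?KS ?P") auto
    have "betti R \<mm> (Suc j) M = n" by (rule bd) (simp only: len preZ n)
    then show "b (Suc j) = r (Suc j) + betti R \<mm> (Suc j) M + r j" using tot n by simp
  qed
qed

end

section \<open>Ext of the residue field and regular sequences\<close>

lemma hom_module_simps:
  "carrier (hom_module R P M) = module_hom R P M \<inter> extensional (carrier P)"
  "f \<oplus>\<^bsub>hom_module R P M\<^esub> g = (\<lambda>x\<in>carrier P. f x \<oplus>\<^bsub>M\<^esub> g x)"
  "\<zero>\<^bsub>hom_module R P M\<^esub> = (\<lambda>x\<in>carrier P. \<zero>\<^bsub>M\<^esub>)"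
  "r \<odot>\<^bsub>hom_module R P M\<^esub> f = (\<lambda>x\<in>carrier P. r \<odot>\<^bsub>M\<^esub> f x)"
  by (simp_all add: hom_module_def)

lemma hom_module_eqI:
  "f \<in> carrier (hom_module R P M) \<Longrightarrow> g \<in> carrier (hom_module R P M) \<Longrightarrow>
    (\<And>x. x \<in> carrier P \<Longrightarrow> f x = g x) \<Longrightarrow> f = g"
  by (auto simp: hom_module_simps intro: extensionalityI)

lemma hom_module_restrict:
  assumes "module R P" "f \<in> module_hom R P M"
  shows "restrict f (carrier P) \<in> carrier (hom_module R P M)"
proof -
  interpret P: module R P by fact
  show ?thesis using assms(2) by (auto simp: hom_module_simps module_hom_def)
qed

lemma hom_module_hom: "f \<in> carrier (hom_module R P M) \<Longrightarrow> f \<in> module_hom R P M"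
  by (simp add: hom_module_simps)

lemma hom_add_hom:
  assumes "module R P" "module R M" "f \<in> module_hom R P M" "g \<in> module_hom R P M"
  shows "(\<lambda>x. f x \<oplus>\<^bsub>M\<^esub> g x) \<in> module_hom R P M"
proof -
  interpret M: module R M by fact
  note c = hom_in_carrier[OF assms(3)] hom_in_carrier[OF assms(4)]
  note ad = module_hom_add[OF assms(3)] module_hom_add[OF assms(4)]
  note sm = module_hom_smult[OF assms(3)] module_hom_smult[OF assms(4)]
  show ?thesis
    unfolding module_hom_def using c by (auto simp: ad sm M.M.a_ac M.smult_r_distr)
qed

lemma hom_smult_hom:
  assumes "module R P" "module R M" "f \<in> module_hom R P M" "r \<in> carrier R"
  shows "(\<lambda>x. r \<odot>\<^bsub>M\<^esub> f x) \<in> module_hom R P M"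
proof -
  interpret M: module R M by fact
  note c = hom_in_carrier[OF assms(3)]
  show ?thesis
    unfolding module_hom_def
    using c assms(4) by (auto simp: module_hom_add[OF assms(3)] module_hom_smult[OF assms(3)]
        M.smult_r_distr M.smult_commute)
qed

lemma hom_diff_hom:
  assumes "module R P" "module R M" "f \<in> module_hom R P M" "g \<in> module_hom R P M"
  shows "(\<lambda>x. f x \<ominus>\<^bsub>M\<^esub> g x) \<in> module_hom R P M"
proof -
  interpret M: module R M by fact
  note c = hom_in_carrier[OF assms(3)] hom_in_carrier[OF assms(4)]
  show ?thesis
    unfolding module_hom_def
    using c by (auto simp: module_hom_add[OF assms(3)] module_hom_smult[OF assms(3)]
        module_hom_add[OF assms(4)] module_hom_smult[OF assms(4)] M.minus_add_minus M.smult_minus)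
qed

lemma hom_zero_hom:
  assumes "module R M"
  shows "(\<lambda>x. \<zero>\<^bsub>M\<^esub>) \<in> module_hom R P M"
proof -
  interpret M: module R M by fact
  show ?thesis by (auto simp: module_hom_def)
qed

lemma hom_comp:
  assumes "f \<in> module_hom R P M" "g \<in> module_hom R Q P"
  shows "(\<lambda>x. f (g x)) \<in> module_hom R Q M"
  using assms by (auto simp: module_hom_def Pi_def)

lemma hom_module_closed:
  assumes P: "module R P" and M: "module R M"
  shows "f \<in> carrier (hom_module R P M) \<Longrightarrow> g \<in> carrier (hom_module R P M) \<Longrightarrow>
      f \<oplus>\<^bsub>hom_module R P M\<^esub> g \<in> carrier (hom_module R P M)"
    "f \<in> carrier (hom_module R P M) \<Longrightarrow> r \<in> carrier R \<Longrightarrow>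
      r \<odot>\<^bsub>hom_module R P M\<^esub> f \<in> carrier (hom_module R P M)"
    "\<zero>\<^bsub>hom_module R P M\<^esub> \<in> carrier (hom_module R P M)"
proof -
  assume f: "f \<in> carrier (hom_module R P M)"
  show "f \<oplus>\<^bsub>hom_module R P M\<^esub> g \<in> carrier (hom_module R P M)" if g: "g \<in> carrier (hom_module R P M)"
    unfolding hom_module_simps(2)
    by (rule hom_module_restrict[OF P hom_add_hom[OF P M hom_module_hom[OF f] hom_module_hom[OF g]]])
  show "r \<odot>\<^bsub>hom_module R P M\<^esub> f \<in> carrier (hom_module R P M)" if r: "r \<in> carrier R"
    unfolding hom_module_simps(4)
    by (rule hom_module_restrict[OF P hom_smult_hom[OF P M hom_module_hom[OF f] r]])
next
  show "\<zero>\<^bsub>hom_module R P M\<^esub> \<in> carrier (hom_module R P M)"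
    unfolding hom_module_simps(3) by (rule hom_module_restrict[OF P hom_zero_hom[OF M]])
qed

lemma hom_module_module:
  assumes P: "module R P" and M: "module R M"
  shows "module R (hom_module R P M)"
proof -
  interpret M: module R M by fact
  interpret P: module R P by fact
  note c = hom_module_closed[OF P M]
  have v: "f x \<in> carrier M" if "f \<in> carrier (hom_module R P M)" "x \<in> carrier P" for f x
    by (rule hom_in_carrier[OF hom_module_hom[OF that(1)] that(2)])
  note app = hom_module_simps(2-4)
  show ?thesis
  proof (rule module_criteria[OF M.R.is_cring], goal_cases)
    case 3
    show ?case
    proof
      fix f assume f: "f \<in> carrier (hom_module R P M)"
      have m: "(\<ominus>\<^bsub>R\<^esub> \<one>\<^bsub>R\<^esub>) \<odot>\<^bsub>hom_module R P M\<^esub> f \<in> carrier (hom_module R P M)" by (rule c(2)[OF f]) simp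
      show "\<exists>g\<in>carrier (hom_module R P M). f \<oplus>\<^bsub>hom_module R P M\<^esub> g = \<zero>\<^bsub>hom_module R P M\<^esub>"
        by (rule bexI[OF _ m], rule hom_module_eqI[OF c(1)[OF f m] c(3)])
          (use v[OF f] in \<open>simp add: app M.smult_l_minus M.M.r_neg\<close>)
    qed
  next
    case 5 show ?case by (auto simp: app v M.M.a_comm intro!: restrict_ext)
  next
    case 6 show ?case by (auto simp: app v M.M.a_assoc intro!: restrict_ext)
  next
    case 7
    show ?case
    proof
      fix f assume f: "f \<in> carrier (hom_module R P M)"
      show "f \<oplus>\<^bsub>hom_module R P M\<^esub> \<zero>\<^bsub>hom_module R P M\<^esub> = f"
        by (rule hom_module_eqI[OF c(1)[OF f c(3)] f]) (simp add: app v[OF f])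
    qed
  next
    case 8 show ?case by (auto simp: app v M.smult_assoc1 intro!: restrict_ext)
  next
    case 9
    show ?case
    proof
      fix f assume f: "f \<in> carrier (hom_module R P M)"
      show "\<one>\<^bsub>R\<^esub> \<odot>\<^bsub>hom_module R P M\<^esub> f = f"
        by (rule hom_module_eqI[OF c(2)[OF f] f]) (simp_all add: app v[OF f])
    qed
  next
    case 10 show ?case by (auto simp: app v M.smult_l_distr intro!: restrict_ext)
  next
    case 11 show ?case by (auto simp: app v M.smult_r_distr intro!: restrict_ext)
  qed (use c in auto)
qed

lemma hom_module_minus:
  assumes P: "module R P" and M: "module R M"
    and f: "f \<in> carrier (hom_module R P M)" and g: "g \<in> carrier (hom_module R P M)" and x: "x \<in> carrier P"
  shows "(f \<ominus>\<^bsub>hom_module R P M\<^esub> g) x = f x \<ominus>\<^bsub>M\<^esub> g x"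
proof -
  interpret H: module R "hom_module R P M" by (rule hom_module_module[OF P M])
  interpret M: module R M by fact
  let ?h = "f \<ominus>\<^bsub>hom_module R P M\<^esub> g"
  have h: "?h \<in> carrier (hom_module R P M)" using f g by simp
  have "?h \<oplus>\<^bsub>hom_module R P M\<^esub> g = f" using f g by simp
  then have "f x = (?h \<oplus>\<^bsub>hom_module R P M\<^esub> g) x" by simp
  then have "f x = ?h x \<oplus>\<^bsub>M\<^esub> g x" using x by (simp only: hom_module_simps(2) restrict_apply')
  moreover have "?h x \<in> carrier M" "g x \<in> carrier M"
    using hom_in_carrier[OF hom_module_hom[OF h] x] hom_in_carrier[OF hom_module_hom[OF g] x] by auto
  ultimately show ?thesis by simp
qed

context module
begin

lemma minus_add_self_left: "x \<in> carrier M \<Longrightarrow> y \<in> carrier M \<Longrightarrow> x \<ominus>\<^bsub>M\<^esub> (x \<oplus>\<^bsub>M\<^esub> y) = \<ominus>\<^bsub>M\<^esub> y"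
  by (simp add: a_minus_def M.minus_add M.a_assoc[symmetric] M.r_neg)

lemma minus_minus_add: "x \<in> carrier M \<Longrightarrow> y \<in> carrier M \<Longrightarrow> z \<in> carrier M \<Longrightarrow>
    x \<ominus>\<^bsub>M\<^esub> ((x \<oplus>\<^bsub>M\<^esub> y) \<ominus>\<^bsub>M\<^esub> z) = z \<ominus>\<^bsub>M\<^esub> y"
  by (simp add: a_minus_def M.minus_add M.a_assoc[symmetric] M.r_neg) (simp add: M.a_comm)

end

section \<open>A free resolution of a cyclic module with annihilator the maximal ideal\<close>

locale residue_resolution = noetherian_local_ring +
  fixes k :: "('a, 'k) module" and b :: "nat \<Rightarrow> nat" and d :: "nat \<Rightarrow> (nat \<Rightarrow> 'a) \<Rightarrow> (nat \<Rightarrow> 'a)"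
    and e :: "(nat \<Rightarrow> 'a) \<Rightarrow> 'k" and q :: "'a \<Rightarrow> 'k"
  assumes k: "module R k"
    and q_hom: "q \<in> module_hom R (ring_module R) k"
    and q_surj: "q ` carrier R = carrier k"
    and q_ker: "\<And>r. r \<in> carrier R \<Longrightarrow> q r = \<zero>\<^bsub>k\<^esub> \<longleftrightarrow> r \<in> \<mm>"
    and res: "free_resolution R k b d e"
begin

abbreviation "F i \<equiv> free_pow R (b i)"

lemma F_module: "module R (F i)"
  by (rule free_pow_module)

lemma d_hom: "d i \<in> module_hom R (F (Suc i)) (F i)"
  using res by (simp add: free_resolution_def)

lemma d_carrier: "x \<in> carrier (F (Suc i)) \<Longrightarrow> d i x \<in> carrier (F i)"
  by (rule hom_in_carrier[OF d_hom])

lemma d_exact: "x \<in> carrier (F (Suc i)) \<Longrightarrow> d i x = \<zero>\<^bsub>F i\<^esub> \<longleftrightarrow> (\<exists>y\<in>carrier (F (Suc (Suc i))). x = d (Suc i) y)"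
proof -
  have "d (Suc i) ` carrier (F (Suc (Suc i))) = ker_on (d i) (F (Suc i)) (F i)"
    using res by (simp add: free_resolution_def)
  then show "x \<in> carrier (F (Suc i)) \<Longrightarrow> ?thesis" unfolding ker_on_def by blast
qed

lemma dd_zero: "y \<in> carrier (F (Suc (Suc i))) \<Longrightarrow> d i (d (Suc i) y) = \<zero>\<^bsub>F i\<^esub>"
  using d_exact[OF d_carrier] by blast

lemma e_hom: "e \<in> module_hom R (F 0) k"
  using res by (simp add: free_resolution_def)

lemma e_surj: "e ` carrier (F 0) = carrier k"
  using res by (simp add: free_resolution_def)

lemma e_exact: "x \<in> carrier (F 0) \<Longrightarrow> e x = \<zero>\<^bsub>k\<^esub> \<longleftrightarrow> (\<exists>y\<in>carrier (F (Suc 0)). x = d 0 y)"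
proof -
  have "d 0 ` carrier (F (Suc 0)) = ker_on e (F 0) k"
    using res by (simp add: free_resolution_def)
  then show "x \<in> carrier (F 0) \<Longrightarrow> ?thesis" unfolding ker_on_def by blast
qed

lemma k_annihilated:
  assumes "x \<in> \<mm>" "v \<in> carrier k"
  shows "x \<odot>\<^bsub>k\<^esub> v = \<zero>\<^bsub>k\<^esub>"
proof -
  obtain r where r: "r \<in> carrier R" "v = q r" using assms(2) q_surj by blast
  have "x \<odot>\<^bsub>k\<^esub> v = q (x \<otimes> r)" using module_hom_smult[OF q_hom, of x r] r assms(1) by simp
  then show ?thesis using q_ker[of "x \<otimes> r"] r assms(1) I_r_closed by simp
qed

lemma residue_eq: "r \<in> carrier R \<Longrightarrow> s \<in> carrier R \<Longrightarrow> q r = q s \<Longrightarrow> r \<ominus> s \<in> \<mm>"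
  using hom_minus[OF module_ring_module k q_hom, of r s] q_ker[of "r \<ominus> s"] hom_in_carrier[OF q_hom, of s]
    module.minus_self[OF k, of "q s"] by simp

lemma augmentation_unit: "\<exists>u\<in>carrier (F 0). e u = q \<one>"
proof -
  have "q \<one> \<in> e ` carrier (F 0)" using e_surj q_surj by auto
  then show ?thesis by (elim imageE) auto
qed

lemma smult_boundary:
  assumes r: "r \<in> \<mm>" and w: "w \<in> carrier (F 0)"
  shows "\<exists>y\<in>carrier (F (Suc 0)). r \<odot>\<^bsub>F 0\<^esub> w = d 0 y"
proof -
  have rR: "r \<in> carrier R" using r by simp
  have "e (r \<odot>\<^bsub>F 0\<^esub> w) = \<zero>\<^bsub>k\<^esub>"
    using module_hom_smult[OF e_hom rR w] k_annihilated[OF r hom_in_carrier[OF e_hom w]] by simp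
  then show ?thesis using e_exact[OF module.smult_closed[OF F_module rR w]] by blast
qed

text \<open>The value \<open>r v\<close> depends on the representative \<open>r\<close> of
  \<open>e w\<close>, since \<open>\<mm>\<close> need not kill \<open>v\<close>. Projectivity of
  \<open>F 0\<close> chooses the representatives linearly.\<close>

lemma augmentation_lift:
  assumes M: "module R M" and v: "v \<in> carrier M"
  obtains f where "f \<in> module_hom R (F 0) M" "\<And>w. w \<in> carrier (F 0) \<Longrightarrow> \<exists>r\<in>carrier R. e w = q r \<and> f w = r \<odot>\<^bsub>M\<^esub> v"
proof -
  interpret M: module R M by fact
  have rv: "(\<lambda>r. r \<odot>\<^bsub>M\<^esub> v) \<in> module_hom R (ring_module R) M"
    using v by (auto simp: module_hom_def M.smult_l_distr M.smult_assoc1)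
  note \<rho> = linear_rel_comp[OF linear_rel_comp[OF hom_graph_linear[OF F_module k e_hom]
        linear_rel_converse[OF hom_graph_linear[OF module_ring_module k q_hom]]]
      hom_graph_linear[OF module_ring_module M rv]]
  let ?\<rho> = "({(x, y). x \<in> carrier (F 0) \<and> y = e x} O {(x, y). x \<in> carrier (ring_module R) \<and> y = q x}\<inverse>)
    O {(x, y). x \<in> carrier (ring_module R) \<and> y = x \<odot>\<^bsub>M\<^esub> v}"
  have tot: "\<exists>m. (w, m) \<in> ?\<rho>" if w: "w \<in> carrier (F 0)" for w
  proof -
    obtain r where r: "r \<in> carrier R" "e w = q r" using hom_in_carrier[OF e_hom w] q_surj by blast
    have "(w, r) \<in> {(x, y). x \<in> carrier (F 0) \<and> y = e x} O {(x, y). x \<in> carrier (ring_module R) \<and> y = q x}\<inverse>"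
      by (rule relcompI[of w "e w"]) (use r w in auto)
    moreover have "(r, r \<odot>\<^bsub>M\<^esub> v) \<in> {(x, y). x \<in> carrier (ring_module R) \<and> y = x \<odot>\<^bsub>M\<^esub> v}" using r(1) by simp
    ultimately show ?thesis by (intro exI) (rule relcompI)
  qed
  obtain f where f: "f \<in> module_hom R (F 0) M" and f': "\<And>w. w \<in> carrier (F 0) \<Longrightarrow> (w, f w) \<in> ?\<rho>"
    by (rule free_lift'[OF \<rho>], erule tot, rule that)
  have "\<exists>r\<in>carrier R. e w = q r \<and> f w = r \<odot>\<^bsub>M\<^esub> v" if w: "w \<in> carrier (F 0)" for w
    using f'[OF w] by auto
  with f show thesis by (rule that)
qed

text \<open>Multiplication by \<open>x\<close> on the resolution covers the zero map of
  \<open>k\<close>, so it is null-homotopic. The homotopy \<open>s\<close> is built degree by degree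
  by lifting along the differentials.\<close>

lemma smult_null_homotopic:
  assumes x: "x \<in> \<mm>"
  obtains s where "\<And>i. s i \<in> module_hom R (F i) (F (Suc i))"
    "\<And>w. w \<in> carrier (F 0) \<Longrightarrow> x \<odot>\<^bsub>F 0\<^esub> w = d 0 (s 0 w)"
    "\<And>i w. w \<in> carrier (F (Suc i)) \<Longrightarrow> x \<odot>\<^bsub>F (Suc i)\<^esub> w = d (Suc i) (s (Suc i) w) \<oplus>\<^bsub>F (Suc i)\<^esub> s i (d i w)"
proof -
  have xc: "x \<in> carrier R" using x by simp
  \<comment> \<open>The middle clause \<open>d s d = x d\<close> is what the next degree needs: it
    puts \<open>x - s d\<close> into the kernel of \<open>d\<close>.\<close>
  define P where "P i s \<longleftrightarrow> s \<in> module_hom R (F i) (F (Suc i)) \<and>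
      (\<forall>w\<in>carrier (F (Suc i)). d i (s (d i w)) = x \<odot>\<^bsub>F i\<^esub> d i w) \<and>
      (i = 0 \<longrightarrow> (\<forall>w\<in>carrier (F 0). x \<odot>\<^bsub>F 0\<^esub> w = d 0 (s w)))" for i s
  define Q where "Q i s t \<longleftrightarrow> (\<forall>w\<in>carrier (F (Suc i)). x \<odot>\<^bsub>F (Suc i)\<^esub> w = d (Suc i) (t w) \<oplus>\<^bsub>F (Suc i)\<^esub> s (d i w))"
    for i and s t :: "(nat \<Rightarrow> 'a) \<Rightarrow> nat \<Rightarrow> 'a"
  have "\<exists>s. \<forall>i. P i (s i) \<and> Q i (s i) (s (Suc i))"
  proof (rule dependent_nat_choice)
    have im: "x \<odot>\<^bsub>F 0\<^esub> w \<in> d 0 ` carrier (F (Suc 0))" if w: "w \<in> carrier (F 0)" for w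
      using smult_boundary[OF x w] by blast
    obtain s where "s \<in> module_hom R (F 0) (F (Suc 0))" "\<And>w. w \<in> carrier (F 0) \<Longrightarrow> d 0 (s w) = x \<odot>\<^bsub>F 0\<^esub> w"
      using free_lift_along[OF F_module F_module smult_hom[OF F_module xc] d_hom im] by blast
    then have "P 0 s" unfolding P_def using d_carrier[of _ 0] by auto
    then show "\<exists>s. P 0 s" by (rule exI[of _ s])
  next
    fix s i assume "P i s"
    then have s: "s \<in> module_hom R (F i) (F (Suc i))"
      and sd: "\<And>w. w \<in> carrier (F (Suc i)) \<Longrightarrow> d i (s (d i w)) = x \<odot>\<^bsub>F i\<^esub> d i w" by (auto simp: P_def)
    interpret Fi: module R "F i" by (rule F_module)
    interpret F1: module R "F (Suc i)" by (rule F_module)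
    have sc: "s z \<in> carrier (F (Suc i))" if "z \<in> carrier (F i)" for z by (rule hom_in_carrier[OF s that])
    let ?g = "\<lambda>w. x \<odot>\<^bsub>F (Suc i)\<^esub> w \<ominus>\<^bsub>F (Suc i)\<^esub> s (d i w)"
    have g: "?g \<in> module_hom R (F (Suc i)) (F (Suc i))"
      by (rule hom_diff_hom[OF F_module F_module smult_hom[OF F_module xc] hom_comp[OF s d_hom]])
    have im: "?g w \<in> d (Suc i) ` carrier (F (Suc (Suc i)))" if w: "w \<in> carrier (F (Suc i))" for w
    proof -
      have "d i (?g w) = x \<odot>\<^bsub>F i\<^esub> d i w \<ominus>\<^bsub>F i\<^esub> d i (s (d i w))"
        using hom_minus[OF F_module F_module d_hom, of "x \<odot>\<^bsub>F (Suc i)\<^esub> w" i "s (d i w)"] w xc sc[OF d_carrier[OF w]]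
          module_hom_smult[OF d_hom xc w] by simp
      also have "\<dots> = \<zero>\<^bsub>F i\<^esub>" using sd[OF w] xc d_carrier[OF w] by simp
      finally show ?thesis using d_exact[OF hom_in_carrier[OF g w]] by blast
    qed
    obtain t where t: "t \<in> module_hom R (F (Suc i)) (F (Suc (Suc i)))"
      and td: "\<And>w. w \<in> carrier (F (Suc i)) \<Longrightarrow> d (Suc i) (t w) = ?g w"
      using free_lift_along[OF F_module F_module g d_hom im] by blast
    have "Q i s t" unfolding Q_def using td sc[OF d_carrier] xc by simp
    moreover have "d (Suc i) (t (d (Suc i) w)) = x \<odot>\<^bsub>F (Suc i)\<^esub> d (Suc i) w"
      if w: "w \<in> carrier (F (Suc (Suc i)))" for w
      using td[OF d_carrier[OF w]] dd_zero[OF w] hom_zero[OF F_module F_module s] d_carrier[OF w] xc by simp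
    ultimately show "\<exists>t. P (Suc i) t \<and> Q i s t" unfolding P_def using t by blast
  qed
  then obtain s where s: "\<And>i. P i (s i)" "\<And>i. Q i (s i) (s (Suc i))" by blast
  show thesis
    by (rule that[of s]) (use s in \<open>unfold P_def Q_def, blast+\<close>)
qed

end

subsection \<open>The complex \<open>Hom(F, M)\<close>\<close>

locale residue_resolution_module = residue_resolution +
  fixes M :: "('a, 'm) module"
  assumes M_module: "module R M"
begin

sublocale M: module R M by (rule M_module)

abbreviation "C i \<equiv> hom_module R (F i) M"

definition "\<delta> i f = compose (carrier (F (Suc i))) f (d i)"

text \<open>This is Hom(F i, N). Because \<open>F i\<close> is free, \<open>C i\<close> modulo
  \<open>H i N\<close> is Hom(F i, M/N), and so \<open>Zc i N\<close> modulo \<open>Bc i N\<close>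
  is Ext^i(k, M/N) with \<open>M/N\<close> never formed.\<close>

definition "H i N = {f \<in> carrier (C i). \<forall>x\<in>carrier (F i). f x \<in> N}"

definition "Zc i N = {f \<in> carrier (C i). \<delta> i f \<in> H (Suc i) N}"

text \<open>Coboundaries modulo \<open>N\<close>; in degree 0 only the maps into \<open>N\<close>
  themselves remain.\<close>

definition "Bc i N = (case i of 0 \<Rightarrow> H 0 N | Suc j \<Rightarrow> \<delta> j ` carrier (C j) <+>\<^bsub>C (Suc j)\<^esub> H (Suc j) N)"

lemma C_module: "module R (C i)"
  by (rule hom_module_module[OF F_module M_module])

lemma C_value:
  assumes "f \<in> carrier (C i)" "x \<in> carrier (F i)"
  shows "f x \<in> carrier M"
  by (rule hom_in_carrier[OF hom_module_hom[OF assms(1)] assms(2)])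

lemma \<delta>_value: "x \<in> carrier (F (Suc i)) \<Longrightarrow> \<delta> i f x = f (d i x)"
  by (simp add: \<delta>_def compose_def)

lemma \<delta>_carrier:
  assumes "f \<in> carrier (C i)"
  shows "\<delta> i f \<in> carrier (C (Suc i))"
  using hom_module_restrict[OF F_module hom_comp[OF hom_module_hom[OF assms] d_hom]]
  unfolding \<delta>_def compose_def .

lemma \<delta>_hom: "\<delta> i \<in> module_hom R (C i) (C (Suc i))"
  unfolding module_hom_def
proof (intro CollectI conjI allI impI)
  show "\<delta> i \<in> carrier (C i) \<rightarrow> carrier (C (Suc i))" using \<delta>_carrier by blast
next
  fix f g assume "f \<in> carrier (C i) \<and> g \<in> carrier (C i)"
  then show "\<delta> i (f \<oplus>\<^bsub>C i\<^esub> g) = \<delta> i f \<oplus>\<^bsub>C (Suc i)\<^esub> \<delta> i g"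
    by (auto simp: \<delta>_def compose_def hom_module_simps(2) d_carrier restrict_def fun_eq_iff)
next
  fix r f assume "r \<in> carrier R \<and> f \<in> carrier (C i)"
  then show "\<delta> i (r \<odot>\<^bsub>C i\<^esub> f) = r \<odot>\<^bsub>C (Suc i)\<^esub> \<delta> i f"
    by (auto simp: \<delta>_def compose_def hom_module_simps(4) d_carrier restrict_def fun_eq_iff)
qed

lemma \<delta>\<delta>:
  assumes "f \<in> carrier (C i)"
  shows "\<delta> (Suc i) (\<delta> i f) = \<zero>\<^bsub>C (Suc (Suc i))\<^esub>"
  by (rule hom_module_eqI[OF \<delta>_carrier[OF \<delta>_carrier[OF assms]] hom_module_closed(3)[OF F_module M_module]])
    (simp add: \<delta>_value d_carrier dd_zero hom_module_simps(3) hom_zero[OF F_module M_module hom_module_hom[OF assms]])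

lemma H_submod:
  assumes N: "submod R M N"
  shows "submod R (C i) (H i N)"
  by (rule submodI[OF C_module])
    (use submodD(3-5)[OF N] hom_module_closed[OF F_module M_module] in \<open>auto simp: H_def hom_module_simps(2-4)\<close>)

lemma H_mono: "N \<subseteq> N' \<Longrightarrow> H i N \<subseteq> H i N'"
  by (auto simp: H_def)

lemma \<delta>_H: "f \<in> H i N \<Longrightarrow> \<delta> i f \<in> H (Suc i) N"
  by (auto simp: H_def \<delta>_carrier \<delta>_value d_carrier)

lemma Zc_submod:
  assumes N: "submod R M N"
  shows "submod R (C i) (Zc i N)"
  unfolding Zc_def by (rule hom_preimage_submod[OF C_module C_module \<delta>_hom H_submod[OF N]])

lemma \<delta>_image_submod: "submod R (C (Suc i)) (\<delta> i ` carrier (C i))"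
  by (rule hom_image_submod[OF C_module C_module \<delta>_hom module.submod_carrier[OF C_module]])

lemma Bc_submod:
  assumes N: "submod R M N"
  shows "submod R (C i) (Bc i N)"
  unfolding Bc_def
  by (cases i) (simp_all add: H_submod[OF N] module.submod_set_add[OF C_module \<delta>_image_submod H_submod[OF N]])

lemma H_subset_Bc:
  assumes N: "submod R M N"
  shows "H i N \<subseteq> Bc i N"
  unfolding Bc_def
  using module.set_add_upper2[OF C_module \<delta>_image_submod H_submod[OF N]] by (cases i) simp_all

lemma Bc_mono: "N \<subseteq> N' \<Longrightarrow> Bc i N \<subseteq> Bc i N'"
  unfolding Bc_def using H_mono[of N N'] module.set_add_mono[OF C_module] by (cases i) simp_all

lemma Bc_decomp:
  assumes N: "submod R M N" and f: "f \<in> Bc i N"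
  shows "\<exists>h\<in>H i N. \<delta> i f = \<delta> i h"
proof (cases i)
  case 0 then show ?thesis using f by (auto simp: Bc_def)
next
  case (Suc j)
  interpret Cj: module R "C (Suc j)" by (rule C_module)
  interpret Cj': module R "C (Suc (Suc j))" by (rule C_module)
  from f obtain g h where gh: "g \<in> carrier (C j)" "h \<in> H (Suc j) N" "f = \<delta> j g \<oplus>\<^bsub>C (Suc j)\<^esub> h"
    unfolding Bc_def Suc nat.case Cj.in_set_add by blast
  have hc: "h \<in> carrier (C (Suc j))" by (rule submod_in_carrier[OF H_submod[OF N] gh(2)])
  have "\<delta> (Suc j) f = \<delta> (Suc j) (\<delta> j g) \<oplus>\<^bsub>C (Suc (Suc j))\<^esub> \<delta> (Suc j) h"
    unfolding gh(3) by (rule module_hom_add[OF \<delta>_hom \<delta>_carrier[OF gh(1)] hc])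
  also have "\<dots> = \<delta> (Suc j) h" using \<delta>\<delta>[OF gh(1)] \<delta>_carrier[OF hc] by simp
  finally show ?thesis using gh(2) Suc by blast
qed

lemma Bc_subset_Zc:
  assumes N: "submod R M N"
  shows "Bc i N \<subseteq> Zc i N"
proof
  fix f assume f: "f \<in> Bc i N"
  obtain h where "h \<in> H i N" "\<delta> i f = \<delta> i h" using Bc_decomp[OF N f] by blast
  then show "f \<in> Zc i N"
    unfolding Zc_def using \<delta>_H submod_in_carrier[OF Bc_submod[OF N] f] by simp
qed

text \<open>\<open>\<mm>\<close> kills Ext^i(k, M/N). The homotopy gives
  \<open>x f = f d s + f s d\<close>; the first term has values in \<open>N\<close> because
  \<open>f\<close> is a cocycle, the second is the coboundary of \<open>f s\<close>.\<close>

lemma Zc_homotopy: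
  assumes N: "submod R M N" and x: "x \<in> \<mm>" and f: "f \<in> Zc i N"
  shows "x \<odot>\<^bsub>C i\<^esub> f \<in> Bc i N"
proof -
  obtain s where s: "\<And>i. s i \<in> module_hom R (F i) (F (Suc i))"
    and s0: "\<And>w. w \<in> carrier (F 0) \<Longrightarrow> x \<odot>\<^bsub>F 0\<^esub> w = d 0 (s 0 w)"
    and sS: "\<And>i w. w \<in> carrier (F (Suc i)) \<Longrightarrow> x \<odot>\<^bsub>F (Suc i)\<^esub> w = d (Suc i) (s (Suc i) w) \<oplus>\<^bsub>F (Suc i)\<^esub> s i (d i w)"
    using smult_null_homotopic[OF x] by blast
  have xc: "x \<in> carrier R" using x by simp
  have fc: "f \<in> carrier (C i)" and fN: "\<And>u. u \<in> carrier (F (Suc i)) \<Longrightarrow> f (d i u) \<in> N"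
    using f by (auto simp: Zc_def H_def \<delta>_value)
  have fh: "f \<in> module_hom R (F i) M" by (rule hom_module_hom[OF fc])
  have sc: "w \<in> carrier (F i) \<Longrightarrow> s i w \<in> carrier (F (Suc i))" for w i by (rule hom_in_carrier[OF s])
  have xf: "x \<odot>\<^bsub>C i\<^esub> f \<in> carrier (C i)" by (rule hom_module_closed(2)[OF F_module M_module fc xc])
  have val: "(x \<odot>\<^bsub>C i\<^esub> f) w = f (x \<odot>\<^bsub>F i\<^esub> w)" if w: "w \<in> carrier (F i)" for w
    using w module_hom_smult[OF fh xc w] by (simp add: hom_module_simps(4))
  show ?thesis
  proof (cases i)
    case 0
    have "x \<odot>\<^bsub>C i\<^esub> f \<in> H i N"
      unfolding H_def using xf val s0 sc[of _ 0] fN 0 by auto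
    then show ?thesis using H_subset_Bc[OF N] by blast
  next
    case (Suc j)
    interpret Cj: module R "C (Suc j)" by (rule C_module)
    define g where "g = restrict (\<lambda>w. f (s j w)) (carrier (F j))"
    define h where "h = restrict (\<lambda>w. f (d i (s i w))) (carrier (F i))"
    have g: "g \<in> carrier (C j)"
      unfolding g_def by (rule hom_module_restrict[OF F_module hom_comp[OF fh[unfolded Suc] s]])
    have h: "h \<in> carrier (C i)"
      unfolding h_def by (rule hom_module_restrict[OF F_module hom_comp[OF fh hom_comp[OF d_hom s]]])
    have hN: "h \<in> H i N" unfolding H_def using h fN sc by (auto simp: h_def)
    have "x \<odot>\<^bsub>C i\<^esub> f = \<delta> j g \<oplus>\<^bsub>C i\<^esub> h"
    proof (rule hom_module_eqI[OF xf hom_module_closed(1)[OF F_module M_module]])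
      show "\<delta> j g \<in> carrier (C i)" using \<delta>_carrier[OF g] Suc by simp
      fix w assume w: "w \<in> carrier (F i)"
      have dw: "d j w \<in> carrier (F j)" using d_carrier[of w j] w Suc by simp
      have "(x \<odot>\<^bsub>C i\<^esub> f) w = f (d i (s i w) \<oplus>\<^bsub>F i\<^esub> s j (d j w))" using val[OF w] sS[of w j] w Suc by simp
      also have "\<dots> = f (d i (s i w)) \<oplus>\<^bsub>M\<^esub> f (s j (d j w))"
        using module_hom_add[OF fh, of "d i (s i w)" "s j (d j w)"] d_carrier[OF sc[OF w]] sc[OF dw] Suc by simp
      also have "\<dots> = (\<delta> j g \<oplus>\<^bsub>C i\<^esub> h) w"
        using w dw Suc M.M.a_comm[of "f (d i (s i w))" "f (s j (d j w))"] C_value[OF fc, of "d i (s i w)"]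
          C_value[OF fc, of "s j (d j w)"] d_carrier[OF sc[OF w]] sc[OF dw]
        by (simp add: hom_module_simps(2) \<delta>_value g_def h_def)
      finally show "(x \<odot>\<^bsub>C i\<^esub> f) w = (\<delta> j g \<oplus>\<^bsub>C i\<^esub> h) w" .
    qed (rule h)
    then show ?thesis unfolding Bc_def Suc nat.case Cj.in_set_add using g hN Suc by blast
  qed
qed

lemma H_regular:
  assumes x: "x \<in> carrier R" and reg: "\<And>v. v \<in> carrier M \<Longrightarrow> x \<odot>\<^bsub>M\<^esub> v \<in> N \<Longrightarrow> v \<in> N"
    and f: "f \<in> carrier (C i)" "x \<odot>\<^bsub>C i\<^esub> f \<in> H i N"
  shows "f \<in> H i N"
  unfolding H_def
proof (intro CollectI conjI f(1) ballI)
  fix w assume w: "w \<in> carrier (F i)"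
  have "(x \<odot>\<^bsub>C i\<^esub> f) w \<in> N" using f(2) w by (simp add: H_def)
  then show "f w \<in> N" using reg[OF C_value[OF f(1) w]] w by (simp add: hom_module_simps(4))
qed

abbreviation "N_ext N x \<equiv> plus_mult M N x (carrier M)"

lemma N_ext_facts:
  assumes N: "submod R M N" and x: "x \<in> carrier R"
  shows "submod R M (N_ext N x)" "N \<subseteq> N_ext N x" "v \<in> carrier M \<Longrightarrow> x \<odot>\<^bsub>M\<^esub> v \<in> N_ext N x"
  using M.seq_step[OF N M.submod_carrier submodD(2)[OF N] x] by auto

lemma smult_in_H_ext:
  assumes N: "submod R M N" and x: "x \<in> carrier R" and g: "g \<in> carrier (C i)"
  shows "x \<odot>\<^bsub>C i\<^esub> g \<in> H i (N_ext N x)"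
  unfolding H_def using hom_module_closed(2)[OF F_module M_module g x] N_ext_facts(3)[OF N x] C_value[OF g]
  by (auto simp: hom_module_simps(4))

text \<open>Hom(F i, N + xM) = Hom(F i, N) + x Hom(F i, M), again by freeness: the relation
  \<open>f w - x v \<in> N\<close> is linear and total, and a homomorphism inside it is the cofactor
  of \<open>x\<close>.\<close>

lemma H_ext_decomp:
  assumes N: "submod R M N" and x: "x \<in> carrier R" and f: "f \<in> H i (N_ext N x)"
  shows "\<exists>h\<in>H i N. \<exists>g\<in>carrier (C i). f = h \<oplus>\<^bsub>C i\<^esub> x \<odot>\<^bsub>C i\<^esub> g"
proof -
  interpret Ci: module R "C i" by (rule C_module)
  have fc: "f \<in> carrier (C i)" using f by (simp add: H_def)
  have fh: "f \<in> module_hom R (F i) M" by (rule hom_module_hom[OF fc])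
  let ?\<rho> = "{(w, v). w \<in> carrier (F i) \<and> v \<in> carrier M \<and> f w \<ominus>\<^bsub>M\<^esub> x \<odot>\<^bsub>M\<^esub> v \<in> N}"
  have lin: "linear_rel R (F i) M ?\<rho>"
  proof (rule linear_relI[OF F_module M_module])
    show "(\<zero>\<^bsub>F i\<^esub>, \<zero>\<^bsub>M\<^esub>) \<in> ?\<rho>"
      using module.submod_zero[OF F_module, of i] hom_zero[OF F_module M_module fh] x submodD(3)[OF N]
      by (simp add: submodD(2)[OF module.submod_zero[OF F_module], of i, simplified])
    fix w v w' v' assume a: "(w, v) \<in> ?\<rho>" "(w', v') \<in> ?\<rho>"
    then have c: "f w \<in> carrier M" "f w' \<in> carrier M" using C_value[OF fc] by auto
    have "f (w \<oplus>\<^bsub>F i\<^esub> w') \<ominus>\<^bsub>M\<^esub> x \<odot>\<^bsub>M\<^esub> (v \<oplus>\<^bsub>M\<^esub> v') =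
        (f w \<ominus>\<^bsub>M\<^esub> x \<odot>\<^bsub>M\<^esub> v) \<oplus>\<^bsub>M\<^esub> (f w' \<ominus>\<^bsub>M\<^esub> x \<odot>\<^bsub>M\<^esub> v')"
      using a c x by (simp add: module_hom_add[OF fh] M.smult_r_distr M.minus_add_minus)
    then show "(w \<oplus>\<^bsub>F i\<^esub> w', v \<oplus>\<^bsub>M\<^esub> v') \<in> ?\<rho>"
      using a submodD(4)[OF N] submodD(4)[OF module.submod_carrier[OF F_module], of w i w'] by simp
  next
    fix r w v assume a: "r \<in> carrier R" "(w, v) \<in> ?\<rho>"
    then have c: "f w \<in> carrier M" using C_value[OF fc] by auto
    have "f (r \<odot>\<^bsub>F i\<^esub> w) \<ominus>\<^bsub>M\<^esub> x \<odot>\<^bsub>M\<^esub> (r \<odot>\<^bsub>M\<^esub> v) = r \<odot>\<^bsub>M\<^esub> (f w \<ominus>\<^bsub>M\<^esub> x \<odot>\<^bsub>M\<^esub> v)"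
      using a c x M.smult_commute[of x r v] by (simp add: module_hom_smult[OF fh] M.smult_minus)
    then show "(r \<odot>\<^bsub>F i\<^esub> w, r \<odot>\<^bsub>M\<^esub> v) \<in> ?\<rho>"
      using a submodD(5)[OF N] submodD(5)[OF module.submod_carrier[OF F_module], of r w i] by simp
  qed auto
  have tot: "\<exists>v. (w, v) \<in> ?\<rho>" if w: "w \<in> carrier (F i)" for w
  proof -
    have "f w \<in> N_ext N x" using f w by (simp add: H_def)
    then obtain n v where nv: "n \<in> N" "v \<in> carrier M" "f w = n \<oplus>\<^bsub>M\<^esub> x \<odot>\<^bsub>M\<^esub> v" unfolding M.in_set_add by blast
    have "f w \<ominus>\<^bsub>M\<^esub> x \<odot>\<^bsub>M\<^esub> v = n" using nv x submod_in_carrier[OF N nv(1)] by simp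
    then show ?thesis using w nv by blast
  qed
  obtain g where g: "g \<in> module_hom R (F i) M" "\<And>w. w \<in> carrier (F i) \<Longrightarrow> (w, g w) \<in> ?\<rho>"
    using free_lift'[OF lin tot] by blast
  define g' where "g' = restrict g (carrier (F i))"
  have g': "g' \<in> carrier (C i)" unfolding g'_def by (rule hom_module_restrict[OF F_module g(1)])
  have xg: "x \<odot>\<^bsub>C i\<^esub> g' \<in> carrier (C i)" by (rule hom_module_closed(2)[OF F_module M_module g' x])
  let ?h = "f \<ominus>\<^bsub>C i\<^esub> x \<odot>\<^bsub>C i\<^esub> g'"
  have "?h \<in> H i N"
    unfolding H_def
  proof (intro CollectI conjI ballI)
    show "?h \<in> carrier (C i)" using fc xg by simp
    fix w assume w: "w \<in> carrier (F i)"
    have "?h w = f w \<ominus>\<^bsub>M\<^esub> (x \<odot>\<^bsub>C i\<^esub> g') w" by (rule hom_module_minus[OF F_module M_module fc xg w])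
    then show "?h w \<in> N" using g(2)[OF w] w by (simp add: hom_module_simps(4) g'_def)
  qed
  moreover have "f = ?h \<oplus>\<^bsub>C i\<^esub> x \<odot>\<^bsub>C i\<^esub> g'" using fc xg by simp
  ultimately show ?thesis using g' by blast
qed

text \<open>The connecting map sends the class of \<open>f\<close> to that of a \<open>g\<close>
  with \<open>\<delta> f \<equiv> x g\<close> modulo \<open>N\<close>. If \<open>f\<close> is a
  coboundary modulo \<open>N + xM\<close>, regularity of \<open>x\<close> modulo \<open>N\<close>
  cancels \<open>x\<close> and makes \<open>g\<close> a coboundary.\<close>

lemma connecting_forward:
  assumes N: "submod R M N" and x: "x \<in> carrier R" and reg: "\<And>v. v \<in> carrier M \<Longrightarrow> x \<odot>\<^bsub>M\<^esub> v \<in> N \<Longrightarrow> v \<in> N"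
    and f: "f \<in> Bc i (N_ext N x)" and g: "g \<in> carrier (C (Suc i))"
    and fg: "\<delta> i f \<ominus>\<^bsub>C (Suc i)\<^esub> x \<odot>\<^bsub>C (Suc i)\<^esub> g \<in> H (Suc i) N"
  shows "g \<in> Bc (Suc i) N"
proof -
  interpret C0: module R "C i" by (rule C_module)
  interpret C1: module R "C (Suc i)" by (rule C_module)
  note N' = N_ext_facts[OF N x]
  obtain h' where h': "h' \<in> H i (N_ext N x)" "\<delta> i f = \<delta> i h'" using Bc_decomp[OF N'(1) f] by blast
  obtain h g1 where hg: "h \<in> H i N" "g1 \<in> carrier (C i)" "h' = h \<oplus>\<^bsub>C i\<^esub> x \<odot>\<^bsub>C i\<^esub> g1"
    using H_ext_decomp[OF N x h'(1)] by blast
  have hc: "h \<in> carrier (C i)" by (rule submod_in_carrier[OF H_submod[OF N] hg(1)])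
  note Hs = H_submod[OF N, of "Suc i"]
  have \<delta>f: "\<delta> i f = \<delta> i h \<oplus>\<^bsub>C (Suc i)\<^esub> x \<odot>\<^bsub>C (Suc i)\<^esub> \<delta> i g1"
    unfolding h'(2) hg(3) using module_hom_add[OF \<delta>_hom hc C0.smult_closed[OF x hg(2)]] module_hom_smult[OF \<delta>_hom x hg(2)] by simp
  let ?u = "g \<ominus>\<^bsub>C (Suc i)\<^esub> \<delta> i g1"
  have c: "\<delta> i h \<in> carrier (C (Suc i))" "\<delta> i g1 \<in> carrier (C (Suc i))" using \<delta>_carrier hc hg(2) by blast+
  have "x \<odot>\<^bsub>C (Suc i)\<^esub> ?u = \<delta> i h \<ominus>\<^bsub>C (Suc i)\<^esub> (\<delta> i f \<ominus>\<^bsub>C (Suc i)\<^esub> x \<odot>\<^bsub>C (Suc i)\<^esub> g)"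
    unfolding \<delta>f using c g x by (simp add: C1.smult_minus C1.minus_minus_add)
  then have "x \<odot>\<^bsub>C (Suc i)\<^esub> ?u \<in> H (Suc i) N"
    using C1.submod_minus[OF Hs \<delta>_H[OF hg(1)] fg] by simp
  then have "?u \<in> H (Suc i) N" using H_regular[OF x reg, where i = "Suc i" and f = ?u] c g by simp
  moreover have "g = \<delta> i g1 \<oplus>\<^bsub>C (Suc i)\<^esub> ?u"
    using c g C1.minus_add_cancel[OF g c(2)] C1.M.a_comm[of "\<delta> i g1" ?u] by simp
  ultimately show ?thesis unfolding Bc_def nat.case C1.in_set_add using hg(2) by blast
qed

text \<open>The connecting map is onto because \<open>x\<close> kills Ext^{i+1}(k, M/N):
  \<open>x g\<close> is a coboundary modulo \<open>N\<close>, and the cochain it bounds is the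
  preimage.\<close>

lemma connecting_exists:
  assumes N: "submod R M N" and x: "x \<in> \<mm>" and g: "g \<in> Zc (Suc i) N"
  shows "\<exists>f\<in>Zc i (N_ext N x). \<delta> i f \<ominus>\<^bsub>C (Suc i)\<^esub> x \<odot>\<^bsub>C (Suc i)\<^esub> g \<in> H (Suc i) N"
proof -
  interpret C1: module R "C (Suc i)" by (rule C_module)
  have xc: "x \<in> carrier R" using x by simp
  note N' = N_ext_facts[OF N xc]
  have gc: "g \<in> carrier (C (Suc i))" by (rule submod_in_carrier[OF Zc_submod[OF N] g])
  obtain f h where fh: "f \<in> carrier (C i)" "h \<in> H (Suc i) N" "x \<odot>\<^bsub>C (Suc i)\<^esub> g = \<delta> i f \<oplus>\<^bsub>C (Suc i)\<^esub> h"
    using Zc_homotopy[OF N x g] unfolding Bc_def nat.case C1.in_set_add by blast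
  note Hs = H_submod[OF N, of "Suc i"] and Hs' = H_submod[OF N'(1), of "Suc i"]
  have hc: "h \<in> carrier (C (Suc i))" by (rule submod_in_carrier[OF Hs fh(2)])
  have \<delta>f: "\<delta> i f \<in> carrier (C (Suc i))" by (rule \<delta>_carrier[OF fh(1)])
  have e: "\<delta> i f = x \<odot>\<^bsub>C (Suc i)\<^esub> g \<ominus>\<^bsub>C (Suc i)\<^esub> h" unfolding fh(3) using \<delta>f hc by simp
  have "\<delta> i f \<in> H (Suc i) (N_ext N x)"
    unfolding e by (rule C1.submod_minus[OF Hs' smult_in_H_ext[OF N xc gc]]) (use H_mono[OF N'(2)] fh(2) in blast)
  then have "f \<in> Zc i (N_ext N x)" using fh(1) by (simp add: Zc_def)
  moreover have "\<delta> i f \<ominus>\<^bsub>C (Suc i)\<^esub> x \<odot>\<^bsub>C (Suc i)\<^esub> g = \<ominus>\<^bsub>C (Suc i)\<^esub> h"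
    unfolding fh(3) by (rule C1.minus_add_self_left[OF \<delta>f hc])
  moreover have "\<ominus>\<^bsub>C (Suc i)\<^esub> h \<in> H (Suc i) N" by (rule C1.submod_uminus[OF Hs fh(2)])
  ultimately show ?thesis by metis
qed

text \<open>Ext^i(k, M/(N + xM)) is isomorphic to Ext^{i+1}(k, M/N) when Ext^i(k, M/N) vanishes.
  This is the long exact sequence of multiplication by \<open>x\<close>, which acts as zero on
  Ext.\<close>

lemma connecting_iso:
  assumes N: "submod R M N" and x: "x \<in> \<mm>" and reg: "\<And>v. v \<in> carrier M \<Longrightarrow> x \<odot>\<^bsub>M\<^esub> v \<in> N \<Longrightarrow> v \<in> N"
    and van: "Zc i N \<subseteq> Bc i N"
  shows "subquot_iso R (C i) (Bc i (N_ext N x)) (Zc i (N_ext N x)) (C (Suc i)) (Bc (Suc i) N) (Zc (Suc i) N)"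
proof -
  interpret C0: module R "C i" by (rule C_module)
  interpret C1: module R "C (Suc i)" by (rule C_module)
  interpret C2: module R "C (Suc (Suc i))" by (rule C_module)
  have xc: "x \<in> carrier R" using x by simp
  note N' = N_ext_facts[OF N xc]
  note Hs = H_submod[OF N, of "Suc i"] and Z0 = Zc_submod[OF N'(1), of i] and Z1 = Zc_submod[OF N, of "Suc i"]
  let ?d = "\<lambda>f g. \<delta> i f \<ominus>\<^bsub>C (Suc i)\<^esub> x \<odot>\<^bsub>C (Suc i)\<^esub> g"
  \<comment> \<open>The relation is rewritten as a composite of graphs and a congruence, restricted
    on both sides, so that its linearity needs no calculation.\<close>
  let ?\<sigma> = "{(f, g). f \<in> carrier (C i) \<and> g = \<delta> i f} O {(u, v). u \<in> carrier (C (Suc i)) \<and> v \<in> carrier (C (Suc i)) \<and>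
    u \<ominus>\<^bsub>C (Suc i)\<^esub> v \<in> H (Suc i) N} O {(f, g). f \<in> carrier (C (Suc i)) \<and> g = x \<odot>\<^bsub>C (Suc i)\<^esub> f}\<inverse>"
  let ?\<rho>' = "({(g, f). (g, f) \<in> {(f, g). (f, g) \<in> ?\<sigma> \<and> f \<in> Zc i (N_ext N x)}\<inverse> \<and> g \<in> Zc (Suc i) N})\<inverse>"
  let ?\<rho> = "{(f, g). f \<in> Zc i (N_ext N x) \<and> g \<in> Zc (Suc i) N \<and> ?d f g \<in> H (Suc i) N}"
  have zc: "f \<in> Zc i (N_ext N x) \<Longrightarrow> f \<in> carrier (C i)" "g \<in> Zc (Suc i) N \<Longrightarrow> g \<in> carrier (C (Suc i))" for f g
    using submod_in_carrier[OF Z0] submod_in_carrier[OF Z1] by blast+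
  have \<delta>c: "f \<in> carrier (C i) \<Longrightarrow> \<delta> i f \<in> carrier (C (Suc i))" for f by (rule \<delta>_carrier)
  show ?thesis
  proof (rule subquot_isoI[where \<rho> = ?\<rho>])
    have "linear_rel R (C i) (C (Suc i)) ?\<rho>'"
      by (rule linear_rel_converse[OF linear_rel_restrict[OF linear_rel_converse[OF linear_rel_restrict[OF
          linear_rel_comp[OF hom_graph_linear[OF C_module C_module \<delta>_hom] linear_rel_comp[OF linear_rel_congruent[OF Hs]
          linear_rel_converse[OF hom_graph_linear[OF C_module C_module smult_hom[OF C_module xc]]]]] Z0]] Z1]])
    also have "?\<rho>' = ?\<rho>" using zc \<delta>c xc by (auto simp: relcomp_unfold)
    finally show "linear_rel R (C i) (C (Suc i)) ?\<rho>" .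
    fix f assume f: "f \<in> Zc i (N_ext N x)"
    then have "\<delta> i f \<in> H (Suc i) (N_ext N x)" by (simp add: Zc_def)
    then obtain h g where hg: "h \<in> H (Suc i) N" "g \<in> carrier (C (Suc i))" "\<delta> i f = h \<oplus>\<^bsub>C (Suc i)\<^esub> x \<odot>\<^bsub>C (Suc i)\<^esub> g"
      using H_ext_decomp[OF N xc] by blast
    have hc: "h \<in> carrier (C (Suc i))" by (rule submod_in_carrier[OF Hs hg(1)])
    have d: "?d f g = h" unfolding hg(3) using hc hg(2) xc by simp
    have "\<zero>\<^bsub>C (Suc (Suc i))\<^esub> = \<delta> (Suc i) h \<oplus>\<^bsub>C (Suc (Suc i))\<^esub> x \<odot>\<^bsub>C (Suc (Suc i))\<^esub> \<delta> (Suc i) g"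
      using \<delta>\<delta>[OF zc(1)[OF f]] unfolding hg(3)
      using module_hom_add[OF \<delta>_hom hc C1.smult_closed[OF xc hg(2)]] module_hom_smult[OF \<delta>_hom xc hg(2)] by simp
    moreover have Hs2: "submod R (C (Suc (Suc i))) (H (Suc (Suc i)) N)" by (rule H_submod[OF N])
    ultimately have "x \<odot>\<^bsub>C (Suc (Suc i))\<^esub> \<delta> (Suc i) g \<in> H (Suc (Suc i)) N"
      using C2.add_in_submod_iff[OF Hs2 \<delta>_H[OF hg(1)], of "x \<odot>\<^bsub>C (Suc (Suc i))\<^esub> \<delta> (Suc i) g"]
        submodD(3)[OF Hs2] C2.smult_closed[OF xc \<delta>_carrier[OF hg(2)]] by simp
    then have "\<delta> (Suc i) g \<in> H (Suc (Suc i)) N"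
      using H_regular[OF xc reg \<delta>_carrier[OF hg(2)]] by blast
    then have "g \<in> Zc (Suc i) N" using hg(2) by (simp add: Zc_def)
    then show "\<exists>g. (f, g) \<in> ?\<rho>" using f d hg(1) by blast
  next
    fix f g assume "(f, g) \<in> ?\<rho>"
    then show "f \<in> Zc i (N_ext N x) \<and> g \<in> Zc (Suc i) N" by blast
  next
    fix g assume g: "g \<in> Zc (Suc i) N"
    obtain f where "f \<in> Zc i (N_ext N x)" "?d f g \<in> H (Suc i) N" using connecting_exists[OF N x g] by blast
    moreover have "g \<ominus>\<^bsub>C (Suc i)\<^esub> g \<in> Bc (Suc i) N"
      using zc(2)[OF g] submodD(3)[OF Bc_submod[OF N, of "Suc i"]] by simp
    ultimately show "\<exists>f h. (f, h) \<in> ?\<rho> \<and> g \<ominus>\<^bsub>C (Suc i)\<^esub> h \<in> Bc (Suc i) N" using g by blast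
  next
    fix f g assume a: "(f, g) \<in> ?\<rho>"
    then have fg: "f \<in> Zc i (N_ext N x)" "g \<in> Zc (Suc i) N" "?d f g \<in> H (Suc i) N" by auto
    note c = zc(1)[OF fg(1)] zc(2)[OF fg(2)]
    show "f \<in> Bc i (N_ext N x) \<longleftrightarrow> g \<in> Bc (Suc i) N"
    proof
      assume fB: "f \<in> Bc i (N_ext N x)"
      show "g \<in> Bc (Suc i) N" by (rule connecting_forward[OF N xc _ fB c(2) fg(3)]) (rule reg)
    next
      assume "g \<in> Bc (Suc i) N"
      then obtain g' h where gh: "g' \<in> carrier (C i)" "h \<in> H (Suc i) N" "g = \<delta> i g' \<oplus>\<^bsub>C (Suc i)\<^esub> h"
        unfolding Bc_def nat.case C1.in_set_add by blast
      have hc: "h \<in> carrier (C (Suc i))" by (rule submod_in_carrier[OF Hs gh(2)])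
      \<comment> \<open>Subtracting \<open>x g'\<close> makes \<open>f\<close> a cocycle already
        modulo \<open>N\<close>; there cocycles are coboundaries by \<open>van\<close>.\<close>
      let ?xg = "x \<odot>\<^bsub>C i\<^esub> g'"
      have xg: "?xg \<in> carrier (C i)" using xc gh(1) by simp
      have "\<delta> i (f \<ominus>\<^bsub>C i\<^esub> ?xg) = \<delta> i f \<ominus>\<^bsub>C (Suc i)\<^esub> x \<odot>\<^bsub>C (Suc i)\<^esub> \<delta> i g'"
        using hom_minus[OF C_module C_module \<delta>_hom c(1) xg] module_hom_smult[OF \<delta>_hom xc gh(1)] by simp
      also have "\<dots> = ?d f g \<oplus>\<^bsub>C (Suc i)\<^esub> x \<odot>\<^bsub>C (Suc i)\<^esub> h"
        unfolding gh(3) using xc hc \<delta>c[OF c(1)] \<delta>c[OF gh(1)]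
        by (simp add: C1.smult_r_distr a_minus_def C1.M.minus_add C1.M.a_ac C1.M.r_neg1 C1.M.r_neg2 C1.M.l_neg)
      finally have "\<delta> i (f \<ominus>\<^bsub>C i\<^esub> ?xg) \<in> H (Suc i) N"
        using submodD(4)[OF Hs fg(3) submodD(5)[OF Hs xc gh(2)]] by simp
      then have "f \<ominus>\<^bsub>C i\<^esub> ?xg \<in> Zc i N" using c(1) xg by (simp add: Zc_def)
      then have 1: "f \<ominus>\<^bsub>C i\<^esub> ?xg \<in> Bc i (N_ext N x)" using van Bc_mono[OF N'(2)] by blast
      have 2: "?xg \<in> Bc i (N_ext N x)"
        using smult_in_H_ext[OF N xc gh(1)] H_subset_Bc[OF N'(1)] by blast
      have "f \<ominus>\<^bsub>C i\<^esub> ?xg \<oplus>\<^bsub>C i\<^esub> ?xg \<in> Bc i (N_ext N x)" by (rule submodD(4)[OF Bc_submod[OF N'(1)] 1 2])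
      then show "f \<in> Bc i (N_ext N x)" using c(1) xg by simp
    qed
  qed (use Bc_subset_Zc[OF N'(1)] Bc_subset_Zc[OF N] Bc_submod[OF N'(1)] Bc_submod[OF N] Z1 in auto)
qed

lemma subquot_iso_refl:
  assumes "submod R P B" "submod R P Z" "B \<subseteq> Z"
  shows "subquot_iso R P B Z P B Z"
proof -
  have "linear_rel R P P {(x, y). x = y \<and> x \<in> Z}"
    by (rule linear_relI) (use submodD[OF assms(2)] submod_in_carrier[OF assms(2)] in auto)
  then show ?thesis
    unfolding subquot_iso_def using assms by (intro exI[of _ "{(x, y). x = y \<and> x \<in> Z}"]) auto
qed

text \<open>Rees's theorem: Ext^i(k, M/N) vanishes below the length of the sequence, and in that
  degree it is Hom(k, M/(N + (xs)M)). Removing the first element from the sequence moves every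
  statement down by one degree.\<close>

theorem ext_of_regular_sequence:
  "submod R M N \<Longrightarrow> set xs \<subseteq> \<mm> \<Longrightarrow> seq_regular M (carrier M) N xs \<Longrightarrow>
    (\<forall>i<length xs. Zc i N \<subseteq> Bc i N) \<and>
    subquot_iso R (C 0) (Bc 0 (seq_ext M (carrier M) N xs)) (Zc 0 (seq_ext M (carrier M) N xs))
      (C (length xs)) (Bc (length xs) N) (Zc (length xs) N)"
proof (induction xs arbitrary: N)
  case Nil
  then show ?case
    using subquot_iso_refl[OF Bc_submod Zc_submod Bc_subset_Zc] by simp
next
  case (Cons x xs)
  note N = Cons.prems(1)
  have x: "x \<in> \<mm>" and xc: "x \<in> carrier R" using Cons.prems(2) by auto
  have reg: "\<And>v. v \<in> carrier M \<Longrightarrow> x \<odot>\<^bsub>M\<^esub> v \<in> N \<Longrightarrow> v \<in> N"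
    and regs: "seq_regular M (carrier M) (N_ext N x) xs" using Cons.prems(3) by auto
  note N' = N_ext_facts[OF N xc]
  have IH: "\<And>i. i < length xs \<Longrightarrow> Zc i (N_ext N x) \<subseteq> Bc i (N_ext N x)"
    "subquot_iso R (C 0) (Bc 0 (seq_ext M (carrier M) (N_ext N x) xs)) (Zc 0 (seq_ext M (carrier M) (N_ext N x) xs))
      (C (length xs)) (Bc (length xs) (N_ext N x)) (Zc (length xs) (N_ext N x))"
    using Cons.IH[OF N'(1) _ regs] Cons.prems(2) by auto
  have van: "Zc i N \<subseteq> Bc i N" if i: "i < length (x # xs)" for i
  proof (cases i)
    case 0
    show ?thesis
    proof
      fix f assume f: "f \<in> Zc i N"
      \<comment> \<open>In degree 0 nothing can be shifted; \<open>x\<close> kills Hom(k, M/N) and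
        is regular on \<open>M/N\<close>, so this module is zero.\<close>
      have "x \<odot>\<^bsub>C 0\<^esub> f \<in> H 0 N" using Zc_homotopy[OF N x f] unfolding 0 by (simp add: Bc_def)
      then have "f \<in> H 0 N"
        using H_regular[OF xc reg, where i = 0 and f = f] submod_in_carrier[OF Zc_submod[OF N] f] 0 by simp
      then show "f \<in> Bc i N" using 0 by (simp add: Bc_def)
    qed
  next
    case (Suc j)
    show ?thesis
      unfolding Suc
    proof
      fix g assume g: "g \<in> Zc (Suc j) N"
      obtain f where f: "f \<in> Zc j (N_ext N x)" "\<delta> j f \<ominus>\<^bsub>C (Suc j)\<^esub> x \<odot>\<^bsub>C (Suc j)\<^esub> g \<in> H (Suc j) N"
        using connecting_exists[OF N x g] by blast
      have fB: "f \<in> Bc j (N_ext N x)" using IH(1)[of j] f(1) i Suc by auto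
      show "g \<in> Bc (Suc j) N"
        by (rule connecting_forward[OF N xc _ fB submod_in_carrier[OF Zc_submod[OF N] g] f(2)]) (rule reg)
    qed
  qed
  moreover have "subquot_iso R (C (length xs)) (Bc (length xs) (N_ext N x)) (Zc (length xs) (N_ext N x))
      (C (Suc (length xs))) (Bc (Suc (length xs)) N) (Zc (Suc (length xs)) N)"
    by (rule connecting_iso[OF N x reg van]) auto
  ultimately show ?case using subquot_iso_trans[OF IH(2)] by simp
qed

lemma Zc_zero_eq_ker: "Zc i {\<zero>\<^bsub>M\<^esub>} = ker_on (\<delta> i) (C i) (C (Suc i))"
proof -
  have "\<delta> i f \<in> H (Suc i) {\<zero>\<^bsub>M\<^esub>} \<longleftrightarrow> \<delta> i f = \<zero>\<^bsub>C (Suc i)\<^esub>" if f: "f \<in> carrier (C i)" for f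
  proof
    assume "\<delta> i f \<in> H (Suc i) {\<zero>\<^bsub>M\<^esub>}"
    then show "\<delta> i f = \<zero>\<^bsub>C (Suc i)\<^esub>"
      by (intro hom_module_eqI[OF \<delta>_carrier[OF f] hom_module_closed(3)[OF F_module M_module]])
        (simp add: H_def hom_module_simps(3))
  next
    assume "\<delta> i f = \<zero>\<^bsub>C (Suc i)\<^esub>"
    then show "\<delta> i f \<in> H (Suc i) {\<zero>\<^bsub>M\<^esub>}"
      using submodD(3)[OF H_submod[OF M.submod_zero]] by simp
  qed
  then show ?thesis by (auto simp: Zc_def ker_on_def)
qed

lemma Bc_zero_eq_image: "Bc i {\<zero>\<^bsub>M\<^esub>} = (case i of 0 \<Rightarrow> {\<zero>\<^bsub>C 0\<^esub>} | Suc j \<Rightarrow> \<delta> j ` carrier (C j))"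
proof -
  have H0: "H i {\<zero>\<^bsub>M\<^esub>} = {\<zero>\<^bsub>C i\<^esub>}" for i
  proof
    show "H i {\<zero>\<^bsub>M\<^esub>} \<subseteq> {\<zero>\<^bsub>C i\<^esub>}"
    proof
      fix f assume f: "f \<in> H i {\<zero>\<^bsub>M\<^esub>}"
      then have "f = \<zero>\<^bsub>C i\<^esub>"
        by (intro hom_module_eqI[OF _ hom_module_closed(3)[OF F_module M_module]]) (auto simp: H_def hom_module_simps(3))
      then show "f \<in> {\<zero>\<^bsub>C i\<^esub>}" by simp
    qed
    show "{\<zero>\<^bsub>C i\<^esub>} \<subseteq> H i {\<zero>\<^bsub>M\<^esub>}" using submodD(3)[OF H_submod[OF M.submod_zero]] by simp
  qed
  show ?thesis
  proof (cases i)
    case (Suc j)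
    interpret C1: module R "C (Suc j)" by (rule C_module)
    show ?thesis
      unfolding Bc_def Suc nat.case H0
      using C1.set_add_upper1[OF \<delta>_image_submod C1.submod_zero]
        C1.set_add_least[OF \<delta>_image_submod subset_refl, of "{\<zero>\<^bsub>C (Suc j)\<^esub>}"] submodD(3)[OF \<delta>_image_submod, of j]
      by blast
  qed (simp add: Bc_def H0)
qed

text \<open>Hom(k, M/N) is the socle of \<open>M/N\<close>: evaluate at an element \<open>u\<close>
  of \<open>F 0\<close> over the class of 1. Up to boundaries \<open>u\<close> generates
  \<open>F 0\<close>, so the value determines the class.\<close>

lemma Zc0_iso_socle:
  assumes N: "submod R M N"
  defines "S \<equiv> {v \<in> carrier M. \<forall>r\<in>\<mm>. r \<odot>\<^bsub>M\<^esub> v \<in> N}"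
  shows "subquot_iso R (C 0) (Bc 0 N) (Zc 0 N) M N S"
proof -
  interpret F0: module R "F 0" by (rule F_module)
  interpret k: module R k by (rule k)
  have S: "submod R M S"
  proof (rule submodI[OF M_module])
    fix r v assume r: "r \<in> carrier R" and v: "v \<in> S"
    have "s \<odot>\<^bsub>M\<^esub> (r \<odot>\<^bsub>M\<^esub> v) \<in> N" if s: "s \<in> \<mm>" for s
      using M.smult_commute[of s r v] submodD(5)[OF N r, of "s \<odot>\<^bsub>M\<^esub> v"] s v r by (simp add: S_def)
    then show "r \<odot>\<^bsub>M\<^esub> v \<in> S" using r v by (simp add: S_def)
  next
    show "S \<subseteq> carrier M" "\<zero>\<^bsub>M\<^esub> \<in> S" using submodD(3)[OF N] by (simp_all add: S_def)
    fix v w assume "v \<in> S" "w \<in> S"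
    then show "v \<oplus>\<^bsub>M\<^esub> w \<in> S" using submodD(4)[OF N] by (simp add: S_def M.smult_r_distr)
  qed
  have NS: "N \<subseteq> S" using submodD(2,5)[OF N] by (auto simp: S_def)
  have q1: "q \<one> \<in> carrier k" using q_surj by blast
  obtain u where u: "u \<in> carrier (F 0)" "e u = q \<one>" using augmentation_unit by blast
  have qr: "q r = r \<odot>\<^bsub>k\<^esub> q \<one>" if "r \<in> carrier R" for r using module_hom_smult[OF q_hom, of r \<one>] that by simp
  have split: "\<exists>r\<in>carrier R. \<exists>y\<in>carrier (F (Suc 0)). w = d 0 y \<oplus>\<^bsub>F 0\<^esub> r \<odot>\<^bsub>F 0\<^esub> u" if w: "w \<in> carrier (F 0)" for w
  proof -
    obtain r where r: "r \<in> carrier R" "e w = q r" using hom_in_carrier[OF e_hom w] q_surj by blast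
    have "e (w \<ominus>\<^bsub>F 0\<^esub> r \<odot>\<^bsub>F 0\<^esub> u) = \<zero>\<^bsub>k\<^esub>"
      using hom_minus[OF F_module k e_hom w, of "r \<odot>\<^bsub>F 0\<^esub> u"] r u module_hom_smult[OF e_hom r(1) u(1)] qr[OF r(1)] q1 by simp
    then obtain y where y: "y \<in> carrier (F (Suc 0))" "w \<ominus>\<^bsub>F 0\<^esub> r \<odot>\<^bsub>F 0\<^esub> u = d 0 y" using e_exact w r(1) u(1) by auto
    then have "w = d 0 y \<oplus>\<^bsub>F 0\<^esub> r \<odot>\<^bsub>F 0\<^esub> u" using F0.minus_add_cancel[OF w, of "r \<odot>\<^bsub>F 0\<^esub> u"] r(1) u(1) by simp
    then show ?thesis using r(1) y(1) by blast
  qed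
  let ?\<rho> = "{(f, v). (f, v) \<in> {(f, v). f \<in> carrier (C 0) \<and> v = f u} \<and> f \<in> Zc 0 N}"
  have Zf: "f \<in> module_hom R (F 0) M" "\<And>y. y \<in> carrier (F (Suc 0)) \<Longrightarrow> f (d 0 y) \<in> N" if f: "f \<in> Zc 0 N" for f
    using f hom_module_hom[of f R "F 0" M] by (auto simp: Zc_def H_def \<delta>_value)
  note Z = Zc_submod[OF N, of 0]
  show ?thesis
  proof (rule subquot_isoI[where \<rho> = ?\<rho>])
    have "(\<lambda>f. f u) \<in> module_hom R (C 0) M"
      using u(1) C_value[of _ 0 u] by (auto simp: module_hom_def hom_module_simps(2,4))
    then show "linear_rel R (C 0) M ?\<rho>" by (intro linear_rel_restrict hom_graph_linear C_module M_module Z)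
    fix f v assume "(f, v) \<in> ?\<rho>"
    then have f: "f \<in> Zc 0 N" and v: "v = f u" by auto
    have fuc: "f u \<in> carrier M" by (rule hom_in_carrier[OF Zf(1)[OF f] u(1)])
    have "r \<odot>\<^bsub>M\<^esub> f u \<in> N" if r: "r \<in> \<mm>" for r
    proof -
      obtain y where y: "y \<in> carrier (F (Suc 0))" "r \<odot>\<^bsub>F 0\<^esub> u = d 0 y" using smult_boundary[OF r u(1)] by blast
      have "r \<odot>\<^bsub>M\<^esub> f u = f (d 0 y)" using module_hom_smult[OF Zf(1)[OF f] _ u(1), of r] r y(2) by simp
      then show ?thesis using Zf(2)[OF f y(1)] by simp
    qed
    then show "f \<in> Zc 0 N \<and> v \<in> S" using f v fuc by (simp add: S_def)
    show "f \<in> Bc 0 N \<longleftrightarrow> v \<in> N"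
    proof
      assume "f \<in> Bc 0 N" then show "v \<in> N" using u(1) v by (simp add: Bc_def H_def)
    next
      assume vN: "v \<in> N"
      have "f w \<in> N" if w: "w \<in> carrier (F 0)" for w
      proof -
        obtain r y where r: "r \<in> carrier R" "y \<in> carrier (F (Suc 0))" "w = d 0 y \<oplus>\<^bsub>F 0\<^esub> r \<odot>\<^bsub>F 0\<^esub> u" using split[OF w] by blast
        have "f w = f (d 0 y) \<oplus>\<^bsub>M\<^esub> r \<odot>\<^bsub>M\<^esub> f u"
          unfolding r(3) using module_hom_add[OF Zf(1)[OF f] d_carrier[OF r(2)]] module_hom_smult[OF Zf(1)[OF f] r(1) u(1)] r(1) u(1) by simp
        then show ?thesis using submodD(4)[OF N Zf(2)[OF f r(2)] submodD(5)[OF N r(1)]] vN v by simp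
      qed
      then show "f \<in> Bc 0 N" using submod_in_carrier[OF Z f] by (simp add: Bc_def H_def)
    qed
  next
    fix f assume "f \<in> Zc 0 N" then show "\<exists>v. (f, v) \<in> ?\<rho>" using submod_in_carrier[OF Z] by blast
  next
    fix v assume v: "v \<in> S"
    then have vc: "v \<in> carrier M" and vN: "\<And>r. r \<in> \<mm> \<Longrightarrow> r \<odot>\<^bsub>M\<^esub> v \<in> N" by (auto simp: S_def)
    obtain f where f: "f \<in> module_hom R (F 0) M"
      and fr: "\<And>w. w \<in> carrier (F 0) \<Longrightarrow> \<exists>r\<in>carrier R. e w = q r \<and> f w = r \<odot>\<^bsub>M\<^esub> v"
      by (rule augmentation_lift[OF M_module vc], rule that)
    define f' where "f' = restrict f (carrier (F 0))"
    have f': "f' \<in> carrier (C 0)" unfolding f'_def by (rule hom_module_restrict[OF F_module f])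
    have "f' (d 0 y) \<in> N" if y: "y \<in> carrier (F (Suc 0))" for y
    proof -
      have dy: "d 0 y \<in> carrier (F 0)" by (rule d_carrier[OF y])
      obtain r where r: "r \<in> carrier R" "e (d 0 y) = q r" "f (d 0 y) = r \<odot>\<^bsub>M\<^esub> v" using fr[OF dy] by blast
      have "q r = \<zero>\<^bsub>k\<^esub>" using e_exact[OF dy] y r(2) by auto
      then show ?thesis using q_ker[OF r(1)] vN r(3) dy by (simp add: f'_def)
    qed
    then have fZ: "f' \<in> Zc 0 N" using f' \<delta>_carrier[OF f'] by (simp add: Zc_def H_def \<delta>_value)
    \<comment> \<open>Evaluation at \<open>u\<close> returns \<open>r v\<close> with
      \<open>r\<close> only congruent to 1, hence \<open>v\<close> only modulo
      \<open>N\<close>.\<close>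
    obtain r where r: "r \<in> carrier R" "q \<one> = q r" "f u = r \<odot>\<^bsub>M\<^esub> v" using fr[OF u(1)] u(2) by auto
    have "(\<one> \<ominus> r) \<odot>\<^bsub>M\<^esub> v \<in> N" by (rule vN[OF residue_eq]) (use r in auto)
    then have "v \<ominus>\<^bsub>M\<^esub> f' u \<in> N" using r vc u(1) by (simp add: f'_def M.smult_minus_left)
    then show "\<exists>f m. (f, m) \<in> ?\<rho> \<and> v \<ominus>\<^bsub>M\<^esub> m \<in> N" using fZ f' by blast
  qed (use NS S N Bc_submod[OF N] Bc_subset_Zc[OF N] in auto)
qed

end

section \<open>The residue field itself as an instance\<close>

lemma (in noetherian_local_ring) fin_gen_residue_module:
  assumes k: "module R k" and q: "q \<in> module_hom R (ring_module R) k" "q ` carrier R = carrier k"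
  shows "fin_gen R k"
proof -
  interpret k: module R k by fact
  have q1: "q \<one> \<in> carrier k" using q(2) by blast
  have sp: "submod R k (k.span {q \<one>})" "{q \<one>} \<subseteq> k.span {q \<one>}"
    using k.span_is_submodule[of "{q \<one>}"] k.in_own_span[of "{q \<one>}"] q1 by auto
  have "carrier k \<subseteq> k.span {q \<one>}"
  proof
    fix v assume "v \<in> carrier k"
    then obtain r where "r \<in> carrier R" "v = q r" using q(2) by blast
    then have "r \<in> carrier R" "v = r \<odot>\<^bsub>k\<^esub> q \<one>" using module_hom_smult[OF q(1), of r \<one>] by simp_all
    then show "v \<in> k.span {q \<one>}" using submodD(5)[OF sp(1)] sp(2) by simp
  qed
  then have "k.span {q \<one>} = carrier k" using submodD(2)[OF sp(1)] by blast
  then show ?thesis unfolding fin_gen_def using k q1 by (intro conjI exI[of _ "{q \<one>}"]) simp_all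
qed

lemma (in noetherian_local_ring) residue_resolution_exists:
  obtains b d e where "some_resolution R (residue_module R \<mm>) = (b, d)"
    "residue_resolution R \<mm> (residue_module R \<mm>) b d e residue_class"
proof -
  note q = residue_module_module residue_class_facts(1) residue_class_facts(2)[symmetric] residue_class_facts(3)
  obtain b d e where some: "some_resolution R (residue_module R \<mm>) = (b, d)"
    and res: "free_resolution R (residue_module R \<mm>) b d e"
    by (rule some_resolution_is_resolution[OF is_noetherian fin_gen_residue_module[OF q(1-3)]])
  have "residue_resolution R \<mm> (residue_module R \<mm>) b d e residue_class"
    by (intro residue_resolution.intro residue_resolution_axioms.intro noetherian_local_ring_axioms q res)
  with some show thesis by (rule that)
qed

section \<open>Ext into a module of finite injective dimension\<close>

lemma subquot_iso_regular:
  assumes iso: "subquot_iso R M B Z N B' Z'" and x: "x \<in> carrier R"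
    and reg: "\<And>z. z \<in> Z' \<Longrightarrow> x \<odot>\<^bsub>N\<^esub> z \<in> B' \<Longrightarrow> z \<in> B'"
    and z: "z \<in> Z" "x \<odot>\<^bsub>M\<^esub> z \<in> B"
  shows "z \<in> B"
proof -
  obtain \<rho> where r: "linear_rel R M N \<rho>" "Domain \<rho> = Z" "Range \<rho> = Z'"
      "\<And>x y. (x, y) \<in> \<rho> \<Longrightarrow> x \<in> B \<longleftrightarrow> y \<in> B'"
    using iso unfolding subquot_iso_def by blast
  obtain w where w: "(z, w) \<in> \<rho>" using z(1) r(2) by blast
  have "x \<odot>\<^bsub>N\<^esub> w \<in> B'" using r(4)[OF linear_rel_smult[OF r(1) x w]] z(2) by blast
  then show ?thesis using reg[of w] r(3,4) w by blast
qed

lemma subquot_iso_quotient: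
  assumes iso: "subquot_iso R M B Z N B' Z'" and x: "x \<in> carrier R"
  shows "subquot_iso R M (plus_mult M B x Z) Z N (plus_mult N B' x Z') Z'"
proof -
  \<comment> \<open>Isolated for an arbitrary linear relation, since the opposite inclusion is the
    same statement for the converse relation.\<close>
  have half: "y \<in> plus_mult N B' x Z'"
    if r: "linear_rel R M N \<rho>" "Domain \<rho> = Z" "Range \<rho> = Z'" "\<And>x y. (x, y) \<in> \<rho> \<Longrightarrow> x \<in> B \<longleftrightarrow> y \<in> B'"
      and "B \<subseteq> Z" and wy: "(w, y) \<in> \<rho>" "w \<in> plus_mult M B x Z"
    for M :: "('a, 'x, 'y) module_scheme" and N :: "('a, 'z, 'w) module_scheme" and B Z B' Z' \<rho> w y
  proof -
    interpret M: module R M by (rule linear_relD(1)[OF r(1)])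
    interpret N: module R N by (rule linear_relD(2)[OF r(1)])
    note c = linear_rel_carrier[OF r(1)]
    obtain b z where bz: "b \<in> B" "z \<in> Z" "w = b \<oplus>\<^bsub>M\<^esub> x \<odot>\<^bsub>M\<^esub> z" using wy(2) unfolding M.in_set_add by blast
    obtain z' where z': "(z, z') \<in> \<rho>" using bz(2) r(2) by blast
    have xz: "(x \<odot>\<^bsub>M\<^esub> z, x \<odot>\<^bsub>N\<^esub> z') \<in> \<rho>" by (rule linear_rel_smult[OF r(1) x z'])
    have bc: "b \<in> carrier M" using bz(1) \<open>B \<subseteq> Z\<close> r(2) c by blast
    have "w \<ominus>\<^bsub>M\<^esub> x \<odot>\<^bsub>M\<^esub> z = b" unfolding bz(3) using bc c[OF xz] by simp
    then have "(b, y \<ominus>\<^bsub>N\<^esub> x \<odot>\<^bsub>N\<^esub> z') \<in> \<rho>" using linear_rel_minus[OF r(1) wy(1) xz] by simp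
    then have "y \<ominus>\<^bsub>N\<^esub> x \<odot>\<^bsub>N\<^esub> z' \<in> B'" using r(4) bz(1) by blast
    moreover have "y = (y \<ominus>\<^bsub>N\<^esub> x \<odot>\<^bsub>N\<^esub> z') \<oplus>\<^bsub>N\<^esub> x \<odot>\<^bsub>N\<^esub> z'" using c[OF wy(1)] c[OF xz] by simp
    moreover have "z' \<in> Z'" using z' r(3) by blast
    ultimately show ?thesis unfolding N.in_set_add by blast
  qed
  obtain \<rho> where r: "linear_rel R M N \<rho>" "Domain \<rho> = Z" "Range \<rho> = Z'"
      "\<And>x y. (x, y) \<in> \<rho> \<Longrightarrow> x \<in> B \<longleftrightarrow> y \<in> B'" and s: "B \<subseteq> Z" "B' \<subseteq> Z'" "submod R M B" "submod R N B'"
    using iso unfolding subquot_iso_def by blast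
  have Z: "submod R M Z" "submod R N Z'" using linear_rel_Domain[OF r(1)] linear_rel_Range[OF r(1)] r(2,3) by auto
  have c: "linear_rel R N M (\<rho>\<inverse>)" "Domain (\<rho>\<inverse>) = Z'" "Range (\<rho>\<inverse>) = Z"
    using linear_rel_converse[OF r(1)] r(2,3) by auto
  have r4: "\<And>y x. (y, x) \<in> \<rho>\<inverse> \<Longrightarrow> y \<in> B' \<longleftrightarrow> x \<in> B" using r(4) by blast
  have iff: "w \<in> plus_mult M B x Z \<longleftrightarrow> y \<in> plus_mult N B' x Z'" if wy: "(w, y) \<in> \<rho>" for w y
  proof
    assume a: "w \<in> plus_mult M B x Z"
    show "y \<in> plus_mult N B' x Z'" by (rule half[OF r(1-3) _ s(1) wy a]) (rule r(4))
  next
    assume a: "y \<in> plus_mult N B' x Z'"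
    have yw: "(y, w) \<in> \<rho>\<inverse>" using wy by blast
    show "w \<in> plus_mult M B x Z" by (rule half[OF c _ s(2) yw a]) (rule r4)
  qed
  show ?thesis
    unfolding subquot_iso_def
    using r(1-3) iff module.seq_step(1,2)[OF submodD(1)[OF s(3)] s(3) Z(1) s(1) x]
      module.seq_step(1,2)[OF submodD(1)[OF s(4)] s(4) Z(2) s(2) x]
    by (intro exI[of _ \<rho>]) blast
qed

text \<open>Injectivity in terms of relations: a linear relation that relates 0 only to 0 is a
  homomorphism on its domain, a submodule of \<open>B\<close>. The type of \<open>B\<close> is the
  one on which \<open>injective_module\<close> tests.\<close>

lemma injective_extend:
  fixes B :: "('r, nat \<Rightarrow> 'r) module" and E :: "('r, 'm) module"
  assumes E: "injective_module R E" and \<rho>: "linear_rel R B E \<rho>" and single: "\<And>y. (\<zero>\<^bsub>B\<^esub>, y) \<in> \<rho> \<Longrightarrow> y = \<zero>\<^bsub>E\<^esub>"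
  obtains g where "g \<in> module_hom R B E" "\<And>x y. (x, y) \<in> \<rho> \<Longrightarrow> g x = y"
proof -
  interpret B: module R B by (rule linear_relD(1)[OF \<rho>])
  interpret E: module R E by (rule linear_relD(2)[OF \<rho>])
  note c = linear_rel_carrier[OF \<rho>]
  have uniq: "y = y'" if a: "(x, y) \<in> \<rho>" "(x, y') \<in> \<rho>" for x y y'
  proof -
    have "(\<zero>\<^bsub>B\<^esub>, y \<ominus>\<^bsub>E\<^esub> y') \<in> \<rho>" using linear_rel_minus[OF \<rho> a] c[OF a(1)] by simp
    then show ?thesis using single c[OF a(1)] c[OF a(2)] by fastforce
  qed
  define f where "f x = (THE y. (x, y) \<in> \<rho>)" for x
  have f: "f x = y" if a: "(x, y) \<in> \<rho>" for x y unfolding f_def using uniq a by blast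
  have "f \<in> module_hom R (B\<lparr>carrier := Domain \<rho>\<rparr>) E"
    unfolding module_hom_def
  proof (intro CollectI conjI allI impI)
    show "f \<in> carrier (B\<lparr>carrier := Domain \<rho>\<rparr>) \<rightarrow> carrier E" using f c by fastforce
  next
    fix x x' assume "x \<in> carrier (B\<lparr>carrier := Domain \<rho>\<rparr>) \<and> x' \<in> carrier (B\<lparr>carrier := Domain \<rho>\<rparr>)"
    then obtain y y' where a: "(x, y) \<in> \<rho>" "(x', y') \<in> \<rho>" by auto
    show "f (x \<oplus>\<^bsub>B\<lparr>carrier := Domain \<rho>\<rparr>\<^esub> x') = f x \<oplus>\<^bsub>E\<^esub> f x'"
      using f[OF linear_rel_add[OF \<rho> a]] f[OF a(1)] f[OF a(2)] by simp
  next
    fix r x assume "r \<in> carrier R \<and> x \<in> carrier (B\<lparr>carrier := Domain \<rho>\<rparr>)"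
    then obtain y where a: "r \<in> carrier R" "(x, y) \<in> \<rho>" by auto
    show "f (r \<odot>\<^bsub>B\<lparr>carrier := Domain \<rho>\<rparr>\<^esub> x) = r \<odot>\<^bsub>E\<^esub> f x"
      using f[OF linear_rel_smult[OF \<rho> a]] f[OF a(2)] by simp
  qed
  then obtain g where g: "g \<in> module_hom R B E" "\<forall>x\<in>Domain \<rho>. g x = f x"
    using E linear_rel_Domain[OF \<rho>] B.module_axioms unfolding injective_module_def by blast
  show thesis by (rule that[OF g(1)]) (use g(2) f in auto)
qed

subsection \<open>Sums and colons of ideals\<close>

context cring
begin

definition plus_ideal :: "'a set \<Rightarrow> 'a \<Rightarrow> 'a set" where
  "plus_ideal J a = J <+> (\<lambda>r. r \<otimes> a) ` carrier R"

text \<open>Counterpart of \<open>plus_ideal\<close>: multiplication by \<open>a\<close> embeds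
  \<open>R/(J : a)\<close> into \<open>R/J\<close> with cokernel \<open>R/(J + Ra)\<close>.\<close>

definition colon_ideal :: "'a set \<Rightarrow> 'a \<Rightarrow> 'a set" where
  "colon_ideal J a = {r \<in> carrier R. r \<otimes> a \<in> J}"

lemma plus_ideal_facts:
  assumes "ideal J R" "a \<in> carrier R"
  shows "ideal (plus_ideal J a) R" "J \<subseteq> plus_ideal J a" "a \<in> plus_ideal J a"
    "x \<in> plus_ideal J a \<longleftrightarrow> (\<exists>j\<in>J. \<exists>r\<in>carrier R. x = j \<oplus> r \<otimes> a)"
  using module.adjoin_props[OF module_ring_module ideal_submod[OF assms(1)], of a] assms(2)
    module.in_adjoin[OF module_ring_module, of x J a]
  unfolding plus_ideal_def by (simp_all add: submod_iff_ideal)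

lemma colon_ideal_facts:
  assumes "ideal J R" "a \<in> carrier R"
  shows "ideal (colon_ideal J a) R" "J \<subseteq> colon_ideal J a"
proof -
  show "ideal (colon_ideal J a) R"
    using module.annihilator_ideal[OF module_ring_module ideal_submod[OF assms(1)], of a] assms(2)
    unfolding colon_ideal_def by simp
  show "J \<subseteq> colon_ideal J a"
    using ideal.I_r_closed[OF assms(1)] ideal.Icarr[OF assms(1)] assms(2) by (auto simp: colon_ideal_def)
qed

lemma mlength_plus_ideal:
  assumes "ideal J R" "a \<in> carrier R"
  shows "mlength R (ring_module R) J (plus_ideal J a) = colength R (colon_ideal J a)"
  using module.mlength_adjoin[OF module_ring_module ideal_submod[OF assms(1)], of a] assms(2)
  by (simp add: plus_ideal_def colon_ideal_def)

lemma mlength_ideal_add: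
  assumes "ideal J R" "ideal K R" "J \<subseteq> K"
  shows "colength R J = mlength R (ring_module R) J K + colength R K"
  using module.mlength_add[OF module_ring_module ideal_submod[OF assms(1)] ideal_submod[OF assms(2)]
      module.submod_carrier[OF module_ring_module] assms(3)] submodD(2)[OF ideal_submod[OF assms(2)]] by simp

definition seq_ideal :: "'a list \<Rightarrow> 'a set" where
  "seq_ideal ys = seq_ext (ring_module R) (carrier R) {\<zero>} ys"

definition regular_on_ring :: "'a list \<Rightarrow> bool" where
  "regular_on_ring ys \<longleftrightarrow> set ys \<subseteq> carrier R \<and> seq_regular (ring_module R) (carrier R) {\<zero>} ys"

lemma seq_ideal_ideal: "set ys \<subseteq> carrier R \<Longrightarrow> ideal (seq_ideal ys) R"
  using module.seq_ext_props[OF module_ring_module module.submod_carrier[OF module_ring_module]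
      module.submod_zero[OF module_ring_module], of ys] submod_iff_ideal
  by (simp add: seq_ideal_def)

lemma seq_ideal_snoc:
  assumes "y \<in> carrier R"
  shows "seq_ideal (ys @ [y]) = plus_ideal (seq_ideal ys) y"
proof -
  have "(\<lambda>z. y \<otimes> z) ` carrier R = (\<lambda>r. r \<otimes> y) ` carrier R" using m_comm[OF assms] by auto
  then show ?thesis by (simp add: seq_ideal_def plus_ideal_def seq_ext_snoc)
qed

lemma regular_on_ring_snoc:
  assumes "regular_on_ring (ys @ [y])"
  shows "regular_on_ring ys" "y \<in> carrier R" "colon_ideal (seq_ideal ys) y = seq_ideal ys"
proof -
  show r: "regular_on_ring ys" and y: "y \<in> carrier R"
    using assms by (auto simp: regular_on_ring_def seq_regular_snoc)
  have "ideal (seq_ideal ys) R" using seq_ideal_ideal r by (simp add: regular_on_ring_def)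
  from colon_ideal_facts(2)[OF this y]
  show "colon_ideal (seq_ideal ys) y = seq_ideal ys"
    using assms m_comm[OF y] by (auto simp: regular_on_ring_def seq_regular_snoc seq_ideal_def colon_ideal_def)
qed

end

section \<open>Socle elements and composition series of \<open>R/J\<close>\<close>

context noetherian_local_ring
begin

text \<open>Finite colength provides a minimal ideal \<open>K\<close> strictly above
  \<open>J\<close>. Any \<open>a\<close> in \<open>K\<close> outside \<open>J\<close> works: if
  \<open>r a\<close> with \<open>r\<close> in \<open>\<mm>\<close> were outside \<open>J\<close>, it
  would generate \<open>K\<close> over \<open>J\<close> as well, so \<open>a = j + s r a\<close>,
  contradicting that \<open>1 - s r\<close> is a unit.\<close>

lemma socle_element:
  assumes J: "ideal J R" "J \<noteq> carrier R" and fin: "colength R J \<noteq> \<infinity>"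
  obtains a where "a \<in> carrier R" "a \<notin> J" "colon_ideal J a = \<mm>"
proof -
  let ?l = "\<lambda>K. mlength R (ring_module R) J K"
  let ?P = "\<lambda>K. ideal K R \<and> J \<subset> K"
  have car: "?P (carrier R)" using J oneideal ideal.Icarr[OF J(1)] by blast
  have sub: "K \<subseteq> carrier R" if "ideal K R" for K using ideal.Icarr[OF that] by blast
  have fK: "?l K \<noteq> \<infinity>" if K: "?P K" for K
    using mlength_ideal_add[OF J(1), of K] K fin by auto
  obtain K where K: "?P K" and min: "\<And>K'. ?P K' \<Longrightarrow> the_enat (?l K) \<le> the_enat (?l K')"
    using ex_has_least_nat[of ?P "carrier R" "\<lambda>K. the_enat (?l K)"] car by blast
  have least: "K' = K" if K': "?P K'" "K' \<subseteq> K" for K'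
  proof (rule ccontr)
    assume ne: "K' \<noteq> K"
    have s: "submod R (ring_module R) J" "submod R (ring_module R) K'" "submod R (ring_module R) K"
      using J(1) K' K ideal_submod by auto
    have "?l K = ?l K' + mlength R (ring_module R) K' K"
      using module.mlength_add[OF module_ring_module s] K' by blast
    moreover have "1 \<le> mlength R (ring_module R) K' K" by (rule mlength_pos[OF s(2,3)]) (use K'(2) ne in blast)
    moreover obtain p q where "?l K = enat p" "?l K' = enat q" using fK[OF K] fK[OF K'(1)] by auto
    moreover have "the_enat (?l K) \<le> the_enat (?l K')" by (rule min[OF K'(1)])
    ultimately show False by (cases "mlength R (ring_module R) K' K") (auto simp: one_enat_def)
  qed
  obtain a where a: "a \<in> K" "a \<notin> J" using K by blast
  have ac: "a \<in> carrier R" using sub a(1) K by blast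
  have Js: "submod R (ring_module R) J" by (rule ideal_submod[OF J(1)])
  have "r \<otimes> a \<in> J" if r: "r \<in> \<mm>" for r
  proof (rule ccontr)
    assume n: "r \<otimes> a \<notin> J"
    have rc: "r \<otimes> a \<in> carrier R" using r ac by simp
    note p = plus_ideal_facts[OF J(1) rc]
    have Ki: "ideal K R" using K by blast
    have raK: "r \<otimes> a \<in> K" using ideal.I_l_closed[OF Ki a(1)] r by simp
    have "plus_ideal J (r \<otimes> a) \<subseteq> K"
    proof
      fix x assume "x \<in> plus_ideal J (r \<otimes> a)"
      then obtain j s where "j \<in> J" "s \<in> carrier R" "x = j \<oplus> s \<otimes> (r \<otimes> a)" unfolding p(4) by blast
      then show "x \<in> K" using K submodD(4,5)[OF ideal_submod[OF Ki]] raK by auto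
    qed
    then have "plus_ideal J (r \<otimes> a) = K" using least[of "plus_ideal J (r \<otimes> a)"] p(1-3) n by blast
    then have "a \<in> plus_ideal J (r \<otimes> a)" using a(1) by simp
    then obtain j s where js: "j \<in> J" "s \<in> carrier R" "a = j \<oplus> s \<otimes> (r \<otimes> a)"
      unfolding plus_ideal_facts(4)[OF J(1) rc] by blast
    have sr: "s \<otimes> r \<in> \<mm>" using r js(2) I_l_closed by blast
    have "a \<ominus> (s \<otimes> r) \<otimes> a = j"
      using js(3) m_assoc[of s r a] js(2) r ac ideal.Icarr[OF J(1) js(1)]
        module.add_minus_cancel[OF module_ring_module, of j "s \<otimes> (r \<otimes> a)"] by simp
    then have "a \<in> J" using not_in_of_one_minus[OF Js _ sr, of a] ac js(1) by simp
    then show False using a(2) by simp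
  qed
  then have "\<mm> \<subseteq> colon_ideal J a" by (auto simp: colon_ideal_def)
  moreover have "\<one> \<notin> colon_ideal J a" using a(2) ac by (simp add: colon_ideal_def)
  then have "colon_ideal J a \<noteq> carrier R" using one_closed by blast
  ultimately have "colon_ideal J a = \<mm>"
    using proper_ideal_subset_\<mm>[OF colon_ideal_facts(1)[OF J(1) ac]] by blast
  with ac a(2) show thesis by (rule that)
qed

text \<open>Induction along a composition series of \<open>R/J\<close>: passing from
  \<open>J\<close> to \<open>J + Ra\<close> removes one copy of \<open>k\<close> from the bottom of
  \<open>R/J\<close>.\<close>

lemma finite_colength_induct [consumes 2, case_names top step]:
  assumes "ideal J R" "colength R J = enat n"
    and top: "P (carrier R)"
    and step: "\<And>J a. ideal J R \<Longrightarrow> a \<in> carrier R \<Longrightarrow> a \<notin> J \<Longrightarrow> colon_ideal J a = \<mm> \<Longrightarrow>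
      colength R J = 1 + colength R (plus_ideal J a) \<Longrightarrow>
      colength R J \<noteq> \<infinity> \<Longrightarrow> P (plus_ideal J a) \<Longrightarrow> P J"
  shows "P J"
  using assms(1,2)
proof (induction n arbitrary: J)
  case (0 J)
  show ?case
  proof (cases "J = carrier R")
    case False
    have "1 \<le> colength R J"
      by (rule mlength_pos) (use 0 False ideal_submod oneideal submodD(2)[OF ideal_submod[OF 0(1)]] in auto)
    then show ?thesis using 0 by (simp add: one_enat_def)
  qed (simp add: top)
next
  case (Suc n J)
  have ne: "J \<noteq> carrier R" using Suc.prems(2) mlength_self[of R "ring_module R" "carrier R"] by (auto simp: zero_enat_def)
  obtain a where a: "a \<in> carrier R" "a \<notin> J" "colon_ideal J a = \<mm>"
    using socle_element[OF Suc.prems(1) ne] Suc.prems(2) by auto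
  note p = plus_ideal_facts[OF Suc.prems(1) a(1)]
  have eq: "colength R J = 1 + colength R (plus_ideal J a)"
    using mlength_ideal_add[OF Suc.prems(1) p(1,2)] mlength_plus_ideal[OF Suc.prems(1) a(1)] a(3) mlength_\<mm> by simp
  then have l: "colength R (plus_ideal J a) = enat n"
    using Suc.prems(2) by (cases "colength R (plus_ideal J a)") (auto simp: one_enat_def)
  show ?case
    by (rule step[OF Suc.prems(1) a eq _ Suc.IH[OF p(1) l]]) (simp add: Suc.prems(2))
qed

end

subsection \<open>The complexes \<open>0 :\<^sub>I J\<close>\<close>

text \<open>\<open>Ext(R/J, W)\<close> is the cohomology of the complex of elements annihilated by \<open>J\<close> in an
  injective resolution of \<open>W\<close>.\<close>

locale injective_resolution = noetherian_local_ring +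
  fixes W :: "('a, 'w) module" and I :: "nat \<Rightarrow> ('a, nat \<Rightarrow> 'a) module"
    and D :: "nat \<Rightarrow> (nat \<Rightarrow> 'a) \<Rightarrow> (nat \<Rightarrow> 'a)" and \<epsilon> :: "'w \<Rightarrow> (nat \<Rightarrow> 'a)" and n :: nat
  assumes W: "module R W" and inj: "\<And>i. injective_module R (I i)"
    and \<epsilon>_hom: "\<epsilon> \<in> module_hom R W (I 0)" and \<epsilon>_inj: "inj_on \<epsilon> (carrier W)"
    and D_hom: "\<And>i. D i \<in> module_hom R (I i) (I (Suc i))"
    and \<epsilon>_exact: "\<epsilon> ` carrier W = ker_on (D 0) (I 0) (I (Suc 0))"
    and D_exact: "\<And>i. D i ` carrier (I i) = ker_on (D (Suc i)) (I (Suc i)) (I (Suc (Suc i)))"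
    and I_zero: "\<And>i. i > n \<Longrightarrow> carrier (I i) = {\<zero>\<^bsub>I i\<^esub>}"
begin

lemma I_module: "module R (I i)"
  using inj by (simp add: injective_module_def)

sublocale W: module R W by (rule W)

lemma D_carrier: "z \<in> carrier (I i) \<Longrightarrow> D i z \<in> carrier (I (Suc i))"
  by (rule hom_in_carrier[OF D_hom])

lemma DD: "z \<in> carrier (I i) \<Longrightarrow> D (Suc i) (D i z) = \<zero>\<^bsub>I (Suc (Suc i))\<^esub>"
  using D_exact[of i] by (auto simp: ker_on_def)

lemma D_smult: "r \<in> carrier R \<Longrightarrow> z \<in> carrier (I i) \<Longrightarrow> D i (r \<odot>\<^bsub>I i\<^esub> z) = r \<odot>\<^bsub>I (Suc i)\<^esub> D i z"
  by (rule module_hom_smult[OF D_hom])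

lemma D_minus: "z \<in> carrier (I i) \<Longrightarrow> z' \<in> carrier (I i) \<Longrightarrow> D i (z \<ominus>\<^bsub>I i\<^esub> z') = D i z \<ominus>\<^bsub>I (Suc i)\<^esub> D i z'"
  by (rule hom_minus[OF I_module I_module D_hom])

definition "Ann J i = {z \<in> carrier (I i). \<forall>r\<in>J. r \<odot>\<^bsub>I i\<^esub> z = \<zero>\<^bsub>I i\<^esub>}"

definition "Zy J i = {z \<in> Ann J i. D i z = \<zero>\<^bsub>I (Suc i)\<^esub>}"

definition "By J i = (case i of 0 \<Rightarrow> {\<zero>\<^bsub>I 0\<^esub>} | Suc j \<Rightarrow> D j ` Ann J j)"

text \<open>Read as Ext^i(R/J, W) = 0.\<close>

definition "vanishes J i \<longleftrightarrow> Zy J i \<subseteq> By J i"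

lemma Ann_carrier: "z \<in> Ann J i \<Longrightarrow> z \<in> carrier (I i)"
  by (simp add: Ann_def)

lemma Zy_Ann: "z \<in> Zy J i \<Longrightarrow> z \<in> Ann J i"
  by (simp add: Zy_def)

lemma Ann_submod:
  assumes J: "J \<subseteq> carrier R"
  shows "submod R (I i) (Ann J i)"
proof -
  interpret Ii: module R "I i" by (rule I_module)
  show ?thesis
  proof (rule submodI[OF I_module])
    fix r z assume r: "r \<in> carrier R" and z: "z \<in> Ann J i"
    have "s \<odot>\<^bsub>I i\<^esub> (r \<odot>\<^bsub>I i\<^esub> z) = \<zero>\<^bsub>I i\<^esub>" if s: "s \<in> J" for s
      using Ii.smult_commute[of s r z] z r s J by (auto simp: Ann_def)
    then show "r \<odot>\<^bsub>I i\<^esub> z \<in> Ann J i" using r z by (simp add: Ann_def)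
  next
    fix z z' assume z: "z \<in> Ann J i" "z' \<in> Ann J i"
    have "s \<odot>\<^bsub>I i\<^esub> (z \<oplus>\<^bsub>I i\<^esub> z') = \<zero>\<^bsub>I i\<^esub>" if s: "s \<in> J" for s
      using Ii.smult_r_distr[of s z z'] z s J by (auto simp: Ann_def)
    then show "z \<oplus>\<^bsub>I i\<^esub> z' \<in> Ann J i" using z by (simp add: Ann_def)
  qed (use J in \<open>auto simp: Ann_def\<close>)
qed

lemma D_Ann: "J \<subseteq> carrier R \<Longrightarrow> z \<in> Ann J i \<Longrightarrow> D i z \<in> Ann J (Suc i)"
  unfolding Ann_def using D_carrier[of z i] D_smult[of _ z i, symmetric] hom_zero[OF I_module I_module D_hom, of i] by auto

lemma Zy_submod:
  assumes J: "J \<subseteq> carrier R"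
  shows "submod R (I i) (Zy J i)"
proof -
  have "Zy J i = ker_on (D i) (I i) (I (Suc i)) \<inter> Ann J i" by (auto simp: Zy_def ker_on_def Ann_def)
  then show ?thesis using module.submod_Int[OF I_module hom_ker_submod[OF I_module I_module D_hom] Ann_submod[OF J]] by simp
qed

lemma By_submod:
  assumes J: "J \<subseteq> carrier R"
  shows "submod R (I i) (By J i)"
  unfolding By_def
  by (cases i) (simp_all add: module.submod_zero[OF I_module] hom_image_submod[OF I_module I_module D_hom Ann_submod[OF J]])

lemma By_subset_Zy:
  assumes J: "J \<subseteq> carrier R"
  shows "By J i \<subseteq> Zy J i"
proof (cases i)
  case 0
  then show ?thesis using submodD(3)[OF Zy_submod[OF J], of 0] by (simp add: By_def)
next
  case (Suc j)
  then show ?thesis using D_Ann[OF J, of _ j] DD[of _ j] by (auto simp: By_def Zy_def Ann_carrier)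
qed

lemma Ann_antimono: "J \<subseteq> J' \<Longrightarrow> Ann J' i \<subseteq> Ann J i"
  by (auto simp: Ann_def)

lemma By_antimono: "J \<subseteq> J' \<Longrightarrow> By J' i \<subseteq> By J i"
  using Ann_antimono[of J J'] by (cases i) (auto simp: By_def)

lemma Zy_antimono: "J \<subseteq> J' \<Longrightarrow> Zy J' i \<subseteq> Zy J i"
  using Ann_antimono[of J J'] by (auto simp: Zy_def)

section \<open>The long exact sequence for adjoining one element to \<open>J\<close>\<close>

context
  fixes J a assumes J: "ideal J R" and a: "a \<in> carrier R"
begin

lemma J_carrier: "J \<subseteq> carrier R"
  using ideal.Icarr[OF J] by blast

lemma Ann_plus: "z \<in> Ann (plus_ideal J a) i \<longleftrightarrow> z \<in> Ann J i \<and> a \<odot>\<^bsub>I i\<^esub> z = \<zero>\<^bsub>I i\<^esub>"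
proof
  interpret Ii: module R "I i" by (rule I_module)
  assume z: "z \<in> Ann J i \<and> a \<odot>\<^bsub>I i\<^esub> z = \<zero>\<^bsub>I i\<^esub>"
  have "x \<odot>\<^bsub>I i\<^esub> z = \<zero>\<^bsub>I i\<^esub>" if x: "x \<in> plus_ideal J a" for x
  proof -
    obtain j r where jr: "j \<in> J" "r \<in> carrier R" "x = j \<oplus> r \<otimes> a" using x unfolding plus_ideal_facts(4)[OF J a] by blast
    then show ?thesis
      using z a J_carrier by (auto simp: Ann_def Ii.smult_l_distr Ii.smult_assoc1)
  qed
  then show "z \<in> Ann (plus_ideal J a) i" using z by (simp add: Ann_def)
next
  assume "z \<in> Ann (plus_ideal J a) i"
  then show "z \<in> Ann J i \<and> a \<odot>\<^bsub>I i\<^esub> z = \<zero>\<^bsub>I i\<^esub>"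
    using plus_ideal_facts(2,3)[OF J a] by (auto simp: Ann_def)
qed

lemma Ann_colon:
  assumes z: "z \<in> Ann J i"
  shows "a \<odot>\<^bsub>I i\<^esub> z \<in> Ann (colon_ideal J a) i"
proof -
  interpret Ii: module R "I i" by (rule I_module)
  have "r \<odot>\<^bsub>I i\<^esub> (a \<odot>\<^bsub>I i\<^esub> z) = \<zero>\<^bsub>I i\<^esub>" if r: "r \<in> colon_ideal J a" for r
    using Ii.smult_assoc1[of r a z] r a z by (auto simp: Ann_def colon_ideal_def)
  then show ?thesis using a z by (simp add: Ann_def)
qed

text \<open>Here injectivity of \<open>I i\<close> enters: \<open>j + r a \<mapsto> r u\<close> is
  well defined on \<open>J + Ra\<close> because \<open>J : a\<close> kills \<open>u\<close>, and it
  extends to \<open>R\<close>. The image of 1 under the extension is killed by \<open>J\<close>, and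
  \<open>a\<close> times it is \<open>u\<close>.\<close>

lemma Ann_divide:
  assumes u: "u \<in> Ann (colon_ideal J a) i"
  shows "\<exists>c\<in>Ann J i. a \<odot>\<^bsub>I i\<^esub> c = u"
proof -
  interpret Ii: module R "I i" by (rule I_module)
  interpret F: module R "free_pow R (Suc 0)" by (rule free_pow_module)
  have uc: "u \<in> carrier (I i)" by (rule Ann_carrier[OF u])
  \<comment> \<open>The ring is modelled by its free module of rank one, since injectivity is tested
    on modules of functions on naturals.\<close>
  let ?\<rho> = "{(w, y). w \<in> carrier (free_pow R (Suc 0)) \<and> (\<exists>j\<in>J. \<exists>r\<in>carrier R. w 0 = j \<oplus> r \<otimes> a \<and> y = r \<odot>\<^bsub>I i\<^esub> u)}"
  note Js = submodD[OF ideal_submod[OF J], simplified]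
  have w0: "(w \<oplus>\<^bsub>free_pow R (Suc 0)\<^esub> w') 0 = w 0 \<oplus> w' 0" "(r \<odot>\<^bsub>free_pow R (Suc 0)\<^esub> w) 0 = r \<otimes> w 0" "\<zero>\<^bsub>free_pow R (Suc 0)\<^esub> 0 = \<zero>" for w w' r
    by (simp_all add: free_pow_simps)
  have lin: "linear_rel R (free_pow R (Suc 0)) (I i) ?\<rho>"
  proof (rule linear_relI[OF free_pow_module I_module])
    show "(\<zero>\<^bsub>free_pow R (Suc 0)\<^esub>, \<zero>\<^bsub>I i\<^esub>) \<in> ?\<rho>"
      using Js(3) a uc w0(3) F.M.zero_closed by (auto intro!: bexI[of _ \<zero>])
    fix w y assume "(w, y) \<in> ?\<rho>"
    then obtain j r where p: "w \<in> carrier (free_pow R (Suc 0))" "j \<in> J" "r \<in> carrier R" "w 0 = j \<oplus> r \<otimes> a" "y = r \<odot>\<^bsub>I i\<^esub> u" by auto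
    have jc: "j \<in> carrier R" using p(2) J_carrier by blast
    show "w \<in> carrier (free_pow R (Suc 0)) \<and> y \<in> carrier (I i)" using p uc by simp
    {
      fix w' y' assume "(w', y') \<in> ?\<rho>"
      then obtain j' r' where p': "w' \<in> carrier (free_pow R (Suc 0))" "j' \<in> J" "r' \<in> carrier R" "w' 0 = j' \<oplus> r' \<otimes> a" "y' = r' \<odot>\<^bsub>I i\<^esub> u" by auto
      have jc': "j' \<in> carrier R" using p'(2) J_carrier by blast
      have "(w \<oplus>\<^bsub>free_pow R (Suc 0)\<^esub> w') 0 = (j \<oplus> j') \<oplus> (r \<oplus> r') \<otimes> a"
        unfolding w0 p(4) p'(4) using jc jc' p(3) p'(3) a by (simp add: l_distr a_ac)
      moreover have "y \<oplus>\<^bsub>I i\<^esub> y' = (r \<oplus> r') \<odot>\<^bsub>I i\<^esub> u" using p p' uc by (simp add: Ii.smult_l_distr)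
      ultimately show "(w \<oplus>\<^bsub>free_pow R (Suc 0)\<^esub> w', y \<oplus>\<^bsub>I i\<^esub> y') \<in> ?\<rho>"
        using p p' Js(4)[OF p(2) p'(2)] F.M.add.m_closed[OF p(1) p'(1)] by blast
    next
      fix s assume s: "s \<in> carrier R"
      have "(s \<odot>\<^bsub>free_pow R (Suc 0)\<^esub> w) 0 = s \<otimes> j \<oplus> (s \<otimes> r) \<otimes> a"
        unfolding w0 p(4) using jc p(3) a s by (simp add: r_distr m_assoc)
      moreover have "s \<odot>\<^bsub>I i\<^esub> y = (s \<otimes> r) \<odot>\<^bsub>I i\<^esub> u" using p uc s by (simp add: Ii.smult_assoc1)
      ultimately show "(s \<odot>\<^bsub>free_pow R (Suc 0)\<^esub> w, s \<odot>\<^bsub>I i\<^esub> y) \<in> ?\<rho>"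
        using p(3) s Js(5)[OF s p(2)] F.smult_closed[OF s p(1)] by blast
    }
  qed
  have single: "y = \<zero>\<^bsub>I i\<^esub>" if zy: "(\<zero>\<^bsub>free_pow R (Suc 0)\<^esub>, y) \<in> ?\<rho>" for y
  proof -
    obtain j r where p: "j \<in> J" "r \<in> carrier R" "\<zero> = j \<oplus> r \<otimes> a" "y = r \<odot>\<^bsub>I i\<^esub> u" using zy w0(3) by auto
    have jc: "j \<in> carrier R" using p(1) J_carrier by blast
    have "j \<oplus> r \<otimes> a \<in> J" using p(3) Js(3) by simp
    then have "r \<otimes> a \<in> J"
      using module.add_in_submod_iff[OF module_ring_module ideal_submod[OF J] p(1), of "r \<otimes> a"] p(2) a by simp
    then have "r \<in> colon_ideal J a" using p(2) by (simp add: colon_ideal_def)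
    then show ?thesis using u p(4) by (simp add: Ann_def)
  qed
  obtain g where g: "g \<in> module_hom R (free_pow R (Suc 0)) (I i)" "\<And>x y. (x, y) \<in> ?\<rho> \<Longrightarrow> g x = y"
    using injective_extend[OF inj lin single] by blast
  let ?e = "free_gen R {..<Suc 0} (0::nat)"
  have e: "?e \<in> carrier (free_pow R (Suc 0))" "?e 0 = \<one>" using free_gen_carrier[of 0 "Suc 0"] by (simp_all add: free_gen_def)
  have re: "r \<odot>\<^bsub>free_pow R (Suc 0)\<^esub> ?e \<in> carrier (free_pow R (Suc 0))" "(r \<odot>\<^bsub>free_pow R (Suc 0)\<^esub> ?e) 0 = r" if "r \<in> carrier R" for r
    using F.smult_closed[OF that e(1)] w0(2)[of r ?e] e(2) that by simp_all
  have "r \<odot>\<^bsub>I i\<^esub> g ?e = \<zero>\<^bsub>I i\<^esub>" if r: "r \<in> J" for r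
  proof -
    have rc: "r \<in> carrier R" using r J_carrier by blast
    have "\<exists>j\<in>J. \<exists>s\<in>carrier R. (r \<odot>\<^bsub>free_pow R (Suc 0)\<^esub> ?e) 0 = j \<oplus> s \<otimes> a \<and> \<zero>\<^bsub>I i\<^esub> = s \<odot>\<^bsub>I i\<^esub> u"
      by (rule bexI[OF _ r], rule bexI[of _ \<zero>]) (use re(2)[OF rc] rc a uc in simp_all)
    then have "(r \<odot>\<^bsub>free_pow R (Suc 0)\<^esub> ?e, \<zero>\<^bsub>I i\<^esub>) \<in> ?\<rho>" using re(1)[OF rc] by blast
    from g(2)[OF this] show ?thesis using module_hom_smult[OF g(1) rc e(1)] by simp
  qed
  then have "g ?e \<in> Ann J i"
    using hom_in_carrier[OF g(1) e(1)] by (simp add: Ann_def)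
  have "\<exists>j\<in>J. \<exists>s\<in>carrier R. (a \<odot>\<^bsub>free_pow R (Suc 0)\<^esub> ?e) 0 = j \<oplus> s \<otimes> a \<and> u = s \<odot>\<^bsub>I i\<^esub> u"
    by (rule bexI[OF _ Js(3)], rule bexI[of _ \<one>]) (use re(2)[OF a] a uc in simp_all)
  then have "(a \<odot>\<^bsub>free_pow R (Suc 0)\<^esub> ?e, u) \<in> ?\<rho>" using re(1)[OF a] by blast
  from g(2)[OF this] have "a \<odot>\<^bsub>I i\<^esub> g ?e = u" using module_hom_smult[OF g(1) a e(1)] by simp
  with \<open>g ?e \<in> Ann J i\<close> show ?thesis by blast
qed

lemma Zy_plus: "z \<in> Zy (plus_ideal J a) i \<longleftrightarrow> z \<in> Zy J i \<and> a \<odot>\<^bsub>I i\<^esub> z = \<zero>\<^bsub>I i\<^esub>"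
  by (auto simp: Zy_def Ann_plus)

lemma Zy_colon:
  assumes z: "z \<in> Zy J i"
  shows "a \<odot>\<^bsub>I i\<^esub> z \<in> Zy (colon_ideal J a) i"
proof -
  interpret I': module R "I (Suc i)" by (rule I_module)
  have "D i (a \<odot>\<^bsub>I i\<^esub> z) = \<zero>\<^bsub>I (Suc i)\<^esub>"
    using D_smult[OF a Ann_carrier[OF Zy_Ann[OF z]]] z a by (simp add: Zy_def)
  then show ?thesis using Ann_colon[OF Zy_Ann[OF z]] by (simp add: Zy_def)
qed

lemma By_colon:
  assumes z: "z \<in> By J i"
  shows "a \<odot>\<^bsub>I i\<^esub> z \<in> By (colon_ideal J a) i"
proof (cases i)
  case 0
  interpret Ii: module R "I 0" by (rule I_module)
  show ?thesis using z a 0 by (simp add: By_def)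
next
  case (Suc j)
  then obtain c where c: "c \<in> Ann J j" "z = D j c" using z by (auto simp: By_def)
  then have "a \<odot>\<^bsub>I i\<^esub> z = D j (a \<odot>\<^bsub>I j\<^esub> c)" using D_smult[OF a Ann_carrier[OF c(1)]] Suc by simp
  then show ?thesis using Ann_colon[OF c(1)] Suc by (simp add: By_def)
qed

lemma By_colon_lift:
  assumes u: "u \<in> By (colon_ideal J a) i"
  shows "\<exists>z\<in>By J i. a \<odot>\<^bsub>I i\<^esub> z = u"
proof (cases i)
  case 0
  interpret Ii: module R "I 0" by (rule I_module)
  show ?thesis using u a 0 by (simp add: By_def)
next
  case (Suc j)
  then obtain c where c: "c \<in> Ann (colon_ideal J a) j" "u = D j c" using u by (auto simp: By_def)
  obtain c' where c': "c' \<in> Ann J j" "a \<odot>\<^bsub>I j\<^esub> c' = c" using Ann_divide[OF c(1)] by blast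
  have "a \<odot>\<^bsub>I i\<^esub> D j c' = u" using D_smult[OF a Ann_carrier[OF c'(1)]] c(2) c'(2) Suc by simp
  then show ?thesis using c'(1) Suc by (auto simp: By_def)
qed

text \<open>Writing E^i(J) for Ext^i(R/J, W), this is exactness at the middle term of E^i(J + Ra)
  \<rightarrow> E^i(J) \<rightarrow> E^i(J : a) \<rightarrow> E^{i+1}(J + Ra); the second map is
  multiplication by \<open>a\<close>.\<close>

lemma exact_middle:
  assumes z: "z \<in> Zy J i" "a \<odot>\<^bsub>I i\<^esub> z \<in> By (colon_ideal J a) i"
  shows "\<exists>b\<in>By J i. z \<ominus>\<^bsub>I i\<^esub> b \<in> Zy (plus_ideal J a) i"
proof -
  interpret Ii: module R "I i" by (rule I_module)
  obtain b where b: "b \<in> By J i" "a \<odot>\<^bsub>I i\<^esub> b = a \<odot>\<^bsub>I i\<^esub> z" using By_colon_lift[OF z(2)] by blast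
  have bZ: "b \<in> Zy J i" using b(1) By_subset_Zy[OF J_carrier] by blast
  have c: "z \<in> carrier (I i)" "b \<in> carrier (I i)" using z(1) bZ Zy_Ann Ann_carrier by blast+
  have "a \<odot>\<^bsub>I i\<^esub> (z \<ominus>\<^bsub>I i\<^esub> b) = \<zero>\<^bsub>I i\<^esub>" using c a b(2) by (simp add: Ii.smult_minus)
  then have "z \<ominus>\<^bsub>I i\<^esub> b \<in> Zy (plus_ideal J a) i"
    unfolding Zy_plus using Ii.submod_minus[OF Zy_submod[OF J_carrier] z(1) bZ] by simp
  then show ?thesis using b(1) by blast
qed

lemma regular_of_vanishes:
  assumes van: "vanishes (plus_ideal J a) i" and z: "z \<in> Zy J i" "a \<odot>\<^bsub>I i\<^esub> z \<in> By (colon_ideal J a) i"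
  shows "z \<in> By J i"
proof -
  interpret Ii: module R "I i" by (rule I_module)
  obtain b where b: "b \<in> By J i" "z \<ominus>\<^bsub>I i\<^esub> b \<in> Zy (plus_ideal J a) i" using exact_middle[OF z] by blast
  have "z \<ominus>\<^bsub>I i\<^esub> b \<in> By J i"
    using van b(2) By_antimono[OF plus_ideal_facts(2)[OF J a]] unfolding vanishes_def by blast
  then show ?thesis
    using Ii.minus_in_submod_iff[OF By_submod[OF J_carrier] b(1)] Ann_carrier[OF Zy_Ann[OF z(1)]] by blast
qed

lemma vanishes_middle:
  assumes "vanishes (plus_ideal J a) i" "vanishes (colon_ideal J a) i"
  shows "vanishes J i"
  unfolding vanishes_def
  using regular_of_vanishes[OF assms(1)] Zy_colon assms(2) unfolding vanishes_def by blast

text \<open>E^i(J + Ra) \<rightarrow> E^i(J) is injective when E^{i-1}(J : a) = 0: if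
  \<open>z = D c\<close>, then \<open>a c\<close> is a cocycle, hence a boundary, and correcting
  \<open>c\<close> by a boundary \<open>b\<close> with \<open>a b = a c\<close> makes it killed by
  \<open>a\<close>.\<close>

lemma By_of_vanishes:
  assumes van: "i = 0 \<or> vanishes (colon_ideal J a) (i - 1)" and z: "z \<in> Zy (plus_ideal J a) i" "z \<in> By J i"
  shows "z \<in> By (plus_ideal J a) i"
proof (cases i)
  case 0 then show ?thesis using z by (simp add: By_def)
next
  case (Suc j)
  interpret Ij: module R "I j" by (rule I_module)
  interpret Ii: module R "I i" by (rule I_module)
  obtain c where c: "c \<in> Ann J j" "z = D j c" using z(2) Suc by (auto simp: By_def)
  have cc: "c \<in> carrier (I j)" by (rule Ann_carrier[OF c(1)])
  have "D j (a \<odot>\<^bsub>I j\<^esub> c) = \<zero>\<^bsub>I (Suc j)\<^esub>"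
    using z(1) D_smult[OF a cc] c(2) Suc unfolding Zy_plus by simp
  then have "a \<odot>\<^bsub>I j\<^esub> c \<in> Zy (colon_ideal J a) j" using Ann_colon[OF c(1)] by (simp add: Zy_def)
  then have "a \<odot>\<^bsub>I j\<^esub> c \<in> By (colon_ideal J a) j" using van Suc by (auto simp: vanishes_def)
  then obtain b where b: "b \<in> By J j" "a \<odot>\<^bsub>I j\<^esub> b = a \<odot>\<^bsub>I j\<^esub> c" using By_colon_lift by blast
  have bZ: "b \<in> Zy J j" using b(1) By_subset_Zy[OF J_carrier] by blast
  have bc: "b \<in> carrier (I j)" using Ann_carrier[OF Zy_Ann[OF bZ]] .
  have "a \<odot>\<^bsub>I j\<^esub> (c \<ominus>\<^bsub>I j\<^esub> b) = \<zero>\<^bsub>I j\<^esub>" using cc bc a b(2) by (simp add: Ij.smult_minus)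
  then have 1: "c \<ominus>\<^bsub>I j\<^esub> b \<in> Ann (plus_ideal J a) j"
    unfolding Ann_plus using Ij.submod_minus[OF Ann_submod[OF J_carrier] c(1) Zy_Ann[OF bZ]] by simp
  interpret Ij': module R "I (Suc j)" by (rule I_module)
  have "D j (c \<ominus>\<^bsub>I j\<^esub> b) = z"
    using D_minus[OF cc bc] bZ c(2) D_carrier[OF cc] by (simp add: Zy_def)
  then show ?thesis using 1 Suc by (auto simp: By_def)
qed

lemma vanishes_plus:
  assumes "vanishes J i" "i = 0 \<or> vanishes (colon_ideal J a) (i - 1)"
  shows "vanishes (plus_ideal J a) i"
  unfolding vanishes_def
proof
  fix z assume z: "z \<in> Zy (plus_ideal J a) i"
  then have "z \<in> By J i" using assms(1) Zy_antimono[OF plus_ideal_facts(2)[OF J a]] unfolding vanishes_def by blast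
  with z show "z \<in> By (plus_ideal J a) i" by (rule By_of_vanishes[OF assms(2)])
qed

text \<open>E^i(J) \<rightarrow> E^i(J : a) is onto, already on cocycles, when E^{i+1}(J + Ra) = 0:
  an element \<open>c\<close> with \<open>a c = u\<close> has \<open>D c\<close> in the complex of
  \<open>J + Ra\<close>, and subtracting a preimage of \<open>D c\<close> found there makes it a
  cocycle.\<close>

lemma Zy_divide:
  assumes van: "vanishes (plus_ideal J a) (Suc i)" and u: "u \<in> Zy (colon_ideal J a) i"
  shows "\<exists>z\<in>Zy J i. a \<odot>\<^bsub>I i\<^esub> z = u"
proof -
  interpret Ii: module R "I i" by (rule I_module)
  interpret I': module R "I (Suc i)" by (rule I_module)
  obtain c where c: "c \<in> Ann J i" "a \<odot>\<^bsub>I i\<^esub> c = u" using Ann_divide[OF Zy_Ann[OF u]] by blast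
  have cc: "c \<in> carrier (I i)" by (rule Ann_carrier[OF c(1)])
  have "a \<odot>\<^bsub>I (Suc i)\<^esub> D i c = \<zero>\<^bsub>I (Suc i)\<^esub>" using D_smult[OF a cc] c(2) u by (simp add: Zy_def)
  then have "D i c \<in> Zy (plus_ideal J a) (Suc i)"
    unfolding Zy_plus using D_Ann[OF J_carrier c(1)] DD[OF cc] by (simp add: Zy_def)
  then obtain c' where c': "c' \<in> Ann (plus_ideal J a) i" "D i c = D i c'" using van by (auto simp: vanishes_def By_def)
  have c'J: "c' \<in> Ann J i" "a \<odot>\<^bsub>I i\<^esub> c' = \<zero>\<^bsub>I i\<^esub>" using c'(1) by (auto simp: Ann_plus)
  have cc': "c' \<in> carrier (I i)" by (rule Ann_carrier[OF c'J(1)])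
  have "c \<ominus>\<^bsub>I i\<^esub> c' \<in> Zy J i"
    using Ii.submod_minus[OF Ann_submod[OF J_carrier] c(1) c'J(1)] D_minus[OF cc cc'] c'(2) D_carrier[OF cc'] by (simp add: Zy_def)
  moreover have "a \<odot>\<^bsub>I i\<^esub> (c \<ominus>\<^bsub>I i\<^esub> c') = u"
    using cc cc' a c(2) c'J(2) Ann_carrier[OF Zy_Ann[OF u]] by (simp add: Ii.smult_minus)
  ultimately show ?thesis by blast
qed

lemma vanishes_colon:
  assumes "vanishes (plus_ideal J a) (Suc i)" "vanishes J i"
  shows "vanishes (colon_ideal J a) i"
  unfolding vanishes_def
proof
  fix u assume "u \<in> Zy (colon_ideal J a) i"
  then obtain z where "z \<in> Zy J i" "a \<odot>\<^bsub>I i\<^esub> z = u" using Zy_divide[OF assms(1)] by blast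
  then show "u \<in> By (colon_ideal J a) i" using By_colon assms(2) unfolding vanishes_def by blast
qed

end

subsection \<open>Cohomology along a regular sequence\<close>

lemma Zy_zero_ideal: "Zy {\<zero>} i = ker_on (D i) (I i) (I (Suc i))"
proof -
  interpret Ii: module R "I i" by (rule I_module)
  show ?thesis by (auto simp: Zy_def Ann_def ker_on_def)
qed

lemma Ann_zero_ideal: "Ann {\<zero>} i = carrier (I i)"
proof -
  interpret Ii: module R "I i" by (rule I_module)
  show ?thesis by (auto simp: Ann_def)
qed

lemma vanishes_zero_ideal: "vanishes {\<zero>} (Suc i)"
  unfolding vanishes_def By_def using D_exact[of i] by (simp add: Zy_zero_ideal Ann_zero_ideal)

lemma vanishes_above:
  assumes "i > n" "J \<subseteq> carrier R"
  shows "vanishes J i"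
  unfolding vanishes_def
proof
  fix z assume z: "z \<in> Zy J i"
  have "z = \<zero>\<^bsub>I i\<^esub>" using I_zero[OF assms(1)] Ann_carrier[OF Zy_Ann[OF z]] by simp
  then show "z \<in> By J i" using submodD(3)[OF By_submod[OF assms(2)]] by simp
qed

text \<open>For \<open>a\<close> regular on \<open>R/J\<close>, the cokernel of \<open>a\<close> on
  Ext^i(R/J, W) is the kernel of Ext^{i+1}(R/P, W) \<rightarrow> Ext^{i+1}(R/J, W). The intersection
  on the right encodes this kernel.\<close>

lemma connecting_subquot_iso:
  assumes J: "ideal J R" and a: "a \<in> carrier R" and reg: "colon_ideal J a = J"
  defines "P \<equiv> plus_ideal J a"
  shows "subquot_iso R (I i) (plus_mult (I i) (By J i) a (Zy J i)) (Zy J i)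
    (I (Suc i)) (By P (Suc i)) (Zy P (Suc i) \<inter> By J (Suc i))"
proof -
  interpret Ii: module R "I i" by (rule I_module)
  interpret I': module R "I (Suc i)" by (rule I_module)
  have Jc: "J \<subseteq> carrier R" and Pc: "P \<subseteq> carrier R"
    using ideal.Icarr[OF J] ideal.Icarr[OF plus_ideal_facts(1)[OF J a]] by (auto simp: P_def)
  note Z = Zy_submod[OF Jc, of i] and B = By_submod[OF Jc, of i] and ZP = Zy_submod[OF Pc, of "Suc i"]
    and BP = By_submod[OF Pc, of "Suc i"] and BJ = By_submod[OF Jc, of "Suc i"] and A = Ann_submod[OF Jc, of i]
  note Ac = Ann_carrier
  have AnnP: "c \<in> Ann P i \<longleftrightarrow> c \<in> Ann J i \<and> a \<odot>\<^bsub>I i\<^esub> c = \<zero>\<^bsub>I i\<^esub>" for c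
    unfolding P_def by (rule Ann_plus[OF J a])
  have ZyP: "z \<in> Zy P (Suc i) \<longleftrightarrow> z \<in> Zy J (Suc i) \<and> a \<odot>\<^bsub>I (Suc i)\<^esub> z = \<zero>\<^bsub>I (Suc i)\<^esub>" for z
    unfolding P_def by (rule Zy_plus[OF J a])
  have step: "D i c \<in> By P (Suc i)" if c: "c \<in> Ann J i" "z \<in> Zy J i" "a \<odot>\<^bsub>I i\<^esub> c = a \<odot>\<^bsub>I i\<^esub> z" for c z
  proof -
    have cc: "c \<in> carrier (I i)" "z \<in> carrier (I i)" using c Zy_Ann Ac by blast+
    have "c \<ominus>\<^bsub>I i\<^esub> z \<in> Ann P i"
      unfolding AnnP using Ii.submod_minus[OF A c(1) Zy_Ann[OF c(2)]] cc c(3) a by (simp add: Ii.smult_minus)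
    moreover have "D i (c \<ominus>\<^bsub>I i\<^esub> z) = D i c" using D_minus[OF cc] c(2) D_carrier[OF cc(1)] by (simp add: Zy_def)
    ultimately show ?thesis by (auto simp: By_def) (metis imageI)
  qed
  \<comment> \<open>The connecting map divides the cocycle \<open>w\<close> by \<open>a\<close> in
    the complex and applies the differential.\<close>
  let ?\<rho> = "{(w, z). w \<in> Zy J i \<and> (\<exists>c\<in>Ann J i. a \<odot>\<^bsub>I i\<^esub> c = w \<and> z = D i c)}"
  let ?\<rho>' = "{(w, z). (w, z) \<in> {(c, w). (c, w) \<in> {(c, w). c \<in> carrier (I i) \<and> w = a \<odot>\<^bsub>I i\<^esub> c} \<and> c \<in> Ann J i}\<inverse>
    O {(c, z). c \<in> carrier (I i) \<and> z = D i c} \<and> w \<in> Zy J i}"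
  have aZ: "submod R (I i) ((\<lambda>z. a \<odot>\<^bsub>I i\<^esub> z) ` Zy J i)" by (rule Ii.submod_smult_image[OF Z a])
  show ?thesis
  proof (rule subquot_isoI[where \<rho> = ?\<rho>])
    have "linear_rel R (I i) (I (Suc i)) ?\<rho>'"
      by (rule linear_rel_restrict[OF linear_rel_comp[OF linear_rel_converse[OF linear_rel_restrict[OF
          hom_graph_linear[OF I_module I_module smult_hom[OF I_module a]] A]] hom_graph_linear[OF I_module I_module D_hom]] Z])
    also have "?\<rho>' = ?\<rho>" using Ac by blast
    finally show "linear_rel R (I i) (I (Suc i)) ?\<rho>" .
    show "submod R (I i) (plus_mult (I i) (By J i) a (Zy J i))" by (rule Ii.submod_set_add[OF B aZ])
    show "plus_mult (I i) (By J i) a (Zy J i) \<subseteq> Zy J i"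
      by (rule Ii.set_add_least[OF Z By_subset_Zy[OF Jc]]) (use submodD(5)[OF Z a] in blast)
    show "submod R (I (Suc i)) (By P (Suc i))" by (rule BP)
    show "submod R (I (Suc i)) (Zy P (Suc i) \<inter> By J (Suc i))" by (rule I'.submod_Int[OF ZP BJ])
    show "By P (Suc i) \<subseteq> Zy P (Suc i) \<inter> By J (Suc i)"
      using By_subset_Zy[OF Pc] By_antimono[of J P] plus_ideal_facts(2)[OF J a] unfolding P_def by blast
    fix w z assume wz: "(w, z) \<in> ?\<rho>"
    then obtain c where c: "w \<in> Zy J i" "c \<in> Ann J i" "a \<odot>\<^bsub>I i\<^esub> c = w" "z = D i c" by auto
    have cc: "c \<in> carrier (I i)" by (rule Ac[OF c(2)])
    have zB: "z \<in> By J (Suc i)" using c(2,4) by (simp add: By_def)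
    have "a \<odot>\<^bsub>I (Suc i)\<^esub> z = \<zero>\<^bsub>I (Suc i)\<^esub>" using D_smult[OF a cc] c(1,3,4) by (simp add: Zy_def)
    then show "w \<in> Zy J i \<and> z \<in> Zy P (Suc i) \<inter> By J (Suc i)"
      using zB c(1) By_subset_Zy[OF Jc] unfolding Int_iff ZyP by blast
    show "w \<in> plus_mult (I i) (By J i) a (Zy J i) \<longleftrightarrow> z \<in> By P (Suc i)"
    proof
      assume "w \<in> plus_mult (I i) (By J i) a (Zy J i)"
      then obtain u z1 where u: "u \<in> By J i" "z1 \<in> Zy J i" "w = u \<oplus>\<^bsub>I i\<^esub> a \<odot>\<^bsub>I i\<^esub> z1" unfolding Ii.in_set_add by blast
      obtain v where v: "v \<in> By J i" "a \<odot>\<^bsub>I i\<^esub> v = u" using By_colon_lift[OF J a, of u i] u(1) reg by auto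
      have vZ: "v \<in> Zy J i" using v(1) By_subset_Zy[OF Jc] by blast
      have "a \<odot>\<^bsub>I i\<^esub> c = a \<odot>\<^bsub>I i\<^esub> (v \<oplus>\<^bsub>I i\<^esub> z1)"
        using c(3) u(3) v(2) a Ac[OF Zy_Ann[OF vZ]] Ac[OF Zy_Ann[OF u(2)]] by (simp add: Ii.smult_r_distr)
      then show "z \<in> By P (Suc i)" unfolding c(4) by (rule step[OF c(2) submodD(4)[OF Z vZ u(2)]])
    next
      assume "z \<in> By P (Suc i)"
      then obtain c1 where c1: "c1 \<in> Ann P i" "z = D i c1" by (auto simp: By_def)
      then have c1': "c1 \<in> Ann J i" "a \<odot>\<^bsub>I i\<^esub> c1 = \<zero>\<^bsub>I i\<^esub>" by (auto simp: AnnP)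
      have c1c: "c1 \<in> carrier (I i)" by (rule Ac[OF c1'(1)])
      have "D i (c \<ominus>\<^bsub>I i\<^esub> c1) = \<zero>\<^bsub>I (Suc i)\<^esub>" using D_minus[OF cc c1c] c(4) c1(2) D_carrier[OF c1c] by simp
      then have 1: "c \<ominus>\<^bsub>I i\<^esub> c1 \<in> Zy J i" using Ii.submod_minus[OF A c(2) c1'(1)] by (simp add: Zy_def)
      have "a \<odot>\<^bsub>I i\<^esub> (c \<ominus>\<^bsub>I i\<^esub> c1) = w" using cc c1c a c(3) c1'(2) Ac[OF Zy_Ann[OF c(1)]] by (simp add: Ii.smult_minus)
      then have "w \<in> (\<lambda>z. a \<odot>\<^bsub>I i\<^esub> z) ` Zy J i" using 1 by blast
      then show "w \<in> plus_mult (I i) (By J i) a (Zy J i)" using Ii.set_add_upper2[OF B aZ] by blast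
    qed
  next
    fix w assume w: "w \<in> Zy J i"
    obtain c where "c \<in> Ann J i" "a \<odot>\<^bsub>I i\<^esub> c = w" using Ann_divide[OF J a, of w i] Zy_Ann[OF w] reg by auto
    then show "\<exists>z. (w, z) \<in> ?\<rho>" using w by blast
  next
    fix z assume z: "z \<in> Zy P (Suc i) \<inter> By J (Suc i)"
    then obtain c where c: "c \<in> Ann J i" "z = D i c" by (auto simp: By_def)
    have az: "a \<odot>\<^bsub>I (Suc i)\<^esub> z = \<zero>\<^bsub>I (Suc i)\<^esub>" using z ZyP by blast
    have "a \<odot>\<^bsub>I i\<^esub> c \<in> Ann J i" using Ann_colon[OF J a c(1)] reg by simp
    then have "a \<odot>\<^bsub>I i\<^esub> c \<in> Zy J i" using D_smult[OF a Ac[OF c(1)]] az c(2) by (simp add: Zy_def)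
    then have "(a \<odot>\<^bsub>I i\<^esub> c, z) \<in> ?\<rho>" using c by blast
    moreover have "z \<ominus>\<^bsub>I (Suc i)\<^esub> z \<in> By P (Suc i)"
      using I'.minus_self[of z] submodD(3)[OF BP] D_carrier[OF Ac[OF c(1)]] c(2) by simp
    ultimately show "\<exists>x y. (x, y) \<in> ?\<rho> \<and> z \<ominus>\<^bsub>I (Suc i)\<^esub> y \<in> By P (Suc i)" by blast
  qed
qed

text \<open>\<open>R/(ys)\<close> has projective dimension at most \<open>length ys\<close>,
  expressed by Ext. Each new element raises the last possibly nonzero degree by one in the long
  exact sequence.\<close>

lemma vanishes_regular:
  "regular_on_ring ys \<Longrightarrow> length ys < i \<Longrightarrow> vanishes (seq_ideal ys) i"
proof (induction ys arbitrary: i rule: rev_induct)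
  case Nil
  then show ?case using vanishes_zero_ideal[of "i - 1"] by (simp add: seq_ideal_def)
next
  case (snoc y ys)
  note r = regular_on_ring_snoc[OF snoc.prems(1)]
  have J: "ideal (seq_ideal ys) R" using seq_ideal_ideal r(1) by (simp add: regular_on_ring_def)
  show ?case
    unfolding seq_ideal_snoc[OF r(2)]
    by (rule vanishes_plus[OF J r(2)]) (use snoc.IH[OF r(1)] snoc.prems(2) r(3) in auto)
qed

text \<open>In degree \<open>length ys\<close>, Ext(R/(ys), W) is \<open>W/(ys)W\<close>. Here
  \<open>ys\<close> is regular on the ring only; regularity on \<open>W\<close> is derived with the
  help of this isomorphism. Each step takes a cokernel of \<open>y\<close>, and the connecting map
  is onto because the next Ext of \<open>R/(ys)\<close> vanishes.\<close>

lemma top_cohomology_iso: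
  "regular_on_ring ys \<Longrightarrow> subquot_iso R W (seq_mult W (carrier W) ys) (carrier W)
    (I (length ys)) (By (seq_ideal ys) (length ys)) (Zy (seq_ideal ys) (length ys))"
proof (induction ys rule: rev_induct)
  case Nil
  interpret I0: module R "I 0" by (rule I_module)
  have im: "\<epsilon> ` carrier W = Zy {\<zero>} 0" using \<epsilon>_exact by (simp add: Zy_zero_ideal)
  have pre: "{x \<in> carrier W. \<epsilon> x \<in> {\<zero>\<^bsub>I 0\<^esub>}} = {\<zero>\<^bsub>W\<^esub>}"
  proof
    show "{x \<in> carrier W. \<epsilon> x \<in> {\<zero>\<^bsub>I 0\<^esub>}} \<subseteq> {\<zero>\<^bsub>W\<^esub>}"
    proof
      fix x assume "x \<in> {x \<in> carrier W. \<epsilon> x \<in> {\<zero>\<^bsub>I 0\<^esub>}}"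
      then have "\<epsilon> x = \<epsilon> \<zero>\<^bsub>W\<^esub>" "x \<in> carrier W" using hom_zero[OF W I_module \<epsilon>_hom] by auto
      then show "x \<in> {\<zero>\<^bsub>W\<^esub>}" using inj_onD[OF \<epsilon>_inj, of x "\<zero>\<^bsub>W\<^esub>"] W.M.zero_closed by simp
    qed
  qed (simp add: hom_zero[OF W I_module \<epsilon>_hom] W.M.zero_closed)
  have "{\<zero>\<^bsub>I 0\<^esub>} \<subseteq> \<epsilon> ` carrier W" using hom_zero[OF W I_module \<epsilon>_hom] W.M.zero_closed by (metis empty_subsetI image_eqI insert_subset)
  from hom_subquot_iso[OF W I_module \<epsilon>_hom W.submod_carrier I0.submod_zero this]
  show ?case unfolding pre im by (simp add: seq_ideal_def By_def)
next
  case (snoc y ys)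
  note r = regular_on_ring_snoc[OF snoc.prems(1)]
  let ?J = "seq_ideal ys" and ?l = "length ys"
  have J: "ideal ?J R" using seq_ideal_ideal r(1) by (simp add: regular_on_ring_def)
  have "Zy (plus_ideal ?J y) (Suc ?l) \<subseteq> By ?J (Suc ?l)"
    using vanishes_regular[OF r(1), of "Suc ?l"] Zy_antimono[OF plus_ideal_facts(2)[OF J r(2)]]
    unfolding vanishes_def by blast
  then have e: "Zy (plus_ideal ?J y) (Suc ?l) \<inter> By ?J (Suc ?l) = Zy (plus_ideal ?J y) (Suc ?l)" by blast
  show ?case
    using subquot_iso_trans[OF subquot_iso_quotient[OF snoc.IH[OF r(1)] r(2)] connecting_subquot_iso[OF J r(2,3)]]
    unfolding e by (simp add: seq_ext_snoc seq_ideal_snoc[OF r(2)])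
qed

text \<open>The terms of an injective resolution are far from finitely generated, yet Nakayama's
  lemma is to be applied to Ext(R/(ys), W). The chain condition is inherited from \<open>W\<close>
  through the long exact sequence.\<close>

lemma noetherian_cohomology:
  assumes noeth: "noetherian_subquot R W {\<zero>\<^bsub>W\<^esub>} (carrier W)"
  shows "regular_on_ring ys \<Longrightarrow> noetherian_subquot R (I i) (By (seq_ideal ys) i) (Zy (seq_ideal ys) i)"
proof (induction ys arbitrary: i rule: rev_induct)
  case Nil
  show ?case
  proof (cases i)
    case 0
    have "regular_on_ring []" by (simp add: regular_on_ring_def)
    from subquot_iso_sym[OF top_cohomology_iso[OF this]] show ?thesis
      using subquot_iso_noetherian[OF _ noeth] 0 by simp
  next
    case (Suc j)
    have "Zy {\<zero>} i \<subseteq> By {\<zero>} i" using vanishes_zero_ideal[of j] Suc by (simp add: vanishes_def)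
    then show ?thesis
      using noetherian_subquot_mono[OF noetherian_subquot_self[of R "I i" "By {\<zero>} i"]] by (simp add: seq_ideal_def)
  qed
next
  case (snoc y ys)
  note r = regular_on_ring_snoc[OF snoc.prems]
  let ?J = "seq_ideal ys"
  let ?P = "plus_ideal ?J y"
  have J: "ideal ?J R" using seq_ideal_ideal r(1) by (simp add: regular_on_ring_def)
  have Jc: "?J \<subseteq> carrier R" and Pc: "?P \<subseteq> carrier R"
    using ideal.Icarr[OF J] ideal.Icarr[OF plus_ideal_facts(1)[OF J r(2)]] by auto
  note IH = snoc.IH[OF r(1)]
  interpret Ii: module R "I i" by (rule I_module)
  note ZP = Zy_submod[OF Pc, of i] and BJ = By_submod[OF Jc, of i]
  have int: "submod R (I i) (Zy ?P i \<inter> By ?J i)" by (rule Ii.submod_Int[OF ZP BJ])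
  have ZPJ: "Zy ?P i \<subseteq> Zy ?J i" by (rule Zy_antimono[OF plus_ideal_facts(2)[OF J r(2)]])
  have low: "By ?P i \<subseteq> Zy ?P i \<inter> By ?J i"
    using By_subset_Zy[OF Pc] By_antimono[OF plus_ideal_facts(2)[OF J r(2)]] by blast
  have "noetherian_subquot R (I i) (By ?J i) (Zy ?P i <+>\<^bsub>I i\<^esub> By ?J i)"
    by (rule noetherian_subquot_mono[OF IH subset_refl])
      (rule Ii.set_add_least[OF Zy_submod[OF Jc] ZPJ By_subset_Zy[OF Jc]])
  then have upper: "noetherian_subquot R (I i) (Zy ?P i \<inter> By ?J i) (Zy ?P i)"
    by (rule subquot_iso_noetherian[OF Ii.second_iso[OF BJ ZP]])
  have lower: "noetherian_subquot R (I i) (By ?P i) (Zy ?P i \<inter> By ?J i)"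
  proof (cases i)
    case 0
    then have "Zy ?P i \<inter> By ?J i \<subseteq> By ?P i" by (auto simp: By_def)
    then show ?thesis using noetherian_subquot_mono[OF noetherian_subquot_self[of R "I i" "By ?P i"]] by blast
  next
    case (Suc j)
    interpret Ij: module R "I j" by (rule I_module)
    have "noetherian_subquot R (I j) (plus_mult (I j) (By ?J j) y (Zy ?J j)) (Zy ?J j)"
      by (rule noetherian_subquot_mono[OF IH Ij.set_add_upper1 subset_refl])
        (rule By_submod[OF Jc], rule Ij.submod_smult_image[OF Zy_submod[OF Jc] r(2)])
    from subquot_iso_noetherian[OF subquot_iso_sym[OF connecting_subquot_iso[OF J r(2,3)]] this]
    show ?thesis unfolding Suc .
  qed
  show ?case
    unfolding seq_ideal_snoc[OF r(2)]
    by (rule Ii.noetherian_subquot_add[OF int ZP low _ lower upper]) blast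
qed

section \<open>Vanishing and nonvanishing degrees, and regularity on \<open>W\<close>\<close>

lemma seq_ext_proper:
  assumes noeth: "noetherian_subquot R W {\<zero>\<^bsub>W\<^esub>} (carrier W)" and "set ys \<subseteq> \<mm>"
    and eq: "seq_mult W (carrier W) ys = carrier W"
  shows "carrier W = {\<zero>\<^bsub>W\<^esub>}"
proof (rule sym, rule nakayama[OF W.submod_zero W.submod_carrier _ noeth])
  fix S assume S: "submod R W S" "{\<zero>\<^bsub>W\<^esub>} \<subseteq> S" "S \<subseteq> carrier W"
    "\<And>r z. r \<in> \<mm> \<Longrightarrow> z \<in> carrier W \<Longrightarrow> r \<odot>\<^bsub>W\<^esub> z \<in> S"
  have "seq_mult W (carrier W) ys \<subseteq> S"
    by (rule W.seq_ext_least[OF S(1,2)]) (use S(4) assms(2) in blast)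
  then show "S = carrier W" using eq S(3) by blast
qed simp

text \<open>The nonzero module \<open>W/(ys)W\<close> is an Ext in degree \<open>length ys\<close>,
  and Ext vanishes beyond the end of the injective resolution. This bounds the depth of the
  ring.\<close>

lemma length_regular_le:
  assumes noeth: "noetherian_subquot R W {\<zero>\<^bsub>W\<^esub>} (carrier W)" and ne: "carrier W \<noteq> {\<zero>\<^bsub>W\<^esub>}"
    and reg: "regular_on_ring ys" and m: "set ys \<subseteq> \<mm>"
  shows "\<not> vanishes (seq_ideal ys) (length ys)" "length ys \<le> n"
proof -
  let ?J = "seq_ideal ys" and ?l = "length ys"
  have Jc: "?J \<subseteq> carrier R" using ideal.Icarr[OF seq_ideal_ideal] reg by (auto simp: regular_on_ring_def)
  show nv: "\<not> vanishes ?J ?l"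
  proof
    assume v: "vanishes ?J ?l"
    obtain \<rho> where r: "Domain \<rho> = carrier W" "Range \<rho> = Zy ?J ?l"
      "\<And>x y. (x, y) \<in> \<rho> \<Longrightarrow> x \<in> seq_mult W (carrier W) ys \<longleftrightarrow> y \<in> By ?J ?l"
      "seq_mult W (carrier W) ys \<subseteq> carrier W"
      using top_cohomology_iso[OF reg] unfolding subquot_iso_def by blast
    have "carrier W \<subseteq> seq_mult W (carrier W) ys"
    proof
      fix x assume "x \<in> carrier W"
      then obtain y where y: "(x, y) \<in> \<rho>" using r(1) by blast
      then have "y \<in> By ?J ?l" using r(2) v unfolding vanishes_def by blast
      then show "x \<in> seq_mult W (carrier W) ys" using r(3)[OF y] by blast
    qed
    then show False using seq_ext_proper[OF noeth m] ne r(4) by blast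
  qed
  show "?l \<le> n" using nv vanishes_above[OF _ Jc, of ?l] by (meson not_le)
qed

text \<open>All layers of a composition series of \<open>R/J\<close> are \<open>k\<close>, and
  vanishing passes to extensions.\<close>

lemma vanishes_finite_colength:
  assumes J: "ideal J R" "colength R J = enat p" and van: "vanishes \<mm> i"
  shows "vanishes J i"
  using J
proof (induction rule: finite_colength_induct)
  case top
  interpret Ii: module R "I i" by (rule I_module)
  show ?case
    unfolding vanishes_def
  proof
    fix z assume z: "z \<in> Zy (carrier R) i"
    then have "\<one> \<odot>\<^bsub>I i\<^esub> z = \<zero>\<^bsub>I i\<^esub>" by (simp add: Zy_def Ann_def)
    then have "z = \<zero>\<^bsub>I i\<^esub>" using Ann_carrier[OF Zy_Ann[OF z]] by simp
    then show "z \<in> By (carrier R) i" using submodD(3)[OF By_submod[OF subset_refl]] by simp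
  qed
next
  case (step J a)
  then show ?case using vanishes_middle[OF step(1,2)] van by simp
qed

text \<open>Let \<open>t\<close> be the highest degree in which Ext(k, W) is nonzero. The embedding
  of \<open>k\<close> as a socle element of \<open>R/J\<close> puts Ext^t(k, W) between Ext^t(R/J,
  W), zero above \<open>length ys\<close>, and Ext^{t+1} of a module of finite length, zero by the
  choice of \<open>t\<close>.\<close>

lemma vanishes_\<mm>_above:
  assumes reg: "regular_on_ring ys" and m: "set ys \<subseteq> \<mm>"
    and fin: "colength R (seq_ideal ys) = enat p" and i: "length ys < i"
  shows "vanishes \<mm> i"
proof (rule ccontr)
  let ?J = "seq_ideal ys"
  assume "\<not> vanishes \<mm> i"
  moreover have bound: "t \<le> n" if "\<not> vanishes \<mm> t" for t
    using vanishes_above[OF _ \<mm>_subset, of t] that by (meson not_le)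
  ultimately obtain t where t: "\<not> vanishes \<mm> t" "i \<le> t" and max: "\<And>s. \<not> vanishes \<mm> s \<Longrightarrow> s \<le> t"
    using Nat.ex_has_greatest_nat[of "\<lambda>t. \<not> vanishes \<mm> t" i n] by blast
  have J: "ideal ?J R" using seq_ideal_ideal reg by (simp add: regular_on_ring_def)
  have ne: "?J \<noteq> carrier R"
  proof
    assume "?J = carrier R"
    moreover have "?J \<subseteq> \<mm>"
      unfolding seq_ideal_def
      by (rule module.seq_ext_least[OF module_ring_module \<mm>_submod])
        (use m I_r_closed submodD(3)[OF \<mm>_submod] in auto)
    ultimately show False using one_not_in_\<mm> one_closed by blast
  qed
  obtain a where a: "a \<in> carrier R" "a \<notin> ?J" "colon_ideal ?J a = \<mm>" using socle_element[OF J ne] fin by auto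
  note p = plus_ideal_facts[OF J a(1)]
  obtain p' where "colength R (plus_ideal ?J a) = enat p'"
    using mlength_ideal_add[OF J p(1,2)] fin by (cases "colength R (plus_ideal ?J a)") auto
  moreover have "vanishes \<mm> (Suc t)" using max[of "Suc t"] by auto
  ultimately have "vanishes (plus_ideal ?J a) (Suc t)" using vanishes_finite_colength[OF p(1)] by blast
  moreover have "vanishes ?J t" by (rule vanishes_regular[OF reg]) (use i t(2) in simp)
  ultimately have "vanishes (colon_ideal ?J a) t" by (rule vanishes_colon[OF J a(1)])
  then show False using a(3) t(1) by simp
qed

text \<open>With Ext(k, W) zero in the neighbouring degrees, each layer gives an exact sequence 0
  \<rightarrow> Ext^l(R/P, W) \<rightarrow> Ext^l(R/J, W) \<rightarrow> Ext^l(k, W) \<rightarrow> 0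
  with nonzero right end, so every step of a composition series contributes at least one.\<close>

lemma mlength_cohomology_ge:
  assumes below: "l = 0 \<or> vanishes \<mm> (l - 1)" and above: "vanishes \<mm> (Suc l)" and at: "\<not> vanishes \<mm> l"
    and J: "ideal J R" "colength R J = enat p"
  shows "colength R J \<le> mlength R (I l) (By J l) (Zy J l)"
  using J
proof (induction rule: finite_colength_induct)
  case top
  then show ?case by simp
next
  case (step J a)
  interpret Il: module R "I l" by (rule I_module)
  let ?P = "plus_ideal J a"
  note p = plus_ideal_facts[OF step(1,2)]
  have Jc: "J \<subseteq> carrier R" and Pc: "?P \<subseteq> carrier R" using ideal.Icarr[OF step(1)] ideal.Icarr[OF p(1)] by auto
  note ZJ = Zy_submod[OF Jc, of l] and BJ = By_submod[OF Jc, of l] and ZP = Zy_submod[OF Pc, of l]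
  have ZPJ: "Zy ?P l \<subseteq> Zy J l" by (rule Zy_antimono[OF p(2)])
  have BPJ: "By ?P l \<subseteq> By J l" by (rule By_antimono[OF p(2)])
  have int: "Zy ?P l \<inter> By J l = By ?P l"
    using By_of_vanishes[OF step(1,2), of l] below step(4) By_subset_Zy[OF Pc] BPJ by auto
  let ?Y = "Zy ?P l <+>\<^bsub>I l\<^esub> By J l"
  have Y: "submod R (I l) ?Y" by (rule Il.submod_set_add[OF ZP BJ])
  have BY: "By J l \<subseteq> ?Y" by (rule Il.set_add_upper2[OF ZP BJ])
  have YZ: "?Y \<subseteq> Zy J l" by (rule Il.set_add_least[OF ZJ ZPJ By_subset_Zy[OF Jc]])
  have 1: "mlength R (I l) (By J l) ?Y = mlength R (I l) (By ?P l) (Zy ?P l)"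
    using Il.mlength_second_iso[OF BJ ZP] unfolding int by simp
  obtain q where "colength R ?P = enat q"
    using step(5,6) by (cases "colength R ?P") (auto simp: one_enat_def)
  then have vP: "vanishes ?P (Suc l)" using vanishes_finite_colength[OF p(1) _ above] by blast
  \<comment> \<open>A nonzero class over \<open>k\<close> lifts to a cocycle \<open>z\<close> over
    \<open>R/J\<close>; the sum \<open>?Y\<close> maps to zero over \<open>k\<close>, so
    \<open>z\<close> lies outside it.\<close>
  obtain u where u: "u \<in> Zy \<mm> l" "u \<notin> By \<mm> l" using at by (auto simp: vanishes_def)
  obtain z where z: "z \<in> Zy J l" "a \<odot>\<^bsub>I l\<^esub> z = u" using Zy_divide[OF step(1,2) vP] u(1) step(4) by auto
  have "z \<notin> ?Y"
  proof
    assume "z \<in> ?Y"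
    then obtain z' b where zb: "z' \<in> Zy ?P l" "b \<in> By J l" "z = z' \<oplus>\<^bsub>I l\<^esub> b" unfolding Il.in_set_add by blast
    have c: "z' \<in> carrier (I l)" "b \<in> carrier (I l)"
      using Ann_carrier[OF Zy_Ann[OF zb(1)]] submod_in_carrier[OF BJ zb(2)] by auto
    have "a \<odot>\<^bsub>I l\<^esub> z' = \<zero>\<^bsub>I l\<^esub>" using zb(1) Zy_plus[OF step(1,2)] by blast
    then have "u = a \<odot>\<^bsub>I l\<^esub> b" using z(2) zb(3) c step(2) by (simp add: Il.smult_r_distr)
    then show False using By_colon[OF step(1,2) zb(2)] step(4) u(2) by simp
  qed
  then have "1 \<le> mlength R (I l) ?Y (Zy J l)" using mlength_pos[OF Y ZJ] YZ z(1) by blast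
  then have "1 + colength R ?P \<le>
      mlength R (I l) ?Y (Zy J l) + mlength R (I l) (By J l) ?Y"
    unfolding 1 using step(7) by (rule add_mono)
  then show ?case
    using Il.mlength_add[OF BJ Y ZJ BY YZ] step(5) by (simp add: add.commute)
qed

text \<open>Vanishing of Ext(R/(ys, y), W) in all low degrees descends to \<open>R/(ys)\<close> by
  Nakayama, one degree lower. In degree \<open>length ys\<close> it makes \<open>y\<close> regular
  on Ext(R/(ys), W), that is on \<open>W/(ys)W\<close>.\<close>

lemma seq_regular_of_vanishes:
  assumes noeth: "noetherian_subquot R W {\<zero>\<^bsub>W\<^esub>} (carrier W)"
  shows "regular_on_ring ys \<Longrightarrow> set ys \<subseteq> \<mm> \<Longrightarrow> (\<And>i. i < length ys \<Longrightarrow> vanishes (seq_ideal ys) i) \<Longrightarrow>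
    seq_reg W (carrier W) ys"
proof (induction ys rule: rev_induct)
  case (snoc y ys)
  note r = regular_on_ring_snoc[OF snoc.prems(1)]
  let ?J = "seq_ideal ys" and ?l = "length ys"
  let ?P = "plus_ideal ?J y"
  have J: "ideal ?J R" using seq_ideal_ideal r(1) by (simp add: regular_on_ring_def)
  have Jc: "?J \<subseteq> carrier R" using ideal.Icarr[OF J] by blast
  have van: "vanishes ?P i" if i: "i \<le> ?l" for i
    using snoc.prems(3)[of i] i unfolding seq_ideal_snoc[OF r(2)] by simp
  have y: "y \<in> \<mm>" using snoc.prems(2) by simp
  have vJ: "vanishes ?J i" if i: "i < ?l" for i
  proof -
    interpret Ii: module R "I i" by (rule I_module)
    have vP: "vanishes ?P (Suc i)" using van i by simp
    \<comment> \<open>As Ext^{i+1}(R/(ys, y), W) = 0, multiplication by \<open>y\<close> maps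
      Ext^i(R/(ys), W) onto itself.\<close>
    have "By ?J i = Zy ?J i"
    proof (rule nakayama[OF By_submod[OF Jc] Zy_submod[OF Jc] By_subset_Zy[OF Jc] noetherian_cohomology[OF noeth r(1)]])
      fix S assume S: "S \<subseteq> Zy ?J i" "\<And>r z. r \<in> \<mm> \<Longrightarrow> z \<in> Zy ?J i \<Longrightarrow> r \<odot>\<^bsub>I i\<^esub> z \<in> S"
      have "Zy ?J i \<subseteq> S"
      proof
        fix u assume "u \<in> Zy ?J i"
        then obtain z where "z \<in> Zy ?J i" "y \<odot>\<^bsub>I i\<^esub> z = u" using Zy_divide[OF J r(2) vP, of u] r(3) by auto
        then show "u \<in> S" using S(2)[OF y, of z] by simp
      qed
      then show "S = Zy ?J i" using S(1) by blast
    qed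
    then show ?thesis by (simp add: vanishes_def)
  qed
  have reg: "z \<in> By ?J ?l" if z: "z \<in> Zy ?J ?l" "y \<odot>\<^bsub>I ?l\<^esub> z \<in> By ?J ?l" for z
    using regular_of_vanishes[OF J r(2) van[OF le_refl] z(1)] z(2) r(3) by simp
  have "v \<in> seq_mult W (carrier W) ys"
    if v: "v \<in> carrier W" "y \<odot>\<^bsub>W\<^esub> v \<in> seq_mult W (carrier W) ys" for v
    by (rule subquot_iso_regular[OF top_cohomology_iso[OF r(1)] r(2) _ v]) (rule reg)
  moreover have "seq_reg W (carrier W) ys"
    by (rule snoc.IH[OF r(1)]) (use snoc.prems(2) vJ in auto)
  ultimately show ?case by (simp add: seq_regular_snoc)
qed simp

theorem regular_and_long:
  assumes noeth: "noetherian_subquot R W {\<zero>\<^bsub>W\<^esub>} (carrier W)" and ne: "carrier W \<noteq> {\<zero>\<^bsub>W\<^esub>}"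
    and reg: "regular_on_ring ys" and m: "set ys \<subseteq> \<mm>"
    and fin: "colength R (seq_ideal ys) = enat p"
    and low: "\<And>i. i < length ys \<Longrightarrow> vanishes \<mm> i"
  shows "seq_reg W (carrier W) ys"
    "enat p \<le> mlength R W (seq_mult W (carrier W) ys) (carrier W)"
proof -
  let ?J = "seq_ideal ys" and ?l = "length ys"
  have J: "ideal ?J R" using seq_ideal_ideal reg by (simp add: regular_on_ring_def)
  show "seq_reg W (carrier W) ys"
    by (rule seq_regular_of_vanishes[OF noeth reg m]) (rule vanishes_finite_colength[OF J fin low])
  have at: "\<not> vanishes \<mm> ?l"
    using length_regular_le(1)[OF noeth ne reg m] vanishes_finite_colength[OF J fin] by blast
  have "colength R ?J \<le> mlength R (I ?l) (By ?J ?l) (Zy ?J ?l)"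
  proof (rule mlength_cohomology_ge[OF _ vanishes_\<mm>_above[OF reg m fin] at J fin])
    show "?l = 0 \<or> vanishes \<mm> (?l - 1)" using low[of "?l - 1"] by (cases "?l = 0") auto
  qed simp
  then show "enat p \<le> mlength R W (seq_mult W (carrier W) ys) (carrier W)"
    using subquot_iso_mlength[OF top_cohomology_iso[OF reg]] fin by simp
qed

end

section \<open>Balancing the two resolutions\<close>

lemma injective_factor:
  fixes B :: "('r, nat \<Rightarrow> 'r) module" and E :: "('r, 'm) module"
  assumes E: "injective_module R E" and G: "module R G" and B: "module R B"
    and d: "d \<in> module_hom R G B" and u: "u \<in> module_hom R G E"
    and ker: "\<And>x. x \<in> carrier G \<Longrightarrow> d x = \<zero>\<^bsub>B\<^esub> \<Longrightarrow> u x = \<zero>\<^bsub>E\<^esub>"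
  shows "\<exists>p\<in>module_hom R B E. \<forall>x\<in>carrier G. p (d x) = u x"
proof -
  have E': "module R E" using E by (simp add: injective_module_def)
  note \<rho> = linear_rel_comp[OF linear_rel_converse[OF hom_graph_linear[OF G B d]] hom_graph_linear[OF G E' u]]
  obtain p where p: "p \<in> module_hom R B E"
      "\<And>x y. (x, y) \<in> {(x, y). x \<in> carrier G \<and> y = d x}\<inverse> O {(x, y). x \<in> carrier G \<and> y = u x} \<Longrightarrow> p x = y"
    by (rule injective_extend[OF E \<rho>]) (use ker in auto)
  have "p (d x) = u x" if x: "x \<in> carrier G" for x by (rule p(2)) (use x in blast)
  then show ?thesis using p(1) by blast
qed

locale balanced_resolutions = injective_resolution + residue_resolution_module R \<mm> k b d e q W
  for k b d e q
begin

text \<open>Ext^{i+1}(k, V) = 0 for the \<open>j\<close>-th cosyzygy \<open>V\<close>, the kernel of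
  \<open>D j\<close>, computed from the free resolution: each cocycle on \<open>F (Suc i)\<close>
  with values in \<open>V\<close> is a coboundary of a map into \<open>V\<close>.\<close>

definition "lifts i j \<longleftrightarrow> (\<forall>f\<in>module_hom R (F (Suc i)) (I j).
  (\<forall>x\<in>carrier (F (Suc i)). D j (f x) = \<zero>\<^bsub>I (Suc j)\<^esub>) \<longrightarrow>
  (\<forall>y\<in>carrier (F (Suc (Suc i))). f (d (Suc i) y) = \<zero>\<^bsub>I j\<^esub>) \<longrightarrow>
  (\<exists>g\<in>module_hom R (F i) (I j). (\<forall>x\<in>carrier (F i). D j (g x) = \<zero>\<^bsub>I (Suc j)\<^esub>) \<and>
    (\<forall>x\<in>carrier (F (Suc i)). f x = g (d i x))))"

lemma lifts_zero:
  assumes ext: "Zc (Suc i) {\<zero>\<^bsub>W\<^esub>} \<subseteq> Bc (Suc i) {\<zero>\<^bsub>W\<^esub>}"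
  shows "lifts i 0"
  unfolding lifts_def
proof (intro ballI impI)
  fix f assume f: "f \<in> module_hom R (F (Suc i)) (I 0)"
    and fD: "\<forall>x\<in>carrier (F (Suc i)). D 0 (f x) = \<zero>\<^bsub>I (Suc 0)\<^esub>"
    and fd: "\<forall>y\<in>carrier (F (Suc (Suc i))). f (d (Suc i) y) = \<zero>\<^bsub>I 0\<^esub>"
  have "f w \<in> \<epsilon> ` carrier W" if w: "w \<in> carrier (F (Suc i))" for w
    unfolding \<epsilon>_exact ker_on_def using fD w hom_in_carrier[OF f w] by blast
  from free_lift_along[OF I_module W f \<epsilon>_hom this]
  obtain h where h: "h \<in> module_hom R (F (Suc i)) W" "\<And>w. w \<in> carrier (F (Suc i)) \<Longrightarrow> \<epsilon> (h w) = f w" by blast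
  let ?h = "restrict h (carrier (F (Suc i)))"
  have hC: "?h \<in> carrier (C (Suc i))" by (rule hom_module_restrict[OF F_module h(1)])
  have "?h (d (Suc i) y) = \<zero>\<^bsub>W\<^esub>" if y: "y \<in> carrier (F (Suc (Suc i)))" for y
  proof -
    have "\<epsilon> (h (d (Suc i) y)) = \<epsilon> \<zero>\<^bsub>W\<^esub>" using h(2)[OF d_carrier[OF y]] fd y hom_zero[OF W I_module \<epsilon>_hom] by simp
    then show ?thesis
      using inj_onD[OF \<epsilon>_inj] hom_in_carrier[OF h(1) d_carrier[OF y]] abelian_monoid.zero_closed[OF abelian_group.axioms(1)[OF module.axioms(2)[OF W]]] d_carrier[OF y] by simp
  qed
  then have "?h \<in> Zc (Suc i) {\<zero>\<^bsub>W\<^esub>}"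
    using hC \<delta>_carrier[OF hC] by (simp add: Zc_def H_def \<delta>_value)
  then have "?h \<in> \<delta> i ` carrier (C i)" using ext by (auto simp: Bc_zero_eq_image)
  then obtain g where g: "g \<in> carrier (C i)" "?h = \<delta> i g" by blast
  have hg: "h x = g (d i x)" if x: "x \<in> carrier (F (Suc i))" for x
    using fun_cong[OF g(2), of x] x by (simp add: \<delta>_value)
  have "(\<lambda>x. \<epsilon> (g x)) \<in> module_hom R (F i) (I 0)" by (rule hom_comp[OF \<epsilon>_hom hom_module_hom[OF g(1)]])
  moreover have "D 0 (\<epsilon> (g x)) = \<zero>\<^bsub>I (Suc 0)\<^esub>" if x: "x \<in> carrier (F i)" for x
  proof -
    have "\<epsilon> (g x) \<in> ker_on (D 0) (I 0) (I (Suc 0))" unfolding \<epsilon>_exact[symmetric] using C_value[OF g(1) x] by blast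
    then show ?thesis by (simp add: ker_on_def)
  qed
  moreover have "f x = \<epsilon> (g (d i x))" if x: "x \<in> carrier (F (Suc i))" for x using h(2)[OF x] hg[OF x] by simp
  ultimately show "\<exists>g\<in>module_hom R (F i) (I 0). (\<forall>x\<in>carrier (F i). D 0 (g x) = \<zero>\<^bsub>I (Suc 0)\<^esub>) \<and>
      (\<forall>x\<in>carrier (F (Suc i)). f x = g (d i x))" by (intro bexI[of _ "\<lambda>x. \<epsilon> (g x)"]) simp_all
qed

text \<open>A cocycle \<open>f\<close> into \<open>I (j + 1)\<close> is \<open>D h\<close>; correcting \<open>h\<close> by a lift of \<open>h d\<close> makes it a cocycle
  \<open>u\<close> in \<open>Hom(F, I j)\<close> with \<open>D u = f\<close>.\<close>

lemma lift_cocycle: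
  assumes X: "lifts i j" and f: "f \<in> module_hom R (F i) (I (Suc j))"
    and fD: "\<And>x. x \<in> carrier (F i) \<Longrightarrow> D (Suc j) (f x) = \<zero>\<^bsub>I (Suc (Suc j))\<^esub>"
    and fd: "\<And>y. y \<in> carrier (F (Suc i)) \<Longrightarrow> f (d i y) = \<zero>\<^bsub>I (Suc j)\<^esub>"
  obtains u where "u \<in> module_hom R (F i) (I j)" "\<And>x. x \<in> carrier (F i) \<Longrightarrow> D j (u x) = f x"
    "\<And>y. y \<in> carrier (F (Suc i)) \<Longrightarrow> u (d i y) = \<zero>\<^bsub>I j\<^esub>"
proof -
  interpret Ij: module R "I j" by (rule I_module)
  interpret Ij': module R "I (Suc j)" by (rule I_module)
  have "f w \<in> D j ` carrier (I j)" if w: "w \<in> carrier (F i)" for w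
    unfolding D_exact ker_on_def using fD[OF w] hom_in_carrier[OF f w] by blast
  from free_lift_along[OF I_module I_module f D_hom this]
  obtain h where h: "h \<in> module_hom R (F i) (I j)" "\<And>w. w \<in> carrier (F i) \<Longrightarrow> D j (h w) = f w" by blast
  have hd: "(\<lambda>x. h (d i x)) \<in> module_hom R (F (Suc i)) (I j)" by (rule hom_comp[OF h(1) d_hom])
  have "D j (h (d i x)) = \<zero>\<^bsub>I (Suc j)\<^esub>" if x: "x \<in> carrier (F (Suc i))" for x using h(2)[OF d_carrier[OF x]] fd[OF x] by simp
  moreover have "h (d i (d (Suc i) y)) = \<zero>\<^bsub>I j\<^esub>" if y: "y \<in> carrier (F (Suc (Suc i)))" for y
    using dd_zero[OF y] hom_zero[OF F_module I_module h(1)] by simp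
  ultimately obtain g where g: "g \<in> module_hom R (F i) (I j)" "\<And>x. x \<in> carrier (F i) \<Longrightarrow> D j (g x) = \<zero>\<^bsub>I (Suc j)\<^esub>"
      "\<And>x. x \<in> carrier (F (Suc i)) \<Longrightarrow> h (d i x) = g (d i x)"
    using bspec[OF X[unfolded lifts_def] hd] by blast
  show ?thesis
  proof (rule that)
    show "(\<lambda>x. h x \<ominus>\<^bsub>I j\<^esub> g x) \<in> module_hom R (F i) (I j)" by (rule hom_diff_hom[OF F_module I_module h(1) g(1)])
    show "D j (h x \<ominus>\<^bsub>I j\<^esub> g x) = f x" if x: "x \<in> carrier (F i)" for x
      using D_minus[of "h x" j "g x"] hom_in_carrier[OF h(1) x] hom_in_carrier[OF g(1) x] h(2)[OF x] g(2)[OF x]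
        Ij'.minus_zero[OF hom_in_carrier[OF f x]] by simp
    show "h (d i y) \<ominus>\<^bsub>I j\<^esub> g (d i y) = \<zero>\<^bsub>I j\<^esub>" if y: "y \<in> carrier (F (Suc i))" for y
      using g(3)[OF y] Ij.minus_self[OF hom_in_carrier[OF g(1) d_carrier[OF y]]] by simp
  qed
qed

text \<open>Dimension shift: one cosyzygy more costs one degree. The cocycle is first lifted to
  \<open>u\<close> with values in \<open>I j\<close>; injectivity of \<open>I j\<close> then factors
  \<open>u\<close> through the differential, and \<open>D j\<close> of the factor is the required
  map.\<close>

lemma lifts_shift:
  assumes X: "lifts (Suc i) j"
  shows "lifts i (Suc j)"
  unfolding lifts_def
proof (intro ballI impI)
  fix f assume f: "f \<in> module_hom R (F (Suc i)) (I (Suc j))"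
    and fD: "\<forall>x\<in>carrier (F (Suc i)). D (Suc j) (f x) = \<zero>\<^bsub>I (Suc (Suc j))\<^esub>"
    and fd: "\<forall>y\<in>carrier (F (Suc (Suc i))). f (d (Suc i) y) = \<zero>\<^bsub>I (Suc j)\<^esub>"
  obtain u where u: "u \<in> module_hom R (F (Suc i)) (I j)" "\<And>x. x \<in> carrier (F (Suc i)) \<Longrightarrow> D j (u x) = f x"
      "\<And>y. y \<in> carrier (F (Suc (Suc i))) \<Longrightarrow> u (d (Suc i) y) = \<zero>\<^bsub>I j\<^esub>"
    by (rule lift_cocycle[OF X f]) (use fD fd in auto)
  have "\<exists>p\<in>module_hom R (F i) (I j). \<forall>x\<in>carrier (F (Suc i)). p (d i x) = u x"
    by (rule injective_factor[OF inj F_module F_module d_hom u(1)]) (use d_exact u(3) in blast)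
  then obtain p where p: "p \<in> module_hom R (F i) (I j)" "\<And>x. x \<in> carrier (F (Suc i)) \<Longrightarrow> p (d i x) = u x" by blast
  show "\<exists>g\<in>module_hom R (F i) (I (Suc j)). (\<forall>x\<in>carrier (F i). D (Suc j) (g x) = \<zero>\<^bsub>I (Suc (Suc j))\<^esub>) \<and>
      (\<forall>x\<in>carrier (F (Suc i)). f x = g (d i x))"
  proof (intro bexI[of _ "\<lambda>x. D j (p x)"] conjI ballI)
    show "(\<lambda>x. D j (p x)) \<in> module_hom R (F i) (I (Suc j))" by (rule hom_comp[OF D_hom p(1)])
  qed (use DD hom_in_carrier[OF p(1)] p(2) u(2) in simp_all)
qed

text \<open>An element killed by \<open>\<mm>\<close> and by \<open>D\<close> is a map from
  \<open>k\<close> to a cosyzygy. Lifting it through \<open>I j\<close> as a cocycle on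
  \<open>F 0\<close> and evaluating at \<open>w\<close> over the class of 1 yields a preimage that
  is itself killed by \<open>\<mm>\<close>.\<close>

lemma vanishes_Suc_of_lifts:
  assumes X: "lifts 0 j"
  shows "vanishes \<mm> (Suc j)"
  unfolding vanishes_def
proof
  interpret J: module R "I (Suc j)" by (rule I_module)
  fix z assume zz: "z \<in> Zy \<mm> (Suc j)"
  then have z: "z \<in> carrier (I (Suc j))" "\<And>r. r \<in> \<mm> \<Longrightarrow> r \<odot>\<^bsub>I (Suc j)\<^esub> z = \<zero>\<^bsub>I (Suc j)\<^esub>" "D (Suc j) z = \<zero>\<^bsub>I (Suc (Suc j))\<^esub>"
    by (auto simp: Zy_def Ann_def)
  obtain f where f: "f \<in> module_hom R (F 0) (I (Suc j))"
    and fw: "\<And>w. w \<in> carrier (F 0) \<Longrightarrow> \<exists>r\<in>carrier R. e w = q r \<and> f w = r \<odot>\<^bsub>I (Suc j)\<^esub> z"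
    by (rule augmentation_lift[OF I_module z(1)], rule that)
  have fD: "D (Suc j) (f x) = \<zero>\<^bsub>I (Suc (Suc j))\<^esub>" if x: "x \<in> carrier (F 0)" for x
    using fw[OF x] D_smult[OF _ z(1)] z(3) module.smult_r_null[OF I_module] by auto
  have fd: "f (d 0 y) = \<zero>\<^bsub>I (Suc j)\<^esub>" if y: "y \<in> carrier (F (Suc 0))" for y
  proof -
    obtain r where r: "r \<in> carrier R" "e (d 0 y) = q r" "f (d 0 y) = r \<odot>\<^bsub>I (Suc j)\<^esub> z" using fw[OF d_carrier[OF y]] by blast
    have "e (d 0 y) = \<zero>\<^bsub>k\<^esub>" using e_exact[OF d_carrier[OF y]] y by blast
    then show ?thesis using q_ker[OF r(1)] r(2,3) z(2) by simp
  qed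
  obtain u where u: "u \<in> module_hom R (F 0) (I j)" "\<And>x. x \<in> carrier (F 0) \<Longrightarrow> D j (u x) = f x"
      "\<And>y. y \<in> carrier (F (Suc 0)) \<Longrightarrow> u (d 0 y) = \<zero>\<^bsub>I j\<^esub>"
    by (rule lift_cocycle[OF X f]) (use fD fd in auto)
  obtain w where w: "w \<in> carrier (F 0)" "e w = q \<one>" using augmentation_unit by blast
  have "u w \<in> Ann \<mm> j"
  proof -
    have "r \<odot>\<^bsub>I j\<^esub> u w = \<zero>\<^bsub>I j\<^esub>" if r: "r \<in> \<mm>" for r
    proof -
      obtain y where "y \<in> carrier (F (Suc 0))" "r \<odot>\<^bsub>F 0\<^esub> w = d 0 y" using smult_boundary[OF r w(1)] by blast
      then show ?thesis using u(3) module_hom_smult[OF u(1) _ w(1), of r] r by simp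
    qed
    then show ?thesis using hom_in_carrier[OF u(1) w(1)] by (simp add: Ann_def)
  qed
  moreover have "D j (u w) = z"
  proof -
    obtain r where r: "r \<in> carrier R" "q \<one> = q r" "f w = r \<odot>\<^bsub>I (Suc j)\<^esub> z" using fw[OF w(1)] w(2) by auto
    have "r \<ominus> \<one> \<in> \<mm>" by (rule residue_eq) (use r in auto)
    then have "r \<odot>\<^bsub>I (Suc j)\<^esub> z \<ominus>\<^bsub>I (Suc j)\<^esub> \<one> \<odot>\<^bsub>I (Suc j)\<^esub> z = \<zero>\<^bsub>I (Suc j)\<^esub>"
      using z(2) J.smult_minus_left[OF r(1) _ z(1), of \<one>] by simp
    then have "r \<odot>\<^bsub>I (Suc j)\<^esub> z = z" using J.minus_eq_zero_iff[of "r \<odot>\<^bsub>I (Suc j)\<^esub> z" z] r(1) z(1) by simp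
    then show ?thesis using u(2)[OF w(1)] r(3) by simp
  qed
  ultimately show "z \<in> By \<mm> (Suc j)" by (auto simp: By_def)
qed

lemma vanishes_zero_of_ext:
  assumes ext: "Zc 0 {\<zero>\<^bsub>W\<^esub>} \<subseteq> Bc 0 {\<zero>\<^bsub>W\<^esub>}"
  shows "vanishes \<mm> 0"
  unfolding vanishes_def
proof
  fix z assume "z \<in> Zy \<mm> 0"
  then have z: "z \<in> carrier (I 0)" "\<And>r. r \<in> \<mm> \<Longrightarrow> r \<odot>\<^bsub>I 0\<^esub> z = \<zero>\<^bsub>I 0\<^esub>" "D 0 z = \<zero>\<^bsub>I (Suc 0)\<^esub>"
    by (auto simp: Zy_def Ann_def)
  have "z \<in> \<epsilon> ` carrier W" unfolding \<epsilon>_exact ker_on_def using z(1,3) by blast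
  then obtain w where w: "w \<in> carrier W" "z = \<epsilon> w" by blast
  have z0: "\<zero>\<^bsub>W\<^esub> \<in> carrier W" by (rule submodD(3)[OF module.submod_carrier[OF W]])
  have "r \<odot>\<^bsub>W\<^esub> w \<in> {\<zero>\<^bsub>W\<^esub>}" if r: "r \<in> \<mm>" for r
  proof -
    have "\<epsilon> (r \<odot>\<^bsub>W\<^esub> w) = \<epsilon> \<zero>\<^bsub>W\<^esub>"
      using module_hom_smult[OF \<epsilon>_hom, of r w] r w z(2)[OF r] hom_zero[OF W I_module \<epsilon>_hom] by simp
    then show ?thesis using inj_onD[OF \<epsilon>_inj] module.smult_closed[OF W, of r w] r w(1) z0 by simp
  qed
  then have soc: "w \<in> {v \<in> carrier W. \<forall>r\<in>\<mm>. r \<odot>\<^bsub>W\<^esub> v \<in> {\<zero>\<^bsub>W\<^esub>}}" using w(1) by blast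
  have "w \<in> {\<zero>\<^bsub>W\<^esub>}"
    by (rule subquot_iso_regular[OF subquot_iso_sym[OF Zc0_iso_socle[OF module.submod_zero[OF W]]] cring.cring_simprules(2)[OF is_cring]])
      (use soc ext module.smult_l_null[OF W w(1)] in auto)
  then show "z \<in> By \<mm> 0" using w(2) hom_zero[OF W I_module \<epsilon>_hom] by (simp add: By_def)
qed

text \<open>Balancing of Ext(k, W), in the direction from the free to the injective resolution and
  for vanishing only; degree 0 is the socle of \<open>W\<close> on both sides.\<close>

theorem vanishes_of_ext:
  assumes ext: "\<And>i. i < l \<Longrightarrow> Zc i {\<zero>\<^bsub>W\<^esub>} \<subseteq> Bc i {\<zero>\<^bsub>W\<^esub>}" and i: "i < l"
  shows "vanishes \<mm> i"
proof (cases i)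
  case 0
  then show ?thesis using vanishes_zero_of_ext[OF ext[of 0]] i by simp
next
  case (Suc j)
  \<comment> \<open>The sum of both indices is constant under the shift, so all cases reduce to
    \<open>j' = 0\<close>, in total degree below \<open>l\<close>.\<close>
  have "lifts i' j'" if "Suc (i' + j') < l" for i' j'
    using that
  proof (induction j' arbitrary: i')
    case 0
    then show ?case by (intro lifts_zero ext) simp
  next
    case (Suc j')
    then show ?case by (intro lifts_shift Suc.IH) simp
  qed
  from this[of 0 j] show ?thesis using vanishes_Suc_of_lifts[of j] i Suc by simp
qed

end

section \<open>Regular sequences of length \<open>dim R\<close> have finite colength\<close>

context noetherian_local_ring
begin

text \<open>Localising at the multiplicative set of all \<open>u y\<^sup>n\<close> with \<open>u\<close> outside \<open>P\<close>.\<close>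

lemma prime_below:
  assumes J: "ideal J R" and y: "y \<in> carrier R" "colon_ideal J y = J"
    and P: "primeideal P R" "J \<subseteq> P" "y \<in> P"
  obtains Q where "primeideal Q R" "J \<subseteq> Q" "Q \<subset> P"
proof -
  interpret P: primeideal P R by (rule P(1))
  define S where "S = {u \<otimes> y [^] n | u n. u \<in> carrier R \<and> u \<notin> P \<and> (n::nat) \<in> UNIV}"
  have one: "\<one> \<notin> P" using P.I_notcarr P.one_imp_carrier by blast
  have SI: "u \<otimes> y [^] (n::nat) \<in> S" if u: "u \<in> carrier R" "u \<notin> P" for u n using u by (auto simp: S_def)
  have S_mult: "s \<otimes> t \<in> S" if st: "s \<in> S" "t \<in> S" for s t
  proof -
    obtain u n where s: "s = u \<otimes> y [^] (n::nat)" "u \<in> carrier R" "u \<notin> P" using st(1) by (auto simp: S_def)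
    obtain v m where t: "t = v \<otimes> y [^] (m::nat)" "v \<in> carrier R" "v \<notin> P" using st(2) by (auto simp: S_def)
    have "s \<otimes> t = (u \<otimes> v) \<otimes> (y [^] n \<otimes> y [^] m)" using s t y(1) by (simp add: m_ac)
    also have "\<dots> = (u \<otimes> v) \<otimes> y [^] (n + m)" using y(1) by (simp add: nat_pow_mult)
    finally have e: "s \<otimes> t = (u \<otimes> v) \<otimes> y [^] (n + m)" .
    have "u \<otimes> v \<notin> P" using P.I_prime[of u v] s(2,3) t(2,3) by blast
    then show ?thesis unfolding e by (intro SI m_closed s(2) t(2))
  qed
  \<comment> \<open>Regularity of \<open>y\<close> modulo \<open>J\<close> cancels its powers, which
    is why \<open>J\<close> misses \<open>S\<close>.\<close>
  have J_pow: "u \<in> J" if u: "u \<in> carrier R" "u \<otimes> y [^] n \<in> J" for u and n :: nat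
    using u
  proof (induction n)
    case (Suc n)
    have "u \<otimes> y [^] n \<in> colon_ideal J y" using Suc.prems y(1) by (simp add: colon_ideal_def m_assoc)
    then show ?case using Suc y(2) by simp
  qed simp
  have JS: "J \<inter> S = {}" using J_pow P(2) by (auto simp: S_def)
  let ?A = "{K. ideal K R \<and> J \<subseteq> K \<and> K \<inter> S = {}}"
  have "\<exists>Q\<in>?A. J \<subseteq> Q \<and> (\<forall>U\<in>?A. Q \<subseteq> U \<longrightarrow> U = Q)"
    by (rule noetherian_maximal[OF noetherian_family_ideals]) (use J JS in auto)
  then obtain Q where "Q \<in> ?A" and max': "\<forall>U\<in>?A. Q \<subseteq> U \<longrightarrow> U = Q" by (elim bexE conjE)
  then have Q: "ideal Q R" "J \<subseteq> Q" "Q \<inter> S = {}" by auto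
  have max: "U = Q" if U: "ideal U R" "Q \<subseteq> U" "U \<inter> S = {}" for U using max' U Q(2) by blast
  \<comment> \<open>\<open>Q\<close> is maximal among the ideals missing the multiplicative set
    \<open>S\<close>; such an ideal is prime.\<close>
  have meets: "\<exists>q\<in>Q. \<exists>r\<in>carrier R. q \<oplus> r \<otimes> a \<in> S" if a: "a \<in> carrier R" "a \<notin> Q" for a
  proof -
    note f = plus_ideal_facts[OF Q(1) a(1)]
    have "plus_ideal Q a \<inter> S \<noteq> {}" using max[OF f(1,2)] f(3) a(2) by blast
    then obtain s where "s \<in> plus_ideal Q a" "s \<in> S" by blast
    then show ?thesis using f(4)[of s] by blast
  qed
  have one_S: "\<one> \<in> S" using SI[of \<one> 0] one by simp
  have yS: "y \<in> S" using SI[of \<one> 1] one y(1) by simp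
  have "primeideal Q R"
  proof (rule primeidealI[OF Q(1) is_cring])
    show "carrier R \<noteq> Q" using one_S Q(3) by blast
    fix a b assume ab: "a \<in> carrier R" "b \<in> carrier R" "a \<otimes> b \<in> Q"
    show "a \<in> Q \<or> b \<in> Q"
    proof (rule ccontr)
      assume "\<not> ?thesis"
      then have n: "a \<notin> Q" "b \<notin> Q" by auto
      obtain q r where q: "q \<in> Q" "r \<in> carrier R" "q \<oplus> r \<otimes> a \<in> S" using meets[OF ab(1) n(1)] by (elim bexE)
      obtain q' r' where q': "q' \<in> Q" "r' \<in> carrier R" "q' \<oplus> r' \<otimes> b \<in> S" using meets[OF ab(2) n(2)] by (elim bexE)
      note c = ideal.Icarr[OF Q(1) q(1)] ideal.Icarr[OF Q(1) q'(1)]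
      let ?A = "r \<otimes> a" and ?B = "r' \<otimes> b"
      have A: "?A \<in> carrier R" "?B \<in> carrier R" using q(2) q'(2) ab(1,2) by auto
      have "(q \<oplus> ?A) \<otimes> (q' \<oplus> ?B) = (q' \<oplus> ?B) \<otimes> q \<oplus> (?A \<otimes> q' \<oplus> ?A \<otimes> ?B)"
        using c A by (simp add: l_distr r_distr m_comm[of q] a_assoc a_lcomm)
      also have "?A \<otimes> ?B = (r \<otimes> r') \<otimes> (a \<otimes> b)" using q(2) q'(2) ab(1,2) by (simp add: m_ac)
      also have "(q' \<oplus> ?B) \<otimes> q \<oplus> (?A \<otimes> q' \<oplus> (r \<otimes> r') \<otimes> (a \<otimes> b)) \<in> Q"
        by (intro additive_subgroup.a_closed[OF ideal.axioms(1)[OF Q(1)]] ideal.I_l_closed[OF Q(1)] q(1) q'(1) ab(3))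
          (use A c q(2) q'(2) in auto)
      finally show False using S_mult[OF q(3) q'(3)] Q(3) by blast
    qed
  qed
  \<comment> \<open>The exponent 0 puts everything outside \<open>P\<close> into \<open>S\<close>,
    so \<open>Q\<close> lies in \<open>P\<close>; it is strictly smaller because \<open>S\<close>
    contains \<open>y\<close>.\<close>
  moreover have "Q \<subseteq> P"
  proof
    fix u assume u: "u \<in> Q"
    show "u \<in> P" using SI[of u 0] ideal.Icarr[OF Q(1) u] u Q(3) by auto
  qed
  ultimately show ?thesis using that[of Q] Q yS P(3) by blast
qed

text \<open>Every element of the sequence lowers the prime by one strict step, starting from
  \<open>P\<close> at the top.\<close>

lemma prime_chain_regular:
  "regular_on_ring ys \<Longrightarrow> primeideal P R \<Longrightarrow> seq_ideal ys \<subseteq> P \<Longrightarrow>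
    \<exists>C :: nat \<Rightarrow> 'a set. (\<forall>i\<le>length ys. primeideal (C i) R) \<and> (\<forall>i<length ys. C i \<subset> C (Suc i)) \<and> C (length ys) = P"
proof (induction ys arbitrary: P rule: rev_induct)
  case Nil
  then show ?case by (intro exI[of _ "\<lambda>_. P"]) simp
next
  case (snoc y ys)
  note r = regular_on_ring_snoc[OF snoc.prems(1)]
  have J: "ideal (seq_ideal ys) R" using seq_ideal_ideal r(1) by (simp add: regular_on_ring_def)
  note f = plus_ideal_facts[OF J r(2)]
  have P: "seq_ideal ys \<subseteq> P" "y \<in> P" using snoc.prems(3) f(2,3) unfolding seq_ideal_snoc[OF r(2)] by blast+
  obtain Q where Q: "primeideal Q R" "seq_ideal ys \<subseteq> Q" "Q \<subset> P"
    by (rule prime_below[OF J r(2,3) snoc.prems(2) P])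
  obtain C :: "nat \<Rightarrow> 'a set" where C: "\<forall>i\<le>length ys. primeideal (C i) R" "\<forall>i<length ys. C i \<subset> C (Suc i)" "C (length ys) = Q"
    using snoc.IH[OF r(1) Q(1,2)] by blast
  show ?case
    by (rule exI[of _ "C(Suc (length ys) := P)"]) (use C Q(3) snoc.prems(2) in \<open>auto simp: less_Suc_eq le_Suc_eq\<close>)
qed

text \<open>A chain of \<open>dim R\<close> steps ends at \<open>P\<close>; if \<open>P\<close> were
  not maximal, \<open>\<mm>\<close> would add one more step.\<close>

lemma prime_over_regular_eq_\<mm>:
  assumes ys: "regular_on_ring ys" "krull_dim R = enat (length ys)" and P: "primeideal P R" "seq_ideal ys \<subseteq> P"
  shows "P = \<mm>"
proof (rule ccontr)
  assume ne: "P \<noteq> \<mm>"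
  obtain C :: "nat \<Rightarrow> 'a set" where C: "\<forall>i\<le>length ys. primeideal (C i) R" "\<forall>i<length ys. C i \<subset> C (Suc i)" "C (length ys) = P"
    using prime_chain_regular[OF ys(1) P] by blast
  have m: "primeideal \<mm> R" by (rule maximalideal_prime[OF maximalideal_axioms])
  have "P \<subset> \<mm>" using proper_ideal_subset_\<mm>[OF primeideal.axioms(1)[OF P(1)]] primeideal.I_notcarr[OF P(1)] ne by blast
  then have "(\<forall>i\<le>Suc (length ys). primeideal ((C(Suc (length ys) := \<mm>)) i) R) \<and>
      (\<forall>i<Suc (length ys). (C(Suc (length ys) := \<mm>)) i \<subset> (C(Suc (length ys) := \<mm>)) (Suc i))"
    using C m by (auto simp: less_Suc_eq le_Suc_eq)
  then have "enat (Suc (length ys)) \<le> krull_dim R" unfolding krull_dim_def by (intro SUP_upper) blast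
  then show False using ys(2) by simp
qed

text \<open>An ideal \<open>P\<close> maximal among those of infinite colength above
  \<open>(ys)\<close> is prime, because the length of \<open>R/P\<close> is the sum of those of
  \<open>R/(P + Ra)\<close> and \<open>R/(P : a)\<close>. Then \<open>P = \<mm>\<close>, which has
  colength one.\<close>

theorem finite_colength_regular:
  assumes ys: "regular_on_ring ys" "krull_dim R = enat (length ys)"
  shows "colength R (seq_ideal ys) \<noteq> \<infinity>"
proof
  let ?l = "\<lambda>J. colength R J"
  assume inf: "?l (seq_ideal ys) = \<infinity>"
  have J: "ideal (seq_ideal ys) R" using seq_ideal_ideal ys(1) by (simp add: regular_on_ring_def)
  let ?A = "{K. ideal K R \<and> seq_ideal ys \<subseteq> K \<and> ?l K = \<infinity>}"
  have "\<exists>Q\<in>?A. seq_ideal ys \<subseteq> Q \<and> (\<forall>U\<in>?A. Q \<subseteq> U \<longrightarrow> U = Q)"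
    by (rule noetherian_maximal[OF noetherian_family_ideals]) (use J inf in auto)
  then obtain P where "P \<in> ?A" and max': "\<forall>U\<in>?A. P \<subseteq> U \<longrightarrow> U = P" by (elim bexE conjE)
  then have P: "ideal P R" "seq_ideal ys \<subseteq> P" "?l P = \<infinity>" by auto
  have max: "U = P" if U: "ideal U R" "P \<subseteq> U" "?l U = \<infinity>" for U using max' U P(2) by blast
  have "primeideal P R"
  proof (rule primeidealI[OF P(1) is_cring])
    show "carrier R \<noteq> P" using P(3) by (auto simp: mlength_self)
    fix a b assume ab: "a \<in> carrier R" "b \<in> carrier R" "a \<otimes> b \<in> P"
    note p = plus_ideal_facts[OF P(1) ab(1)] and c = colon_ideal_facts[OF P(1) ab(1)]
    show "a \<in> P \<or> b \<in> P"
    proof (rule ccontr)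
      assume n: "\<not> ?thesis"
      have "?l (plus_ideal P a) \<noteq> \<infinity>" using max[OF p(1,2)] p(3) n by blast
      moreover have "b \<in> colon_ideal P a" using ab by (simp add: colon_ideal_def m_comm)
      then have "?l (colon_ideal P a) \<noteq> \<infinity>" using max[OF c(1,2)] n by blast
      ultimately obtain i j where "?l (plus_ideal P a) = enat i" "?l (colon_ideal P a) = enat j" by auto
      then show False
        using mlength_ideal_add[OF P(1) p(1,2)] mlength_plus_ideal[OF P(1) ab(1)] P(3) by simp
    qed
  qed
  then have "P = \<mm>" using prime_over_regular_eq_\<mm>[OF ys] P(2) by blast
  then show False using P(3) mlength_\<mm> by simp
qed

end

section \<open>Syzygies modulo a regular sequence\<close>

lemma seq_ext_image:
  assumes M: "module R M" and N: "module R N" and f: "f \<in> module_hom R M N" and Z: "submod R M Z"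
  shows "set ys \<subseteq> carrier R \<Longrightarrow> f ` seq_mult M Z ys = seq_mult N (f ` Z) ys"
proof (induction ys rule: rev_induct)
  case Nil
  then show ?case using hom_zero[OF M N f] by simp
next
  case (snoc y ys)
  interpret M: module R M by fact
  interpret N: module R N by fact
  let ?B = "seq_mult M Z ys"
  have y: "y \<in> carrier R" and ys: "set ys \<subseteq> carrier R" using snoc.prems by auto
  have B: "submod R M ?B" using M.seq_ext_props[OF Z M.submod_zero _ ys] submodD(3)[OF Z] by simp
  note c = submod_in_carrier[OF B] submod_in_carrier[OF Z]
  have eq: "f (u \<oplus>\<^bsub>M\<^esub> y \<odot>\<^bsub>M\<^esub> z) = f u \<oplus>\<^bsub>N\<^esub> y \<odot>\<^bsub>N\<^esub> f z" if "u \<in> ?B" "z \<in> Z" for u z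
    using c[of u] c[of z] that y module_hom_add[OF f] module_hom_smult[OF f] by simp
  have "f ` (plus_mult M ?B y Z) = plus_mult N (f ` ?B) y (f ` Z)"
  proof
    show "f ` (plus_mult M ?B y Z) \<subseteq> plus_mult N (f ` ?B) y (f ` Z)"
      by (force simp: M.in_set_add N.in_set_add eq)
    show "plus_mult N (f ` ?B) y (f ` Z) \<subseteq> f ` (plus_mult M ?B y Z)"
    proof
      fix w assume "w \<in> plus_mult N (f ` ?B) y (f ` Z)"
      then obtain u z where "u \<in> ?B" "z \<in> Z" "w = f u \<oplus>\<^bsub>N\<^esub> y \<odot>\<^bsub>N\<^esub> f z" by (auto simp: N.in_set_add)
      moreover from this(1,2) have "u \<oplus>\<^bsub>M\<^esub> y \<odot>\<^bsub>M\<^esub> z \<in> plus_mult M ?B y Z" by (auto simp: M.in_set_add)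
      ultimately show "w \<in> f ` (plus_mult M ?B y Z)" using eq by (auto intro: rev_image_eqI)
    qed
  qed
  then show ?case using snoc.IH[OF ys] by (simp add: seq_ext_snoc)
qed

text \<open>A regular sequence on \<open>f Z\<close> keeps \<open>0 \<rightarrow> K \<rightarrow> Z \<rightarrow> f Z \<rightarrow> 0\<close> exact modulo the sequence.\<close>

lemma seq_regular_kernel:
  assumes M: "module R M" and N: "module R N" and f: "f \<in> module_hom R M N" and Z: "submod R M Z"
  defines "K \<equiv> {x \<in> Z. f x = \<zero>\<^bsub>N\<^esub>}"
  shows "set ys \<subseteq> carrier R \<Longrightarrow> seq_reg M Z ys \<Longrightarrow> seq_reg N (f ` Z) ys \<Longrightarrow>
    seq_reg M K ys \<and> K \<inter> seq_mult M Z ys = seq_mult M K ys"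
proof (induction ys rule: rev_induct)
  case Nil
  then show ?case using submodD(3)[OF Z] hom_zero[OF M N f] by (auto simp: K_def)
next
  case (snoc y ys)
  interpret M: module R M by fact
  interpret N: module R N by fact
  let ?B = "seq_mult M Z ys"
  have y: "y \<in> carrier R" and ys: "set ys \<subseteq> carrier R" using snoc.prems by auto
  have K: "submod R M K"
    unfolding K_def by (rule hom_kernel_submod[OF M N f Z])
  have BP: "submod R M ?B" "?B \<subseteq> Z" using M.seq_ext_props[OF Z M.submod_zero _ ys] submodD(3)[OF Z] by auto
  note c = submod_in_carrier[OF BP(1)] submod_in_carrier[OF Z]
  have rZ: "seq_reg M Z ys" and rN: "seq_reg N (f ` Z) ys"
    and regZ: "\<And>z. z \<in> Z \<Longrightarrow> y \<odot>\<^bsub>M\<^esub> z \<in> ?B \<Longrightarrow> z \<in> ?B"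
    and regN: "\<And>z. z \<in> Z \<Longrightarrow> y \<odot>\<^bsub>N\<^esub> f z \<in> f ` ?B \<Longrightarrow> f z \<in> f ` ?B"
    using snoc.prems(2,3) by (auto simp: seq_regular_snoc seq_ext_image[OF M N f Z ys])
  note IH = snoc.IH[OF ys rZ rN]
  have "z \<in> seq_mult M K ys" if z: "z \<in> K" "y \<odot>\<^bsub>M\<^esub> z \<in> seq_mult M K ys" for z
    using IH z regZ[of z] by (auto simp: K_def)
  moreover have "K \<inter> (plus_mult M ?B y Z) = plus_mult M (seq_mult M K ys) y K"
  proof
    show "K \<inter> (plus_mult M ?B y Z) \<subseteq> plus_mult M (seq_mult M K ys) y K"
    proof
      fix w assume w: "w \<in> K \<inter> (plus_mult M ?B y Z)"
      then obtain u z where u: "u \<in> ?B" and z: "z \<in> Z" and e: "w = u \<oplus>\<^bsub>M\<^esub> y \<odot>\<^bsub>M\<^esub> z" by (auto simp: M.in_set_add)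
      note fc = hom_in_carrier[OF f]
      have "f u \<oplus>\<^bsub>N\<^esub> y \<odot>\<^bsub>N\<^esub> f z = \<zero>\<^bsub>N\<^esub>"
        using w e c(1)[OF u] c(2)[OF z] y module_hom_add[OF f] module_hom_smult[OF f] by (simp add: K_def)
      then have "y \<odot>\<^bsub>N\<^esub> f z = \<ominus>\<^bsub>N\<^esub> f u"
        using N.M.minus_equality[of "y \<odot>\<^bsub>N\<^esub> f z" "f u"] N.M.a_comm[of "f u" "y \<odot>\<^bsub>N\<^esub> f z"]
          fc[OF c(1)[OF u]] fc[OF c(2)[OF z]] y by simp
      moreover have "\<ominus>\<^bsub>N\<^esub> f u \<in> f ` ?B" using N.submod_uminus[OF hom_image_submod[OF M N f BP(1)]] u by blast
      ultimately have "f z \<in> f ` ?B" using regN[OF z] by simp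
      then obtain u' where u': "u' \<in> ?B" "f z = f u'" by blast
      \<comment> \<open>Since \<open>f z\<close> lies in the image of \<open>(ys)Z\<close>, a
        correction of \<open>z\<close> by \<open>u'\<close> lands in the kernel. Then
        \<open>w\<close> is \<open>y \<kappa>\<close> plus an element of both \<open>K\<close> and
        \<open>(ys)Z\<close>, to which the induction hypothesis applies.\<close>
      define \<kappa> where "\<kappa> = z \<ominus>\<^bsub>M\<^esub> u'"
      have \<kappa>c: "\<kappa> \<in> carrier M" using c(1)[OF u'(1)] c(2)[OF z] by (simp add: \<kappa>_def)
      have \<kappa>: "\<kappa> \<in> K"
        using M.submod_minus[OF Z z, of u'] BP(2) u' hom_minus[OF M N f c(2)[OF z] c(1)[OF u'(1)]] fc[OF c(1)[OF u'(1)]]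
        by (auto simp: K_def \<kappa>_def)
      have zk: "z = u' \<oplus>\<^bsub>M\<^esub> \<kappa>" using c(1)[OF u'(1)] c(2)[OF z] by (simp add: \<kappa>_def M.M.a_comm[of u'])
      let ?v = "u \<oplus>\<^bsub>M\<^esub> y \<odot>\<^bsub>M\<^esub> u'"
      have v: "?v \<in> ?B" by (intro submodD(4,5)[OF BP(1)] u u'(1) y)
      have wv: "w = ?v \<oplus>\<^bsub>M\<^esub> y \<odot>\<^bsub>M\<^esub> \<kappa>"
        using e zk c(1)[OF u] c(1)[OF u'(1)] \<kappa>c y by (simp add: M.smult_r_distr M.M.a_assoc)
      have "y \<odot>\<^bsub>M\<^esub> \<kappa> \<in> K" by (rule submodD(5)[OF K y \<kappa>])
      then have "?v = w \<ominus>\<^bsub>M\<^esub> y \<odot>\<^bsub>M\<^esub> \<kappa>" unfolding wv using c(1)[OF v] \<kappa>c y by simp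
      then have "?v \<in> K" using M.submod_minus[OF K, of w "y \<odot>\<^bsub>M\<^esub> \<kappa>"] w \<open>y \<odot>\<^bsub>M\<^esub> \<kappa> \<in> K\<close> by simp
      then show "w \<in> plus_mult M (seq_mult M K ys) y K"
        unfolding M.in_set_add using v IH \<kappa> wv by blast
    qed
    show "plus_mult M (seq_mult M K ys) y K \<subseteq> K \<inter> (plus_mult M ?B y Z)"
    proof (intro Int_greatest)
      show "plus_mult M (seq_mult M K ys) y K \<subseteq> K"
        by (rule M.set_add_least[OF K]) (use IH submodD(5)[OF K y] in auto)
      show "plus_mult M (seq_mult M K ys) y K \<subseteq> plus_mult M ?B y Z"
        by (rule M.set_add_mono) (use IH in \<open>auto simp: K_def\<close>)
    qed
  qed
  ultimately show ?case using IH by (simp add: seq_regular_snoc seq_ext_snoc)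
qed

text \<open>Additivity of length along 0 \<rightarrow> K \<rightarrow> Z \<rightarrow> f Z
  \<rightarrow> 0 after reduction modulo \<open>ys\<close>; the left end is the part that depends on
  regularity.\<close>

lemma mlength_kernel:
  assumes M: "module R M" and N: "module R N" and f: "f \<in> module_hom R M N" and Z: "submod R M Z"
    and ys: "set ys \<subseteq> carrier R" and rM: "seq_reg M Z ys" and rN: "seq_reg N (f ` Z) ys"
  defines "K \<equiv> {x \<in> Z. f x = \<zero>\<^bsub>N\<^esub>}"
  shows "mlength R M (seq_mult M Z ys) Z =
    mlength R M (seq_mult M K ys) K + mlength R N (seq_mult N (f ` Z) ys) (f ` Z)"
proof -
  interpret M: module R M by fact
  interpret N: module R N by fact
  let ?B = "seq_mult M Z ys" and ?B' = "seq_mult N (f ` Z) ys"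
  have K: "submod R M K"
    unfolding K_def by (rule hom_kernel_submod[OF M N f Z])
  have KZ: "K \<subseteq> Z" by (auto simp: K_def)
  have B: "submod R M ?B" "?B \<subseteq> Z" using M.seq_ext_props[OF Z M.submod_zero _ ys] submodD(3)[OF Z] by auto
  note S = M.submod_set_add[OF K B(1)]
  have fB: "f ` ?B = ?B'" by (rule seq_ext_image[OF M N f Z ys])
  have e: "{x \<in> Z. f x \<in> ?B'} = K <+>\<^bsub>M\<^esub> ?B"
    using hom_vimage_image[OF M N f Z B] unfolding K_def fB .
  have B': "submod R N ?B'" "?B' \<subseteq> f ` Z" using hom_image_submod[OF M N f B(1)] B(2) unfolding fB[symmetric] by auto
  have "mlength R M (K <+>\<^bsub>M\<^esub> ?B) Z = mlength R N ?B' (f ` Z)"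
    using hom_mlength[OF M N f Z B'] unfolding e .
  moreover have "mlength R M ?B (K <+>\<^bsub>M\<^esub> ?B) = mlength R M (seq_mult M K ys) K"
    using M.mlength_second_iso[OF B(1) K] seq_regular_kernel[OF M N f Z ys rM rN] by (simp add: K_def)
  ultimately show ?thesis
    using M.mlength_add[OF B(1) S Z M.set_add_upper2[OF K B(1)] M.set_add_least[OF Z KZ B(2)]] by simp
qed

lemma (in cring) seq_ideal_smult:
  assumes Z: "submod R M Z" and ys: "set ys \<subseteq> carrier R" and r: "r \<in> seq_ideal ys" and z: "z \<in> Z"
  shows "r \<odot>\<^bsub>M\<^esub> z \<in> seq_mult M Z ys"
proof -
  interpret M: module R M by (rule submodD(1)[OF Z])
  let ?B = "seq_mult M Z ys"
  have zc: "z \<in> carrier M" by (rule submod_in_carrier[OF Z z])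
  have B: "submod R M ?B" "\<And>x z. x \<in> set ys \<Longrightarrow> z \<in> Z \<Longrightarrow> x \<odot>\<^bsub>M\<^esub> z \<in> ?B"
    using M.seq_ext_props[OF Z M.submod_zero _ ys] submodD(3)[OF Z] by auto
  have "submod R (ring_module R) {r \<in> carrier R. r \<odot>\<^bsub>M\<^esub> z \<in> ?B}"
    using M.annihilator_ideal[OF B(1) zc] ideal_submod by blast
  then have "seq_ideal ys \<subseteq> {r \<in> carrier R. r \<odot>\<^bsub>M\<^esub> z \<in> ?B}"
    unfolding seq_ideal_def
  proof (rule module.seq_ext_least[OF module_ring_module])
    show "{\<zero>} \<subseteq> {r \<in> carrier R. r \<odot>\<^bsub>M\<^esub> z \<in> ?B}" using submodD(3)[OF B(1)] zc by simp
    fix x s assume "x \<in> set ys" "s \<in> carrier R"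
    moreover from this have "x \<in> carrier R" using ys by blast
    ultimately show "x \<odot>\<^bsub>ring_module R\<^esub> s \<in> {r \<in> carrier R. r \<odot>\<^bsub>M\<^esub> z \<in> ?B}"
      using M.smult_assoc1[of x s z] zc B(2)[of x "s \<odot>\<^bsub>M\<^esub> z"] submodD(5)[OF Z _ z] by simp
  qed
  then show ?thesis using r by blast
qed

section \<open>Length modulo a regular sequence against the number of generators\<close>

context noetherian_local_ring
begin

text \<open>Adjoining one minimal generator at a time, each layer is a quotient of
  \<open>R/J\<close> and has length at most \<open>p\<close>. Once \<open>U + \<mm>Z = Z\<close>,
  Nakayama gives \<open>U = Z\<close>.\<close>

lemma mlength_le_generators:
  assumes Z: "submod R M Z" and noeth: "noetherian_subquot R M {\<zero>\<^bsub>M\<^esub>} Z"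
    and J: "ideal J R" "colength R J = enat p"
  shows "submod R M U \<Longrightarrow> U \<subseteq> Z \<Longrightarrow> (\<And>r z. r \<in> J \<Longrightarrow> z \<in> Z \<Longrightarrow> r \<odot>\<^bsub>M\<^esub> z \<in> U) \<Longrightarrow>
    mlength R M (U <+>\<^bsub>M\<^esub> module.ideal_smult R M \<mm> Z) Z = enat m \<Longrightarrow> mlength R M U Z \<le> enat (m * p)"
proof (induction m arbitrary: U)
  case (0 U)
  interpret M: module R M by (rule submodD(1)[OF Z])
  let ?mZ = "M.ideal_smult \<mm> Z"
  have mZ: "submod R M ?mZ" "?mZ \<subseteq> Z"
    using M.ideal_smult_submod[OF \<mm>_subset submodD(2)[OF Z]] M.ideal_smult_subset[OF Z \<mm>_subset] by auto
  note S = M.submod_set_add[OF 0(1) mZ(1)] and SZ = M.set_add_least[OF Z 0(2) mZ(2)]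
  have top: "U <+>\<^bsub>M\<^esub> ?mZ = Z"
  proof (rule ccontr)
    assume "U <+>\<^bsub>M\<^esub> ?mZ \<noteq> Z"
    then have "1 \<le> mlength R M (U <+>\<^bsub>M\<^esub> ?mZ) Z" using SZ by (intro mlength_pos[OF S Z]) blast
    then show False using 0(4) by (simp add: zero_enat_def[symmetric])
  qed
  have "U = Z"
  proof (rule nakayama[OF 0(1) Z 0(2)])
    show "noetherian_subquot R M U Z" by (rule noetherian_subquot_mono[OF noeth]) (use submodD(3)[OF 0(1)] in auto)
    fix S assume "submod R M S" "U \<subseteq> S" "S \<subseteq> Z" "\<And>r z. r \<in> \<mm> \<Longrightarrow> z \<in> Z \<Longrightarrow> r \<odot>\<^bsub>M\<^esub> z \<in> S"
    then show "S = Z" using M.set_add_least[of S U ?mZ] M.ideal_smult_least[of S \<mm> Z] top by blast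
  qed
  then show ?case by simp
next
  case (Suc m U)
  interpret M: module R M by (rule submodD(1)[OF Z])
  let ?mZ = "M.ideal_smult \<mm> Z"
  have mZ: "submod R M ?mZ" "?mZ \<subseteq> Z"
    using M.ideal_smult_submod[OF \<mm>_subset submodD(2)[OF Z]] M.ideal_smult_subset[OF Z \<mm>_subset] by auto
  note S = M.submod_set_add[OF Suc.prems(1) mZ(1)] and SZ = M.set_add_least[OF Z Suc.prems(2) mZ(2)]
  have "U <+>\<^bsub>M\<^esub> ?mZ \<noteq> Z" using Suc.prems(4) by (auto simp: zero_enat_def)
  then obtain v where v: "v \<in> Z" "v \<notin> U <+>\<^bsub>M\<^esub> ?mZ" using SZ by blast
  have vc: "v \<in> carrier M" by (rule submod_in_carrier[OF Z v(1)])
  note ad = M.adjoin_props[OF Suc.prems(1) vc] and aZ = M.adjoin_least[OF Z Suc.prems(2) v(1)]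
  note cyc = M.submod_cyclic[OF vc]
  have eq: "M.adjoin U v <+>\<^bsub>M\<^esub> ?mZ = M.adjoin (U <+>\<^bsub>M\<^esub> ?mZ) v"
    by (rule antisym; intro M.set_add_least M.submod_set_add S mZ(1) cyc Suc.prems(1))
      (use M.set_add_upper1[OF S cyc] M.set_add_upper2[OF S cyc] M.set_add_upper1[OF Suc.prems(1) mZ(1)]
        M.set_add_upper2[OF Suc.prems(1) mZ(1)] M.set_add_upper1[OF ad(1) mZ(1)] M.set_add_upper2[OF ad(1) mZ(1)]
        M.set_add_upper1[OF Suc.prems(1) cyc] M.set_add_upper2[OF Suc.prems(1) cyc] in blast)+
  have one: "mlength R M (U <+>\<^bsub>M\<^esub> ?mZ) (M.adjoin (U <+>\<^bsub>M\<^esub> ?mZ) v) = 1"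
    by (rule mlength_adjoin_simple[OF S vc v(2)])
      (use M.ideal_smult_mem[OF \<mm>_subset submodD(2)[OF Z] _ v(1)] M.set_add_upper2[OF Suc.prems(1) mZ(1)] in blast)
  have "enat (Suc m) = 1 + mlength R M (M.adjoin (U <+>\<^bsub>M\<^esub> ?mZ) v) Z"
    using M.mlength_add[OF S M.adjoin_props(1)[OF S vc] Z M.adjoin_props(2)[OF S vc] M.adjoin_least[OF Z SZ v(1)]] one Suc.prems(4)
    by simp
  then have "mlength R M (M.adjoin U v <+>\<^bsub>M\<^esub> ?mZ) Z = enat m"
    unfolding eq by (cases "mlength R M (M.adjoin (U <+>\<^bsub>M\<^esub> ?mZ) v) Z") (auto simp: one_enat_def)
  from Suc.IH[OF ad(1) aZ _ this] have IH: "mlength R M (M.adjoin U v) Z \<le> enat (m * p)" using Suc.prems(3) ad(2) by blast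
  have "mlength R M U (M.adjoin U v) \<le> enat p"
    unfolding M.mlength_adjoin[OF Suc.prems(1) vc] J(2)[symmetric]
    by (rule mlength_mono) (use ideal.Icarr[OF J(1)] Suc.prems(3)[OF _ v(1)] M.annihilator_ideal[OF Suc.prems(1) vc] ideal_submod in auto)
  then have "mlength R M U Z \<le> enat p + enat (m * p)"
    unfolding M.mlength_add[OF Suc.prems(1) ad(1) Z ad(2) aZ] using IH by (rule add_mono)
  then show ?case by simp
qed

lemma seq_ext_subset_\<mm>:
  assumes Z: "submod R M Z" and ys: "set ys \<subseteq> \<mm>"
  shows "seq_mult M Z ys \<subseteq> module.ideal_smult R M \<mm> Z"
proof -
  interpret M: module R M by (rule submodD(1)[OF Z])
  have mZ: "submod R M (M.ideal_smult \<mm> Z)" by (rule M.ideal_smult_submod[OF \<mm>_subset submodD(2)[OF Z]])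
  show ?thesis
    by (rule M.seq_ext_least[OF mZ])
      (use submodD(3)[OF mZ] ys M.ideal_smult_mem[OF \<mm>_subset submodD(2)[OF Z]] in auto)
qed

lemma mlength_seq_le_generators:
  assumes Z: "submod R M Z" and noeth: "noetherian_subquot R M {\<zero>\<^bsub>M\<^esub>} Z"
    and ys: "set ys \<subseteq> \<mm>" and fin: "colength R (seq_ideal ys) = enat p"
    and \<mu>: "mlength R M (module.ideal_smult R M \<mm> Z) Z = enat \<mu>"
  shows "mlength R M (seq_mult M Z ys) Z \<le> enat (\<mu> * p)"
proof -
  interpret M: module R M by (rule submodD(1)[OF Z])
  have ysR: "set ys \<subseteq> carrier R" using ys \<mm>_subset by blast
  have B: "submod R M (seq_mult M Z ys)" "seq_mult M Z ys \<subseteq> Z"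
    using M.seq_ext_props[OF Z M.submod_zero _ ysR] submodD(3)[OF Z] by auto
  have mZ: "submod R M (M.ideal_smult \<mm> Z)" by (rule M.ideal_smult_submod[OF \<mm>_subset submodD(2)[OF Z]])
  have e: "seq_mult M Z ys <+>\<^bsub>M\<^esub> M.ideal_smult \<mm> Z = M.ideal_smult \<mm> Z"
    by (rule antisym[OF M.set_add_least[OF mZ seq_ext_subset_\<mm>[OF Z ys] order_refl] M.set_add_upper2[OF B(1) mZ]])
  show ?thesis
    by (rule mlength_le_generators[OF Z noeth seq_ideal_ideal[OF ysR] fin B])
      (use seq_ideal_smult[OF Z ysR] \<mu> e in auto)
qed

text \<open>The minimal generator \<open>v\<close> is adjoined before all others. Its layer is
  \<open>R\<close> modulo an ideal that contains \<open>s\<close> besides \<open>(ys)\<close>, so it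
  has length below \<open>p\<close>; the remaining generators contribute at most \<open>p\<close>
  each.\<close>

lemma mlength_seq_less_generators:
  assumes Z: "submod R M Z" and noeth: "noetherian_subquot R M {\<zero>\<^bsub>M\<^esub>} Z"
    and ys: "set ys \<subseteq> \<mm>" and fin: "colength R (seq_ideal ys) = enat p"
    and \<mu>: "mlength R M (module.ideal_smult R M \<mm> Z) Z = enat \<mu>"
    and v: "v \<in> Z" "v \<notin> module.ideal_smult R M \<mm> Z"
    and s: "s \<in> carrier R" "s \<notin> seq_ideal ys" "s \<odot>\<^bsub>M\<^esub> v \<in> seq_mult M Z ys"
  shows "mlength R M (seq_mult M Z ys) Z < enat (\<mu> * p)"
proof -
  interpret M: module R M by (rule submodD(1)[OF Z])
  let ?B = "seq_mult M Z ys" and ?mZ = "M.ideal_smult \<mm> Z"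
  have ysR: "set ys \<subseteq> carrier R" using ys \<mm>_subset by blast
  note J = seq_ideal_ideal[OF ysR]
  have B: "submod R M ?B" "?B \<subseteq> Z" using M.seq_ext_props[OF Z M.submod_zero _ ysR] submodD(3)[OF Z] by auto
  have mZ: "submod R M ?mZ" "?mZ \<subseteq> Z"
    using M.ideal_smult_submod[OF \<mm>_subset submodD(2)[OF Z]] M.ideal_smult_subset[OF Z \<mm>_subset] by auto
  have vc: "v \<in> carrier M" by (rule submod_in_carrier[OF Z v(1)])
  note ad = M.adjoin_props[OF B(1) vc] and aZ = M.adjoin_least[OF Z B(2) v(1)]
  note am = M.adjoin_props[OF mZ(1) vc] and amZ = M.adjoin_least[OF Z mZ(2) v(1)]
  have Bm: "?B \<subseteq> ?mZ" by (rule seq_ext_subset_\<mm>[OF Z ys])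
  have eq: "M.adjoin ?B v <+>\<^bsub>M\<^esub> ?mZ = M.adjoin ?mZ v"
  proof
    show "M.adjoin ?B v <+>\<^bsub>M\<^esub> ?mZ \<subseteq> M.adjoin ?mZ v"
      by (intro M.set_add_least[OF am(1) _ am(2)] M.adjoin_least[OF am(1) _ am(3)]) (use Bm am(2) in blast)
    show "M.adjoin ?mZ v \<subseteq> M.adjoin ?B v <+>\<^bsub>M\<^esub> ?mZ"
      by (rule M.adjoin_least[OF M.submod_set_add[OF ad(1) mZ(1)] M.set_add_upper2[OF ad(1) mZ(1)]])
        (use ad(3) M.set_add_upper1[OF ad(1) mZ(1)] in blast)
  qed
  have one: "mlength R M ?mZ (M.adjoin ?mZ v) = 1"
    by (rule mlength_adjoin_simple[OF mZ(1) vc v(2)]) (rule M.ideal_smult_mem[OF \<mm>_subset submodD(2)[OF Z] _ v(1)])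
  have "enat \<mu> = 1 + mlength R M (M.adjoin ?mZ v) Z"
    using M.mlength_add[OF mZ(1) am(1) Z am(2) amZ] one \<mu> by simp
  then obtain m where m: "mlength R M (M.adjoin ?mZ v) Z = enat m" "\<mu> = Suc m"
    by (cases "mlength R M (M.adjoin ?mZ v) Z") (auto simp: one_enat_def)
  have le: "mlength R M (M.adjoin ?B v) Z \<le> enat (m * p)"
    by (rule mlength_le_generators[OF Z noeth J fin ad(1) aZ]) (use seq_ideal_smult[OF Z ysR] ad(2) m(1) eq in auto)
  let ?I = "{r \<in> carrier R. r \<odot>\<^bsub>M\<^esub> v \<in> ?B}"
  have I: "ideal ?I R" by (rule M.annihilator_ideal[OF B(1) vc])
  have JI: "seq_ideal ys \<subset> ?I" using ideal.Icarr[OF J] seq_ideal_smult[OF Z ysR _ v(1)] s by blast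
  have "1 \<le> mlength R (ring_module R) (seq_ideal ys) ?I" by (rule mlength_pos[OF ideal_submod[OF J] ideal_submod[OF I] JI])
  moreover have "enat p = mlength R (ring_module R) (seq_ideal ys) ?I + colength R ?I"
    using mlength_ideal_add[OF J I] JI fin by auto
  ultimately obtain t where t: "colength R ?I = enat t" "t < p"
    by (cases "colength R ?I"; cases "mlength R (ring_module R) (seq_ideal ys) ?I") (auto simp: one_enat_def)
  have "mlength R M ?B Z = enat t + mlength R M (M.adjoin ?B v) Z"
    using M.mlength_add[OF B(1) ad(1) Z ad(2) aZ] M.mlength_adjoin[OF B(1) vc] t(1) by simp
  moreover obtain c where "mlength R M (M.adjoin ?B v) Z = enat c" "c \<le> m * p"
    using le by (cases "mlength R M (M.adjoin ?B v) Z") auto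
  ultimately show ?thesis using t(2) m(2) by simp
qed

section \<open>One syzygy step: \<open>K\<close> is the kernel of a map from a free module onto
  \<open>Z\<close>\<close>

context
  fixes M :: "('a, 'm, 'd) module_scheme" and f :: "(nat \<Rightarrow> 'a) \<Rightarrow> 'm" and n :: nat and ys :: "'a list" and p :: nat and K Z
  assumes M: "module R M" and f: "f \<in> module_hom R (free_pow R n) M"
    and Z_def: "Z = f ` carrier (free_pow R n)"
    and K_def: "K = {x \<in> carrier (free_pow R n). f x = \<zero>\<^bsub>M\<^esub>}"
    and ys: "regular_on_ring ys" "set ys \<subseteq> \<mm>"
    and fin: "colength R (seq_ideal ys) = enat p"
    and reg: "seq_reg M Z ys"
begin

interpretation F: module R "free_pow R n" by (rule free_pow_module)
interpretation M: module R M by (rule M)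

lemma syzygy_facts:
  shows "submod R (free_pow R n) K" "submod R M Z" "set ys \<subseteq> carrier R" "seq_regular (ring_module R) (carrier R) {\<zero>} ys"
  using hom_kernel_submod[OF F.module_axioms M f F.submod_carrier] hom_image_submod[OF F.module_axioms M f F.submod_carrier]
    ys(1) by (simp_all add: K_def Z_def regular_on_ring_def)

lemma syzygy_regular:
  "seq_reg (free_pow R n) K ys"
  "K \<inter> coord_sub n (seq_ideal ys) 0 = seq_mult (free_pow R n) K ys"
  using seq_regular_kernel[OF F.module_axioms M f F.submod_carrier syzygy_facts(3)
      seq_regular_free_pow[OF syzygy_facts(3,4)] reg[unfolded Z_def]]
    seq_ext_free_pow[OF syzygy_facts(3)]
  by (simp_all add: K_def seq_ideal_def)

lemma syzygy_mlength:
  "enat (n * p) = mlength R (free_pow R n) (seq_mult (free_pow R n) K ys) K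
    + mlength R M (seq_mult M Z ys) Z"
  using mlength_kernel[OF F.module_axioms M f F.submod_carrier syzygy_facts(3)
      seq_regular_free_pow[OF syzygy_facts(3,4)] reg[unfolded Z_def]]
    seq_ext_free_pow[OF syzygy_facts(3), of n] mlength_free_pow[OF seq_ideal_ideal[OF syzygy_facts(3)], of n] fin
  by (simp add: K_def Z_def seq_ideal_def of_nat_eq_enat)

text \<open>The minimal number of generators of \<open>Z\<close> is \<open>n\<close> minus the rank
  of \<open>K\<close> modulo \<open>\<mm>\<close>, since \<open>\<mm>Z\<close> pulls back to
  \<open>K + \<mm>F\<close>.\<close>

lemma syzygy_generators:
  "enat n = mlength R (free_pow R n) (coord_sub n \<mm> 0) (K <+>\<^bsub>free_pow R n\<^esub> coord_sub n \<mm> 0)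
    + mlength R M (module.ideal_smult R M \<mm> Z) Z"
proof -
  let ?mF = "coord_sub n \<mm> 0"
  have mF: "submod R (free_pow R n) ?mF" "?mF \<subseteq> carrier (free_pow R n)" using coord_sub_submod[OF \<mm>_ideal] submodD(2) by blast+
  have im: "f ` ?mF = M.ideal_smult \<mm> Z"
    using hom_ideal_smult_image[OF F.module_axioms M f F.submod_carrier \<mm>_subset] ideal_smult_free_pow[OF \<mm>_ideal]
    by (simp add: Z_def)
  have B': "submod R M (M.ideal_smult \<mm> Z)" "M.ideal_smult \<mm> Z \<subseteq> f ` carrier (free_pow R n)"
    using hom_image_submod[OF F.module_axioms M f mF(1)] mF(2) unfolding im[symmetric] by auto
  have "{x \<in> carrier (free_pow R n). f x \<in> M.ideal_smult \<mm> Z} = K <+>\<^bsub>free_pow R n\<^esub> ?mF"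
    using hom_vimage_image[OF F.module_axioms M f F.submod_carrier mF] unfolding im K_def .
  then have "mlength R (free_pow R n) (K <+>\<^bsub>free_pow R n\<^esub> ?mF) (carrier (free_pow R n)) = mlength R M (M.ideal_smult \<mm> Z) Z"
    using hom_mlength[OF F.module_axioms M f F.submod_carrier B'] by (simp add: Z_def)
  then show ?thesis
    using F.mlength_add[OF mF(1) F.submod_set_add[OF syzygy_facts(1) mF(1)] F.submod_carrier F.set_add_upper2[OF syzygy_facts(1) mF(1)]
        F.set_add_least[OF F.submod_carrier submodD(2)[OF syzygy_facts(1)] mF(2)]] mlength_free_pow_\<mm>[of n] by simp
qed

lemma syzygy_strict:
  assumes r: "mlength R (free_pow R n) (coord_sub n \<mm> 0) (K <+>\<^bsub>free_pow R n\<^esub> coord_sub n \<mm> 0) = enat r"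
    and \<mu>: "mlength R (free_pow R n) (module.ideal_smult R (free_pow R n) \<mm> K) K = enat \<mu>"
    and gt: "enat (r * p) < mlength R (free_pow R n) (seq_mult (free_pow R n) K ys) K"
  shows "mlength R (free_pow R n) (seq_mult (free_pow R n) K ys) K < enat (\<mu> * p)"
proof -
  let ?F = "free_pow R n" and ?mF = "coord_sub n \<mm> 0" and ?J = "seq_ideal ys"
  let ?mK = "F.ideal_smult \<mm> K"
  note K = syzygy_facts(1)
  have mF: "submod R ?F ?mF" by (rule coord_sub_submod[OF \<mm>_ideal])
  have noeth: "noetherian_subquot R ?F {\<zero>\<^bsub>?F\<^esub>} K" by (rule noetherian_free_pow[OF is_noetherian])
  show ?thesis
  proof (cases "K \<inter> ?mF \<subseteq> ?mK")
    \<comment> \<open>If no minimal generator of \<open>K\<close> lies in \<open>\<mm>F\<close>,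
      then \<open>\<mu> = r\<close>, and the weak bound \<open>\<mu> p\<close> on the length
      contradicts \<open>gt\<close>.\<close>
    case True
    have "?mK \<subseteq> ?mF"
      using F.ideal_smult_mono[OF \<mm>_subset order_refl submodD(2)[OF K]] ideal_smult_free_pow[OF \<mm>_ideal, of n] by simp
    then have "?mK = K \<inter> ?mF" using True F.ideal_smult_subset[OF K \<mm>_subset] by blast
    then have "\<mu> = r" using F.mlength_second_iso[OF mF K] \<mu> r by simp
    then show ?thesis using mlength_seq_le_generators[OF K noeth ys(2) fin \<mu>] gt by simp
  next
    case False
    then obtain v where v: "v \<in> K" "v \<in> ?mF" "v \<notin> ?mK" by blast
    have J: "ideal ?J R" by (rule seq_ideal_ideal[OF syzygy_facts(3)])
    have "?J \<subseteq> \<mm>"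
      unfolding seq_ideal_def
      by (rule module.seq_ext_least[OF module_ring_module \<mm>_submod]) (use submodD(3)[OF \<mm>_submod] ys(2) I_r_closed in auto)
    then have "?J \<noteq> carrier R" using one_not_in_\<mm> by blast
    \<comment> \<open>A socle element \<open>s\<close> of \<open>R\<close> modulo
      \<open>(ys)\<close> kills the coordinates of \<open>v\<close>, which lie in
      \<open>\<mm>\<close>; exactness modulo \<open>ys\<close> then moves \<open>s v\<close> from
      \<open>(ys)F\<close> into \<open>(ys)K\<close>.\<close>
    then obtain s where s: "s \<in> carrier R" "s \<notin> ?J" "colon_ideal ?J s = \<mm>"
      using socle_element[OF J] fin by (metis enat.distinct(2))
    have "s \<odot>\<^bsub>?F\<^esub> v \<in> coord_sub n ?J 0"
    proof -
      have vc: "v \<in> carrier ?F" by (rule submod_in_carrier[OF K v(1)])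
      have "s \<otimes> v i \<in> ?J" if i: "i < n" for i
      proof -
        have "v i \<in> colon_ideal ?J s" using v(2) i unfolding s(3) by (simp add: coord_sub_def)
        then show ?thesis using s(1) by (simp add: colon_ideal_def m_comm[of s "v i"])
      qed
      then show ?thesis using F.smult_closed[OF s(1) vc] vc s(1) by (simp add: coord_sub_def free_pow_simps)
    qed
    moreover have "s \<odot>\<^bsub>?F\<^esub> v \<in> K" by (rule submodD(5)[OF K s(1) v(1)])
    ultimately have "s \<odot>\<^bsub>?F\<^esub> v \<in> seq_mult ?F K ys" using syzygy_regular(2) by blast
    then show ?thesis by (rule mlength_seq_less_generators[OF K noeth ys(2) fin \<mu> v(1,3) s(1,2)])
  qed
qed

end

end

section \<open>Socles and the type\<close>

context noetherian_local_ring
begin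

text \<open>Rees's isomorphism turns Ext in degree depth into Hom(k, M/(ys)M), the socle of
  \<open>M/(ys)M\<close>. It serves twice: for the canonical module and for the ring.\<close>

theorem module_type_socle:
  fixes M :: "('a, 'm) module"
  assumes M: "module R M" and depth: "depth R \<mm> M = enat (length ys)" and ys: "set ys \<subseteq> \<mm>"
    and reg: "seq_reg M (carrier M) ys"
  defines "N \<equiv> seq_mult M (carrier M) ys"
  assumes t: "mlength R M N {v \<in> carrier M. \<forall>r\<in>\<mm>. r \<odot>\<^bsub>M\<^esub> v \<in> N} = enat t"
  shows "module_type R \<mm> M = t"
proof -
  let ?k = "residue_module R \<mm>" and ?l = "length ys"
  obtain b d e where some: "some_resolution R ?k = (b, d)" and res: "residue_resolution R \<mm> ?k b d e residue_class"
    by (rule residue_resolution_exists)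
  interpret residue_resolution_module R \<mm> ?k b d e residue_class M
    by (intro residue_resolution_module.intro residue_resolution_module_axioms.intro res M)
  have ysR: "set ys \<subseteq> carrier R" using ys \<mm>_subset by blast
  have N: "submod R M N" using M.seq_ext_props[OF M.submod_carrier M.submod_zero _ ysR] by (simp add: N_def)
  have \<delta>: "(\<lambda>f. compose (carrier (F (Suc j))) f (d j)) = \<delta> j" for j by (simp add: \<delta>_def fun_eq_iff)
  have Bc: "(case ?l of 0 \<Rightarrow> {\<zero>\<^bsub>C 0\<^esub>} | Suc j \<Rightarrow> (\<lambda>f. compose (carrier (F (Suc j))) f (d j)) ` carrier (C j)) = Bc ?l {\<zero>\<^bsub>M\<^esub>}"
    unfolding Bc_zero_eq_image \<delta> by (rule refl)
  have "Ext R ?l ?k M = subquot (C ?l) (Zc ?l {\<zero>\<^bsub>M\<^esub>}) (Bc ?l {\<zero>\<^bsub>M\<^esub>})"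
    by (simp add: Ext_def some Let_def \<delta> Zc_zero_eq_ker Bc)
  moreover have "residue_dim R \<mm> (subquot (C ?l) (Zc ?l {\<zero>\<^bsub>M\<^esub>}) (Bc ?l {\<zero>\<^bsub>M\<^esub>})) = t"
  proof (rule residue_dim_subquot[OF Bc_submod Zc_submod Bc_subset_Zc])
    have "subquot_iso R (C 0) (Bc 0 N) (Zc 0 N) (C ?l) (Bc ?l {\<zero>\<^bsub>M\<^esub>}) (Zc ?l {\<zero>\<^bsub>M\<^esub>})"
      using ext_of_regular_sequence[OF M.submod_zero ys reg] by (simp add: N_def)
    from subquot_iso_mlength[OF this] subquot_iso_mlength[OF Zc0_iso_socle[OF N]] t
    show "mlength R (C ?l) (Bc ?l {\<zero>\<^bsub>M\<^esub>}) (Zc ?l {\<zero>\<^bsub>M\<^esub>}) = enat t" by simp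
  qed (use M.submod_zero Zc_homotopy[OF M.submod_zero] in auto)
  ultimately show ?thesis by (simp add: module_type_def depth)
qed

section \<open>A quotient \<open>W/N\<close> with socle of length at most one\<close>

context
  fixes W :: "('a, 'w) module" and N
  assumes N: "submod R W N" and soc: "mlength R W N {v \<in> carrier W. \<forall>r\<in>\<mm>. r \<odot>\<^bsub>W\<^esub> v \<in> N} \<le> 1"
begin

interpretation W: module R W by (rule submodD(1)[OF N])

text \<open>Modulo \<open>N\<close> this is Hom(R/I, W/N), which plays the role of the dual of
  \<open>R/I\<close>.\<close>

definition "annd I = {v \<in> carrier W. \<forall>r\<in>I. r \<odot>\<^bsub>W\<^esub> v \<in> N}"

lemma annd_submod:
  assumes I: "I \<subseteq> carrier R"
  shows "submod R W (annd I)"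
proof (rule submodI[OF W.module_axioms])
  fix x y assume "x \<in> annd I" "y \<in> annd I"
  then show "x \<oplus>\<^bsub>W\<^esub> y \<in> annd I" using I submodD(4)[OF N] W.smult_r_distr by (auto simp: annd_def subset_iff)
next
  fix r x assume r: "r \<in> carrier R" and x: "x \<in> annd I"
  have "s \<odot>\<^bsub>W\<^esub> (r \<odot>\<^bsub>W\<^esub> x) \<in> N" if s: "s \<in> I" for s
    using submodD(5)[OF N r, of "s \<odot>\<^bsub>W\<^esub> x"] W.smult_commute[of s r x] s x r I by (auto simp: annd_def)
  then show "r \<odot>\<^bsub>W\<^esub> x \<in> annd I" using r x by (simp add: annd_def)
qed (use I submodD(3)[OF N] in \<open>auto simp: annd_def subset_iff\<close>)

lemma N_subset_annd: "I \<subseteq> carrier R \<Longrightarrow> N \<subseteq> annd I"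
  using submodD(2,5)[OF N] by (auto simp: annd_def)

lemma mlength_in_socle:
  assumes Y: "submod R W Y" "Y \<subseteq> annd \<mm>"
  shows "mlength R W (Y \<inter> N) Y \<le> 1"
proof -
  have "mlength R W (Y \<inter> N) Y = mlength R W N (Y <+>\<^bsub>W\<^esub> N)" by (rule W.mlength_second_iso[OF N Y(1)])
  also have "\<dots> \<le> mlength R W N (annd \<mm>)"
    by (rule mlength_mono[OF order_refl W.set_add_least[OF annd_submod[OF \<mm>_subset] Y(2) N_subset_annd[OF \<mm>_subset]]
          N W.set_add_upper2[OF Y(1) N]])
  finally show ?thesis using soc by (simp add: annd_def)
qed

text \<open>Dualising shortens length: multiplication by the socle element \<open>a\<close> of
  \<open>R/J\<close> maps \<open>annd J\<close> into the socle of \<open>W/N\<close>, with kernel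
  \<open>annd (plus_ideal J a)\<close>, so each layer contributes at most one.\<close>

lemma mlength_annd_le:
  assumes I: "ideal I R" "colength R I = enat p"
  shows "mlength R W N (annd I) \<le> colength R I"
  using I
proof (induction rule: finite_colength_induct)
  case top
  have "annd (carrier R) = N"
    using N_subset_annd[of "carrier R"] W.smult_one by (force simp: annd_def)
  then show ?case by simp
next
  case (step J a)
  let ?P = "plus_ideal J a"
  note p = plus_ideal_facts[OF step(1,2)]
  have Jc: "J \<subseteq> carrier R" and Pc: "?P \<subseteq> carrier R" using ideal.Icarr[OF step(1)] ideal.Icarr[OF p(1)] by auto
  note Z = annd_submod[OF Jc] and ZP = annd_submod[OF Pc]
  note aW = smult_hom[OF W.module_axioms step(2)]
  let ?aZ = "(\<lambda>v. a \<odot>\<^bsub>W\<^esub> v) ` annd J"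
  have aZ: "submod R W ?aZ" by (rule W.submod_smult_image[OF Z step(2)])
  have "?aZ \<subseteq> annd \<mm>"
  proof
    fix w assume "w \<in> ?aZ"
    then obtain v where v: "v \<in> annd J" "w = a \<odot>\<^bsub>W\<^esub> v" by blast
    have vc: "v \<in> carrier W" using v(1) by (simp add: annd_def)
    have "r \<odot>\<^bsub>W\<^esub> w \<in> N" if r: "r \<in> \<mm>" for r
    proof -
      have "r \<in> carrier R" "r \<otimes> a \<in> J" using r unfolding step(4)[symmetric] by (simp_all add: colon_ideal_def)
      moreover from this(2) have "(r \<otimes> a) \<odot>\<^bsub>W\<^esub> v \<in> N" using v(1) by (simp add: annd_def)
      ultimately show ?thesis using v(2) W.smult_assoc1[of r a v] step(2) vc by simp
    qed
    then show "w \<in> annd \<mm>" using vc v(2) step(2) by (simp add: annd_def)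
  qed
  from mlength_in_socle[OF aZ this] have le: "mlength R W (?aZ \<inter> N) ?aZ \<le> 1" .
  have e: "{v \<in> annd J. a \<odot>\<^bsub>W\<^esub> v \<in> ?aZ \<inter> N} = annd ?P"
  proof
    show "annd ?P \<subseteq> {v \<in> annd J. a \<odot>\<^bsub>W\<^esub> v \<in> ?aZ \<inter> N}" using p(2,3) by (auto simp: annd_def)
    show "{v \<in> annd J. a \<odot>\<^bsub>W\<^esub> v \<in> ?aZ \<inter> N} \<subseteq> annd ?P"
    proof
      fix v assume v: "v \<in> {v \<in> annd J. a \<odot>\<^bsub>W\<^esub> v \<in> ?aZ \<inter> N}"
      then have vc: "v \<in> carrier W" by (simp add: annd_def)
      have "r \<odot>\<^bsub>W\<^esub> v \<in> N" if r: "r \<in> ?P" for r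
      proof -
        obtain j s where j: "j \<in> J" "s \<in> carrier R" "r = j \<oplus> s \<otimes> a" using r p(4) by blast
        have jc: "j \<in> carrier R" using j(1) Jc by blast
        have "j \<odot>\<^bsub>W\<^esub> v \<in> N" "s \<odot>\<^bsub>W\<^esub> (a \<odot>\<^bsub>W\<^esub> v) \<in> N" using v j submodD(5)[OF N j(2)] by (auto simp: annd_def)
        then show ?thesis
          using submodD(4)[OF N] j jc step(2) vc by (simp add: W.smult_l_distr W.smult_assoc1)
      qed
      then show "v \<in> annd ?P" using vc by (simp add: annd_def)
    qed
  qed
  have "mlength R W (annd ?P) (annd J) \<le> 1"
    using hom_mlength[OF W.module_axioms W.module_axioms aW Z W.submod_Int[OF aZ N]] le unfolding e by simp
  moreover have "mlength R W N (annd J) = mlength R W N (annd ?P) + mlength R W (annd ?P) (annd J)"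
    by (rule W.mlength_add[OF N ZP Z N_subset_annd[OF Pc]]) (use p(2) in \<open>auto simp: annd_def\<close>)
  ultimately show ?case using step.IH step(5) by (metis add.commute add_mono)
qed

text \<open>The ring modulo the annihilator of \<open>X/N\<close> is no longer than
  \<open>X/N\<close>. Along a maximal proper submodule \<open>S\<close> of \<open>X\<close> the
  annihilator shrinks by a part of the socle of \<open>W/N\<close> only.\<close>

lemma mlength_annihilator_le:
  assumes noeth: "noetherian_subquot R W N (carrier W)"
  shows "submod R W X \<Longrightarrow> N \<subseteq> X \<Longrightarrow> mlength R W N X = enat m \<Longrightarrow>
    colength R {r \<in> carrier R. \<forall>x\<in>X. r \<odot>\<^bsub>W\<^esub> x \<in> N} \<le> enat m"
proof (induction m arbitrary: X)
  case (0 X)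
  have "X = N" using mlength_pos[OF N 0(1)] 0(2,3) by (auto simp: zero_enat_def[symmetric])
  then have "{r \<in> carrier R. \<forall>x\<in>X. r \<odot>\<^bsub>W\<^esub> x \<in> N} = carrier R" using submodD(5)[OF N] by blast
  then show ?case by simp
next
  case (Suc m X)
  note X = Suc.prems(1)
  let ?A = "submod_interval R W N X - {X}"
  have "N \<noteq> X" using Suc.prems(3) by (auto simp: zero_enat_def)
  then have NA: "N \<in> ?A" using N Suc.prems(2) by (simp add: submod_interval_def)
  have "noetherian_subquot R W N X" by (rule noetherian_subquot_mono[OF noeth order_refl submodD(2)[OF X]])
  then have "\<exists>S\<in>?A. N \<subseteq> S \<and> (\<forall>U\<in>?A. S \<subseteq> U \<longrightarrow> U = S)"
    unfolding noetherian_subquot_def by (rule noetherian_maximal) (use NA in auto)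
  then obtain S where "S \<in> ?A" and max': "\<forall>U\<in>?A. S \<subseteq> U \<longrightarrow> U = S" by (elim bexE conjE)
  then have S: "submod R W S" "N \<subseteq> S" "S \<subset> X" by (auto simp: submod_interval_def)
  have max: "U = X" if U: "submod R W U" "S \<subset> U" "U \<subseteq> X" for U
    using max' U S(2) by (auto simp: submod_interval_def)
  obtain v where v: "v \<in> X" "v \<notin> S" using S(3) by blast
  have vc: "v \<in> carrier W" by (rule submod_in_carrier[OF X v(1)])
  have gen: "W.adjoin S w = X" if w: "w \<in> X" "w \<notin> S" for w
  proof (rule max)
    note a = W.adjoin_props[OF S(1) submod_in_carrier[OF X w(1)]]
    show "submod R W (W.adjoin S w)" by (rule a(1))
    show "S \<subset> W.adjoin S w" using a(2,3) w(2) by blast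
    show "W.adjoin S w \<subseteq> X" by (rule W.adjoin_least[OF X _ w(1)]) (use S(3) in blast)
  qed
  have mv: "r \<odot>\<^bsub>W\<^esub> v \<in> S" if r: "r \<in> \<mm>" for r
  proof (rule ccontr)
    assume n: "r \<odot>\<^bsub>W\<^esub> v \<notin> S"
    have rR: "r \<in> carrier R" using r by simp
    have "v \<in> W.adjoin S (r \<odot>\<^bsub>W\<^esub> v)" using gen[OF submodD(5)[OF X rR v(1)] n] v(1) by simp
    then obtain s t where s: "s \<in> S" "t \<in> carrier R" "v = s \<oplus>\<^bsub>W\<^esub> t \<odot>\<^bsub>W\<^esub> (r \<odot>\<^bsub>W\<^esub> v)" unfolding W.in_adjoin by blast
    have sc: "s \<in> carrier W" by (rule submod_in_carrier[OF S(1) s(1)])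
    have "v = s \<oplus>\<^bsub>W\<^esub> (t \<otimes> r) \<odot>\<^bsub>W\<^esub> v" using s(3) W.smult_assoc1[OF s(2) rR vc] by simp
    then have "v \<ominus>\<^bsub>W\<^esub> (t \<otimes> r) \<odot>\<^bsub>W\<^esub> v = s"
      using W.add_minus_cancel[OF sc W.smult_closed[OF m_closed[OF s(2) rR] vc]] by simp
    then show False using not_in_of_one_minus[OF S(1) vc I_l_closed[OF r s(2)]] s(1) v(2) by simp
  qed
  have one: "mlength R W S X = 1" using mlength_adjoin_simple[OF S(1) vc v(2) mv] gen[OF v] by simp
  have "enat (Suc m) = mlength R W N S + 1"
    using W.mlength_add[OF N S(1) X S(2)] S(3) one Suc.prems(3) by auto
  then have "mlength R W N S = enat m" by (cases "mlength R W N S") (auto simp: one_enat_def)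
  note IH = Suc.IH[OF S(1,2) this]
  let ?ann = "\<lambda>Y. {r \<in> carrier R. \<forall>x\<in>Y. r \<odot>\<^bsub>W\<^esub> x \<in> N}"
  have ann: "submod R (ring_module R) (?ann Y)" if Y: "Y \<subseteq> carrier W" for Y
    by (rule submodI[OF module_ring_module])
      (use Y submodD(3-5)[OF N] in \<open>auto simp: W.smult_l_distr W.smult_assoc1 subset_iff\<close>)
  have Sc: "S \<subseteq> carrier W" and Xc: "X \<subseteq> carrier W" using submodD(2)[OF S(1)] submodD(2)[OF X] by auto
  have h: "(\<lambda>r. r \<odot>\<^bsub>W\<^esub> v) \<in> module_hom R (ring_module R) W"
    using vc by (auto simp: module_hom_def W.smult_l_distr W.smult_assoc1)
  \<comment> \<open>For \<open>r\<close> annihilating \<open>S\<close> modulo \<open>N\<close> and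
    \<open>t\<close> in \<open>\<mm>\<close>, \<open>t r v = r (t v)\<close> lies in
    \<open>N\<close>, so \<open>r v\<close> is in the socle. It lies in \<open>N\<close> exactly
    when \<open>r\<close> annihilates all of \<open>X\<close>.\<close>
  let ?Y = "(\<lambda>r. r \<odot>\<^bsub>W\<^esub> v) ` ?ann S"
  have Y: "submod R W ?Y" by (rule hom_image_submod[OF module_ring_module W.module_axioms h ann[OF Sc]])
  have "?Y \<subseteq> annd \<mm>"
  proof
    fix w assume "w \<in> ?Y"
    then obtain r where r: "r \<in> carrier R" "\<forall>x\<in>S. r \<odot>\<^bsub>W\<^esub> x \<in> N" "w = r \<odot>\<^bsub>W\<^esub> v" by blast
    have "t \<odot>\<^bsub>W\<^esub> w \<in> N" if t: "t \<in> \<mm>" for t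
      using r(2) mv[OF t] W.smult_commute[of t r v] t r(1,3) vc by simp
    then show "w \<in> annd \<mm>" using r(1,3) vc by (simp add: annd_def)
  qed
  from mlength_in_socle[OF Y this] have le: "mlength R W (?Y \<inter> N) ?Y \<le> 1" .
  have e: "{r \<in> ?ann S. r \<odot>\<^bsub>W\<^esub> v \<in> ?Y \<inter> N} = ?ann X"
  proof
    show "?ann X \<subseteq> {r \<in> ?ann S. r \<odot>\<^bsub>W\<^esub> v \<in> ?Y \<inter> N}" using S(3) v(1) by auto
    show "{r \<in> ?ann S. r \<odot>\<^bsub>W\<^esub> v \<in> ?Y \<inter> N} \<subseteq> ?ann X"
    proof
      fix r assume "r \<in> {r \<in> ?ann S. r \<odot>\<^bsub>W\<^esub> v \<in> ?Y \<inter> N}"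
      then have r: "r \<in> carrier R" "\<And>x. x \<in> S \<Longrightarrow> r \<odot>\<^bsub>W\<^esub> x \<in> N" "r \<odot>\<^bsub>W\<^esub> v \<in> N" by auto
      have "r \<odot>\<^bsub>W\<^esub> x \<in> N" if x: "x \<in> X" for x
      proof -
        obtain s t where s: "s \<in> S" "t \<in> carrier R" "x = s \<oplus>\<^bsub>W\<^esub> t \<odot>\<^bsub>W\<^esub> v"
          using x gen[OF v] W.in_adjoin[of x S v] by blast
        have "r \<odot>\<^bsub>W\<^esub> x = r \<odot>\<^bsub>W\<^esub> s \<oplus>\<^bsub>W\<^esub> t \<odot>\<^bsub>W\<^esub> (r \<odot>\<^bsub>W\<^esub> v)"
          using s submod_in_carrier[OF S(1) s(1)] r(1) vc by (simp add: W.smult_r_distr W.smult_commute)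
        then show ?thesis using submodD(4)[OF N r(2)[OF s(1)] submodD(5)[OF N s(2) r(3)]] by simp
      qed
      then show "r \<in> ?ann X" using r(1) by blast
    qed
  qed
  have XS: "mlength R (ring_module R) (?ann X) (?ann S) \<le> 1"
    using hom_mlength[OF module_ring_module W.module_axioms h ann[OF Sc] W.submod_Int[OF Y N]] le unfolding e by simp
  have "colength R (?ann X) =
      mlength R (ring_module R) (?ann X) (?ann S) + colength R (?ann S)"
    using module.mlength_add[OF module_ring_module ann[OF Xc] ann[OF Sc] module.submod_carrier[OF module_ring_module]] S(3) by auto
  then have "colength R (?ann X) \<le> 1 + enat m" using add_mono[OF XS IH] by simp
  then show ?case by (simp add: one_enat_def)
qed

text \<open>\<open>W/N\<close> behaves like the injective hull of the residue field over \<open>R/J\<close>.\<close>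

lemma socle_one_duality:
  assumes noeth: "noetherian_subquot R W N (carrier W)"
    and J: "ideal J R" "colength R J = enat p"
    and JW: "\<And>r v. r \<in> J \<Longrightarrow> v \<in> carrier W \<Longrightarrow> r \<odot>\<^bsub>W\<^esub> v \<in> N"
    and Nm: "N \<subseteq> W.ideal_smult \<mm> (carrier W)"
    and long: "enat p \<le> mlength R W N (carrier W)"
  shows "mlength R W N (carrier W) = enat p"
    "mlength R W (W.ideal_smult \<mm> (carrier W)) (carrier W) \<le> mlength R (ring_module R) J {s \<in> carrier R. \<forall>r\<in>\<mm>. r \<otimes> s \<in> J}"
proof -
  let ?X = "W.ideal_smult \<mm> (carrier W)" and ?l = "mlength R (ring_module R)"
  let ?ann = "\<lambda>Y. {r \<in> carrier R. \<forall>x\<in>Y. r \<odot>\<^bsub>W\<^esub> x \<in> N}"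
  have annJ: "annd J = carrier W" using JW by (auto simp: annd_def)
  show eq: "mlength R W N (carrier W) = enat p"
    using mlength_annd_le[OF J] long unfolding annJ J(2) by (rule antisym)
  have Jc: "J \<subseteq> carrier R" using ideal.Icarr[OF J(1)] by blast
  have ann: "ideal (?ann Y) R" if Y: "Y \<subseteq> carrier W" for Y
    unfolding submod_iff_ideal[symmetric]
    by (rule submodI[OF module_ring_module])
      (use Y submodD(3-5)[OF N] in \<open>auto simp: W.smult_l_distr W.smult_assoc1 subset_iff\<close>)
  have X: "submod R W ?X" "?X \<subseteq> carrier W"
    using W.ideal_smult_submod[OF \<mm>_subset order_refl] submodD(2) by blast+
  have sub: "J \<subseteq> ?ann Y" if Y: "Y \<subseteq> carrier W" for Y using JW Jc Y by blast
  have split: "enat p = ?l J (?ann Y) + ?l (?ann Y) (carrier R)" if Y: "Y \<subseteq> carrier W" for Y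
    using mlength_ideal_add[OF J(1) ann[OF Y] sub[OF Y]] J(2) by simp
  \<comment> \<open>\<open>W/N\<close> is faithful over \<open>R/J\<close> by counting: the length
    of \<open>W/N\<close> is \<open>p\<close>, and it is at most the colength of the annihilator,
    which contains \<open>J\<close>.\<close>
  have annW: "?ann (carrier W) = J"
  proof -
    note s = split[OF order_refl]
    obtain i j where ij: "?l J (?ann (carrier W)) = enat i" "?l (?ann (carrier W)) (carrier R) = enat j" "p = i + j"
      using s by (cases "?l J (?ann (carrier W))"; cases "?l (?ann (carrier W)) (carrier R)") auto
    have "annd (?ann (carrier W)) = carrier W" by (auto simp: annd_def)
    then have "p \<le> j" using mlength_annd_le[OF ann[OF order_refl] ij(2)] ij(2) eq by simp
    then have "?l J (?ann (carrier W)) = 0" using ij by (simp add: zero_enat_def)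
    then have "\<not> J \<subset> ?ann (carrier W)"
      using mlength_pos[OF ideal_submod[OF J(1)] ideal_submod[OF ann[OF order_refl]]] by auto
    then show ?thesis using sub[OF order_refl] by blast
  qed
  \<comment> \<open>Both \<open>R/J\<close> and \<open>W/N\<close> have length \<open>p\<close>, so
    bounding the colength of the annihilator of \<open>\<mm>W\<close> by the length of
    \<open>\<mm>W/N\<close> leaves at least the length of \<open>W/\<mm>W\<close> for that
    annihilator modulo \<open>J\<close>.\<close>
  have WX: "enat p = mlength R W N ?X + mlength R W ?X (carrier W)"
    using W.mlength_add[OF N X(1) W.submod_carrier Nm X(2)] eq by simp
  then obtain x y where xy: "mlength R W N ?X = enat x" "mlength R W ?X (carrier W) = enat y" "p = x + y"
    by (cases "mlength R W N ?X"; cases "mlength R W ?X (carrier W)") auto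
  have "?l (?ann ?X) (carrier R) \<le> enat x" by (rule mlength_annihilator_le[OF noeth X(1) Nm xy(1)])
  then have "enat y \<le> ?l J (?ann ?X)"
    using split[OF X(2)] xy(3) by (cases "?l J (?ann ?X)"; cases "?l (?ann ?X) (carrier R)") auto
  \<comment> \<open>The annihilator of \<open>\<mm>W\<close> modulo \<open>N\<close> consists of
    socle elements: \<open>\<mm>\<close> times it annihilates \<open>W\<close>, hence lies in
    \<open>J\<close>.\<close>
  also have "\<dots> \<le> ?l J {s \<in> carrier R. \<forall>r\<in>\<mm>. r \<otimes> s \<in> J}"
  proof (rule mlength_mono[OF order_refl _ ideal_submod[OF J(1)] sub[OF X(2)]])
    have "r \<otimes> s \<in> J" if s: "s \<in> ?ann ?X" and r: "r \<in> \<mm>" for r s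
    proof -
      have "(r \<otimes> s) \<odot>\<^bsub>W\<^esub> v \<in> N" if v: "v \<in> carrier W" for v
        using s W.ideal_smult_mem[OF \<mm>_subset order_refl r v] W.smult_assoc1[of s r v] r v m_comm[of r s] by simp
      then have "r \<otimes> s \<in> ?ann (carrier W)" using r s by simp
      then show ?thesis unfolding annW .
    qed
    then show "?ann ?X \<subseteq> {s \<in> carrier R. \<forall>r\<in>\<mm>. r \<otimes> s \<in> J}" by blast
  qed
  finally show "mlength R W ?X (carrier W) \<le> ?l J {s \<in> carrier R. \<forall>r\<in>\<mm>. r \<otimes> s \<in> J}" unfolding xy(2) .
qed

end

end

section \<open>The canonical module\<close>

lemma (in noetherian_local_ring) seq_ideal_subset_\<mm>:
  assumes "set ys \<subseteq> \<mm>"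
  shows "seq_ideal ys \<subseteq> \<mm>"
  unfolding seq_ideal_def
  by (rule module.seq_ext_least[OF module_ring_module \<mm>_submod])
    (use submodD(3)[OF \<mm>_submod] assms I_r_closed in auto)

lemma finite_inj_dim_iso:
  assumes "finite_inj_dim R W" and h: "h \<in> module_hom R M W" "inj_on h (carrier M)" "h ` carrier M = carrier W"
  shows "finite_inj_dim R M"
proof -
  obtain I :: "nat \<Rightarrow> ('a, nat \<Rightarrow> 'a) module" and d e n where
    r: "\<forall>i. injective_module R (I i)" "e \<in> module_hom R W (I 0)" "inj_on e (carrier W)"
      "\<forall>i. d i \<in> module_hom R (I i) (I (Suc i))" "e ` carrier W = ker_on (d 0) (I 0) (I (Suc 0))"
      "\<forall>i. d i ` carrier (I i) = ker_on (d (Suc i)) (I (Suc i)) (I (Suc (Suc i)))"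
      "\<forall>i>n. carrier (I i) = {\<zero>\<^bsub>I i\<^esub>}"
    using assms(1) unfolding finite_inj_dim_def by (elim exE conjE) (rule that)
  have "(\<lambda>x. e (h x)) \<in> module_hom R M (I 0)" by (rule hom_comp[OF r(2) h(1)])
  moreover have "inj_on (\<lambda>x. e (h x)) (carrier M)"
    using comp_inj_on[OF h(2)] r(3) h(3) by (simp add: comp_def)
  moreover have "(\<lambda>x. e (h x)) ` carrier M = ker_on (d 0) (I 0) (I (Suc 0))"
    using r(5) h(3) by (simp add: image_image[symmetric])
  ultimately show ?thesis unfolding finite_inj_dim_def using r(1,4,6,7) by blast
qed

context noetherian_local_ring
begin

text \<open>The annihilator \<open>K\<close> of a generator satisfies \<open>K = (ys) K\<close> by counting lengths, so \<open>K = 0\<close>.\<close>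

lemma gorenstein_of_cyclic:
  fixes W :: "('a, 'w) module"
  assumes W: "module R W" and noeth: "noetherian_subquot R W {\<zero>\<^bsub>W\<^esub>} (carrier W)"
    and ys: "regular_on_ring ys" "set ys \<subseteq> \<mm>"
    and fin: "colength R (seq_ideal ys) = enat p"
    and reg: "seq_reg W (carrier W) ys"
    and len: "mlength R W (seq_mult W (carrier W) ys) (carrier W) = enat p"
    and one: "mlength R W (module.ideal_smult R W \<mm> (carrier W)) (carrier W) = 1"
    and inj: "finite_inj_dim R W"
  shows "gorenstein R"
proof -
  interpret W: module R W by (rule W)
  interpret A: module R "ring_module R" by (rule module_ring_module)
  let ?mW = "W.ideal_smult \<mm> (carrier W)"
  have ysR: "set ys \<subseteq> carrier R" using ys(2) \<mm>_subset by blast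
  have mW: "submod R W ?mW" "?mW \<subseteq> carrier W" using W.ideal_smult_submod[OF \<mm>_subset order_refl] submodD(2) by blast+
  have "?mW \<noteq> carrier W" using one by auto
  then obtain v where v: "v \<in> carrier W" "v \<notin> ?mW" using mW(2) by blast
  \<comment> \<open>A length of one leaves no room between \<open>\<mm>W + Rv\<close> and
    \<open>W\<close>.\<close>
  have top: "W.adjoin ?mW v = carrier W"
  proof (rule ccontr)
    assume n: "W.adjoin ?mW v \<noteq> carrier W"
    note a = W.adjoin_props[OF mW(1) v(1)]
    have c: "W.adjoin ?mW v \<subseteq> carrier W" by (rule submodD(2)[OF a(1)])
    have "1 \<le> mlength R W (W.adjoin ?mW v) (carrier W)" by (rule mlength_pos[OF a(1) W.submod_carrier]) (use n c in blast)
    moreover have "1 \<le> mlength R W ?mW (W.adjoin ?mW v)" by (rule mlength_pos[OF mW(1) a(1)]) (use a(2,3) v(2) in blast)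
    ultimately have "1 + 1 \<le> mlength R W ?mW (carrier W)"
      unfolding W.mlength_add[OF mW(1) a(1) W.submod_carrier a(2) c] by (intro add_mono)
    then show False unfolding one by (simp add: one_enat_def)
  qed
  let ?h = "\<lambda>r. r \<odot>\<^bsub>W\<^esub> v"
  have h: "?h \<in> module_hom R (ring_module R) W" using v(1) by (auto simp: module_hom_def W.smult_l_distr W.smult_assoc1)
  have cyc: "submod R W (?h ` carrier R)" by (rule W.submod_cyclic[OF v(1)])
  have "v \<in> ?h ` carrier R" using W.smult_one[OF v(1)] one_closed by (metis image_eqI)
  have surj: "?h ` carrier R = carrier W"
  proof (rule nakayama[OF cyc W.submod_carrier submodD(2)[OF cyc]])
    show "noetherian_subquot R W (?h ` carrier R) (carrier W)"
      by (rule noetherian_subquot_mono[OF noeth]) (use submodD(3)[OF cyc] in auto)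
    fix S assume S: "submod R W S" "?h ` carrier R \<subseteq> S" "S \<subseteq> carrier W" "\<And>r z. r \<in> \<mm> \<Longrightarrow> z \<in> carrier W \<Longrightarrow> r \<odot>\<^bsub>W\<^esub> z \<in> S"
    have "?mW \<subseteq> S" by (rule W.ideal_smult_least[OF S(1,4)])
    then have "W.adjoin ?mW v \<subseteq> S" using W.adjoin_least[OF S(1)] S(2) \<open>v \<in> ?h ` carrier R\<close> by blast
    then show "S = carrier W" using S(3) top by blast
  qed
  define K where "K = {r \<in> carrier R. ?h r = \<zero>\<^bsub>W\<^esub>}"
  have cR: "submod R (ring_module R) (carrier R)" using A.submod_carrier by simp
  have K: "submod R (ring_module R) K"
    using hom_kernel_submod[OF module_ring_module W h cR] by (simp add: K_def)
  have B: "submod R (ring_module R) (seq_ext (ring_module R) K {\<zero>} ys)" "seq_ext (ring_module R) K {\<zero>} ys \<subseteq> K"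
    using A.seq_ext_props[OF K A.submod_zero _ ysR] submodD(3)[OF K] by auto
  \<comment> \<open>Reduction modulo \<open>ys\<close> leaves length \<open>p\<close> both for the
    ring and for \<open>W\<close>, so the kernel reduces to zero.\<close>
  have "enat p = mlength R (ring_module R) (seq_ext (ring_module R) K {\<zero>} ys) K + enat p"
    using mlength_kernel[OF module_ring_module W h cR ysR] ys(1) reg surj len fin
    by (simp add: regular_on_ring_def seq_ideal_def K_def)
  then have "mlength R (ring_module R) (seq_ext (ring_module R) K {\<zero>} ys) K = 0"
    by (cases "mlength R (ring_module R) (seq_ext (ring_module R) K {\<zero>} ys) K") (auto simp: zero_enat_def)
  then have "\<not> seq_ext (ring_module R) K {\<zero>} ys \<subset> K" using mlength_pos[OF B(1) K] by auto
  then have eq: "seq_ext (ring_module R) K {\<zero>} ys = K" using B(2) by blast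
  have "{\<zero>} = K"
  proof (rule nakayama[OF _ K])
    show "submod R (ring_module R) {\<zero>}" using A.submod_zero by simp
    show "{\<zero>} \<subseteq> K" using submodD(3)[OF K] by simp
    show "noetherian_subquot R (ring_module R) {\<zero>} K" by (rule noetherian_ring_module[OF is_cring is_noetherian])
    fix S assume S: "submod R (ring_module R) S" "{\<zero>} \<subseteq> S" "S \<subseteq> K"
      "\<And>r z. r \<in> \<mm> \<Longrightarrow> z \<in> K \<Longrightarrow> r \<odot>\<^bsub>ring_module R\<^esub> z \<in> S"
    have "seq_ext (ring_module R) K {\<zero>} ys \<subseteq> S" by (rule A.seq_ext_least[OF S(1,2)]) (use S(4) ys(2) in blast)
    then show "S = K" using S(3) eq by blast
  qed
  then have K0: "\<And>r. r \<in> carrier R \<Longrightarrow> ?h r = \<zero>\<^bsub>W\<^esub> \<Longrightarrow> r = \<zero>" unfolding K_def by blast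
  have "inj_on ?h (carrier R)"
  proof (rule inj_onI)
    fix r s assume r: "r \<in> carrier R" "s \<in> carrier R" "?h r = ?h s"
    then have "?h (r \<ominus> s) = \<zero>\<^bsub>W\<^esub>" using W.smult_minus_left[OF r(1,2) v(1)] v(1) by simp
    then have "r \<ominus> s = \<zero>" using K0 r(1,2) by simp
    then show "r = s" using r(1,2) by simp
  qed
  then show ?thesis
    unfolding gorenstein_def by (intro finite_inj_dim_iso[OF inj h]) (use surj in simp_all)
qed

end

text \<open>Two sequences meet here. \<open>xs\<close>, regular on \<omega>, only serves to make
  Ext^i(k, \<omega>) vanish below the depth; \<open>ys\<close>, regular on the ring and of finite
  colength, then turns out to be \<omega>-regular too.\<close>

lemma canonical_module_reduction:
  fixes R :: "('r, 'c) ring_scheme" and \<mm> :: "'r set" and \<omega> :: "('r, 'w) module"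
  assumes CM: "cohen_macaulay_local_ring R \<mm>" and can: "canonical_module R \<mm> \<omega>"
  obtains ys p where "cring.regular_on_ring R ys" "set ys \<subseteq> \<mm>"
    "colength R (cring.seq_ideal R ys) = enat p"
    "seq_reg \<omega> (carrier \<omega>) ys"
    "enat p \<le> mlength R \<omega> (seq_mult \<omega> (carrier \<omega>) ys) (carrier \<omega>)"
    "depth R \<mm> (ring_module R) = enat (length ys)" "depth R \<mm> \<omega> = enat (length ys)"
proof -
  interpret cohen_macaulay_local_ring R \<mm> by (rule CM)
  have \<omega>: "module R \<omega>" "fin_gen R \<omega>" "carrier \<omega> \<noteq> {\<zero>\<^bsub>\<omega>\<^esub>}" "depth R \<mm> \<omega> = krull_dim R" "finite_inj_dim R \<omega>"
    using can by (auto simp: canonical_module_def maximal_cohen_macaulay_def fin_gen_def)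
  have noeth: "noetherian_subquot R \<omega> {\<zero>\<^bsub>\<omega>\<^esub>} (carrier \<omega>)" by (rule fin_gen_noetherian[OF is_noetherian \<omega>(2)])
  obtain I :: "nat \<Rightarrow> ('r, nat \<Rightarrow> 'r) module" and D \<epsilon> n where
    inj: "\<forall>i. injective_module R (I i)" "\<epsilon> \<in> module_hom R \<omega> (I 0)" "inj_on \<epsilon> (carrier \<omega>)"
      "\<forall>i. D i \<in> module_hom R (I i) (I (Suc i))" "\<epsilon> ` carrier \<omega> = ker_on (D 0) (I 0) (I (Suc 0))"
      "\<forall>i. D i ` carrier (I i) = ker_on (D (Suc i)) (I (Suc i)) (I (Suc (Suc i)))"
      "\<forall>i>n. carrier (I i) = {\<zero>\<^bsub>I i\<^esub>}"
    using \<omega>(5) unfolding finite_inj_dim_def by (elim exE conjE) (rule that)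
  have IR: "injective_resolution R \<mm> \<omega> I D \<epsilon> n"
    by (intro injective_resolution.intro noetherian_local_ring_axioms injective_resolution_axioms.intro) (use inj \<omega>(1) in auto)
  interpret IR: injective_resolution R \<mm> \<omega> I D \<epsilon> n by (rule IR)
  \<comment> \<open>Depth and dimension are extended naturals; their finiteness comes from the
    length of the injective resolution of \<omega>.\<close>
  have "depth R \<mm> (ring_module R) \<noteq> \<infinity>"
  proof
    assume "depth R \<mm> (ring_module R) = \<infinity>"
    then have "enat (Suc n) \<le> depth R \<mm> (ring_module R)" by simp
    then obtain xs where xs: "regular_sequence R (ring_module R) xs" "set xs \<subseteq> \<mm>" "Suc n \<le> length xs"
      by (rule depth_ge_regular) simp
    have "regular_on_ring xs"
      using regular_sequence_imp_seq_regular[OF module_ring_module xs(1)] xs(2) \<mm>_subset by (auto simp: regular_on_ring_def)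
    then show False using IR.length_regular_le(2)[OF noeth \<omega>(3) _ xs(2)] xs(3) by simp
  qed
  then obtain l where l: "depth R \<mm> (ring_module R) = enat l" by auto
  then have l': "krull_dim R = enat l" "depth R \<mm> \<omega> = enat l" using depth_eq_dim \<omega>(4) by auto
  obtain ys where ys: "seq_reg (ring_module R) (carrier (ring_module R)) ys" "set ys \<subseteq> \<mm>" "length ys = l"
    by (rule depth_eq_regular[OF module_ring_module l])
  have reg: "regular_on_ring ys" using ys(1,2) \<mm>_subset by (auto simp: regular_on_ring_def)
  obtain p where p: "colength R (seq_ideal ys) = enat p"
    using finite_colength_regular[OF reg] l'(1) ys(3) by auto
  obtain xs where xs: "seq_reg \<omega> (carrier \<omega>) xs" "set xs \<subseteq> \<mm>" "length xs = l"
    by (rule depth_eq_regular[OF \<omega>(1) l'(2)])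
  let ?k = "residue_module R \<mm>"
  obtain b d e where res: "residue_resolution R \<mm> ?k b d e residue_class"
    by (rule residue_resolution_exists)
  have RR: "residue_resolution_module R \<mm> ?k b d e residue_class \<omega>"
    by (intro residue_resolution_module.intro residue_resolution_module_axioms.intro res \<omega>(1))
  interpret B: balanced_resolutions R \<mm> \<omega> I D \<epsilon> n ?k b d e residue_class
    by (rule balanced_resolutions.intro[OF IR RR])
  have ext: "B.Zc i {\<zero>\<^bsub>\<omega>\<^esub>} \<subseteq> B.Bc i {\<zero>\<^bsub>\<omega>\<^esub>}" if i: "i < l" for i
    using B.ext_of_regular_sequence[OF module.submod_zero[OF \<omega>(1)] xs(2,1)] i xs(3) by blast
  have low: "IR.vanishes \<mm> i" if i: "i < length ys" for i
    by (rule B.vanishes_of_ext[of l]) (use ext i ys(3) in auto)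
  note long = IR.regular_and_long[OF noeth \<omega>(3) reg ys(2) p low]
  show thesis by (rule that[OF reg ys(2) p]) (use long l l' ys(3) in simp_all)
qed

section \<open>Counting along the resolution\<close>

text \<open>\<open>\<beta>\<close> are Betti numbers, \<open>b\<close> ranks in the resolution,
  \<open>r\<close> ranks of differentials modulo \<open>\<mm>\<close>, and \<open>x i\<close> is the
  length of the \<open>i\<close>-th syzygy modulo \<open>y\<close>, with \<omega> at
  \<open>i = 0\<close>.\<close>

lemma alternating_sum_bound:
  fixes \<beta> b r x :: "nat \<Rightarrow> nat"
  assumes b: "b 0 = r 0 + \<beta> 0" "\<And>i. b (Suc i) = r (Suc i) + \<beta> (Suc i) + r i"
    and x: "x 0 = p" "\<And>i. x i + x (Suc i) = b i * p" "\<And>i. r i * p < x (Suc i)"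
  shows "int (\<beta> (Suc n)) - (\<Sum>i=0..n. (- 1) ^ (n - i) * int (\<beta> i)) > (- 1) ^ (Suc n)"
proof -
  define \<chi> where "\<chi> n = (\<Sum>i=0..n. (- 1) ^ (n - i) * int (\<beta> i))" for n
  have \<chi>: "\<chi> (Suc n) = int (\<beta> (Suc n)) - \<chi> n" for n
  proof -
    have "(\<Sum>i=0..n. (- 1) ^ (Suc n - i) * int (\<beta> i)) = (\<Sum>i=0..n. - ((- 1) ^ (n - i) * int (\<beta> i)))"
      by (rule sum.cong) (simp_all add: Suc_diff_le)
    then show ?thesis by (simp add: \<chi>_def sum_negf)
  qed
  \<comment> \<open>Telescoping \<open>b\<close> and \<open>x\<close> leaves one boundary rank
    \<open>r n\<close> and the start \<open>x 0 = p\<close>, which accounts for the sign term.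
    Comparison with \<open>r n * p\<close> cancels \<open>r n\<close>.\<close>
  have xi: "int (x (Suc n)) = (\<chi> n + int (r n) - (- 1) ^ n) * int p" for n
  proof (induction n)
    case 0
    have "int (x (Suc 0)) = int (b 0) * int p - int (x 0)" using x(2)[of 0] by (metis add_diff_cancel_left' of_nat_add of_nat_mult)
    then show ?case using b(1) x(1) by (simp add: \<chi>_def algebra_simps)
  next
    case (Suc n)
    have "int (x (Suc (Suc n))) = int (b (Suc n)) * int p - int (x (Suc n))"
      using x(2)[of "Suc n"] by (metis add_diff_cancel_left' of_nat_add of_nat_mult)
    also have "\<dots> = (int (\<beta> (Suc n)) + int (r (Suc n)) + int (r n)) * int p - (\<chi> n + int (r n) - (- 1) ^ n) * int p"
      unfolding Suc by (simp add: b(2))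
    also have "\<dots> = (\<chi> (Suc n) + int (r (Suc n)) - (- 1) ^ Suc n) * int p" by (simp add: \<chi> algebra_simps)
    finally show ?case .
  qed
  have "int (r (Suc n)) * int p < int (x (Suc (Suc n)))" using x(3)[of "Suc n"] by (metis of_nat_less_iff of_nat_mult)
  then have "0 < (\<chi> (Suc n) - (- 1) ^ (Suc n)) * int p" unfolding xi by (simp add: algebra_simps)
  then have "0 < \<chi> (Suc n) - (- 1) ^ (Suc n)" by (simp add: zero_less_mult_iff)
  then show ?thesis unfolding \<chi> by (simp add: \<chi>_def)
qed

text \<open>The parity cases of the final statement come from one inequality with right-hand side
  \<open>(- 1) ^ (Suc n)\<close>; the bound by the type is the ingredient for type 2.\<close>

theorem canonical_module_betti_bounds:
  fixes R :: "('r, 'c) ring_scheme" and \<mm> :: "'r set" and \<omega> :: "('r, 'w) module"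
  assumes CM: "cohen_macaulay_local_ring R \<mm>" and can: "canonical_module R \<mm> \<omega>" and ng: "\<not> gorenstein R"
  shows "int (betti R \<mm> (Suc n) \<omega>) - (\<Sum>i=0..n. (- 1) ^ (n - i) * int (betti R \<mm> i \<omega>)) > (- 1) ^ (Suc n)"
    and "betti R \<mm> 0 \<omega> \<le> ring_type R \<mm>"
proof -
  interpret cohen_macaulay_local_ring R \<mm> by (rule CM)
  have \<omega>: "module R \<omega>" "fin_gen R \<omega>" "module_type R \<mm> \<omega> = 1" "finite_inj_dim R \<omega>"
    using can by (auto simp: canonical_module_def maximal_cohen_macaulay_def fin_gen_def)
  interpret W: module R \<omega> by (rule \<omega>(1))
  have noeth: "noetherian_subquot R \<omega> {\<zero>\<^bsub>\<omega>\<^esub>} (carrier \<omega>)" by (rule fin_gen_noetherian[OF is_noetherian \<omega>(2)])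
  obtain ys p where ys: "regular_on_ring ys" "set ys \<subseteq> \<mm>"
    and fin: "colength R (seq_ideal ys) = enat p"
    and reg: "seq_reg \<omega> (carrier \<omega>) ys"
    and long: "enat p \<le> mlength R \<omega> (seq_mult \<omega> (carrier \<omega>) ys) (carrier \<omega>)"
    and depth: "depth R \<mm> (ring_module R) = enat (length ys)" "depth R \<mm> \<omega> = enat (length ys)"
    by (rule canonical_module_reduction[OF CM can])
  have ysR: "set ys \<subseteq> carrier R" using ys(2) \<mm>_subset by blast
  let ?N = "seq_mult \<omega> (carrier \<omega>) ys" and ?J = "seq_ideal ys"
  have J: "ideal ?J R" by (rule seq_ideal_ideal[OF ysR])
  have N: "submod R \<omega> ?N" "?N \<subseteq> carrier \<omega>" using W.seq_ext_props[OF W.submod_carrier W.submod_zero _ ysR] by auto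
  obtain b d e where some: "some_resolution R \<omega> = (b, d)" and res: "free_resolution R \<omega> b d e"
    by (rule some_resolution_is_resolution[OF is_noetherian \<omega>(2)])
  define K where "K i = d i ` carrier (free_pow R (b (Suc i)))" for i
  obtain r where r: "\<And>i. mlength R (free_pow R (b i)) (coord_sub (b i) \<mm> 0) (K i <+>\<^bsub>free_pow R (b i)\<^esub> coord_sub (b i) \<mm> 0) = enat (r i)"
    and b: "b 0 = r 0 + betti R \<mm> 0 \<omega>" "\<And>i. b (Suc i) = r (Suc i) + betti R \<mm> (Suc i) \<omega> + r i"
    by (rule betti_ranks[OF some res, folded K_def], rule that)
  note rf = resolution_facts[OF res]
  have e: "e \<in> module_hom R (free_pow R (b 0)) \<omega>" "carrier \<omega> = e ` carrier (free_pow R (b 0))"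
    and K0: "K 0 = {u \<in> carrier (free_pow R (b 0)). e u = \<zero>\<^bsub>\<omega>\<^esub>}"
    using res by (simp_all add: free_resolution_def ker_on_def K_def)
  have KS: "K (Suc i) = {u \<in> carrier (free_pow R (b (Suc i))). d i u = \<zero>\<^bsub>free_pow R (b i)\<^esub>}" for i
    using rf(3) by (simp add: K_def)
  have regK: "seq_reg (free_pow R (b i)) (K i) ys" for i
  proof (induction i)
    case 0
    show ?case by (rule syzygy_regular(1)[OF \<omega>(1) e K0 ys fin reg])
  next
    case (Suc i)
    show ?case by (rule syzygy_regular(1)[OF free_pow_module rf(1) K_def KS ys fin Suc])
  qed
  let ?F = "\<lambda>i. free_pow R (b i)"
  \<comment> \<open>Index 0 belongs to \<omega> and index \<open>Suc j\<close> to
    \<open>K j\<close>, the image of \<open>d j\<close>, so that \<open>K j\<close> is the syzygy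
    number \<open>j + 1\<close>.\<close>
  define X where "X i = (case i of 0 \<Rightarrow> mlength R \<omega> ?N (carrier \<omega>)
    | Suc j \<Rightarrow> mlength R (?F j) (seq_mult (?F j) (K j) ys) (K j))" for i
  define Mu where "Mu i = (case i of 0 \<Rightarrow> mlength R \<omega> (W.ideal_smult \<mm> (carrier \<omega>)) (carrier \<omega>)
    | Suc j \<Rightarrow> mlength R (?F j) (module.ideal_smult R (?F j) \<mm> (K j)) (K j))" for i
  have X0: "enat (b i * p) = X (Suc i) + X i" for i
    using syzygy_mlength[OF \<omega>(1) e K0 ys fin reg] syzygy_mlength[OF free_pow_module rf(1) K_def KS ys fin regK]
    by (cases i) (simp_all add: X_def)
  have Mu0: "enat (b i) = enat (r i) + Mu i" for i
    using syzygy_generators[OF \<omega>(1) e K0 ys fin reg] syzygy_generators[OF free_pow_module rf(1) K_def KS ys fin regK] r[of i]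
    by (cases i) (simp_all add: Mu_def)
  define x where "x i = the_enat (X i)" for i
  define \<mu> where "\<mu> i = the_enat (Mu i)" for i
  have X: "X i = enat (x i)" for i using X0[of i] by (cases "X i") (auto simp: x_def)
  have Mu: "Mu i = enat (\<mu> i)" for i using Mu0[of i] by (cases "Mu i") (auto simp: \<mu>_def)
  have xx: "x i + x (Suc i) = b i * p" for i using X0[of i] by (simp add: X)
  have b\<mu>: "b i = r i + \<mu> i" for i using Mu0[of i] by (simp add: Mu)
  have strict: "x (Suc i) < \<mu> (Suc i) * p" if gt: "r i * p < x (Suc i)" for i
  proof (cases i)
    case 0
    show ?thesis
      using syzygy_strict[OF \<omega>(1) e K0 ys fin reg r, of "\<mu> 1"] gt X[of 1] Mu[of 1] 0 by (simp add: X_def Mu_def)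
  next
    case (Suc j)
    show ?thesis
      using syzygy_strict[OF free_pow_module rf(1)[of j] K_def[of j] KS[of j] ys fin regK[of j] r[of "Suc j"], of "\<mu> (Suc i)"]
        gt X[of "Suc i"] Mu[of "Suc i"] Suc
      by (simp add: X_def Mu_def)
  qed
  have W\<mu>: "mlength R \<omega> (W.ideal_smult \<mm> (carrier \<omega>)) (carrier \<omega>) = enat (\<mu> 0)" using Mu[of 0] by (simp add: Mu_def)
  have Wx: "mlength R \<omega> ?N (carrier \<omega>) = enat (x 0)" using X[of 0] by (simp add: X_def)
  have soc: "mlength R \<omega> ?N {v \<in> carrier \<omega>. \<forall>r\<in>\<mm>. r \<odot>\<^bsub>\<omega>\<^esub> v \<in> ?N} = 1"
  proof -
    let ?S = "{v \<in> carrier \<omega>. \<forall>r\<in>\<mm>. r \<odot>\<^bsub>\<omega>\<^esub> v \<in> ?N}"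
    have "?N \<subseteq> ?S" using N(2) submodD(5)[OF N(1)] by auto
    then have "mlength R \<omega> ?N ?S \<le> mlength R \<omega> ?N (carrier \<omega>)" by (intro mlength_mono N(1)) auto
    then obtain t where t: "mlength R \<omega> ?N ?S = enat t" unfolding Wx by (cases "mlength R \<omega> ?N ?S") auto
    then show ?thesis using module_type_socle[OF \<omega>(1) depth(2) ys(2) reg t] \<omega>(3) by (simp add: one_enat_def)
  qed
  have dual: "x 0 = p" "enat (\<mu> 0) \<le> mlength R (ring_module R) ?J {s \<in> carrier R. \<forall>r\<in>\<mm>. r \<otimes>\<^bsub>R\<^esub> s \<in> ?J}"
  proof -
    have le1: "mlength R \<omega> ?N {v \<in> carrier \<omega>. \<forall>r\<in>\<mm>. r \<odot>\<^bsub>\<omega>\<^esub> v \<in> ?N} \<le> 1" using soc by simp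
    have n: "noetherian_subquot R \<omega> ?N (carrier \<omega>)" by (rule noetherian_subquot_mono[OF noeth]) (use submodD(3)[OF N(1)] in auto)
    note dd = socle_one_duality[OF N(1) le1 n J fin _ seq_ext_subset_\<mm>[OF W.submod_carrier ys(2)] long]
    have "mlength R \<omega> ?N (carrier \<omega>) = enat p" by (rule dd(1)) (rule seq_ideal_smult[OF W.submod_carrier ysR])
    then show "x 0 = p" by (simp add: Wx)
    show "enat (\<mu> 0) \<le> mlength R (ring_module R) ?J {s \<in> carrier R. \<forall>r\<in>\<mm>. r \<otimes>\<^bsub>R\<^esub> s \<in> ?J}"
      unfolding W\<mu>[symmetric] by (rule dd(2)) (rule seq_ideal_smult[OF W.submod_carrier ysR])
  qed
  have Jm: "?J \<subseteq> \<mm>" by (rule seq_ideal_subset_\<mm>[OF ys(2)])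
  have "p \<noteq> 0"
  proof
    assume p0: "p = 0"
    have "?J \<subset> carrier R" using Jm \<mm>_subset one_not_in_\<mm> by auto
    then show False using mlength_pos[OF ideal_submod[OF J] module.submod_carrier[OF module_ring_module]] fin p0
      by (simp add: zero_enat_def[symmetric])
  qed
  \<comment> \<open>With \<open>x 0 = p > 0\<close> the weak bound excludes
    \<open>\<mu> 0 = 0\<close>, and \<open>\<mu> 0 = 1\<close> would make \<omega> cyclic, so
    \<open>\<mu> 0\<close> is at least 2.\<close>
  have "x 0 < \<mu> 0 * p"
  proof -
    have "x 0 \<le> \<mu> 0 * p"
      using mlength_seq_le_generators[OF W.submod_carrier noeth ys(2) fin W\<mu>] by (simp add: Wx)
    moreover have "\<mu> 0 \<noteq> 1"
    proof
      assume one: "\<mu> 0 = 1"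
      have "gorenstein R"
        by (rule gorenstein_of_cyclic[OF \<omega>(1) noeth ys fin reg _ _ \<omega>(4)]) (use Wx W\<mu> one dual(1) in \<open>simp_all add: one_enat_def\<close>)
      then show False using ng by blast
    qed
    ultimately show ?thesis using dual(1) \<open>p \<noteq> 0\<close> by (cases "\<mu> 0 = 0") auto
  qed
  then have lt: "x i < \<mu> i * p" for i
  proof (induction i)
    case (Suc i)
    \<comment> \<open>From \<open>x i + x (Suc i) = (r i + \<mu> i) * p\<close>, a deficit of
      \<open>x i\<close> below \<open>\<mu> i * p\<close> is a surplus of \<open>x (Suc i)\<close>
      over \<open>r i * p\<close>.\<close>
    have "r i * p < x (Suc i)" using xx[of i] Suc.IH[OF Suc.prems] b\<mu>[of i] by (simp add: algebra_simps)
    then show ?case by (rule strict)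
  qed
  have gt: "r i * p < x (Suc i)" for i using xx[of i] lt[of i] b\<mu>[of i] by (simp add: algebra_simps)
  show "int (betti R \<mm> (Suc n) \<omega>) - (\<Sum>i=0..n. (- 1) ^ (n - i) * int (betti R \<mm> i \<omega>)) > (- 1) ^ (Suc n)"
    by (rule alternating_sum_bound[OF b dual(1) xx gt])
  let ?S = "{s \<in> carrier R. \<forall>r\<in>\<mm>. r \<otimes>\<^bsub>R\<^esub> s \<in> ?J}"
  have JS: "?J \<subseteq> ?S" using ideal.Icarr[OF J] ideal.I_l_closed[OF J] \<mm>_subset by auto
  have "mlength R (ring_module R) ?J ?S \<le> colength R ?J"
    by (rule mlength_mono[OF order_refl _ ideal_submod[OF J] JS]) auto
  then obtain t where t: "mlength R (ring_module R) ?J ?S = enat t"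
    unfolding fin by (cases "mlength R (ring_module R) ?J ?S") auto
  have "ring_type R \<mm> = t"
    unfolding ring_type_def
    by (rule module_type_socle[OF module_ring_module depth(1) ys(2)])
      (use ys(1) t in \<open>simp_all add: regular_on_ring_def seq_ideal_def\<close>)
  moreover have "\<mu> 0 = betti R \<mm> 0 \<omega>" using b(1) b\<mu>[of 0] by simp
  ultimately show "betti R \<mm> 0 \<omega> \<le> ring_type R \<mm>" using dual(2) t by simp
qed

theorem mainTheorem1:
  fixes R :: "('r, 'c) ring_scheme" and \<mm> :: "'r set" and \<omega> :: "('r, 'w) module"
  assumes "cohen_macaulay_local_ring R \<mm>"
    and "canonical_module R \<mm> \<omega>"
    and "\<not> gorenstein R"
  shows "(\<forall>n::nat. n \<ge> 1 \<longrightarrow>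
           (odd n \<longrightarrow>
              int (betti R \<mm> n \<omega>) \<ge>
                (\<Sum>i = 0..n - 1. (- 1) ^ (n - i + 1) * int (betti R \<mm> i \<omega>))) \<and>
           (even n \<longrightarrow>
              int (betti R \<mm> n \<omega>) \<ge>
                (\<Sum>i = 0..n - 1. (- 1) ^ (n - i + 1) * int (betti R \<mm> i \<omega>)) + 2)) \<and>
         (ring_type R \<mm> = 2 \<longrightarrow> betti R \<mm> 2 \<omega> \<ge> betti R \<mm> 1 \<omega>)"
proof -
  note bounds = canonical_module_betti_bounds[OF assms]
  let ?s = "\<lambda>n. \<Sum>i = 0..n - 1. (- 1) ^ (n - i + 1) * int (betti R \<mm> i \<omega>)"
  have gt: "int (betti R \<mm> n \<omega>) - ?s n > (- 1) ^ n" if n: "n \<ge> 1" for n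
  proof -
    obtain m where m: "n = Suc m" using n by (cases n) auto
    have "?s n = (\<Sum>i=0..m. (- 1) ^ (m - i) * int (betti R \<mm> i \<omega>))"
      unfolding m by (rule sum.cong) (simp_all add: Suc_diff_le)
    then show ?thesis using bounds(1)[of m] m by simp
  qed
  \<comment> \<open>For odd \<open>n\<close> the difference exceeds -1 and is nonnegative; for even
    \<open>n\<close> it exceeds 1 and is at least 2.\<close>
  have odd: "int (betti R \<mm> n \<omega>) \<ge> ?s n" if n: "n \<ge> 1" "odd n" for n using gt[OF n(1)] n(2) by simp
  have even: "int (betti R \<mm> n \<omega>) \<ge> ?s n + 2" if n: "n \<ge> 1" "even n" for n using gt[OF n(1)] n(2) by simp
  \<comment> \<open>For \<open>n = 2\<close> the sum is \<open>\<beta>_1 - \<beta>_0\<close>, and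
    \<open>\<beta>_0\<close> is at most the type 2.\<close>
  have "betti R \<mm> 2 \<omega> \<ge> betti R \<mm> 1 \<omega>" if t: "ring_type R \<mm> = 2"
    using even[of 2] bounds(2) t by (simp add: numeral_2_eq_2)
  then show ?thesis using odd even by blast
qed

end
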